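(* Let $M\subset\mathbb R^4$ be a smooth surface parametrized near the origin by $(x,y)\mapsto(f(x,y),g(x,y),x,y)$, where the $2$-jet of $(f,g)$ at $(0,0)$ is $(f_{11}xy,\ g_{20}x^2)$, and suppose that $$f_{11}\ne0,\quad g_{20}\neq0,\quad g_{04}\neq0,\quad\text{and } g_{12}\ne0 \text{ or } g_{03}\neq0 .$$ Then, in a neighbourhood of $(0,0)$ in the $(p,q)$-parameter plane of $M$, the bifurcation set $\mathcal B$ of the family of contact maps of $M$ is exactly the parabolic set of $M$. Moreover a sign can be given to each such point of the parabolic set, namely the sign of $g_{20}g_{04}$ when the $2$-jet of $(f,g)$ at the point is reduced to the form $(f_{11}xy,\ g_{20}x^2)$.
   Context: For $M$ parametrized as $(f(x,y),g(x,y),x,y)$, with $f,g$ smooth with zero $1$-jet at the origin, $f_{ij},g_{ij}$ denote the coefficients of $x^iy^j$ in the Taylor expansions of $f,g$ at $(0,0)$. Reduction at an arbitrary point of $M$: by an affine transformation of $\mathbb R^4$ taking the point to the origin, $M$ is written in the form $(f,g,x,y)$ with the $2$-jet of $(f,g)$ in a standard form. Parabolic set: the set of parameter values (points of $M$) at which $(f_{xx}g_{yy}-f_{yy}g_{xx})^2=4(f_{xy}g_{yy}-f_{yy}g_{xy})(f_{xx}g_{xy}-f_{xy}g_{xx})$. Family of contact maps (contact of $M$ with its reflexion in the point of $M$ with parameters $(p,q)$): $$F_{(p,q)}(x,y)=\bigl(f(p+x,q+y)+f(p-x,q-y)-2f(p,q),\ g(p+x,q+y)+g(p-x,q-y)-2g(p,q)\bigr).$$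 Since $F_{(p,q)}(x,y)=F_{(p,q)}(-x,-y)$ one can write $F_{(p,q)}(x,y)=H_{(p,q)}(x^2,xy,y^2)$ with $H_{(p,q)}:(\mathbb R^3,0)\to(\mathbb R^2,0)$ smooth in $(u,v,w)=(x^2,xy,y^2)$. Bifurcation set $\mathcal B$ (as a germ at the base point): the set of $(p,q)$ for which there is $(x,y)$ (near the origin) at which $F_{(p,q)}$ has an unstable singularity with respect to $\mathcal K$-equivalence of maps symmetric under $(x,y)\mapsto(-x,-y)$. Concretely, it is stratified by constancy of the contact data: the multiplicities of the intersections of $H_{(p,q)}^{-1}(0)$ with the half-cone $V: v^2=uw,\ u\ge0,\ w\ge0$, in an arbitrarily small neighbourhood of the origin of $\mathbb R^3$. A parameter $(p,q)$ belongs to $\mathcal B$ when either the intersection at the origin has multiplicity greater than its minimal (generic, stable) value, or there is an intersection point of $H_{(p,q)}^{-1}(0)$ with $V$ away from the origin of multiplicity greater than $1$ (i.e. a tangency). *)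

theory Defs
  imports "HOL-Analysis.Analysis"
begin

section \<open>Smooth functions and Taylor coefficients\<close>

text \<open>
  In finite dimension and on an open set \<open>S\<close>, this is membership in the class \<open>C^n\<close>: all iterated
  directional derivatives up to order \<open>n\<close> exist and are continuous.
\<close>

fun higher_differentiable_on ::
  "'a::real_normed_vector set \<Rightarrow> ('a \<Rightarrow> 'b::real_normed_vector) \<Rightarrow> nat \<Rightarrow> bool" where
  "higher_differentiable_on S f 0 \<longleftrightarrow> continuous_on S f"
| "higher_differentiable_on S f (Suc n) \<longleftrightarrow>
     (\<forall>x\<in>S. f differentiable (at x)) \<and>
     (\<forall>v. higher_differentiable_on S (\<lambda>x. frechet_derivative f (at x) v) n)"

definition smooth_on :: "'a::real_normed_vector set \<Rightarrow> ('a \<Rightarrow> 'b::real_normed_vector) \<Rightarrow> bool" where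
  "smooth_on S f \<longleftrightarrow> (\<forall>n. higher_differentiable_on S f n)"

definition smooth_germ_at :: "'a::real_normed_vector \<Rightarrow> ('a \<Rightarrow> 'b::real_normed_vector) \<Rightarrow> bool" where
  "smooth_germ_at P h \<longleftrightarrow> (\<exists>S. open S \<and> P \<in> S \<and> smooth_on S h)"

definition partial_x :: "(real \<times> real \<Rightarrow> real) \<Rightarrow> real \<times> real \<Rightarrow> real" where
  "partial_x f = (\<lambda>z. frechet_derivative f (at z) (1, 0))"

definition partial_y :: "(real \<times> real \<Rightarrow> real) \<Rightarrow> real \<times> real \<Rightarrow> real" where
  "partial_y f = (\<lambda>z. frechet_derivative f (at z) (0, 1))"

definition taylor_coeff :: "(real \<times> real \<Rightarrow> real) \<Rightarrow> nat \<Rightarrow> nat \<Rightarrow> real" where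
  "taylor_coeff f i j = (partial_x ^^ i) ((partial_y ^^ j) f) (0, 0) / (fact i * fact j)"

text \<open>The 2-jet of \<open>(f, g)\<close> at the origin is \<open>(f\<^sub>1\<^sub>1 x y, g\<^sub>2\<^sub>0 x^2)\<close>.\<close>

definition two_jet_reduced :: "(real \<times> real \<Rightarrow> real) \<Rightarrow> (real \<times> real \<Rightarrow> real) \<Rightarrow> bool" where
  "two_jet_reduced f g \<longleftrightarrow>
     (\<forall>i j. i + j \<le> 2 \<and> (i, j) \<noteq> (1, 1) \<longrightarrow> taylor_coeff f i j = 0) \<and>
     (\<forall>i j. i + j \<le> 2 \<and> (i, j) \<noteq> (2, 0) \<longrightarrow> taylor_coeff g i j = 0)"


section \<open>The surface, its parabolic set, and reduction at a point\<close>

definition surface_param ::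
  "(real \<times> real \<Rightarrow> real) \<Rightarrow> (real \<times> real \<Rightarrow> real) \<Rightarrow> real \<times> real \<Rightarrow> real \<times> real \<times> real \<times> real" where
  "surface_param f g = (\<lambda>(x, y). (f (x, y), g (x, y), x, y))"

definition parabolic_set ::
  "(real \<times> real) set \<Rightarrow> (real \<times> real \<Rightarrow> real) \<Rightarrow> (real \<times> real \<Rightarrow> real) \<Rightarrow> (real \<times> real) set" where
  "parabolic_set W f g = {z \<in> W.
     (let fxx = partial_x (partial_x f) z; fxy = partial_x (partial_y f) z;
          fyy = partial_y (partial_y f) z;
          gxx = partial_x (partial_x g) z; gxy = partial_x (partial_y g) z;
          gyy = partial_y (partial_y g) z
      in (fxx * gyy - fyy * gxx)\<^sup>2 = 4 * (fxy * gyy - fyy * gxy) * (fxx * gxy - fxy * gxx))}"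

definition affine_transformation ::
  "(real \<times> real \<times> real \<times> real \<Rightarrow> real \<times> real \<times> real \<times> real) \<Rightarrow> bool" where
  "affine_transformation A \<longleftrightarrow> (\<exists>L b. linear L \<and> bij L \<and> A = (\<lambda>z. L z + b))"

text \<open>
  Some affine transformation takes the point of \<open>M\<close> with parameters \<open>c\<close> to the origin and the germ
  of \<open>M\<close> there to the germ at the origin of the surface \<open>(fr, gr, x, y)\<close>, whose 2-jet is reduced.
  Non-vanishing of the two remaining coefficients is not part of this predicate.
\<close>

definition reduction_at ::
  "(real \<times> real) set \<Rightarrow> (real \<times> real \<Rightarrow> real) \<Rightarrow> (real \<times> real \<Rightarrow> real) \<Rightarrow> real \<times> real \<Rightarrow>
   (real \<times> real \<Rightarrow> real) \<Rightarrow> (real \<times> real \<Rightarrow> real) \<Rightarrow> bool" where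
  "reduction_at W f g c fr gr \<longleftrightarrow>
     two_jet_reduced fr gr \<and>
     (\<exists>A W' N. affine_transformation A \<and> A (surface_param f g c) = 0 \<and>
        open W' \<and> (0, 0) \<in> W' \<and> smooth_on W' fr \<and> smooth_on W' gr \<and>
        open N \<and> 0 \<in> N \<and>
        A ` (surface_param f g ` W) \<inter> N = surface_param fr gr ` W' \<inter> N)"


section \<open>Contact maps and their bifurcation set\<close>

definition contact_map ::
  "(real \<times> real \<Rightarrow> real) \<Rightarrow> (real \<times> real \<Rightarrow> real) \<Rightarrow> real \<times> real \<Rightarrow> real \<times> real \<Rightarrow> real \<times> real" where
  "contact_map f g = (\<lambda>(p, q) (x, y).
     (f (p + x, q + y) + f (p - x, q - y) - 2 * f (p, q),
      g (p + x, q + y) + g (p - x, q - y) - 2 * g (p, q)))"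

text \<open>\<open>H\<close> is smooth on \<open>N\<close> and \<open>F (x, y) = H (x^2, x y, y^2)\<close> as long as the argument of \<open>H\<close> is in \<open>N\<close>.\<close>

definition invariant_lift ::
  "(real \<times> real \<times> real) set \<Rightarrow> (real \<times> real \<Rightarrow> real \<times> real) \<Rightarrow>
   (real \<times> real \<times> real \<Rightarrow> real \<times> real) \<Rightarrow> bool" where
  "invariant_lift N F H \<longleftrightarrow>
     smooth_on N H \<and>
     (\<forall>x y. (x\<^sup>2, x * y, y\<^sup>2) \<in> N \<longrightarrow> F (x, y) = H (x\<^sup>2, x * y, y\<^sup>2))"

definition half_cone :: "(real \<times> real \<times> real) set" where
  "half_cone = {(u, v, w). v\<^sup>2 = u * w \<and> u \<ge> 0 \<and> w \<ge> 0}"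

definition cone_eq :: "real \<times> real \<times> real \<Rightarrow> real" where
  "cone_eq = (\<lambda>(u, v, w). v\<^sup>2 - u * w)"

text \<open>
  The multiplicity at \<open>P\<close> of the intersection of \<open>H = 0\<close> with the cone is the dimension over \<open>\<real>\<close> of
  the local algebra \<open>E / I\<close>, where \<open>E\<close> is the ring of smooth function germs at \<open>P\<close> and \<open>I\<close> the ideal
  generated by the two components of \<open>H\<close> and the equation of the cone. The first predicate says that
  this quotient is spanned by \<open>k\<close> elements, that is, has dimension at most \<open>k\<close>; the multiplicity is
  \<open>\<infinity>\<close> if there is no such \<open>k\<close>.
\<close>

definition local_algebra_spanned ::
  "(real \<times> real \<times> real \<Rightarrow> real \<times> real) \<Rightarrow> real \<times> real \<times> real \<Rightarrow> nat \<Rightarrow> bool" where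
  "local_algebra_spanned H P k \<longleftrightarrow>
     (\<exists>e :: nat \<Rightarrow> real \<times> real \<times> real \<Rightarrow> real.
        (\<forall>i<k. smooth_germ_at P (e i)) \<and>
        (\<forall>h :: real \<times> real \<times> real \<Rightarrow> real. smooth_germ_at P h \<longrightarrow>
           (\<exists>(c :: nat \<Rightarrow> real) a1 a2 a3.
              smooth_germ_at P a1 \<and> smooth_germ_at P a2 \<and> smooth_germ_at P a3 \<and>
              (\<forall>\<^sub>F z in nhds P. h z = (\<Sum>i<k. c i * e i z)
                 + a1 z * fst (H z) + a2 z * snd (H z) + a3 z * cone_eq z))))"

definition intersection_mult ::
  "(real \<times> real \<times> real \<Rightarrow> real \<times> real) \<Rightarrow> real \<times> real \<times> real \<Rightarrow> enat" where
  "intersection_mult H P = Inf {enat k |k. local_algebra_spanned H P k}"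

definition minimal_origin_mult :: enat where
  "minimal_origin_mult =
     (INF H \<in> {H :: real \<times> real \<times> real \<Rightarrow> real \<times> real. smooth_germ_at 0 H \<and> H 0 = 0}.
        intersection_mult H 0)"

text \<open>
  \<open>N\<close> is the neighbourhood of the origin of three-space in which intersections are considered. The
  germ of the bifurcation set is obtained by taking \<open>N\<close> arbitrarily small.
\<close>

definition bifurcation_set ::
  "(real \<times> real \<times> real) set \<Rightarrow> (real \<times> real \<Rightarrow> real) \<Rightarrow> (real \<times> real \<Rightarrow> real) \<Rightarrow> (real \<times> real) set" where
  "bifurcation_set N f g =
     {c. \<exists>H. invariant_lift N (contact_map f g c) H \<and>
        (intersection_mult H 0 > minimal_origin_mult \<or>
         (\<exists>P \<in> half_cone \<inter> N. P \<noteq> 0 \<and> H P = 0 \<and> intersection_mult H P > 1))}"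

end

theory Submission
  imports Defs
begin

text \<open>
  Two things can put a parameter into the bifurcation set: a tangency of the zero set of the lift \<open>H\<close> with the cone
  away from the vertex, or an excessive multiplicity at the vertex. Near the base point the first does not happen.
  The second component of the contact map is close to a multiple of \<open>x\<^sup>2\<close> up to second order, so its zeros are close
  to the \<open>y\<close>-axis. There the nonvanishing of \<open>f\<^sub>1\<^sub>1\<close> and \<open>g\<^sub>0\<^sub>4\<close> makes the Jacobian determinant of the contact map nonzero
  (\<open>contact_map_zeros_transverse\<close>). Up to a nonzero factor this is the determinant of the differentials of the two
  components of \<open>H\<close> and of the equation of the cone, so the intersection is transverse and has multiplicity one
  (\<open>lift_spanned_1\<close>).

  At the vertex the equation of the cone is quadratic, so the multiplicity is at least two, and two is attained. It is two
  if the common zeros of the differentials of the components of \<open>H\<close> form a line that is not on the cone, and at least three if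
  this line is on the cone (\<open>origin_mult_greater_iff\<close>). The upper bound follows from Hadamard's lemma. For the lower
  bound, germs are restricted to a curve along which all generators of the ideal vanish to high order. The differential
  of \<open>H\<close> is given by the Hessians of \<open>f\<close> and \<open>g\<close>, and the condition that the line is on the cone is the equation of the
  parabolic set (\<open>lift_origin_mult_greater_iff\<close>). That smooth lifts exist at all is a theorem of Whitney, in the form
  \<open>even_function_lift\<close>; it rests on Borel's lemma.

  As for the sign, the parabolic equation is the vanishing of the resultant of the two Hessian forms. At a parabolic point
  they therefore have a common isotropic direction \<open>(m, 1)\<close>, and some \<open>G = g - \<kappa> f\<close> has this direction in the kernel of its Hessian. A
  shear that makes it the \<open>y\<close>-axis yields a reduction (\<open>reduction_exists\<close>). For every reduction the product of the two
  coefficients of \<open>gr\<close> is a positive multiple of the product of \<open>G\<^sub>x\<^sub>x\<close> and the fourth derivative of \<open>G\<close> in the direction \<open>(m, 1)\<close>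
  (\<open>reduced_sign\<close>). At the origin this product is \<open>g\<^sub>x\<^sub>x g\<^sub>y\<^sub>y\<^sub>y\<^sub>y\<close>, and by continuity its sign is constant nearby.
\<close>

section \<open>Calculus of smooth functions\<close>

lemma higher_differentiable_on_cong:
  assumes "open S" "\<And>x. x \<in> S \<Longrightarrow> f x = g x" "higher_differentiable_on S f n"
  shows "higher_differentiable_on S g n"
  using assms(2,3)
proof (induction n arbitrary: f g)
  case 0
  then show ?case by (simp cong: continuous_on_cong)
next
  case (Suc n)
  have diff: "f differentiable (at x)" if "x \<in> S" for x
    using Suc.prems that by simp
  have eq: "frechet_derivative f (at x) = frechet_derivative g (at x)" if "x \<in> S" for x
    using frechet_derivative_transform_within_open[OF diff[OF that] \<open>open S\<close> that] Suc.prems(1) by blast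
  have dg: "g differentiable (at x)" if x: "x \<in> S" for x
  proof -
    have "(f has_derivative frechet_derivative f (at x)) (at x)"
      using diff[OF x] by (simp add: frechet_derivative_works)
    then have "(g has_derivative frechet_derivative f (at x)) (at x)"
      by (rule has_derivative_transform_within_open[OF _ \<open>open S\<close> x]) (use Suc.prems(1) in auto)
    then show ?thesis by (rule differentiableI)
  qed
  have "higher_differentiable_on S (\<lambda>x. frechet_derivative g (at x) v) n" for v
    by (rule Suc.IH[of "\<lambda>x. frechet_derivative f (at x) v"]) (use eq Suc.prems in auto)
  then show ?case using dg by simp
qed

lemma smooth_on_cong:
  assumes "open S" "\<And>x. x \<in> S \<Longrightarrow> f x = g x" "smooth_on S f"
  shows "smooth_on S g"
  using assms higher_differentiable_on_cong unfolding smooth_on_def by blast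

lemma smooth_on_subset: "smooth_on T f \<Longrightarrow> S \<subseteq> T \<Longrightarrow> smooth_on S f"
proof -
  have "higher_differentiable_on T f n \<Longrightarrow> S \<subseteq> T \<Longrightarrow> higher_differentiable_on S f n" for n
    by (induction n arbitrary: f) (auto intro: continuous_on_subset)
  then show "smooth_on T f \<Longrightarrow> S \<subseteq> T \<Longrightarrow> smooth_on S f"
    unfolding smooth_on_def by blast
qed

lemma smooth_on_has_derivative:
  assumes "smooth_on S f" "x \<in> S"
  shows "(f has_derivative frechet_derivative f (at x)) (at x)"
proof -
  have "higher_differentiable_on S f (Suc 0)" using assms(1) unfolding smooth_on_def by blast
  then show ?thesis using assms(2) by (simp add: frechet_derivative_works)
qed

lemma smooth_on_frechet_derivative:
  assumes "smooth_on S f"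
  shows "smooth_on S (\<lambda>x. frechet_derivative f (at x) v)"
  unfolding smooth_on_def
proof
  fix n
  have "higher_differentiable_on S f (Suc n)" using assms unfolding smooth_on_def by blast
  then show "higher_differentiable_on S (\<lambda>x. frechet_derivative f (at x) v) n" by simp
qed

lemma smooth_on_continuous_on: "smooth_on S f \<Longrightarrow> continuous_on S f"
  unfolding smooth_on_def by (metis higher_differentiable_on.simps(1))

lemma smooth_on_isCont:
  assumes "smooth_on S f" "x \<in> S" shows "isCont f x"
  using has_derivative_continuous[OF smooth_on_has_derivative[OF assms]] .

text \<open>
  Smoothness is a greatest fixed point, so it can be proved by coinduction: it suffices to find a
  class of differentiable functions that contains all directional derivatives of its members.
\<close>

lemma smooth_on_coinduct:
  assumes S: "open S" and f: "f \<in> C"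
    and step: "\<And>f. f \<in> C \<Longrightarrow> \<exists>D. (\<forall>x\<in>S. (f has_derivative D x) (at x)) \<and>
                 (\<forall>v. \<exists>g\<in>C. \<forall>x\<in>S. D x v = g x)"
  shows "smooth_on S f"
proof -
  have "\<forall>f\<in>C. higher_differentiable_on S f n" for n
  proof (induction n)
    case 0
    show ?case
    proof
      fix f assume "f \<in> C"
      then obtain D where "\<And>x. x \<in> S \<Longrightarrow> (f has_derivative D x) (at x)"
        using step by blast
      then show "higher_differentiable_on S f 0"
        by (auto intro!: continuous_at_imp_continuous_on has_derivative_continuous)
    qed
  next
    case (Suc n)
    show ?case
    proof
      fix f assume "f \<in> C"
      then obtain D where D: "\<And>x. x \<in> S \<Longrightarrow> (f has_derivative D x) (at x)"
        and D': "\<And>v. \<exists>g\<in>C. \<forall>x\<in>S. D x v = g x"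
        using step by metis
      have eq: "frechet_derivative f (at x) = D x" if "x \<in> S" for x
        using frechet_derivative_at[OF D[OF that]] by simp
      have "higher_differentiable_on S (\<lambda>x. frechet_derivative f (at x) v) n" for v
      proof -
        obtain g where g: "g \<in> C" "\<forall>x\<in>S. D x v = g x" using D' by blast
        show ?thesis
          by (rule higher_differentiable_on_cong[OF S, of g]) (use g eq Suc in auto)
      qed
      then show "higher_differentiable_on S f (Suc n)"
        using D by (auto intro: differentiableI)
    qed
  qed
  then show ?thesis using f unfolding smooth_on_def by blast
qed

text \<open>
  The class in a coinductive proof is rarely closed under derivatives literally, but its derivatives
  are sums of products of its members with smooth functions. This is good enough.
\<close>

inductive_set smooth_algebra ::
  "'a::real_normed_vector set \<Rightarrow> ('a \<Rightarrow> real) set \<Rightarrow> ('a \<Rightarrow> real) set" for S C where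
  gen: "f \<in> C \<Longrightarrow> f \<in> smooth_algebra S C"
| smooth: "smooth_on S f \<Longrightarrow> f \<in> smooth_algebra S C"
| add: "f \<in> smooth_algebra S C \<Longrightarrow> g \<in> smooth_algebra S C \<Longrightarrow> (\<lambda>x. f x + g x) \<in> smooth_algebra S C"
| mult: "f \<in> smooth_algebra S C \<Longrightarrow> g \<in> smooth_algebra S C \<Longrightarrow> (\<lambda>x. f x * g x) \<in> smooth_algebra S C"

lemma smooth_on_up_to_algebra:
  assumes S: "open S" and f: "f \<in> smooth_algebra S C"
    and step: "\<And>f. f \<in> C \<Longrightarrow> \<exists>D. (\<forall>x\<in>S. (f has_derivative D x) (at x)) \<and>
                 (\<forall>v. \<exists>g\<in>smooth_algebra S C. \<forall>x\<in>S. D x v = g x)"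
  shows "smooth_on S f"
proof (rule smooth_on_coinduct[OF S f])
  fix f assume "f \<in> smooth_algebra S C"
  then show "\<exists>D. (\<forall>x\<in>S. (f has_derivative D x) (at x)) \<and>
      (\<forall>v. \<exists>g\<in>smooth_algebra S C. \<forall>x\<in>S. D x v = g x)"
  proof induction
    case (gen f)
    then show ?case by (rule step)
  next
    case (smooth f)
    show ?case
    proof (intro exI[of _ "\<lambda>x. frechet_derivative f (at x)"] conjI ballI allI)
      show "(f has_derivative frechet_derivative f (at x)) (at x)" if "x \<in> S" for x
        by (rule smooth_on_has_derivative[OF smooth that])
      show "\<exists>g\<in>smooth_algebra S C. \<forall>x\<in>S. frechet_derivative f (at x) v = g x" for v
        by (rule bexI[OF _ smooth_algebra.smooth[OF smooth_on_frechet_derivative[OF smooth, of v]]]) simp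
    qed
  next
    case (add f g)
    from add.IH(1) obtain D where D: "\<forall>x\<in>S. (f has_derivative D x) (at x)"
      "\<forall>v. \<exists>g\<in>smooth_algebra S C. \<forall>x\<in>S. D x v = g x" by (elim exE conjE)
    from add.IH(2) obtain E where E: "\<forall>x\<in>S. (g has_derivative E x) (at x)"
      "\<forall>v. \<exists>g\<in>smooth_algebra S C. \<forall>x\<in>S. E x v = g x" by (elim exE conjE)
    show ?case
    proof (intro exI[of _ "\<lambda>x v. D x v + E x v"] conjI ballI allI)
      show "((\<lambda>x. f x + g x) has_derivative (\<lambda>v. D x v + E x v)) (at x)" if "x \<in> S" for x
        using D(1)[rule_format, OF that] E(1)[rule_format, OF that] by (rule has_derivative_add)
      fix v
      from D(2)[rule_format, of v] obtain d where d: "d\<in>smooth_algebra S C" "\<forall>x\<in>S. D x v = d x"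
        by (elim bexE)
      from E(2)[rule_format, of v] obtain e where e: "e\<in>smooth_algebra S C" "\<forall>x\<in>S. E x v = e x"
        by (elim bexE)
      from d e show "\<exists>h\<in>smooth_algebra S C. \<forall>x\<in>S. D x v + E x v = h x"
        by (intro bexI[of _ "\<lambda>x. d x + e x"] smooth_algebra.add) auto
    qed
  next
    case (mult f g)
    from mult.IH(1) obtain D where D: "\<forall>x\<in>S. (f has_derivative D x) (at x)"
      "\<forall>v. \<exists>g\<in>smooth_algebra S C. \<forall>x\<in>S. D x v = g x" by (elim exE conjE)
    from mult.IH(2) obtain E where E: "\<forall>x\<in>S. (g has_derivative E x) (at x)"
      "\<forall>v. \<exists>g\<in>smooth_algebra S C. \<forall>x\<in>S. E x v = g x" by (elim exE conjE)
    show ?case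
    proof (intro exI[of _ "\<lambda>x v. f x * E x v + D x v * g x"] conjI ballI allI)
      show "((\<lambda>x. f x * g x) has_derivative (\<lambda>v. f x * E x v + D x v * g x)) (at x)" if "x \<in> S" for x
        using D(1)[rule_format, OF that] E(1)[rule_format, OF that] by (rule has_derivative_mult)
      fix v
      from D(2)[rule_format, of v] obtain d where d: "d\<in>smooth_algebra S C" "\<forall>x\<in>S. D x v = d x"
        by (elim bexE)
      from E(2)[rule_format, of v] obtain e where e: "e\<in>smooth_algebra S C" "\<forall>x\<in>S. E x v = e x"
        by (elim bexE)
      from d e have "(\<lambda>x. f x * e x + d x * g x) \<in> smooth_algebra S C"
         "\<forall>x\<in>S. f x * E x v + D x v * g x = f x * e x + d x * g x"
        using mult.hyps by (simp_all add: smooth_algebra.add smooth_algebra.mult)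
      then show "\<exists>h\<in>smooth_algebra S C. \<forall>x\<in>S. f x * E x v + D x v * g x = h x"
        by (intro bexI[of _ "\<lambda>x. f x * e x + d x * g x"]) auto
    qed
  qed
qed

lemma smooth_on_const: "open S \<Longrightarrow> smooth_on S (\<lambda>x. c)"
proof (rule smooth_on_coinduct[where C = "range (\<lambda>c x. c)"])
  have "\<exists>g\<in>range (\<lambda>c x. c). \<forall>x\<in>S. 0 = g x" by (intro bexI[of _ "\<lambda>x. 0"]) auto
  then show "f \<in> range (\<lambda>c x. c) \<Longrightarrow> \<exists>D. (\<forall>x\<in>S. (f has_derivative D x) (at x)) \<and>
      (\<forall>v. \<exists>g\<in>range (\<lambda>c x. c). \<forall>x\<in>S. D x v = g x)" for f :: "'a \<Rightarrow> 'b"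
    by (intro exI[of _ "\<lambda>x v. 0"]) auto
qed auto

lemma smooth_on_bounded_linear:
  assumes "open S" "bounded_linear l" shows "smooth_on S l"
proof (rule smooth_on_coinduct[where C = "insert l (range (\<lambda>c x. c))"])
  fix f assume "f \<in> insert l (range (\<lambda>c x. c))"
  then consider "f = l" | c where "f = (\<lambda>x. c)" by auto
  then show "\<exists>D. (\<forall>x\<in>S. (f has_derivative D x) (at x)) \<and>
      (\<forall>v. \<exists>g\<in>insert l (range (\<lambda>c x. c)). \<forall>x\<in>S. D x v = g x)"
  proof cases
    case 1
    have "\<exists>g\<in>insert l (range (\<lambda>c x. c)). \<forall>x\<in>S. l v = g x" for v
      by (intro bexI[of _ "\<lambda>x. l v"]) auto
    then show ?thesis
      using assms(2) 1 by (intro exI[of _ "\<lambda>x. l"]) (simp add: bounded_linear_imp_has_derivative)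
  next
    case 2
    have "\<exists>g\<in>insert l (range (\<lambda>c x. c)). \<forall>x\<in>S. 0 = g x"
      by (intro bexI[of _ "\<lambda>x. 0"]) auto
    then show ?thesis
      using 2 by (intro exI[of _ "\<lambda>x v. 0"]) simp
  qed
qed (use assms in auto)

lemma
  fixes f g :: "'a::real_normed_vector \<Rightarrow> real"
  assumes S: "open S" and fg: "smooth_on S f" "smooth_on S g"
  shows smooth_on_add: "smooth_on S (\<lambda>x. f x + g x)"
    and smooth_on_mult: "smooth_on S (\<lambda>x. f x * g x)"
proof -
  have gen: "h \<in> smooth_algebra S {} \<Longrightarrow> smooth_on S h" for h
    by (erule smooth_on_up_to_algebra[OF S]) simp
  have "f \<in> smooth_algebra S {}" "g \<in> smooth_algebra S {}"
    using fg by (auto intro: smooth_algebra.smooth)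
  then show "smooth_on S (\<lambda>x. f x + g x)" "smooth_on S (\<lambda>x. f x * g x)"
    by (simp_all add: gen smooth_algebra.add smooth_algebra.mult)
qed

lemma smooth_on_minus:
  fixes f :: "'a::real_normed_vector \<Rightarrow> real"
  assumes "open S" "smooth_on S f" shows "smooth_on S (\<lambda>x. - f x)"
  using smooth_on_mult[OF assms(1) smooth_on_const[OF assms(1), of "-1"] assms(2)] by simp

lemma smooth_on_diff:
  fixes f :: "'a::real_normed_vector \<Rightarrow> real"
  assumes "open S" "smooth_on S f" "smooth_on S g" shows "smooth_on S (\<lambda>x. f x - g x)"
  using smooth_on_add[OF assms(1,2) smooth_on_minus[OF assms(1,3)]] by simp

lemma smooth_on_power:
  fixes f :: "'a::real_normed_vector \<Rightarrow> real"
  assumes "open S" "smooth_on S f" shows "smooth_on S (\<lambda>x. f x ^ n)"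
  by (induction n) (simp_all add: smooth_on_const smooth_on_mult assms)

lemma smooth_algebra_sum:
  assumes "open S" "\<And>i. i \<in> I \<Longrightarrow> f i \<in> smooth_algebra S C"
  shows "(\<lambda>x. \<Sum>i\<in>I. f i x) \<in> smooth_algebra S C"
  using assms(2)
  by (induction I rule: infinite_finite_induct)
     (simp_all add: smooth_algebra.add smooth_algebra.smooth smooth_on_const assms(1))

text \<open>On a Euclidean space the directions of a basis suffice.\<close>

lemma smooth_on_up_to_algebra_Basis:
  fixes C :: "('a::euclidean_space \<Rightarrow> real) set"
  assumes S: "open S" and f: "f \<in> smooth_algebra S C"
    and step: "\<And>f. f \<in> C \<Longrightarrow> \<exists>g. (\<forall>x\<in>S. (f has_derivative (\<lambda>v. \<Sum>b\<in>Basis. (v \<bullet> b) * g b x)) (at x)) \<and>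
                 (\<forall>b\<in>Basis. g b \<in> smooth_algebra S C)"
  shows "smooth_on S f"
proof (rule smooth_on_up_to_algebra[OF S f])
  fix f assume "f \<in> C"
  from step[OF this] obtain g where
    g: "\<forall>x\<in>S. (f has_derivative (\<lambda>v. \<Sum>b\<in>Basis. (v \<bullet> b) * g b x)) (at x)"
      "\<forall>b\<in>Basis. g b \<in> smooth_algebra S C" by (elim exE conjE)
  show "\<exists>D. (\<forall>x\<in>S. (f has_derivative D x) (at x)) \<and>
                 (\<forall>v. \<exists>g\<in>smooth_algebra S C. \<forall>x\<in>S. D x v = g x)"
  proof (intro exI conjI allI, rule g(1))
    fix v
    have "(\<lambda>x. \<Sum>b\<in>Basis. (v \<bullet> b) * g b x) \<in> smooth_algebra S C"
      by (intro smooth_algebra_sum[OF S] smooth_algebra.mult)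
         (use g S in \<open>auto intro: smooth_algebra.smooth smooth_on_const\<close>)
    then show "\<exists>g'\<in>smooth_algebra S C. \<forall>x\<in>S. (\<Sum>b\<in>Basis. (v \<bullet> b) * g b x) = g' x"
      by (intro bexI[of _ "\<lambda>x. \<Sum>b\<in>Basis. (v \<bullet> b) * g b x"]) auto
  qed
qed

lemma smooth_on_up_to_algebra_real:
  fixes C :: "(real \<Rightarrow> real) set"
  assumes S: "open S" and f: "f \<in> C"
    and step: "\<And>f. f \<in> C \<Longrightarrow> \<exists>g\<in>smooth_algebra S C. \<forall>x\<in>S. (f has_real_derivative g x) (at x)"
  shows "smooth_on S f"
proof (rule smooth_on_up_to_algebra_Basis[OF S smooth_algebra.gen[OF f]])
  fix f assume "f \<in> C"
  then obtain g where g: "g\<in>smooth_algebra S C" "\<And>x. x\<in>S \<Longrightarrow> (f has_real_derivative g x) (at x)"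
    using step by blast
  have "(f has_derivative (\<lambda>v. \<Sum>b\<in>Basis. (v \<bullet> b) * g x)) (at x)" if "x \<in> S" for x
    using g(2)[OF that] by (simp add: has_field_derivative_def mult_commute_abs)
  then show "\<exists>g. (\<forall>x\<in>S. (f has_derivative (\<lambda>v. \<Sum>b\<in>Basis. (v \<bullet> b) * g b x)) (at x)) \<and>
                 (\<forall>b\<in>Basis. g b \<in> smooth_algebra S C)"
    using g(1) by (intro exI[of _ "\<lambda>b. g"]) auto
qed

lemma smooth_on_up_to_algebra_plane:
  fixes C :: "(real \<times> real \<Rightarrow> real) set"
  assumes S: "open S" and f: "f \<in> C"
    and step: "\<And>f. f \<in> C \<Longrightarrow> \<exists>g\<in>smooth_algebra S C. \<exists>h\<in>smooth_algebra S C. \<forall>z\<in>S.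
                 (f has_derivative (\<lambda>v. fst v * g z + snd v * h z)) (at z)"
  shows "smooth_on S f"
proof (rule smooth_on_up_to_algebra[OF S smooth_algebra.gen[OF f]])
  fix f assume "f \<in> C"
  from step[OF this] obtain g h where gh: "g\<in>smooth_algebra S C" "h\<in>smooth_algebra S C"
     "\<forall>z\<in>S. (f has_derivative (\<lambda>v. fst v * g z + snd v * h z)) (at z)"
    by (elim bexE)
  show "\<exists>D. (\<forall>x\<in>S. (f has_derivative D x) (at x)) \<and>
                 (\<forall>v. \<exists>g\<in>smooth_algebra S C. \<forall>x\<in>S. D x v = g x)"
  proof (intro exI conjI allI, rule gh(3))
    fix v :: "real \<times> real"
    have "(\<lambda>z. fst v * g z + snd v * h z) \<in> smooth_algebra S C"
      by (intro smooth_algebra.add smooth_algebra.mult smooth_algebra.smooth[OF smooth_on_const] gh(1,2) S)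
    then show "\<exists>g'\<in>smooth_algebra S C. \<forall>z\<in>S. fst v * g z + snd v * h z = g' z"
      by (intro bexI[of _ "\<lambda>z. fst v * g z + snd v * h z"]) auto
  qed
qed

lemma smooth_on_inverse:
  fixes f :: "'a::real_normed_vector \<Rightarrow> real"
  assumes S: "open S" and f: "smooth_on S f" and nz: "\<And>x. x \<in> S \<Longrightarrow> f x \<noteq> 0"
  shows "smooth_on S (\<lambda>x. inverse (f x))"
proof (rule smooth_on_up_to_algebra[OF S, where C = "{\<lambda>x. inverse (f x)}"])
  fix h assume "h \<in> {\<lambda>x. inverse (f x)}"
  then have h: "h = (\<lambda>x. inverse (f x))" by simp
  show "\<exists>D. (\<forall>x\<in>S. (h has_derivative D x) (at x)) \<and>
      (\<forall>v. \<exists>g\<in>smooth_algebra S {\<lambda>x. inverse (f x)}. \<forall>x\<in>S. D x v = g x)"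
  proof (intro exI[of _ "\<lambda>x v. - (inverse (f x) * frechet_derivative f (at x) v * inverse (f x))"] conjI ballI allI)
    show "(h has_derivative (\<lambda>v. - (inverse (f x) * frechet_derivative f (at x) v * inverse (f x)))) (at x)"
      if "x \<in> S" for x
      unfolding h by (rule Deriv.has_derivative_inverse[OF nz[OF that] smooth_on_has_derivative[OF f that]])
    fix v
    have "(\<lambda>x. (- inverse (f x) * frechet_derivative f (at x) v) * inverse (f x)) \<in> smooth_algebra S {\<lambda>x. inverse (f x)}"
    proof (intro smooth_algebra.mult)
      show "(\<lambda>x. - inverse (f x)) \<in> smooth_algebra S {\<lambda>x. inverse (f x)}"
        using smooth_algebra.mult[OF smooth_algebra.smooth[OF smooth_on_const[OF S, of "-1"]] smooth_algebra.gen[OF singletonI], of "\<lambda>x. inverse (f x)"]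
        by simp
    qed (simp_all add: smooth_algebra.gen smooth_algebra.smooth smooth_on_frechet_derivative f)
    then show "\<exists>g\<in>smooth_algebra S {\<lambda>x. inverse (f x)}. \<forall>x\<in>S. - (inverse (f x) * frechet_derivative f (at x) v * inverse (f x)) = g x"
      by (rule rev_bexI) auto
  qed
qed (auto intro: smooth_algebra.gen)

lemma smooth_on_divide:
  fixes f :: "'a::real_normed_vector \<Rightarrow> real"
  assumes "open S" "smooth_on S f" "smooth_on S g" "\<And>x. x \<in> S \<Longrightarrow> g x \<noteq> 0"
  shows "smooth_on S (\<lambda>x. f x / g x)"
  using smooth_on_mult[OF assms(1,2) smooth_on_inverse[OF assms(1,3,4)]]
  by (simp add: divide_inverse)

lemma smooth_on_compose:
  fixes \<phi> :: "'a::real_normed_vector \<Rightarrow> 'b::euclidean_space" and g :: "'b \<Rightarrow> real"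
  assumes S: "open S" and g: "smooth_on T g" and sub: "\<And>x. x \<in> S \<Longrightarrow> \<phi> x \<in> T"
    and \<phi>: "\<And>b. b \<in> Basis \<Longrightarrow> smooth_on S (\<lambda>x. \<phi> x \<bullet> b)"
  shows "smooth_on S (\<lambda>x. g (\<phi> x))"
proof (rule smooth_on_up_to_algebra[OF S, where C = "{\<lambda>x. g (\<phi> x) |g. smooth_on T g}"])
  fix h :: "'a \<Rightarrow> real"
  assume "h \<in> {\<lambda>x. g (\<phi> x) |g. smooth_on T g}"
  then obtain g :: "'b \<Rightarrow> real" where g: "smooth_on T g" and h: "h = (\<lambda>x. g (\<phi> x))" by blast
  let ?D = "\<lambda>x v. \<Sum>b\<in>Basis. frechet_derivative (\<lambda>x. \<phi> x \<bullet> b) (at x) v * frechet_derivative g (at (\<phi> x)) b"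
  show "\<exists>D. (\<forall>x\<in>S. (h has_derivative D x) (at x)) \<and>
      (\<forall>v. \<exists>g\<in>smooth_algebra S {\<lambda>x. g (\<phi> x) |g. smooth_on T g}. \<forall>x\<in>S. D x v = g x)"
  proof (intro exI[of _ ?D] conjI ballI allI)
    fix x assume x: "x \<in> S"
    define \<phi>' where "\<phi>' v = (\<Sum>b\<in>Basis. frechet_derivative (\<lambda>x. \<phi> x \<bullet> b) (at x) v *\<^sub>R b)" for v
    have "(\<phi> has_derivative \<phi>') (at x)"
      unfolding has_derivative_componentwise_within[of \<phi>]
    proof
      fix b :: 'b assume b: "b \<in> Basis"
      have "\<phi>' v \<bullet> b = frechet_derivative (\<lambda>x. \<phi> x \<bullet> b) (at x) v" for v
        unfolding \<phi>'_def using b by simp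
      then show "((\<lambda>x. \<phi> x \<bullet> b) has_derivative (\<lambda>v. \<phi>' v \<bullet> b)) (at x)"
        using smooth_on_has_derivative[OF \<phi>[OF b] x] by simp
    qed
    moreover have Dg: "(g has_derivative frechet_derivative g (at (\<phi> x))) (at (\<phi> x))"
      by (rule smooth_on_has_derivative[OF g sub[OF x]])
    ultimately have *: "((\<lambda>x. g (\<phi> x)) has_derivative (\<lambda>v. frechet_derivative g (at (\<phi> x)) (\<phi>' v))) (at x)"
      by (rule has_derivative_compose)
    have lin: "linear (frechet_derivative g (at (\<phi> x)))"
      using Dg has_derivative_linear by blast
    have "frechet_derivative g (at (\<phi> x)) (\<phi>' v) = ?D x v" for v
      unfolding \<phi>'_def linear_sum[OF lin] by (simp add: linear_cmul[OF lin])
    then show "(h has_derivative (\<lambda>v. ?D x v)) (at x)"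
      using * unfolding h by simp
  next
    fix v
    have "(\<lambda>x. ?D x v) \<in> smooth_algebra S {\<lambda>x. g (\<phi> x) |g. smooth_on T g}"
    proof (intro smooth_algebra_sum[OF S] smooth_algebra.mult)
      fix b :: 'b assume b: "b \<in> Basis"
      show "(\<lambda>x. frechet_derivative (\<lambda>x. \<phi> x \<bullet> b) (at x) v)
          \<in> smooth_algebra S {\<lambda>x. g (\<phi> x) |g. smooth_on T g}"
        by (intro smooth_algebra.smooth smooth_on_frechet_derivative \<phi> b)
      show "(\<lambda>x. frechet_derivative g (at (\<phi> x)) b)
          \<in> smooth_algebra S {\<lambda>x. g (\<phi> x) |g. smooth_on T g}"
        using smooth_on_frechet_derivative[OF g, of b]
        by (intro smooth_algebra.gen CollectI exI[of _ "\<lambda>y. frechet_derivative g (at y) b"]) simp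
    qed
    then show "\<exists>g'\<in>smooth_algebra S {\<lambda>x. g (\<phi> x) |g. smooth_on T g}. \<forall>x\<in>S. ?D x v = g' x"
      by (intro bexI[of _ "\<lambda>x. ?D x v"]) auto
  qed
qed (use g in \<open>auto intro: smooth_algebra.gen\<close>)

lemma smooth_on_bounded_linear_compose:
  assumes l: "bounded_linear l" and S: "open S" and f: "smooth_on S f"
  shows "smooth_on S (\<lambda>x. l (f x))"
proof (rule smooth_on_coinduct[OF S, where C = "{\<lambda>x. l (f x) |f. smooth_on S f}"])
  fix h assume "h \<in> {\<lambda>x. l (f x) |f. smooth_on S f}"
  then obtain f where f: "smooth_on S f" and h: "h = (\<lambda>x. l (f x))" by blast
  let ?D = "\<lambda>x v. l (frechet_derivative f (at x) v)"
  have "\<exists>k\<in>{\<lambda>x. l (f x) |f. smooth_on S f}. \<forall>x\<in>S. ?D x v = k x" for v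
    using smooth_on_frechet_derivative[OF f, of v] by (intro bexI[of _ "\<lambda>x. ?D x v"]) auto
  moreover have "(h has_derivative ?D x) (at x)" if "x \<in> S" for x
    unfolding h by (intro bounded_linear.has_derivative[OF l] smooth_on_has_derivative[OF f that])
  ultimately show "\<exists>D. (\<forall>x\<in>S. (h has_derivative D x) (at x)) \<and>
                 (\<forall>v. \<exists>g\<in>{\<lambda>x. l (f x) |f. smooth_on S f}. \<forall>x\<in>S. D x v = g x)"
    by (intro exI[of _ ?D]) blast
qed (use f in auto)

lemma smooth_on_Pair:
  assumes S: "open S" and f: "smooth_on S f" and g: "smooth_on S g"
  shows "smooth_on S (\<lambda>x. (f x, g x))"
proof (rule smooth_on_coinduct[OF S, where C = "{\<lambda>x. (f x, g x) |f g. smooth_on S f \<and> smooth_on S g}"])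
  fix h :: "'a \<Rightarrow> 'b \<times> 'c"
  assume "h \<in> {\<lambda>x. (f x, g x) |f g. smooth_on S f \<and> smooth_on S g}"
  then obtain f :: "'a \<Rightarrow> 'b" and g :: "'a \<Rightarrow> 'c" where f: "smooth_on S f" and g: "smooth_on S g" and h: "h = (\<lambda>x. (f x, g x))" by blast
  let ?D = "\<lambda>x v. (frechet_derivative f (at x) v, frechet_derivative g (at x) v)"
  have "\<exists>k\<in>{\<lambda>x. (f x, g x) |f g. smooth_on S f \<and> smooth_on S g}. \<forall>x\<in>S. ?D x v = k x" for v
    using smooth_on_frechet_derivative[OF f, of v] smooth_on_frechet_derivative[OF g, of v]
    by (intro bexI[of _ "\<lambda>x. ?D x v"]) auto
  moreover have "(h has_derivative ?D x) (at x)" if "x \<in> S" for x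
    unfolding h by (intro has_derivative_Pair smooth_on_has_derivative[OF _ that] f g)
  ultimately show "\<exists>D. (\<forall>x\<in>S. (h has_derivative D x) (at x)) \<and>
     (\<forall>v. \<exists>g\<in>{\<lambda>x. (f x, g x) |f g. smooth_on S f \<and> smooth_on S g}. \<forall>x\<in>S. D x v = g x)"
    by (intro exI[of _ ?D]) blast
qed (use f g in auto)

section \<open>Partial derivatives in the plane\<close>

lemma smooth_on_partial:
  assumes "smooth_on S f"
  shows smooth_on_partial_x: "smooth_on S (partial_x f)"
    and smooth_on_partial_y: "smooth_on S (partial_y f)"
  using assms smooth_on_frechet_derivative unfolding partial_x_def partial_y_def by blast+

lemma has_derivative_partials:
  fixes f :: "real \<times> real \<Rightarrow> real"
  assumes "smooth_on S f" "z \<in> S"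
  shows "(f has_derivative (\<lambda>v. fst v * partial_x f z + snd v * partial_y f z)) (at z)"
proof -
  have d: "(f has_derivative frechet_derivative f (at z)) (at z)"
    by (rule smooth_on_has_derivative[OF assms])
  then have lin: "linear (frechet_derivative f (at z))" by (rule has_derivative_linear)
  have "frechet_derivative f (at z) v = fst v * partial_x f z + snd v * partial_y f z" for v
  proof -
    have "v = fst v *\<^sub>R (1, 0) + snd v *\<^sub>R (0, 1)" by (simp add: prod_eq_iff)
    then show ?thesis unfolding partial_x_def partial_y_def
      by (metis linear_add[OF lin] linear_cmul[OF lin] real_scaleR_def)
  qed
  then show ?thesis using d by (metis (lifting) ext)
qed

lemma partials_eqI:
  assumes "(f has_derivative (\<lambda>v. fst v * a + snd v * b)) (at z)"
  shows "partial_x f z = a" "partial_y f z = b"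
  using frechet_derivative_at[OF assms, symmetric] by (auto simp: partial_x_def partial_y_def)

lemma partials_cong:
  assumes "open S" "z \<in> S" "smooth_on S f" "\<And>w. w \<in> S \<Longrightarrow> f w = g w"
  shows "partial_x f z = partial_x g z" "partial_y f z = partial_y g z"
  using frechet_derivative_transform_within_open[OF _ assms(1,2,4)]
    differentiableI[OF smooth_on_has_derivative[OF assms(3,2)]]
  by (simp_all add: partial_x_def partial_y_def)

lemma has_derivative_along:
  fixes f :: "real \<times> real \<Rightarrow> real"
  assumes f: "smooth_on S f" and z: "(a t, b t) \<in> S"
    and a: "(a has_real_derivative a') (at t)" and b: "(b has_real_derivative b') (at t)"
  shows "((\<lambda>t. f (a t, b t)) has_real_derivative (a' * partial_x f (a t, b t) + b' * partial_y f (a t, b t))) (at t)"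
proof -
  have "((\<lambda>t. (a t, b t)) has_derivative (\<lambda>h. (h * a', h * b'))) (at t)"
    using a b by (auto simp: has_field_derivative_def mult_commute_abs intro!: has_derivative_Pair)
  from has_derivative_compose[OF this has_derivative_partials[OF f z]]
  have "((\<lambda>t. f (a t, b t)) has_derivative
      (\<lambda>h. h * a' * partial_x f (a t, b t) + h * b' * partial_y f (a t, b t))) (at t)" by simp
  then show ?thesis
    unfolding has_field_derivative_def by (rule has_derivative_eq_rhs) (auto simp: algebra_simps)
qed

lemma smooth_on_compose_plane:
  fixes \<alpha> \<beta> :: "'a::real_normed_vector \<Rightarrow> real" and g :: "real \<times> real \<Rightarrow> real"
  assumes S: "open S" and g: "smooth_on T g" and sub: "\<And>z. z \<in> S \<Longrightarrow> (\<alpha> z, \<beta> z) \<in> T"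
    and ab: "smooth_on S \<alpha>" "smooth_on S \<beta>"
  shows "smooth_on S (\<lambda>z. g (\<alpha> z, \<beta> z))"
proof (rule smooth_on_compose[where \<phi> = "\<lambda>z. (\<alpha> z, \<beta> z)", OF S g])
  show "(\<alpha> z, \<beta> z) \<in> T" if "z \<in> S" for z by (rule sub[OF that])
  fix b :: "real \<times> real" assume "b \<in> Basis"
  then consider "b = (1, 0)" | "b = (0, 1)" by (auto simp: Basis_prod_def)
  then show "smooth_on S (\<lambda>x. (\<alpha> x, \<beta> x) \<bullet> b)"
    by cases (use ab in auto)
qed

lemma smooth_on_compose_real:
  fixes \<alpha> :: "'a::real_normed_vector \<Rightarrow> real" and g :: "real \<Rightarrow> real"
  assumes S: "open S" and g: "smooth_on T g" and sub: "\<And>z. z \<in> S \<Longrightarrow> \<alpha> z \<in> T"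
    and a: "smooth_on S \<alpha>"
  shows "smooth_on S (\<lambda>z. g (\<alpha> z))"
  by (rule smooth_on_compose[OF S g sub]) (use a in auto)

lemma smooth_on_fst: "open S \<Longrightarrow> smooth_on S fst"
  and smooth_on_snd: "open S \<Longrightarrow> smooth_on S snd"
  by (simp_all add: smooth_on_bounded_linear bounded_linear_fst bounded_linear_snd)

lemma isCont_eventually_near:
  fixes f :: "'a::metric_space \<Rightarrow> 'b::metric_space"
  assumes "isCont f z" "e > 0"
  shows "\<forall>\<^sub>F w in nhds z. dist (f w) (f z) < e"
proof -
  have "\<forall>\<^sub>F w in at z. dist (f w) (f z) < e"
    using assms tendstoD unfolding isCont_def by blast
  then show ?thesis
    unfolding eventually_at_filter by (rule eventually_mono) (use assms(2) in force)
qed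

lemma second_difference_mvt:
  fixes F :: "real \<Rightarrow> real \<Rightarrow> real"
  assumes h: "h > 0"
    and dx: "\<And>x y. x \<in> {p..p+h} \<Longrightarrow> y \<in> {q..q+h} \<Longrightarrow> ((\<lambda>x. F x y) has_real_derivative Fx x y) (at x)"
    and dy: "\<And>x y. x \<in> {p..p+h} \<Longrightarrow> y \<in> {q..q+h} \<Longrightarrow> ((\<lambda>y. Fx x y) has_real_derivative Fxy x y) (at y)"
  obtains x y where "x \<in> {p..p+h}" "y \<in> {q..q+h}"
    "F (p+h) (q+h) - F (p+h) q - F p (q+h) + F p q = h * h * Fxy x y"
proof -
  have "\<exists>x. p < x \<and> x < p + h \<and> (F (p+h) (q+h) - F (p+h) q) - (F p (q+h) - F p q)
      = (p + h - p) * (Fx x (q+h) - Fx x q)"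
    using h by (intro MVT2) (auto intro!: derivative_intros dx)
  then obtain x where x: "p < x" "x < p + h"
    "(F (p+h) (q+h) - F (p+h) q) - (F p (q+h) - F p q) = h * (Fx x (q+h) - Fx x q)" by auto
  have "\<exists>y. q < y \<and> y < q + h \<and> Fx x (q+h) - Fx x q = (q + h - q) * Fxy x y"
    using h x by (intro MVT2) (auto intro!: dy)
  then obtain y where "q < y" "y < q + h" "Fx x (q+h) - Fx x q = h * Fxy x y" by auto
  then show ?thesis using x that[of x y] by auto
qed

text \<open>Both mixed second derivatives are limits of the same second difference quotient.\<close>

lemma partial_x_partial_y_commute:
  fixes f :: "real \<times> real \<Rightarrow> real"
  assumes S: "open S" and f: "smooth_on S f" and z: "z \<in> S"
  shows "partial_x (partial_y f) z = partial_y (partial_x f) z"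
proof (rule ccontr)
  obtain p q where pq: "z = (p, q)" by force
  let ?A = "partial_x (partial_y f)" and ?B = "partial_y (partial_x f)"
  have fx: "smooth_on S (partial_x f)" and fy: "smooth_on S (partial_y f)"
    by (intro smooth_on_partial f)+
  assume "?A z \<noteq> ?B z"
  define e where "e = \<bar>?A z - ?B z\<bar> / 2"
  have e: "e > 0" using \<open>?A z \<noteq> ?B z\<close> by (simp add: e_def)
  have "isCont ?A z" "isCont ?B z"
    using smooth_on_isCont[OF smooth_on_partial_x[OF fy] z] smooth_on_isCont[OF smooth_on_partial_y[OF fx] z] .
  then have "\<forall>\<^sub>F w in nhds z. dist (?A w) (?A z) < e" "\<forall>\<^sub>F w in nhds z. dist (?B w) (?B z) < e"
    using e by (simp_all add: isCont_eventually_near)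
  moreover have "\<forall>\<^sub>F w in nhds z. w \<in> S" using S z by (rule eventually_nhds_in_open)
  ultimately have "\<forall>\<^sub>F w in nhds z. w \<in> S \<and> dist (?A w) (?A z) < e \<and> dist (?B w) (?B z) < e"
    by eventually_elim auto
  then obtain d where d: "d > 0"
    "\<And>w. dist w z < d \<Longrightarrow> w \<in> S \<and> dist (?A w) (?A z) < e \<and> dist (?B w) (?B z) < e"
    unfolding eventually_nhds_metric by blast
  define h where "h = d / 3"
  have h: "h > 0" using d by (simp add: h_def)
  have near: "dist (x, y) z < d" if "x \<in> {p..p+h}" "y \<in> {q..q+h}" for x y
  proof -
    have "dist (x, y) z \<le> \<bar>x - p\<bar> + \<bar>y - q\<bar>"
      unfolding pq dist_Pair_Pair dist_real_def by (rule order_trans[OF sqrt_sum_squares_le_sum_abs]) simp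
    also have "\<dots> < d" using that d(1) by (auto simp: h_def)
    finally show ?thesis .
  qed
  have dx: "((\<lambda>x. f (x, y)) has_real_derivative partial_x f (x, y)) (at x)"
    and dy: "((\<lambda>y. f (x, y)) has_real_derivative partial_y f (x, y)) (at y)"
    and dxy: "((\<lambda>y. partial_x f (x, y)) has_real_derivative ?B (x, y)) (at y)"
    and dyx: "((\<lambda>x. partial_y f (x, y)) has_real_derivative ?A (x, y)) (at x)"
    if "x \<in> {p..p+h}" "y \<in> {q..q+h}" for x y
  proof -
    have xy: "(x, y) \<in> S" using d(2)[OF near[OF that]] by blast
    show "((\<lambda>x. f (x, y)) has_real_derivative partial_x f (x, y)) (at x)"
      "((\<lambda>y. f (x, y)) has_real_derivative partial_y f (x, y)) (at y)"
      "((\<lambda>y. partial_x f (x, y)) has_real_derivative ?B (x, y)) (at y)"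
      "((\<lambda>x. partial_y f (x, y)) has_real_derivative ?A (x, y)) (at x)"
      using has_derivative_along[OF f, of "\<lambda>x. x" x "\<lambda>_. y" 1 0]
        has_derivative_along[OF f, of "\<lambda>_. x" y "\<lambda>y. y" 0 1]
        has_derivative_along[OF fx, of "\<lambda>_. x" y "\<lambda>y. y" 0 1]
        has_derivative_along[OF fy, of "\<lambda>x. x" x "\<lambda>_. y" 1 0] xy by simp_all
  qed
  obtain x y where xy: "x \<in> {p..p+h}" "y \<in> {q..q+h}"
    "f (p+h,q+h) - f (p+h,q) - f (p,q+h) + f (p,q) = h * h * ?B (x, y)"
    by (rule second_difference_mvt[OF h dx dxy])
  obtain y' x' where xy': "x' \<in> {p..p+h}" "y' \<in> {q..q+h}"
    "f (p+h,q+h) - f (p,q+h) - f (p+h,q) + f (p,q) = h * h * ?A (x', y')"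
    using second_difference_mvt[where F = "\<lambda>y x. f (x, y)" and Fx = "\<lambda>y x. partial_y f (x, y)"
      and Fxy = "\<lambda>y x. ?A (x, y)" and p = q and q = p, OF h dy dyx] by blast
  have "h * h * ?A (x', y') = h * h * ?B (x, y)" using xy(3) xy'(3) by linarith
  then have "?A (x', y') = ?B (x, y)" using h by simp
  moreover have "dist (?A (x', y')) (?A z) < e" "dist (?B (x, y)) (?B z) < e"
    using d(2) near xy xy' by blast+
  ultimately show False unfolding e_def dist_real_def by (simp add: abs_if split: if_splits)
qed

lemma smooth_on_partial_iterates:
  assumes "smooth_on S f"
  shows "smooth_on S ((partial_x ^^ n) f)" "smooth_on S ((partial_y ^^ n) f)"
  by (induction n) (use assms smooth_on_partial in auto)

lemma partial_x_iterate_partial_y: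
  assumes S: "open S" and f: "smooth_on S f" and z: "z \<in> S"
  shows "(partial_x ^^ n) (partial_y f) z = partial_y ((partial_x ^^ n) f) z"
  using z
proof (induction n arbitrary: z)
  case (Suc n)
  have "(partial_x ^^ Suc n) (partial_y f) z = partial_x (partial_y ((partial_x ^^ n) f)) z"
    using partials_cong(1)[OF S Suc.prems smooth_on_partial_iterates(1)[OF smooth_on_partial_y[OF f]] Suc.IH]
    by simp
  also have "\<dots> = partial_y ((partial_x ^^ Suc n) f) z"
    using partial_x_partial_y_commute[OF S smooth_on_partial_iterates(1)[OF f] Suc.prems] by simp
  finally show ?case .
qed simp

lemma DERIV_partial_x_iterate:
  assumes "smooth_on S f" "(x, y) \<in> S"
  shows "((\<lambda>x. (partial_x ^^ n) f (x, y)) has_real_derivative (partial_x ^^ Suc n) f (x, y)) (at x)"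
  using has_derivative_along[OF smooth_on_partial_iterates(1)[OF assms(1)], of "\<lambda>x. x" x "\<lambda>_. y" 1 0] assms(2)
  by simp

lemma DERIV_partial_y_iterate:
  assumes "smooth_on S f" "(x, y) \<in> S"
  shows "((\<lambda>y. (partial_y ^^ n) f (x, y)) has_real_derivative (partial_y ^^ Suc n) f (x, y)) (at y)"
  using has_derivative_along[OF smooth_on_partial_iterates(2)[OF assms(1)], of "\<lambda>_. x" y "\<lambda>y. y" 0 1] assms(2)
  by simp

section \<open>Cut-off functions\<close>

text \<open>
  The flat function \<open>exp (- 1 / t)\<close> is the case \<open>k = 0\<close>. The powers of \<open>t\<close> in the denominator make the
  family closed under differentiation, which is what the proof of smoothness needs.
\<close>

definition exp_flat :: "nat \<Rightarrow> real \<Rightarrow> real" where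
  "exp_flat k t = (if t > 0 then exp (- (1 / t)) / t ^ k else 0)"

lemma exp_flat_tendsto_0: "(exp_flat k \<longlongrightarrow> 0) (at 0)"
proof -
  have "((\<lambda>x. x ^ k / exp x) \<longlongrightarrow> (0::real)) at_top" by (rule tendsto_power_div_exp_0)
  then have "((\<lambda>t. inverse t ^ k / exp (inverse t)) \<longlongrightarrow> (0::real)) (at_right 0)"
    by (rule filterlim_compose[OF _ filterlim_inverse_at_top_right])
  then have "(exp_flat k \<longlongrightarrow> 0) (at_right 0)"
  proof (rule Lim_transform_eventually)
    show "\<forall>\<^sub>F t in at_right 0. inverse t ^ k / exp (inverse t) = exp_flat k t"
      by (auto simp: exp_flat_def eventually_at_right_less exp_minus field_simps power_inverse
        intro!: eventually_at_rightI[of 0 1])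
  qed
  moreover have "(exp_flat k \<longlongrightarrow> 0) (at_left 0)"
    by (rule tendsto_eventually) (auto simp: exp_flat_def intro!: eventually_at_leftI[of "-1"])
  ultimately show ?thesis by (simp add: filterlim_at_split)
qed

lemma exp_flat_derivative:
  "(exp_flat k has_real_derivative exp_flat (k + 2) t - k * exp_flat (k + 1) t) (at t)"
proof -
  consider "t > 0" | "t < 0" | "t = 0" by linarith
  then show ?thesis
  proof cases
    case 1
    have "((\<lambda>t. exp (- (1 / t)) / t ^ k) has_real_derivative
        exp_flat (k + 2) t - k * exp_flat (k + 1) t) (at t)"
    proof (rule DERIV_cong[OF DERIV_divide])
      show "((\<lambda>t. exp (- (1 / t))) has_real_derivative exp (- (1 / t)) / t\<^sup>2) (at t)"
        using 1 by (auto intro!: derivative_eq_intros simp: power2_eq_square)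
      show "((\<lambda>t. t ^ k) has_real_derivative k * t ^ k / t) (at t)"
        by (rule DERIV_cong[OF DERIV_pow]) (use 1 in \<open>cases k; simp\<close>)
    qed (use 1 in \<open>auto simp: exp_flat_def field_simps power2_eq_square\<close>)
    then show ?thesis
      by (rule has_field_derivative_transform_within_open[of _ _ _ "{0<..}"])
         (use 1 in \<open>auto simp: exp_flat_def\<close>)
  next
    case 2
    have "((\<lambda>t. 0) has_real_derivative 0) (at t)" by simp
    then have "(exp_flat k has_real_derivative 0) (at t)"
      by (rule has_field_derivative_transform_within_open[of _ _ _ "{..<0}"])
         (use 2 in \<open>auto simp: exp_flat_def\<close>)
    then show ?thesis using 2 by (simp add: exp_flat_def)
  next
    case 3
    have "((\<lambda>h. (exp_flat k (0 + h) - exp_flat k 0) / h) \<longlongrightarrow> 0) (at 0)"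
      by (rule Lim_transform_eventually[OF exp_flat_tendsto_0[of "Suc k"]])
         (auto simp: exp_flat_def eventually_at_filter intro!: always_eventually)
    then show ?thesis using 3 by (simp add: DERIV_def exp_flat_def)
  qed
qed

lemma smooth_on_exp_flat: "smooth_on UNIV (exp_flat k)"
proof (rule smooth_on_up_to_algebra_real[where C = "range exp_flat"])
  fix f assume "f \<in> range exp_flat"
  then obtain k where f: "f = exp_flat k" by blast
  have "(\<lambda>t. exp_flat (k + 2) t + (- real k) * exp_flat (k + 1) t) \<in> smooth_algebra UNIV (range exp_flat)"
    by (intro smooth_algebra.add smooth_algebra.mult smooth_algebra.smooth[OF smooth_on_const])
       (auto intro: smooth_algebra.gen)
  then show "\<exists>g\<in>smooth_algebra UNIV (range exp_flat). \<forall>x\<in>UNIV. (f has_real_derivative g x) (at x)"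
    using exp_flat_derivative[of k] f by (intro bexI) auto
qed auto

definition cutoff :: "real \<Rightarrow> real" where
  "cutoff t = exp_flat 0 (4 - t\<^sup>2) / (exp_flat 0 (4 - t\<^sup>2) + exp_flat 0 (t\<^sup>2 - 1))"

lemma smooth_on_cutoff: "smooth_on UNIV cutoff"
proof -
  have id: "smooth_on UNIV (\<lambda>t::real. t)" by (intro smooth_on_bounded_linear bounded_linear_ident) simp
  have "smooth_on UNIV (\<lambda>t. exp_flat 0 (4 - t\<^sup>2))" "smooth_on UNIV (\<lambda>t. exp_flat 0 (t\<^sup>2 - 1))"
    by (auto intro!: smooth_on_compose_real[OF _ smooth_on_exp_flat] smooth_on_diff smooth_on_power
        smooth_on_const id)
  moreover have "exp_flat 0 (4 - t\<^sup>2) + exp_flat 0 (t\<^sup>2 - 1) \<noteq> 0" for t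
    by (auto simp: exp_flat_def add_pos_pos[THEN less_imp_neq, symmetric])
  ultimately show ?thesis unfolding cutoff_def
    by (intro smooth_on_divide smooth_on_add) auto
qed

lemma cutoff_eq_1: "\<bar>t\<bar> \<le> 1 \<Longrightarrow> cutoff t = 1"
  and cutoff_eq_0: "\<bar>t\<bar> \<ge> 2 \<Longrightarrow> cutoff t = 0"
proof -
  assume "\<bar>t\<bar> \<le> 1"
  then have "t\<^sup>2 \<le> 1" using abs_square_le_1 by blast
  then show "cutoff t = 1" by (auto simp: cutoff_def exp_flat_def)
next
  assume "\<bar>t\<bar> \<ge> 2"
  then have "t\<^sup>2 \<ge> 2\<^sup>2" by (metis abs_le_square_iff abs_numeral)
  then show "cutoff t = 0" by (auto simp: cutoff_def exp_flat_def)
qed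

section \<open>Borel's lemma\<close>

lemma
  fixes f :: "real \<Rightarrow> real"
  assumes S: "open S" and f: "smooth_on S f"
  shows has_real_derivative_deriv: "x \<in> S \<Longrightarrow> (f has_real_derivative deriv f x) (at x)"
    and smooth_on_deriv: "smooth_on S (deriv f)"
proof -
  have *: "(f has_real_derivative deriv f x) (at x)" if "x \<in> S" for x
    using smooth_on_has_derivative[OF f that] DERIV_imp_deriv has_real_derivative by metis
  then show "x \<in> S \<Longrightarrow> (f has_real_derivative deriv f x) (at x)" .
  show "smooth_on S (deriv f)"
  proof (rule smooth_on_cong[OF S _ smooth_on_frechet_derivative[OF f, of 1]])
    fix x assume "x \<in> S"
    from frechet_derivative_at[OF *[OF this, unfolded has_field_derivative_def]]
    show "frechet_derivative f (at x) 1 = deriv f x" by (metis mult.right_neutral)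
  qed
qed

definition cut_monomial :: "nat \<Rightarrow> real \<Rightarrow> real" where
  "cut_monomial n s = s ^ n * cutoff s"

lemma smooth_on_cut_monomial_deriv: "smooth_on UNIV ((deriv ^^ i) (cut_monomial n))"
proof (induction i)
  case 0
  have "smooth_on UNIV (\<lambda>s. s ^ n * cutoff s)"
    by (intro smooth_on_mult smooth_on_power smooth_on_cutoff smooth_on_bounded_linear bounded_linear_ident) simp_all
  then show ?case by (simp add: cut_monomial_def[abs_def])
next
  case (Suc i)
  then show ?case using smooth_on_deriv[OF open_UNIV] by simp
qed

lemma DERIV_cut_monomial:
  "((deriv ^^ i) (cut_monomial n) has_real_derivative (deriv ^^ Suc i) (cut_monomial n) s) (at s)"
  using has_real_derivative_deriv[OF open_UNIV smooth_on_cut_monomial_deriv] by simp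

lemma cut_monomial_deriv_outside: "\<bar>s\<bar> > 2 \<Longrightarrow> (deriv ^^ i) (cut_monomial n) s = 0"
proof (induction i arbitrary: s)
  case 0
  then show ?case by (simp add: cut_monomial_def cutoff_eq_0)
next
  case (Suc i)
  have "open {s::real. \<bar>s\<bar> > 2}" by (intro open_Collect_less continuous_intros)
  then have "((deriv ^^ i) (cut_monomial n) has_real_derivative 0) (at s)"
    using Suc has_field_derivative_transform_within_open[OF DERIV_const[of 0 "at s"], of "{s. \<bar>s\<bar> > 2}"]
    by auto
  then show ?case using DERIV_unique[OF DERIV_cut_monomial] by blast
qed

lemma cut_monomial_deriv_bounded: "\<exists>K\<ge>0. \<forall>s. \<bar>(deriv ^^ i) (cut_monomial n) s\<bar> \<le> K"
proof -
  have "compact ((deriv ^^ i) (cut_monomial n) ` {-2..2})"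
    using smooth_on_continuous_on[OF smooth_on_cut_monomial_deriv]
    by (intro compact_continuous_image) (auto intro: continuous_on_subset)
  from compact_imp_bounded[OF this] obtain K where
    K: "\<forall>x\<in>(deriv ^^ i) (cut_monomial n) ` {-2..2}. norm x \<le> K"
    unfolding bounded_iff by blast
  have "\<bar>(deriv ^^ i) (cut_monomial n) s\<bar> \<le> max 0 K" for s
  proof (cases "\<bar>s\<bar> > 2")
    case False
    then have "s \<in> {-2..2}" by auto
    then have "norm ((deriv ^^ i) (cut_monomial n) s) \<le> K" using K by blast
    then show ?thesis by simp
  qed (simp add: cut_monomial_deriv_outside)
  then show ?thesis by (intro exI[of _ "max 0 K"]) auto
qed

lemma cut_monomial_deriv_near_0:
  "\<bar>s\<bar> < 1 \<Longrightarrow> (deriv ^^ i) (cut_monomial n) s = (if i \<le> n then fact n / fact (n - i) * s ^ (n - i) else 0)"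
proof (induction i arbitrary: s)
  case 0
  then show ?case by (simp add: cut_monomial_def cutoff_eq_1)
next
  case (Suc i)
  let ?p = "\<lambda>s::real. if i \<le> n then fact n / fact (n - i) * s ^ (n - i) else 0"
  let ?q = "\<lambda>s::real. if Suc i \<le> n then fact n / fact (n - Suc i) * s ^ (n - Suc i) else 0"
  have "(?p has_real_derivative ?q s) (at s)"
  proof (cases "Suc i \<le> n")
    case True
    define m where "m = n - Suc i"
    have m: "n - i = Suc m" "n - Suc i = m" "i \<le> n" using True by (auto simp: m_def)
    have "((\<lambda>s. fact n / fact (Suc m) * s ^ Suc m) has_real_derivative
        fact n / fact (Suc m) * (real (Suc m) * s ^ m)) (at s)"
      by (intro DERIV_cmult DERIV_cong[OF DERIV_pow]) simp
    moreover have "fact n / fact (Suc m) * (real (Suc m) * s ^ m) = fact n / fact m * s ^ m"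
      by (simp del: of_nat_Suc add: fact_Suc)
    ultimately show ?thesis using m True by simp
  next
    case False
    then show ?thesis by (cases "i = n") auto
  qed
  moreover have "open {s::real. \<bar>s\<bar> < 1}" by (intro open_Collect_less continuous_intros)
  ultimately have "((deriv ^^ i) (cut_monomial n) has_real_derivative ?q s) (at s)"
    by (rule has_field_derivative_transform_within_open) (use Suc in auto)
  then show ?case using DERIV_unique[OF DERIV_cut_monomial] by blast
qed

text \<open>
  The series \<open>\<Sum>n. a n 0 y * u ^ n\<close> need not converge. The monomial \<open>u ^ n\<close> is therefore cut off at distance
  \<open>2 * \<epsilon> n\<close> from zero, which does not change its Taylor polynomial, and \<open>\<epsilon> n\<close> is taken so small that the series of
  derivatives of every order is dominated by a geometric series from some index on. The second index of
  \<open>a\<close> counts derivatives with respect to the parameter \<open>y\<close>.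
\<close>

lemma Borel_lemma:
  fixes a :: "nat \<Rightarrow> nat \<Rightarrow> real \<Rightarrow> real"
  assumes Y: "open Y" "convex Y"
    and da: "\<And>n l y. y \<in> Y \<Longrightarrow> (a n l has_real_derivative a n (Suc l) y) (at y)"
    and bd: "\<And>n l. \<exists>A. \<forall>y\<in>Y. \<bar>a n l y\<bar> \<le> A"
  obtains E where "smooth_on (UNIV \<times> Y) E"
    "\<And>N y. y \<in> Y \<Longrightarrow> \<exists>C. \<forall>u. \<bar>E (u, y) - (\<Sum>n<N. a n 0 y * u ^ n)\<bar> \<le> C * \<bar>u\<bar> ^ N"
proof -
  have "\<exists>A\<ge>0. \<forall>y\<in>Y. \<bar>a n l y\<bar> \<le> A" for n l
    using bd[of n l] by (meson max.cobounded1 max.cobounded2 order_trans)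
  then have "\<forall>n l. \<exists>A\<ge>0. \<forall>y\<in>Y. \<bar>a n l y\<bar> \<le> A" by blast
  then obtain A where "\<forall>n l. A n l \<ge> 0 \<and> (\<forall>y\<in>Y. \<bar>a n l y\<bar> \<le> A n l)" by moura
  then have A0: "\<And>n l. A n l \<ge> 0" and A: "\<And>n l y. y \<in> Y \<Longrightarrow> \<bar>a n l y\<bar> \<le> A n l" by auto
  have "\<forall>n i. \<exists>K\<ge>0. \<forall>s. \<bar>(deriv ^^ i) (cut_monomial n) s\<bar> \<le> K"
    using cut_monomial_deriv_bounded by blast
  then obtain K where "\<forall>n i. K n i \<ge> 0 \<and> (\<forall>s. \<bar>(deriv ^^ i) (cut_monomial n) s\<bar> \<le> K n i)" by moura
  then have K0: "\<And>n i. K n i \<ge> 0" and K: "\<And>n i s. \<bar>(deriv ^^ i) (cut_monomial n) s\<bar> \<le> K n i" by auto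
  define B where "B n = (\<Sum>i\<le>n. \<Sum>l\<le>n. A n l * K n i)" for n
  have B: "A n l * K n i \<le> B n" if "i \<le> n" "l \<le> n" for n i l
  proof -
    have "A n l * K n i \<le> (\<Sum>l\<le>n. A n l * K n i)"
      using that A0 K0 by (intro member_le_sum) auto
    also have "\<dots> \<le> B n" unfolding B_def
      using that A0 K0 by (intro member_le_sum[where f = "\<lambda>i. \<Sum>l\<le>n. A n l * K n i"] sum_nonneg) auto
    finally show ?thesis .
  qed
  have B0: "B n \<ge> 0" for n unfolding B_def using A0 K0 by (intro sum_nonneg) auto
  \<comment> \<open>If \<open>i < n\<close>, the \<open>i\<close>-th derivative of the rescaled monomial keeps a factor \<open>\<epsilon> n\<close>, which outweighs \<open>B n\<close>.\<close>
  define \<epsilon> where "\<epsilon> n = 1 / (2 ^ n * (1 + B n))" for n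
  have ge1: "1 \<le> 2 ^ n * (1 + B n)" for n
    using mult_mono[of 1 "2 ^ n" 1 "1 + B n"] B0[of n] by simp
  have e0: "\<epsilon> n > 0" and e1: "\<epsilon> n \<le> 1" for n
    using ge1[of n] by (auto simp: \<epsilon>_def divide_le_eq_1)
  define P where "P n i u = \<epsilon> n ^ n / \<epsilon> n ^ i * (deriv ^^ i) (cut_monomial n) (u / \<epsilon> n)" for n i u
  have dP: "(P n i has_real_derivative P n (Suc i) u) (at u)" for n i u
    unfolding P_def
    by (rule DERIV_cong[OF DERIV_cmult[OF DERIV_chain'[OF _ DERIV_cut_monomial]]])
       (use e0[of n] in \<open>auto intro!: derivative_eq_intros simp: field_simps\<close>)
  define M where "M i l n = (if i < n \<and> l \<le> n then (1 / 2) ^ n else A n l * (\<epsilon> n ^ n / \<epsilon> n ^ i * K n i))" for i l n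
  have bound: "\<bar>a n l y * P n i u\<bar> \<le> M i l n" if "y \<in> Y" for n l i y u
  proof -
    have pos: "\<epsilon> n ^ n / \<epsilon> n ^ i > 0" using e0 by simp
    have "\<bar>P n i u\<bar> \<le> \<epsilon> n ^ n / \<epsilon> n ^ i * K n i"
      unfolding P_def abs_mult abs_of_pos[OF pos] using pos K by (intro mult_left_mono) auto
    then have *: "\<bar>a n l y * P n i u\<bar> \<le> A n l * (\<epsilon> n ^ n / \<epsilon> n ^ i * K n i)"
      unfolding abs_mult using A[OF that] A0 by (intro mult_mono) auto
    show ?thesis
    proof (cases "i < n \<and> l \<le> n")
      case True
      then obtain m where m: "n = Suc (i + m)" using less_iff_Suc_add by auto
      have "\<epsilon> n ^ n / \<epsilon> n ^ i = \<epsilon> n ^ m * \<epsilon> n"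
        using e0[of n] unfolding m by (simp add: power_add)
      also have "\<dots> \<le> 1 * \<epsilon> n"
        by (intro mult_right_mono power_le_one) (use e0[of n] e1[of n] in auto)
      finally have "A n l * (\<epsilon> n ^ n / \<epsilon> n ^ i * K n i) \<le> A n l * K n i * \<epsilon> n"
        using A0[of n l] K0[of n i] by (metis mult.assoc mult.commute mult_1 mult_left_mono mult_nonneg_nonneg)
      also have "\<dots> \<le> B n * \<epsilon> n" using B[of i n l] True e0[of n] by (intro mult_right_mono) auto
      also have "\<dots> \<le> (1 / 2) ^ n"
      proof -
        have "B n * \<epsilon> n = B n / (1 + B n) * (1 / 2) ^ n" by (simp add: \<epsilon>_def power_one_over)
        also have "\<dots> \<le> 1 * (1 / 2) ^ n" using B0[of n] by (intro mult_right_mono) auto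
        finally show ?thesis by simp
      qed
      finally show ?thesis using * True by (simp add: M_def)
    qed (use * in \<open>auto simp: M_def\<close>)
  qed
  have sumM: "summable (M i l)" for i l
  proof -
    have "\<forall>\<^sub>F n in sequentially. M i l n = (1 / 2) ^ n"
      using eventually_gt_at_top[of i] eventually_ge_at_top[of l]
      by eventually_elim (simp add: M_def)
    then show ?thesis using summable_cong[of "M i l" "\<lambda>n. (1/2) ^ n"] summable_geometric[of "1/2::real"] by auto
  qed
  define E where "E i l z = (\<Sum>n. a n l (snd z) * P n i (fst z))" for i l z
  have unif: "uniform_limit (UNIV \<times> Y) (\<lambda>N z. \<Sum>n<N. a n l (snd z) * P n i (fst z)) (E i l) sequentially" for i l
    unfolding E_def by (rule Weierstrass_m_test[OF _ sumM[of i l]]) (use bound in auto)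
  have S: "open (UNIV \<times> Y :: (real \<times> real) set)" "convex (UNIV \<times> Y :: (real \<times> real) set)"
    using Y by (simp_all add: open_Times convex_Times)
  have dE: "(E i l has_derivative (\<lambda>v. fst v * E (Suc i) l z + snd v * E i (Suc l) z)) (at z)"
    if z: "z \<in> UNIV \<times> Y" for i l z
  proof -
    have "\<exists>g. \<forall>z\<in>UNIV \<times> Y. (\<lambda>n. a n l (snd z) * P n i (fst z)) sums g z \<and>
        (g has_derivative (\<lambda>v. fst v * E (Suc i) l z + snd v * E i (Suc l) z)) (at z within UNIV \<times> Y)"
    proof (rule has_derivative_series[OF S(2) _ _ z,
        where f' = "\<lambda>n z v. fst v * (a n l (snd z) * P n (Suc i) (fst z)) + snd v * (a n (Suc l) (snd z) * P n i (fst z))"])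
      fix n and z :: "real \<times> real" assume "z \<in> UNIV \<times> Y"
      then have "snd z \<in> Y" by auto
      have "((\<lambda>z. a n l (snd z)) has_derivative (\<lambda>v. a n (Suc l) (snd z) * snd v)) (at z)"
        by (rule has_derivative_compose[OF has_derivative_snd[OF has_derivative_ident]
              da[OF \<open>snd z \<in> Y\<close>, unfolded has_field_derivative_def]])
      moreover have "((\<lambda>z. P n i (fst z)) has_derivative (\<lambda>v. P n (Suc i) (fst z) * fst v)) (at z)"
        by (rule has_derivative_compose[OF has_derivative_fst[OF has_derivative_ident]
              dP[unfolded has_field_derivative_def]])
      ultimately have "((\<lambda>z. a n l (snd z) * P n i (fst z)) has_derivative
         (\<lambda>v. a n l (snd z) * (P n (Suc i) (fst z) * fst v) + a n (Suc l) (snd z) * snd v * P n i (fst z))) (at z)"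
        by (rule has_derivative_mult)
      then show "((\<lambda>z. a n l (snd z) * P n i (fst z)) has_derivative
         (\<lambda>v. fst v * (a n l (snd z) * P n (Suc i) (fst z)) + snd v * (a n (Suc l) (snd z) * P n i (fst z)))) (at z within UNIV \<times> Y)"
        by (rule has_derivative_at_withinI[OF has_derivative_eq_rhs]) (rule ext, algebra)
    next
      fix e :: real assume "e > 0"
      then have "e / 2 > 0" by simp
      from uniform_limitD[OF unif[of l "Suc i"] this] uniform_limitD[OF unif[of "Suc l" i] this]
      show "\<forall>\<^sub>F N in sequentially. \<forall>z\<in>UNIV \<times> Y. \<forall>v.
        norm ((\<Sum>n<N. fst v * (a n l (snd z) * P n (Suc i) (fst z)) + snd v * (a n (Suc l) (snd z) * P n i (fst z)))
          - (fst v * E (Suc i) l z + snd v * E i (Suc l) z)) \<le> e * norm v"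
      proof (eventually_elim, intro ballI allI)
        fix N and z v :: "real \<times> real" assume z: "z \<in> UNIV \<times> Y"
        let ?p = "(\<Sum>n<N. a n l (snd z) * P n (Suc i) (fst z)) - E (Suc i) l z"
        let ?q = "(\<Sum>n<N. a n (Suc l) (snd z) * P n i (fst z)) - E i (Suc l) z"
        assume *: "\<forall>z\<in>UNIV \<times> Y. dist (\<Sum>n<N. a n l (snd z) * P n (Suc i) (fst z)) (E (Suc i) l z) < e / 2"
          "\<forall>z\<in>UNIV \<times> Y. dist (\<Sum>n<N. a n (Suc l) (snd z) * P n i (fst z)) (E i (Suc l) z) < e / 2"
        have pq: "\<bar>?p\<bar> \<le> e / 2" "\<bar>?q\<bar> \<le> e / 2"
          using bspec[OF *(1) z] bspec[OF *(2) z] by (simp_all add: dist_real_def)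
        have v: "\<bar>fst v\<bar> \<le> norm v" "\<bar>snd v\<bar> \<le> norm v"
          by (metis norm_fst_le norm_snd_le prod.collapse real_norm_def)+
        have "(\<Sum>n<N. fst v * (a n l (snd z) * P n (Suc i) (fst z)) + snd v * (a n (Suc l) (snd z) * P n i (fst z)))
          - (fst v * E (Suc i) l z + snd v * E i (Suc l) z) = fst v * ?p + snd v * ?q"
          by (simp add: sum.distrib sum_distrib_left algebra_simps)
        also have "norm \<dots> \<le> norm v * (e / 2) + norm v * (e / 2)"
          unfolding real_norm_def
          by (rule order_trans[OF abs_triangle_ineq]) (unfold abs_mult, intro add_mono mult_mono pq v; simp)
        finally show "norm ((\<Sum>n<N. fst v * (a n l (snd z) * P n (Suc i) (fst z)) + snd v * (a n (Suc l) (snd z) * P n i (fst z)))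
          - (fst v * E (Suc i) l z + snd v * E i (Suc l) z)) \<le> e * norm v" by simp
      qed
    next
      show "(\<lambda>n. a n l (snd z) * P n i (fst z)) sums E i l z"
        unfolding E_def
        by (intro summable_sums summable_comparison_test[OF _ sumM[of i l]]) (use bound z in auto)
    qed
    then obtain g where g: "\<forall>z\<in>UNIV \<times> Y. (\<lambda>n. a n l (snd z) * P n i (fst z)) sums g z \<and>
        (g has_derivative (\<lambda>v. fst v * E (Suc i) l z + snd v * E i (Suc l) z)) (at z within UNIV \<times> Y)"
      by (rule exE)
    have "(g has_derivative (\<lambda>v. fst v * E (Suc i) l z + snd v * E i (Suc l) z)) (at z)"
      using bspec[OF g z] unfolding at_within_open[OF z S(1)] by (rule conjunct2)
    then show ?thesis
    proof (rule has_derivative_transform_within_open[OF _ S(1) z])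
      fix w :: "real \<times> real" assume "w \<in> UNIV \<times> Y"
      from bspec[OF g this] show "g w = E i l w" unfolding E_def by (simp add: sums_iff)
    qed
  qed
  have smE: "smooth_on (UNIV \<times> Y) (E 0 0)"
  proof (rule smooth_on_up_to_algebra_plane[OF S(1), where C = "{E i l |i l. True}"])
    fix h assume "h \<in> {E i l |i l. True}"
    then obtain i l where "h = E i l" by blast
    have gen: "E i l \<in> smooth_algebra (UNIV \<times> Y) {E i l |i l. True}" for i l
      by (intro smooth_algebra.gen) blast
    have "\<forall>z\<in>UNIV \<times> Y. (h has_derivative (\<lambda>v. fst v * E (Suc i) l z + snd v * E i (Suc l) z)) (at z)"
      unfolding \<open>h = E i l\<close> using dE by (intro ballI)
    then show "\<exists>g\<in>smooth_algebra (UNIV \<times> Y) {E i l |i l. True}. \<exists>k\<in>smooth_algebra (UNIV \<times> Y) {E i l |i l. True}.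
        \<forall>z\<in>UNIV \<times> Y. (h has_derivative (\<lambda>v. fst v * g z + snd v * k z)) (at z)"
      by (rule bexI[OF bexI[OF _ gen] gen])
  qed auto
  have P0: "P n i 0 = (if i = n then fact n else 0)" for n i
  proof -
    have "P n i 0 = \<epsilon> n ^ n / \<epsilon> n ^ i * (if i \<le> n then fact n / fact (n - i) * 0 ^ (n - i) else 0)"
      using cut_monomial_deriv_near_0[of 0 i n] by (simp only: P_def div_0 abs_zero zero_less_one simp_thms)
    moreover have "\<epsilon> n ^ n \<noteq> 0" using e0[of n] by simp
    ultimately show ?thesis by (cases "i < n"; cases "i = n") (simp_all add: power_0_left)
  qed
  have taylor: "\<bar>E 0 0 (u, y) - (\<Sum>n<N. a n 0 y * u ^ n)\<bar> \<le> (\<Sum>n. M N 0 n) / fact N * \<bar>u\<bar> ^ N"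
    if y: "y \<in> Y" for N u y
  proof -
    have "((\<lambda>u. E m 0 (u, y)) has_real_derivative E (Suc m) 0 (t, y)) (at t)" for m t
    proof -
      have "((\<lambda>u. (u, y)) has_derivative (\<lambda>h. (h, 0))) (at t)" by (auto intro!: derivative_eq_intros)
      moreover have "(E m 0 has_derivative (\<lambda>v. fst v * E (Suc m) 0 (t, y) + snd v * E m (Suc 0) (t, y))) (at (t, y))"
        using dE y by blast
      ultimately have "((\<lambda>u. E m 0 (u, y)) has_derivative
          (\<lambda>h. fst (h, 0::real) * E (Suc m) 0 (t, y) + snd (h, 0) * E m (Suc 0) (t, y))) (at t)"
        by (rule has_derivative_compose)
      then show ?thesis unfolding has_field_derivative_def by (rule has_derivative_eq_rhs) auto
    qed
    then have "\<forall>m t. m < N \<and> \<bar>t\<bar> \<le> \<bar>u\<bar> \<longrightarrow> ((\<lambda>u. E m 0 (u, y)) has_real_derivative E (Suc m) 0 (t, y)) (at t)"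
      by (intro allI impI)
    from Maclaurin_bi_le[where diff = "\<lambda>m u. E m 0 (u, y)", OF refl this]
    obtain t where t: "E 0 0 (u, y) = (\<Sum>m<N. E m 0 (0, y) / fact m * u ^ m) + E N 0 (t, y) / fact N * u ^ N"
      by (elim exE conjE)
    have "E m 0 (0, y) = a m 0 y * fact m" for m
    proof -
      have "(\<lambda>n. if n = m then a n 0 y * fact n else 0) sums (a m 0 y * fact m)"
        by (rule sums_single)
      moreover have "(\<lambda>n. if n = m then a n 0 y * fact n else 0) = (\<lambda>n. a n 0 y * P n m 0)"
        by (rule ext) (simp add: P0)
      ultimately show ?thesis using sums_unique unfolding E_def by fastforce
    qed
    then have "E 0 0 (u, y) - (\<Sum>n<N. a n 0 y * u ^ n) = E N 0 (t, y) / fact N * u ^ N"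
      unfolding t by simp
    moreover have "\<bar>E N 0 (t, y)\<bar> \<le> (\<Sum>n. M N 0 n)"
      using norm_suminf_le[of "\<lambda>n. a n 0 y * P n N t" "M N 0"] bound[OF y, of _ 0 N t] sumM
      unfolding E_def by simp
    then have "\<bar>E N 0 (t, y)\<bar> / fact N * \<bar>u\<bar> ^ N \<le> (\<Sum>n. M N 0 n) / fact N * \<bar>u\<bar> ^ N"
      by (intro mult_right_mono divide_right_mono) simp_all
    ultimately show ?thesis
      by (simp add: abs_mult power_abs)
  qed
  show ?thesis
  proof (rule that[OF smE])
    show "\<exists>C. \<forall>u. \<bar>E 0 0 (u, y) - (\<Sum>n<N. a n 0 y * u ^ n)\<bar> \<le> C * \<bar>u\<bar> ^ N" if "y \<in> Y" for N y
      by (intro exI allI) (rule taylor[OF that])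
  qed
qed

section \<open>Whitney's theorem on even functions\<close>

lemma bounded_on_segment:
  fixes f :: "real \<Rightarrow> real"
  assumes "\<And>t. \<bar>t\<bar> \<le> h \<Longrightarrow> isCont f t"
  shows "\<exists>B\<ge>0. \<forall>t. \<bar>t\<bar> \<le> h \<longrightarrow> \<bar>f t\<bar> \<le> B"
proof -
  have "continuous_on {-h..h} f"
    using assms by (intro continuous_at_imp_continuous_on) auto
  then have "compact (f ` {-h..h})" by (intro compact_continuous_image) auto
  from compact_imp_bounded[OF this] obtain B where B: "\<forall>x\<in>f ` {-h..h}. norm x \<le> B"
    unfolding bounded_iff by blast
  have "\<bar>f t\<bar> \<le> max 0 B" if "\<bar>t\<bar> \<le> h" for t
  proof -
    have "t \<in> {-h..h}" using that by auto
    then have "norm (f t) \<le> B" using B by blast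
    then show ?thesis by simp
  qed
  then show ?thesis by (intro exI[of _ "max 0 B"]) auto
qed

text \<open>The first nonzero Taylor coefficient would dominate near zero.\<close>

lemma derivatives_eq_0_if_flat:
  fixes r :: "nat \<Rightarrow> real \<Rightarrow> real"
  assumes \<delta>: "\<delta> > 0" and dr: "\<And>n t. \<bar>t\<bar> < \<delta> \<Longrightarrow> (r n has_real_derivative r (Suc n) t) (at t)"
    and flat: "\<And>N. \<exists>C \<rho>. \<rho> > 0 \<and> (\<forall>t. \<bar>t\<bar> < \<rho> \<longrightarrow> \<bar>r 0 t\<bar> \<le> C * \<bar>t\<bar> ^ N)"
  shows "r n 0 = 0"
proof (induction n rule: less_induct)
  case (less n)
  obtain C \<rho> where \<rho>: "\<rho> > 0" and C: "\<And>t. \<bar>t\<bar> < \<rho> \<Longrightarrow> \<bar>r 0 t\<bar> \<le> C * \<bar>t\<bar> ^ Suc n"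
    using flat[of "Suc n"] by blast
  have "\<exists>B\<ge>0. \<forall>t. \<bar>t\<bar> \<le> \<delta> / 2 \<longrightarrow> \<bar>r (Suc n) t\<bar> \<le> B"
    using \<delta> by (intro bounded_on_segment DERIV_isCont[OF dr]) auto
  then obtain B where B: "B \<ge> 0" "\<And>t. \<bar>t\<bar> \<le> \<delta> / 2 \<Longrightarrow> \<bar>r (Suc n) t\<bar> \<le> B" by blast
  define c where "c = \<bar>r n 0\<bar> / fact n"
  define D where "D = max 1 (C + B)"
  have key: "c \<le> D * t" if t: "0 < t" "t < \<rho>" "t \<le> \<delta> / 2" for t
  proof -
    have "\<forall>m s. m < Suc n \<and> \<bar>s\<bar> \<le> \<bar>t\<bar> \<longrightarrow> (r m has_real_derivative r (Suc m) s) (at s)"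
      using t \<delta> by (intro allI impI dr) auto
    from Maclaurin_bi_le[OF refl this] obtain s where s: "\<bar>s\<bar> \<le> \<bar>t\<bar>"
      "r 0 t = (\<Sum>m<Suc n. r m 0 / fact m * t ^ m) + r (Suc n) s / fact (Suc n) * t ^ Suc n"
      by (elim exE conjE)
    have "(\<Sum>m<n. r m 0 / fact m * t ^ m) = 0" using less by (intro sum.neutral) simp
    then have eq: "r n 0 / fact n * t ^ n = r 0 t - r (Suc n) s / fact (Suc n) * t ^ Suc n"
      unfolding s(2) by simp
    have "\<bar>r (Suc n) s / fact (Suc n)\<bar> \<le> B / 1"
      unfolding abs_divide using B s(1) t by (intro frac_le) (auto simp: fact_ge_1 simp del: fact_Suc)
    then have "\<bar>r (Suc n) s / fact (Suc n) * t ^ Suc n\<bar> \<le> B * t ^ Suc n"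
      unfolding abs_mult using t B(1) by (intro mult_mono) auto
    moreover have "\<bar>r 0 t\<bar> \<le> C * t ^ Suc n" using C[of t] t by simp
    ultimately have "\<bar>r n 0 / fact n * t ^ n\<bar> \<le> C * t ^ Suc n + B * t ^ Suc n" unfolding eq by linarith
    also have "\<dots> = (C + B) * t * t ^ n" by (simp add: algebra_simps)
    also have "\<dots> \<le> D * t * t ^ n" unfolding D_def using t by (intro mult_right_mono) auto
    also have "\<bar>r n 0 / fact n * t ^ n\<bar> = c * t ^ n" using t by (simp add: c_def abs_mult)
    finally show ?thesis using t by (simp add: mult_le_cancel_right)
  qed
  show ?case
  proof (rule ccontr)
    assume "r n 0 \<noteq> 0"
    then have c: "c > 0" by (simp add: c_def)
    have D: "D \<ge> 1" by (simp add: D_def)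
    define t where "t = min (\<rho> / 2) (min (\<delta> / 2) (c / (2 * D)))"
    have "c \<le> D * t" by (rule key) (use \<rho> \<delta> c D in \<open>auto simp: t_def\<close>)
    also have "\<dots> \<le> D * (c / (2 * D))" using D by (intro mult_left_mono) (auto simp: t_def)
    also have "\<dots> = c / 2" using D by simp
    finally show False using c by simp
  qed
qed

text \<open>
  The function \<open>R (x, y) / x ^ k\<close> for \<open>x > 0\<close>, in terms of \<open>u = x\<^sup>2\<close>. Differentiation with respect to \<open>u\<close> divides
  by \<open>2 * x\<close>, hence the exponent.
\<close>

definition sqrt_quotient :: "nat \<Rightarrow> (real \<times> real \<Rightarrow> real) \<Rightarrow> real \<times> real \<Rightarrow> real" where
  "sqrt_quotient k R z = (if fst z > 0 then R (sqrt (fst z), snd z) / sqrt (fst z) ^ k else 0)"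

text \<open>
  The bound is uniform in \<open>y'\<close> near \<open>y\<close>, because the differentiability of a quotient at a boundary point \<open>(0, y)\<close>
  concerns both variables at once.
\<close>

lemma flat_bound:
  assumes a: "a > 0" and Y: "open Y" "y \<in> Y" and R: "smooth_on ({-a<..<a} \<times> Y) R"
    and flat: "\<And>n y. y \<in> Y \<Longrightarrow> (partial_x ^^ n) R (0, y) = 0"
  shows "\<exists>C \<rho>. C \<ge> 0 \<and> \<rho> > 0 \<and> (\<forall>x y'. \<bar>x\<bar> < \<rho> \<longrightarrow> \<bar>y' - y\<bar> < \<rho> \<longrightarrow> \<bar>R (x, y')\<bar> \<le> C * \<bar>x\<bar> ^ N)"
proof -
  let ?Q = "{-a<..<a} \<times> Y" and ?P = "(partial_x ^^ N) R"
  have z: "(0, y) \<in> ?Q" using a Y by auto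
  have "isCont ?P (0, y)" using smooth_on_isCont[OF smooth_on_partial_iterates(1)[OF R] z] .
  then have "\<forall>\<^sub>F w in nhds (0, y). dist (?P w) (?P (0, y)) < 1"
    by (rule isCont_eventually_near) simp
  moreover have "\<forall>\<^sub>F w in nhds (0, y). w \<in> ?Q"
    using Y z by (intro eventually_nhds_in_open open_Times) auto
  ultimately have "\<forall>\<^sub>F w in nhds (0, y). w \<in> ?Q \<and> dist (?P w) (?P (0, y)) < 1"
    by eventually_elim auto
  then obtain d where d: "d > 0" "\<And>w. dist w (0, y) < d \<Longrightarrow> w \<in> ?Q \<and> dist (?P w) (?P (0, y)) < 1"
    unfolding eventually_nhds_metric by blast
  define C where "C = \<bar>?P (0, y)\<bar> + 1"
  have C: "w \<in> ?Q" "\<bar>?P w\<bar> \<le> C" if w: "w = (x, y')" "\<bar>x\<bar> < d / 2" "\<bar>y' - y\<bar> < d / 2" for w x y'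
  proof -
    have "dist w (0, y) \<le> \<bar>x\<bar> + \<bar>y' - y\<bar>"
      unfolding w dist_Pair_Pair dist_real_def by (rule order_trans[OF sqrt_sum_squares_le_sum_abs]) simp
    also have "\<dots> < d" using w by simp
    finally have *: "w \<in> ?Q" "dist (?P w) (?P (0, y)) < 1" using d(2) by blast+
    show "w \<in> ?Q" by (rule *)
    show "\<bar>?P w\<bar> \<le> C" using *(2) unfolding C_def dist_real_def by linarith
  qed
  have "\<bar>R (x, y')\<bar> \<le> C * \<bar>x\<bar> ^ N" if x: "\<bar>x\<bar> < d / 2" and y': "\<bar>y' - y\<bar> < d / 2" for x y'
  proof -
    have Q: "(t, y') \<in> ?Q" if "\<bar>t\<bar> \<le> \<bar>x\<bar>" for t using C(1)[OF refl, of t y'] x y' that by simp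
    then have "\<forall>m t. m < N \<and> \<bar>t\<bar> \<le> \<bar>x\<bar> \<longrightarrow>
        ((\<lambda>x. (partial_x ^^ m) R (x, y')) has_real_derivative (partial_x ^^ Suc m) R (t, y')) (at t)"
      by (intro allI impI DERIV_partial_x_iterate[OF R]) auto
    from Maclaurin_bi_le[where diff = "\<lambda>m x. (partial_x ^^ m) R (x, y')", OF refl this]
    obtain t where t: "\<bar>t\<bar> \<le> \<bar>x\<bar>" "(partial_x ^^ 0) R (x, y') =
        (\<Sum>m<N. (partial_x ^^ m) R (0, y') / fact m * x ^ m) + ?P (t, y') / fact N * x ^ N"
      by (elim exE conjE)
    have "(\<Sum>m<N. (partial_x ^^ m) R (0, y') / fact m * x ^ m) = 0"
      using flat[of y'] Q[of x] by (intro sum.neutral) simp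
    then have "R (x, y') = ?P (t, y') / fact N * x ^ N" using t(2) by simp
    also have "\<bar>\<dots>\<bar> \<le> C / 1 * \<bar>x\<bar> ^ N"
      unfolding abs_mult abs_divide power_abs using C(2)[OF refl, of t y'] t(1) x y'
      by (intro mult_mono frac_le) (auto simp: C_def fact_ge_1)
    finally show ?thesis by simp
  qed
  then show ?thesis using d(1) by (intro exI[of _ C] exI[of _ "d / 2"]) (auto simp: C_def)
qed

lemma has_derivative_sqrt_quotient:
  assumes a: "a > 0" and Y: "open Y" and R: "smooth_on ({-a<..<a} \<times> Y) R"
    and flat: "\<And>n y. y \<in> Y \<Longrightarrow> (partial_x ^^ n) R (0, y) = 0"
    and z: "z \<in> {..<a\<^sup>2} \<times> Y"
  shows "(sqrt_quotient k R has_derivative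
     (\<lambda>v. fst v * ((1 / 2) * sqrt_quotient (k + 1) (partial_x R) z + (- real k / 2) * sqrt_quotient (k + 2) R z)
        + snd v * sqrt_quotient k (partial_y R) z)) (at z)"
proof -
  obtain u y where uy: "z = (u, y)" by force
  have y: "y \<in> Y" "u < a\<^sup>2" using z uy by auto
  consider "u > 0" | "u < 0" | "u = 0" by linarith
  then show ?thesis
  proof cases
    case 1
    define s where "s = sqrt u"
    have s: "s > 0" "s < a" "s * s = u"
      using 1 y a by (auto simp: s_def real_less_lsqrt)
    have Q: "(s, y) \<in> {-a<..<a} \<times> Y" using s y by auto
    have sq': "(sqrt has_real_derivative 1 / (2 * s)) (at u)"
      using DERIV_real_sqrt[OF 1] by (simp add: s_def field_simps)
    then have sq: "(sqrt has_derivative (\<lambda>h. 1 / (2 * s) * h)) (at (fst z))"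
      by (simp only: has_field_derivative_def uy fst_conv)
    have "((\<lambda>w. (sqrt (fst w), snd w)) has_derivative (\<lambda>v. (1 / (2 * s) * fst v, snd v))) (at z)"
      by (intro has_derivative_Pair has_derivative_snd has_derivative_ident
           has_derivative_compose[OF has_derivative_fst[OF has_derivative_ident] sq])
    moreover have "(R has_derivative (\<lambda>v. fst v * partial_x R (s, y) + snd v * partial_y R (s, y)))
        (at (sqrt (fst z), snd z))"
      using has_derivative_partials[OF R Q] by (simp add: uy s_def)
    ultimately have d1: "((\<lambda>w. R (sqrt (fst w), snd w)) has_derivative
       (\<lambda>v. fst (1 / (2 * s) * fst v, snd v) * partial_x R (s, y) + snd (1 / (2 * s) * fst v, snd v) * partial_y R (s, y))) (at z)"
      by (rule has_derivative_compose)
    have "((\<lambda>t. t ^ k) has_real_derivative k * s ^ k / s) (at s)"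
      by (rule DERIV_cong[OF DERIV_pow]) (use s in \<open>cases k; simp\<close>)
    then have "((\<lambda>t. t ^ k) has_real_derivative k * s ^ k / s) (at (sqrt u))" by (simp add: s_def)
    from DERIV_inverse'[OF DERIV_chain'[OF sq' this]] s
    have dq: "((\<lambda>t. inverse (sqrt t ^ k)) has_real_derivative
        - (inverse (s ^ k) * (k * s ^ k / s * (1 / (2 * s))) * inverse (s ^ k))) (at u)"
      by (simp add: s_def)
    then have dq': "((\<lambda>t. inverse (sqrt t ^ k)) has_derivative
        (\<lambda>h. - (inverse (s ^ k) * (k * s ^ k / s * (1 / (2 * s))) * inverse (s ^ k)) * h)) (at (fst z))"
      by (simp only: has_field_derivative_def uy fst_conv)
    have "((\<lambda>w. inverse (sqrt (fst w) ^ k)) has_derivative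
       (\<lambda>v. - (inverse (s ^ k) * (k * s ^ k / s * (1 / (2 * s))) * inverse (s ^ k)) * fst v)) (at z)"
      by (rule has_derivative_compose[OF has_derivative_fst[OF has_derivative_ident] dq'])
    from has_derivative_mult[OF d1 this]
    have "((\<lambda>w. R (sqrt (fst w), snd w) * inverse (sqrt (fst w) ^ k)) has_derivative
      (\<lambda>v. fst v * ((1 / 2) * sqrt_quotient (k + 1) (partial_x R) z + (- real k / 2) * sqrt_quotient (k + 2) R z)
        + snd v * sqrt_quotient k (partial_y R) z)) (at z)"
    proof (rule has_derivative_eq_rhs, intro ext)
      fix v :: "real \<times> real"
      show "R (sqrt (fst z), snd z) * (- (inverse (s ^ k) * (k * s ^ k / s * (1 / (2 * s))) * inverse (s ^ k)) * fst v)
        + (fst (1 / (2 * s) * fst v, snd v) * partial_x R (s, y) + snd (1 / (2 * s) * fst v, snd v) * partial_y R (s, y))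
          * inverse (sqrt (fst z) ^ k)
        = fst v * ((1 / 2) * sqrt_quotient (k + 1) (partial_x R) z + (- real k / 2) * sqrt_quotient (k + 2) R z)
        + snd v * sqrt_quotient k (partial_y R) z"
        using s 1 by (simp add: sqrt_quotient_def uy s_def[symmetric] field_simps power_add power2_eq_square)
    qed
    then show ?thesis
      by (rule has_derivative_transform_within_open[of _ _ _ _ "{0<..} \<times> UNIV"])
         (use 1 in \<open>auto simp: sqrt_quotient_def uy divide_inverse intro!: open_Times\<close>)
  next
    case 2
    have "((\<lambda>w. 0) has_derivative (\<lambda>v. 0)) (at z)" by (rule has_derivative_const)
    then have "(sqrt_quotient k R has_derivative (\<lambda>v. 0)) (at z)"
      by (rule has_derivative_transform_within_open[of _ _ _ _ "{..<0} \<times> UNIV"])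
         (use 2 in \<open>auto simp: sqrt_quotient_def uy intro!: open_Times\<close>)
    then show ?thesis using 2 by (simp add: sqrt_quotient_def uy)
  next
    case 3
    obtain C \<rho> where C: "C \<ge> 0" "\<rho> > 0"
      "\<And>x y'. \<bar>x\<bar> < \<rho> \<Longrightarrow> \<bar>y' - y\<bar> < \<rho> \<Longrightarrow> \<bar>R (x, y')\<bar> \<le> C * \<bar>x\<bar> ^ (k + 4)"
      using flat_bound[OF a Y y(1) R flat, of "k + 4"] by blast
    have b: "\<bar>sqrt_quotient k R (u', y')\<bar> \<le> C * (u' * u')" if u': "\<bar>u'\<bar> < \<rho>\<^sup>2" and y': "\<bar>y' - y\<bar> < \<rho>" for u' y'
    proof (cases "u' > 0")
      case True
      define s where "s = sqrt u'"
      have s: "s > 0" "s < \<rho>" "s * s = u'"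
        using True u' C(2) by (auto simp: s_def real_less_lsqrt)
      have "\<bar>R (s, y')\<bar> \<le> C * (u' * u') * s ^ k"
        using C(3)[of s y'] s y' by (simp add: power_add s(3)[symmetric] eval_nat_numeral ac_simps)
      then show ?thesis using s True by (simp add: sqrt_quotient_def s_def[symmetric] divide_le_eq abs_divide)
    qed (use C in \<open>auto simp: sqrt_quotient_def\<close>)
    have "(sqrt_quotient k R has_derivative (\<lambda>v. 0)) (at z)"
      unfolding has_derivative_at_alt
    proof (intro conjI allI impI)
      fix e :: real assume e: "e > 0"
      define d where "d = min (min \<rho> (\<rho>\<^sup>2)) (e / (C + 1))"
      have d: "d > 0" using C e by (auto simp: d_def)
      have "norm (sqrt_quotient k R w - sqrt_quotient k R z - 0) \<le> e * norm (w - z)" if w: "norm (w - z) < d" for w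
      proof -
        obtain u' y' where w': "w = (u', y')" by force
        have n: "\<bar>u'\<bar> \<le> norm (w - z)" "\<bar>y' - y\<bar> \<le> norm (w - z)"
          using norm_fst_le[of u' "y' - y"] norm_snd_le[of "y' - y" u'] by (auto simp: w' uy 3)
        then have lt: "\<bar>u'\<bar> < \<rho>\<^sup>2" "\<bar>y' - y\<bar> < \<rho>" "\<bar>u'\<bar> < e / (C + 1)" using w by (auto simp: d_def)
        have "C * \<bar>u'\<bar> \<le> (C + 1) * \<bar>u'\<bar>" by (simp add: mult_right_mono)
        also have "\<dots> \<le> e" using lt(3) C(1) by (simp add: field_simps)
        finally have "C * \<bar>u'\<bar> * \<bar>u'\<bar> \<le> e * norm (w - z)" using n e by (intro mult_mono) auto
        moreover have "\<bar>sqrt_quotient k R w\<bar> \<le> C * \<bar>u'\<bar> * \<bar>u'\<bar>"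
          using b[OF lt(1,2)] by (simp add: w' mult.assoc)
        moreover have "sqrt_quotient k R z = 0" by (simp add: sqrt_quotient_def uy 3)
        ultimately show ?thesis by simp
      qed
      then show "\<exists>d>0. \<forall>w. norm (w - z) < d \<longrightarrow>
          norm (sqrt_quotient k R w - sqrt_quotient k R z - 0) \<le> e * norm (w - z)"
        using d by blast
    qed (rule bounded_linear_zero)
    then show ?thesis using 3 by (simp add: sqrt_quotient_def uy)
  qed
qed

text \<open>
  Quotients of functions that are flat along \<open>x = 0\<close> are closed under differentiation in the sense of
  \<open>smooth_on_up_to_algebra\<close>.
\<close>

lemma smooth_on_sqrt_quotient:
  assumes a: "a > 0" and Y: "open Y" and R: "smooth_on ({-a<..<a} \<times> Y) R"
    and flat: "\<And>n y. y \<in> Y \<Longrightarrow> (partial_x ^^ n) R (0, y) = 0"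
  shows "smooth_on ({..<a\<^sup>2} \<times> Y) (sqrt_quotient k R)"
proof -
  let ?Q = "{-a<..<a} \<times> Y" and ?S = "{..<a\<^sup>2} \<times> Y"
  define F where "F = {R. smooth_on ?Q R \<and> (\<forall>n. \<forall>y\<in>Y. (partial_x ^^ n) R (0, y) = 0)}"
  define C where "C = {sqrt_quotient k R |k R. R \<in> F}"
  have S: "open ?S" and Q: "open ?Q" using Y by (auto intro: open_Times)
  have Fx: "partial_x R \<in> F" if "R \<in> F" for R
  proof -
    have "(partial_x ^^ n) (partial_x R) (0, y) = 0" if "y \<in> Y" for n y
      using \<open>R \<in> F\<close> that funpow_swap1[of partial_x n R] unfolding F_def
      by (metis (mono_tags, lifting) funpow.simps(2) comp_apply mem_Collect_eq)
    then show ?thesis using that smooth_on_partial_x by (auto simp: F_def)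
  qed
  have Fy: "partial_y R \<in> F" if "R \<in> F" for R
  proof -
    have R: "smooth_on ?Q R" and fl: "\<And>n y. y \<in> Y \<Longrightarrow> (partial_x ^^ n) R (0, y) = 0"
      using that by (auto simp: F_def)
    have "(partial_x ^^ n) (partial_y R) (0, y) = 0" if y: "y \<in> Y" for n y
    proof -
      have z: "(0, y) \<in> ?Q" using a y by auto
      have "((\<lambda>y. (partial_x ^^ n) R (0, y)) has_real_derivative partial_y ((partial_x ^^ n) R) (0, y)) (at y)"
        using DERIV_partial_y_iterate[OF smooth_on_partial_iterates(1)[OF R] z, of 0] by simp
      moreover have "((\<lambda>y. (partial_x ^^ n) R (0, y)) has_real_derivative 0) (at y)"
        by (rule has_field_derivative_transform_within_open[OF DERIV_const Y y]) (use fl in auto)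
      ultimately have "partial_y ((partial_x ^^ n) R) (0, y) = 0" by (rule DERIV_unique)
      then show ?thesis using partial_x_iterate_partial_y[OF Q R z] by simp
    qed
    then show ?thesis using smooth_on_partial_y[OF R] by (auto simp: F_def)
  qed
  have gen: "sqrt_quotient k R \<in> smooth_algebra ?S C" if "R \<in> F" for k R
    by (rule smooth_algebra.gen) (use that in \<open>auto simp: C_def\<close>)
  show ?thesis
  proof (rule smooth_on_up_to_algebra_plane[OF S, where C = C])
    show "sqrt_quotient k R \<in> C" using R flat by (auto simp: C_def F_def)
    fix f assume "f \<in> C"
    then obtain k R where f: "f = sqrt_quotient k R" and RF: "R \<in> F" by (auto simp: C_def)
    then have R: "smooth_on ?Q R" and fl: "\<And>n y. y \<in> Y \<Longrightarrow> (partial_x ^^ n) R (0, y) = 0"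
      by (auto simp: F_def)
    have "(\<lambda>z. (1 / 2) * sqrt_quotient (k + 1) (partial_x R) z + (- real k / 2) * sqrt_quotient (k + 2) R z) \<in> smooth_algebra ?S C"
      by (intro smooth_algebra.add smooth_algebra.mult gen Fx RF smooth_algebra.smooth[OF smooth_on_const] S)
    moreover have "sqrt_quotient k (partial_y R) \<in> smooth_algebra ?S C"
      by (intro gen Fy RF)
    moreover note has_derivative_sqrt_quotient[OF a Y R fl, of _ k]
    ultimately show "\<exists>g\<in>smooth_algebra ?S C. \<exists>h\<in>smooth_algebra ?S C. \<forall>z\<in>?S.
       (f has_derivative (\<lambda>v. fst v * g z + snd v * h z)) (at z)"
      unfolding f by (intro bexI ballI)
  qed
qed

lemma sum_even_odd:
  fixes c :: "nat \<Rightarrow> real"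
  shows "(\<Sum>m<2*N. c m * x ^ m) = (\<Sum>n<N. c (2*n) * (x\<^sup>2) ^ n) + x * (\<Sum>n<N. c (2*n+1) * (x\<^sup>2) ^ n)"
  by (induction N) (simp_all add: power_mult algebra_simps power2_eq_square power_mult_distrib)

text \<open>
  Whitney's theorem with a parameter. By Borel's lemma there are smooth \<open>E\<close> and \<open>D\<close> such that
  \<open>E (x\<^sup>2, y) + x * D (x\<^sup>2, y)\<close> has the Taylor series of \<open>\<phi>\<close> in \<open>x\<close> along \<open>x = 0\<close>. The difference \<open>R\<close> is flat along
  \<open>x = 0\<close>, and its even and odd parts are smooth functions of \<open>x\<^sup>2\<close>, up to the factor \<open>x\<close>, because square roots do no
  harm to flat functions. The strip is narrowed from \<open>b\<close> to \<open>b'\<close> in order to have bounded coefficients.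
\<close>

lemma smooth_even_odd_split:
  fixes \<phi> :: "real \<times> real \<Rightarrow> real"
  assumes a: "0 < a" and b: "0 < b'" "b' < b"
    and \<phi>: "smooth_on ({-a<..<a} \<times> {-b<..<b}) \<phi>"
  obtains e d where "smooth_on ({..<a\<^sup>2} \<times> {-b'<..<b'}) e" "smooth_on ({..<a\<^sup>2} \<times> {-b'<..<b'}) d"
    "\<And>x y. \<bar>x\<bar> < a \<Longrightarrow> \<bar>y\<bar> < b' \<Longrightarrow> \<phi> (x, y) = e (x\<^sup>2, y) + x * d (x\<^sup>2, y)"
proof -
  define Y where "Y = {-b'<..<b'}"
  let ?B = "{-a<..<a} \<times> {-b<..<b}" and ?Q = "{-a<..<a} \<times> Y"
  have Y: "open Y" "convex Y" by (auto simp: Y_def)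
  have Q: "open ?Q" using Y by (auto intro: open_Times)
  have Q0: "(0, y) \<in> ?B" if "\<bar>y\<bar> \<le> b'" for y using a b that by auto
  define c where "c n l y = (partial_y ^^ l) ((partial_x ^^ n) \<phi>) (0, y) / fact n" for n l y
  have sm: "smooth_on ?B ((partial_x ^^ n) \<phi>)" for n by (rule smooth_on_partial_iterates[OF \<phi>])
  have dc: "(c n l has_real_derivative c n (Suc l) y) (at y)" if "\<bar>y\<bar> \<le> b'" for n l y
    unfolding c_def by (intro DERIV_cdivide DERIV_partial_y_iterate[OF sm Q0[OF that]])
  have bc: "\<exists>A. \<forall>y\<in>Y. \<bar>c n l y\<bar> \<le> A" for n l
  proof -
    have "\<exists>B\<ge>0. \<forall>y. \<bar>y\<bar> \<le> b' \<longrightarrow> \<bar>c n l y\<bar> \<le> B"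
      by (rule bounded_on_segment[OF DERIV_isCont[OF dc]])
    then obtain B where "\<And>y. \<bar>y\<bar> \<le> b' \<Longrightarrow> \<bar>c n l y\<bar> \<le> B" by blast
    then show ?thesis by (intro exI[of _ B]) (auto simp: Y_def)
  qed
  have dc': "(c n l has_real_derivative c n (Suc l) y) (at y)" if "y \<in> Y" for n l y
    by (rule dc) (use that in \<open>auto simp: Y_def\<close>)
  obtain E where E: "smooth_on (UNIV \<times> Y) E"
    "\<And>N y. y \<in> Y \<Longrightarrow> \<exists>C. \<forall>u. \<bar>E (u, y) - (\<Sum>n<N. c (2*n) 0 y * u ^ n)\<bar> \<le> C * \<bar>u\<bar> ^ N"
    by (rule Borel_lemma[of Y "\<lambda>n. c (2 * n)"]) (use Y dc' bc in auto)
  obtain D where D: "smooth_on (UNIV \<times> Y) D"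
    "\<And>N y. y \<in> Y \<Longrightarrow> \<exists>C. \<forall>u. \<bar>D (u, y) - (\<Sum>n<N. c (2*n+1) 0 y * u ^ n)\<bar> \<le> C * \<bar>u\<bar> ^ N"
    by (rule Borel_lemma[of Y "\<lambda>n. c (2 * n + 1)"]) (use Y dc' bc in auto)
  define R where "R z = \<phi> z - (E ((fst z)\<^sup>2, snd z) + fst z * D ((fst z)\<^sup>2, snd z))" for z
  have smsq: "smooth_on ?Q (\<lambda>z. G ((fst z)\<^sup>2, snd z))" if "smooth_on (UNIV \<times> Y) G" for G :: "real \<times> real \<Rightarrow> real"
    by (rule smooth_on_compose_plane[OF Q that])
       (auto intro: smooth_on_power[OF Q smooth_on_fst[OF Q]] smooth_on_snd[OF Q])
  have smR: "smooth_on ?Q R"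
    unfolding R_def
    by (intro smooth_on_diff[OF Q] smooth_on_add[OF Q] smooth_on_mult[OF Q] smsq E D smooth_on_fst[OF Q]
          smooth_on_subset[OF \<phi>]) (use b in \<open>auto simp: Y_def\<close>)
  have bound: "\<exists>C. \<forall>x. \<bar>x\<bar> < min (a / 2) 1 \<longrightarrow> \<bar>R (x, y)\<bar> \<le> C * \<bar>x\<bar> ^ N" if y: "y \<in> Y" for y N
  proof -
    have y': "y \<in> {-b<..<b}" using y b by (auto simp: Y_def)
    have dx: "((\<lambda>x. (partial_x ^^ m) \<phi> (x, y)) has_real_derivative (partial_x ^^ Suc m) \<phi> (t, y)) (at t)"
      if "\<bar>t\<bar> < a" for m t
      by (rule DERIV_partial_x_iterate[OF \<phi>]) (use that y' in auto)
    have "\<exists>B\<ge>0. \<forall>t. \<bar>t\<bar> \<le> a / 2 \<longrightarrow> \<bar>(partial_x ^^ (2 * N)) \<phi> (t, y)\<bar> \<le> B"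
      by (rule bounded_on_segment[OF DERIV_isCont[OF dx]]) (use a in auto)
    then obtain B where B: "B \<ge> 0" "\<And>t. \<bar>t\<bar> \<le> a / 2 \<Longrightarrow> \<bar>(partial_x ^^ (2 * N)) \<phi> (t, y)\<bar> \<le> B" by blast
    obtain C1 where C1: "\<And>u. \<bar>E (u, y) - (\<Sum>n<N. c (2*n) 0 y * u ^ n)\<bar> \<le> C1 * \<bar>u\<bar> ^ N" using E(2)[OF y] by blast
    obtain C2 where C2: "\<And>u. \<bar>D (u, y) - (\<Sum>n<N. c (2*n+1) 0 y * u ^ n)\<bar> \<le> C2 * \<bar>u\<bar> ^ N" using D(2)[OF y] by blast
    have triangle: "\<bar>r\<bar> \<le> P + Q + S" if "r = p - q - s" "\<bar>p\<bar> \<le> P" "\<bar>q\<bar> \<le> Q" "\<bar>s\<bar> \<le> S"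
      for r p q s P Q S :: real using that by linarith
    have "\<bar>R (x, y)\<bar> \<le> (B + C1 + C2) * \<bar>x\<bar> ^ N" if x: "\<bar>x\<bar> < min (a / 2) 1" for x
    proof -
      have "\<forall>m t. m < 2 * N \<and> \<bar>t\<bar> \<le> \<bar>x\<bar> \<longrightarrow>
          ((\<lambda>x. (partial_x ^^ m) \<phi> (x, y)) has_real_derivative (partial_x ^^ Suc m) \<phi> (t, y)) (at t)"
        using x a by (intro allI impI dx) auto
      from Maclaurin_bi_le[where diff = "\<lambda>m x. (partial_x ^^ m) \<phi> (x, y)", OF refl this]
      obtain t where t: "\<bar>t\<bar> \<le> \<bar>x\<bar>" "(partial_x ^^ 0) \<phi> (x, y) =
        (\<Sum>m<2*N. (partial_x ^^ m) \<phi> (0, y) / fact m * x ^ m)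
          + (partial_x ^^ (2*N)) \<phi> (t, y) / fact (2*N) * x ^ (2*N)"
        by (elim exE conjE)
      have "(\<Sum>m<2*N. (partial_x ^^ m) \<phi> (0, y) / fact m * x ^ m) = (\<Sum>m<2*N. c m 0 y * x ^ m)"
        by (simp add: c_def)
      also note sum_even_odd
      finally have "R (x, y) = (partial_x ^^ (2*N)) \<phi> (t, y) / fact (2*N) * x ^ (2*N)
          - (E (x\<^sup>2, y) - (\<Sum>n<N. c (2*n) 0 y * (x\<^sup>2) ^ n))
          - x * (D (x\<^sup>2, y) - (\<Sum>n<N. c (2*n+1) 0 y * (x\<^sup>2) ^ n))"
        using t(2) by (simp add: R_def algebra_simps)
      moreover have "\<bar>(partial_x ^^ (2*N)) \<phi> (t, y) / fact (2*N) * x ^ (2*N)\<bar> \<le> B / 1 * \<bar>x\<bar> ^ (2*N)"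
        unfolding abs_mult abs_divide power_abs using B t(1) x
        by (intro mult_mono frac_le) (auto simp: fact_ge_1)
      moreover have "\<bar>E (x\<^sup>2, y) - (\<Sum>n<N. c (2*n) 0 y * (x\<^sup>2) ^ n)\<bar> \<le> C1 * \<bar>x\<bar> ^ (2*N)"
        using C1[of "x\<^sup>2"] by (simp add: power_mult)
      moreover have "\<bar>x * (D (x\<^sup>2, y) - (\<Sum>n<N. c (2*n+1) 0 y * (x\<^sup>2) ^ n))\<bar> \<le> 1 * (C2 * \<bar>x\<bar> ^ (2*N))"
        unfolding abs_mult using C2[of "x\<^sup>2"] x by (intro mult_mono) (auto simp: power_mult)
      ultimately have "\<bar>R (x, y)\<bar> \<le> B / 1 * \<bar>x\<bar> ^ (2*N) + C1 * \<bar>x\<bar> ^ (2*N) + 1 * (C2 * \<bar>x\<bar> ^ (2*N))"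
        by (rule triangle)
      also have "\<dots> = (B + C1 + C2) * \<bar>x\<bar> ^ (2*N)" by (simp add: algebra_simps)
      also have "\<dots> \<le> (B + C1 + C2) * \<bar>x\<bar> ^ N"
      proof (rule mult_left_mono)
        show "\<bar>x\<bar> ^ (2*N) \<le> \<bar>x\<bar> ^ N" using x by (intro power_decreasing) auto
        show "0 \<le> B + C1 + C2" using B(1) C1[of 1] C2[of 1] by simp
      qed
      finally show ?thesis .
    qed
    then show ?thesis by blast
  qed
  \<comment> \<open>A square root is nonnegative, so the values of \<open>R\<close> at negative \<open>x\<close> are reached through its reflection.\<close>
  define R' where "R' z = R (- fst z, snd z)" for z
  have smR': "smooth_on ?Q R'"
    unfolding R'_def
    by (rule smooth_on_compose_plane[OF Q smR])
       (auto intro: smooth_on_minus[OF Q smooth_on_fst[OF Q]] smooth_on_snd[OF Q])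
  have flat: "(partial_x ^^ n) G (0, y) = 0"
    if G: "smooth_on ?Q G" and y: "y \<in> Y" and eq: "\<And>x. \<bar>G (x, y)\<bar> = \<bar>R (x, y)\<bar> \<or> \<bar>G (x, y)\<bar> = \<bar>R (- x, y)\<bar>" for G n y
  proof (rule derivatives_eq_0_if_flat[OF a])
    show "((\<lambda>x. (partial_x ^^ n) G (x, y)) has_real_derivative (partial_x ^^ Suc n) G (t, y)) (at t)"
      if "\<bar>t\<bar> < a" for n t by (rule DERIV_partial_x_iterate[OF G]) (use that y in auto)
    fix N
    obtain C where C: "\<And>x. \<bar>x\<bar> < min (a / 2) 1 \<Longrightarrow> \<bar>R (x, y)\<bar> \<le> C * \<bar>x\<bar> ^ N" using bound[OF y] by blast
    have "\<bar>(partial_x ^^ 0) G (t, y)\<bar> \<le> C * \<bar>t\<bar> ^ N" if "\<bar>t\<bar> < min (a / 2) 1" for t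
      using eq[of t] C[of t] C[of "- t"] that by auto
    then show "\<exists>C \<rho>. \<rho> > 0 \<and> (\<forall>t. \<bar>t\<bar> < \<rho> \<longrightarrow> \<bar>(partial_x ^^ 0) G (t, y)\<bar> \<le> C * \<bar>t\<bar> ^ N)"
      using a by (intro exI[of _ C] exI[of _ "min (a / 2) 1"]) auto
  qed
  have flR: "(partial_x ^^ n) R (0, y) = 0" "(partial_x ^^ n) R' (0, y) = 0" if "y \<in> Y" for n y
    by (rule flat[OF smR that], simp) (rule flat[OF smR' that], simp add: R'_def)
  let ?S = "{..<a\<^sup>2} \<times> Y"
  have S: "open ?S" using Y by (auto intro: open_Times)
  define e where "e z = E z + (1 / 2) * (sqrt_quotient 0 R z + sqrt_quotient 0 R' z)" for z
  define d where "d z = D z + (1 / 2) * (sqrt_quotient 1 R z - sqrt_quotient 1 R' z)" for z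
  have sq: "smooth_on ?S (sqrt_quotient k R)" "smooth_on ?S (sqrt_quotient k R')" for k
    by (rule smooth_on_sqrt_quotient[OF a Y(1) smR flR(1)], assumption)
       (rule smooth_on_sqrt_quotient[OF a Y(1) smR' flR(2)], assumption)
  have "smooth_on ?S e" "smooth_on ?S d"
    unfolding e_def d_def
    by (intro smooth_on_add[OF S] smooth_on_diff[OF S] smooth_on_mult[OF S] smooth_on_const[OF S] sq
       smooth_on_subset[OF E(1)] smooth_on_subset[OF D(1)]; auto)+
  moreover have "\<phi> (x, y) = e (x\<^sup>2, y) + x * d (x\<^sup>2, y)" if "\<bar>x\<bar> < a" "\<bar>y\<bar> < b'" for x y
  proof -
    have y: "y \<in> Y" using that by (auto simp: Y_def)
    have "e (x\<^sup>2, y) + x * d (x\<^sup>2, y) = E (x\<^sup>2, y) + x * D (x\<^sup>2, y) + R (x, y)"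
    proof -
      have R0: "R (0, y) = 0" using flR(1)[OF y, of 0] by simp
      consider "x > 0" | "x < 0" | "x = 0" by linarith
      then show ?thesis
        by cases (simp_all add: e_def d_def sqrt_quotient_def R'_def R0 field_simps)
    qed
    then show ?thesis by (simp add: R_def)
  qed
  ultimately show ?thesis using that unfolding Y_def by blast
qed

text \<open>
  Splitting first with respect to \<open>x\<close> and then with respect to \<open>y\<close> gives four smooth functions of
  \<open>(x\<^sup>2, y\<^sup>2)\<close> with the factors \<open>1\<close>, \<open>x\<close>, \<open>y\<close> and \<open>x * y\<close>. The symmetry removes the terms with the factors \<open>x\<close> and \<open>y\<close>.
\<close>

lemma even_function_lift:
  fixes F :: "real \<times> real \<Rightarrow> real"
  assumes a: "a > 0" and F: "smooth_on ({-a<..<a} \<times> {-a<..<a}) F"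
    and even: "\<And>x y. F (- x, - y) = F (x, y)"
  obtains H where "smooth_on {(u, v, w). \<bar>u\<bar> < (a/2)\<^sup>2 \<and> \<bar>w\<bar> < (a/2)\<^sup>2} H"
    "\<And>x y. \<bar>x\<bar> < a/2 \<Longrightarrow> \<bar>y\<bar> < a/2 \<Longrightarrow> F (x, y) = H (x\<^sup>2, x * y, y\<^sup>2)"
proof -
  define b where "b = a / 2"
  have b: "0 < b" "b < a" "b\<^sup>2 < a\<^sup>2" using a by (auto simp: b_def power2_eq_square mult_strict_mono)
  obtain e d where ed: "smooth_on ({..<a\<^sup>2} \<times> {-b<..<b}) e" "smooth_on ({..<a\<^sup>2} \<times> {-b<..<b}) d"
    and F1: "\<And>x y. \<bar>x\<bar> < a \<Longrightarrow> \<bar>y\<bar> < b \<Longrightarrow> F (x, y) = e (x\<^sup>2, y) + x * d (x\<^sup>2, y)"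
    by (rule smooth_even_odd_split[OF a b(1,2) F]) blast
  have Q: "open ({-b<..<b} \<times> {-a\<^sup>2<..<a\<^sup>2})" by (intro open_Times) auto
  have swap: "smooth_on ({-b<..<b} \<times> {-a\<^sup>2<..<a\<^sup>2}) (\<lambda>z. g (snd z, fst z))"
    if "smooth_on ({..<a\<^sup>2} \<times> {-b<..<b}) g" for g :: "real \<times> real \<Rightarrow> real"
    by (rule smooth_on_compose_plane[OF Q that]) (auto intro: smooth_on_fst[OF Q] smooth_on_snd[OF Q])
  have b2: "0 < b\<^sup>2" using b by simp
  obtain e1 e2 where e: "smooth_on ({..<b\<^sup>2} \<times> {-b\<^sup>2<..<b\<^sup>2}) e1" "smooth_on ({..<b\<^sup>2} \<times> {-b\<^sup>2<..<b\<^sup>2}) e2"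
    and e12: "\<And>y u. \<bar>y\<bar> < b \<Longrightarrow> \<bar>u\<bar> < b\<^sup>2 \<Longrightarrow> e (u, y) = e1 (y\<^sup>2, u) + y * e2 (y\<^sup>2, u)"
    by (rule smooth_even_odd_split[OF b(1) b2 b(3) swap[OF ed(1)]]) auto
  obtain d1 d2 where d: "smooth_on ({..<b\<^sup>2} \<times> {-b\<^sup>2<..<b\<^sup>2}) d1" "smooth_on ({..<b\<^sup>2} \<times> {-b\<^sup>2<..<b\<^sup>2}) d2"
    and d12: "\<And>y u. \<bar>y\<bar> < b \<Longrightarrow> \<bar>u\<bar> < b\<^sup>2 \<Longrightarrow> d (u, y) = d1 (y\<^sup>2, u) + y * d2 (y\<^sup>2, u)"
    by (rule smooth_even_odd_split[OF b(1) b2 b(3) swap[OF ed(2)]]) auto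
  define H where "H p = e1 (snd (snd p), fst p) + fst (snd p) * d2 (snd (snd p), fst p)" for p :: "real \<times> real \<times> real"
  let ?S = "{(u, v, w). \<bar>u\<bar> < b\<^sup>2 \<and> \<bar>w\<bar> < b\<^sup>2} :: (real \<times> real \<times> real) set"
  have S: "open ?S"
    unfolding case_prod_unfold by (intro open_Collect_conj open_Collect_less continuous_intros)
  have "smooth_on ?S H"
    unfolding H_def
    by (intro smooth_on_add[OF S] smooth_on_mult[OF S] smooth_on_compose_plane[OF S e(1)] smooth_on_compose_plane[OF S d(2)]
          smooth_on_bounded_linear[OF S] bounded_linear_fst bounded_linear_snd
          bounded_linear_compose[OF bounded_linear_fst bounded_linear_snd]
          bounded_linear_compose[OF bounded_linear_snd bounded_linear_snd]) auto
  moreover have "F (x, y) = H (x\<^sup>2, x * y, y\<^sup>2)" if xy: "\<bar>x\<bar> < b" "\<bar>y\<bar> < b" for x y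
  proof -
    have x2: "\<bar>x\<^sup>2\<bar> < b\<^sup>2" using xy b by (simp add: abs_square_less_1 power2_strict_mono)
    have "F (x, y) = e1 (y\<^sup>2, x\<^sup>2) + y * e2 (y\<^sup>2, x\<^sup>2) + x * (d1 (y\<^sup>2, x\<^sup>2) + y * d2 (y\<^sup>2, x\<^sup>2))"
      using F1[of x y] e12[of y "x\<^sup>2"] d12[of y "x\<^sup>2"] x2 xy b by simp
    moreover have "F (- x, - y) = e1 (y\<^sup>2, x\<^sup>2) - y * e2 (y\<^sup>2, x\<^sup>2) - x * (d1 (y\<^sup>2, x\<^sup>2) - y * d2 (y\<^sup>2, x\<^sup>2))"
      using F1[of "- x" "- y"] e12[of "- y" "x\<^sup>2"] d12[of "- y" "x\<^sup>2"] x2 xy b by simp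
    ultimately show ?thesis using even[of x y] by (simp add: H_def algebra_simps)
  qed
  ultimately show ?thesis using that unfolding b_def by blast
qed

section \<open>Germs of smooth functions\<close>

lemma smooth_germ_at_I: "open S \<Longrightarrow> P \<in> S \<Longrightarrow> smooth_on S h \<Longrightarrow> smooth_germ_at P h"
  unfolding smooth_germ_at_def by blast

lemma smooth_germ_at_common:
  assumes "smooth_germ_at P f" "smooth_germ_at P g"
  obtains S where "open S" "P \<in> S" "smooth_on S f" "smooth_on S g"
proof -
  obtain S T where "open S" "P \<in> S" "smooth_on S f" "open T" "P \<in> T" "smooth_on T g"
    using assms unfolding smooth_germ_at_def by blast
  then show ?thesis using that[of "S \<inter> T"] smooth_on_subset[of S f "S \<inter> T"] smooth_on_subset[of T g "S \<inter> T"] by auto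
qed

lemma smooth_germ_at_const: "smooth_germ_at P (\<lambda>z. c)"
  by (rule smooth_germ_at_I[of UNIV]) (auto intro: smooth_on_const)

lemma smooth_germ_at_bounded_linear: "bounded_linear l \<Longrightarrow> smooth_germ_at P l"
  by (rule smooth_germ_at_I[of UNIV]) (auto intro: smooth_on_bounded_linear)

lemma
  fixes f g :: "'a::real_normed_vector \<Rightarrow> real"
  assumes "smooth_germ_at P f" "smooth_germ_at P g"
  shows smooth_germ_at_add: "smooth_germ_at P (\<lambda>z. f z + g z)"
    and smooth_germ_at_mult: "smooth_germ_at P (\<lambda>z. f z * g z)"
    and smooth_germ_at_diff: "smooth_germ_at P (\<lambda>z. f z - g z)"
proof -
  obtain S where S: "open S" "P \<in> S" "smooth_on S f" "smooth_on S g"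
    by (rule smooth_germ_at_common[OF assms])
  show "smooth_germ_at P (\<lambda>z. f z + g z)" "smooth_germ_at P (\<lambda>z. f z * g z)" "smooth_germ_at P (\<lambda>z. f z - g z)"
    by (rule smooth_germ_at_I[OF S(1,2)], rule smooth_on_add[OF S(1,3,4)] smooth_on_mult[OF S(1,3,4)] smooth_on_diff[OF S(1,3,4)])+
qed

lemma smooth_germ_at_isCont: "smooth_germ_at P f \<Longrightarrow> isCont f P"
  unfolding smooth_germ_at_def using smooth_on_isCont by blast

lemma smooth_germ_at_has_derivative:
  "smooth_germ_at P f \<Longrightarrow> (f has_derivative frechet_derivative f (at P)) (at P)"
  unfolding smooth_germ_at_def using smooth_on_has_derivative by blast

lemma smooth_germ_at_inverse:
  fixes f :: "'a::real_normed_vector \<Rightarrow> real"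
  assumes f: "smooth_germ_at P f" and nz: "f P \<noteq> 0"
  shows "smooth_germ_at P (\<lambda>z. inverse (f z))"
proof -
  obtain S where S: "open S" "P \<in> S" "smooth_on S f" using f unfolding smooth_germ_at_def by blast
  have "\<forall>\<^sub>F z in nhds P. dist (f z) (f P) < \<bar>f P\<bar>"
    by (rule isCont_eventually_near[OF smooth_germ_at_isCont[OF f]]) (use nz in simp)
  then obtain T where T: "open T" "P \<in> T" "\<And>z. z \<in> T \<Longrightarrow> dist (f z) (f P) < \<bar>f P\<bar>"
    unfolding eventually_nhds by blast
  have "f z \<noteq> 0" if "z \<in> S \<inter> T" for z using T(3)[of z] that by (auto simp: dist_real_def)
  then have "smooth_on (S \<inter> T) (\<lambda>z. inverse (f z))"
    using S T by (intro smooth_on_inverse smooth_on_subset[OF S(3)]) auto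
  then show ?thesis using S T by (intro smooth_germ_at_I[of "S \<inter> T"]) auto
qed

section \<open>Hadamard's lemma\<close>

text \<open>
  The weight \<open>t ^ k\<close> is present because each derivative with respect to \<open>z\<close> brings out one factor \<open>t\<close>.
\<close>

definition ray_average :: "'a::euclidean_space \<Rightarrow> nat \<Rightarrow> ('a \<Rightarrow> real) \<Rightarrow> 'a \<Rightarrow> real" where
  "ray_average P k \<phi> z = integral (cbox 0 1) (\<lambda>t::real. t ^ k * \<phi> (P + t *\<^sub>R (z - P)))"

lemma ray_in_ball:
  fixes P z :: "'a::euclidean_space"
  assumes "z \<in> ball P r" "t \<in> cbox (0::real) 1" shows "P + t *\<^sub>R (z - P) \<in> ball P r"
proof -
  have "norm (t *\<^sub>R (z - P)) \<le> 1 * norm (z - P)"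
    unfolding norm_scaleR using assms(2) by (intro mult_right_mono) auto
  then show ?thesis using assms(1) by (simp add: dist_norm norm_minus_commute)
qed

lemma has_derivative_ray_average:
  fixes \<phi> :: "'a::euclidean_space \<Rightarrow> real"
  assumes \<phi>: "smooth_on (ball P r) \<phi>" and z: "z \<in> ball P r"
  shows "(ray_average P k \<phi> has_derivative
     (\<lambda>v. \<Sum>b\<in>Basis. (v \<bullet> b) * ray_average P (Suc k) (\<lambda>x. frechet_derivative \<phi> (at x) b) z)) (at z)"
proof -
  let ?D = "\<lambda>b x. frechet_derivative \<phi> (at x) b"
  define f where "f x t = t ^ k * \<phi> (P + t *\<^sub>R (x - P))" for x :: 'a and t :: real
  define fx where "fx x t = (\<Sum>b\<in>Basis. (t ^ Suc k * ?D b (P + t *\<^sub>R (x - P))) *\<^sub>R blinfun_inner_left b)" for x :: 'a and t :: real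
  have cont: "continuous_on (ball P r \<times> cbox 0 1) (\<lambda>(x, t). t ^ m * g (P + t *\<^sub>R (x - P)))"
    if "smooth_on (ball P r) g" for g :: "'a \<Rightarrow> real" and m
  proof -
    have "continuous_on (ball P r \<times> cbox 0 1) (\<lambda>p. g (P + snd p *\<^sub>R (fst p - P)))"
      by (rule continuous_on_compose2[OF smooth_on_continuous_on[OF that]])
         (auto intro!: continuous_intros ray_in_ball simp del: mem_ball)
    then show ?thesis unfolding case_prod_unfold by (intro continuous_intros)
  qed
  have sD: "smooth_on (ball P r) (?D b)" for b by (rule smooth_on_frechet_derivative[OF \<phi>])
  have int: "(\<lambda>t. t ^ m * g (P + t *\<^sub>R (x - P))) integrable_on cbox 0 1"
    if "smooth_on (ball P r) g" "x \<in> ball P r" for g :: "'a \<Rightarrow> real" and m x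
  proof (rule integrable_continuous)
    have "continuous_on (cbox 0 1) (\<lambda>t. (\<lambda>(x, t). t ^ m * g (P + t *\<^sub>R (x - P))) (x, t))"
      by (rule continuous_on_compose2[OF cont[OF that(1)]]) (use that(2) in \<open>auto intro!: continuous_intros\<close>)
    then show "continuous_on (cbox 0 1) (\<lambda>t. t ^ m * g (P + t *\<^sub>R (x - P)))" by simp
  qed
  have A: "((\<lambda>x. integral (cbox 0 1) (f x)) has_derivative integral (cbox 0 1) (fx z)) (at z within ball P r)"
  proof (rule leibniz_rule)
    fix x and t :: real assume x: "x \<in> ball P r" and t: "t \<in> cbox 0 1"
    let ?p = "P + t *\<^sub>R (x - P)"
    have D: "(\<phi> has_derivative frechet_derivative \<phi> (at ?p)) (at ?p)"
      by (rule smooth_on_has_derivative[OF \<phi> ray_in_ball[OF x t]])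
    have "((\<lambda>x. P + t *\<^sub>R (x - P)) has_derivative (\<lambda>v. t *\<^sub>R v)) (at x)"
      by (auto intro!: derivative_eq_intros)
    from has_derivative_mult_right[OF has_derivative_compose[OF this D], of "t ^ k"]
    have A: "((\<lambda>x. f x t) has_derivative (\<lambda>v. t ^ k * frechet_derivative \<phi> (at ?p) (t *\<^sub>R v))) (at x)"
      unfolding f_def .
    have B: "t ^ k * frechet_derivative \<phi> (at ?p) (t *\<^sub>R v) = blinfun_apply (fx x t) v" for v
    proof -
      have lin: "linear (frechet_derivative \<phi> (at ?p))" using D by (rule has_derivative_linear)
      have "frechet_derivative \<phi> (at ?p) v = (\<Sum>b\<in>Basis. (v \<bullet> b) *\<^sub>R ?D b ?p)"
        by (subst euclidean_representation[of v, symmetric]) (simp only: linear_sum[OF lin] linear_cmul[OF lin])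
      then show ?thesis
        unfolding fx_def linear_cmul[OF lin] blinfun.sum_left blinfun.scaleR_left blinfun_inner_left.rep_eq
        by (simp add: sum_distrib_left algebra_simps)
    qed
    have "((\<lambda>x. f x t) has_derivative blinfun_apply (fx x t)) (at x)"
      by (rule has_derivative_eq_rhs[OF A ext[OF B]])
    then show "((\<lambda>x. f x t) has_derivative blinfun_apply (fx x t)) (at x within ball P r)"
      by (rule has_derivative_at_withinI)
  next
    show "f x integrable_on cbox 0 1" if "x \<in> ball P r" for x
      using int[OF \<phi> that, of k] by (simp add: f_def[abs_def])
    show "continuous_on (ball P r \<times> cbox 0 1) (\<lambda>(x, t). fx x t)"
      unfolding fx_def case_prod_unfold
      by (intro continuous_on_sum continuous_on_scaleR continuous_on_const cont[OF sD, unfolded case_prod_unfold])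
  qed (use z in auto)
  have B: "ray_average P k \<phi> = (\<lambda>x. integral (cbox 0 1) (f x))"
    by (rule ext) (simp only: ray_average_def f_def[abs_def])
  have *: "(ray_average P k \<phi> has_derivative integral (cbox 0 1) (fx z)) (at z)"
    using A unfolding at_within_open[OF z open_ball] B .
  have **: "blinfun_apply (integral (cbox 0 1) (fx z)) v = (\<Sum>b\<in>Basis. (v \<bullet> b) * ray_average P (Suc k) (?D b) z)" for v
  proof -
    have "(fx z has_integral (\<Sum>b\<in>Basis. ray_average P (Suc k) (?D b) z *\<^sub>R blinfun_inner_left b)) (cbox 0 1)"
      unfolding fx_def ray_average_def
      by (intro has_integral_sum finite_Basis has_integral_scaleR_left integrable_integral int[OF sD z])
    from integral_unique[OF this] show ?thesis
      by (simp only: blinfun.sum_left blinfun.scaleR_left blinfun_inner_left.rep_eq real_scaleR_def mult.commute inner_commute)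
  qed
  show ?thesis by (rule has_derivative_eq_rhs[OF * ext[OF **]])
qed

lemma smooth_on_ray_average:
  fixes \<phi> :: "'a::euclidean_space \<Rightarrow> real"
  assumes \<phi>: "smooth_on (ball P r) \<phi>"
  shows "smooth_on (ball P r) (ray_average P k \<phi>)"
proof -
  define C where "C = {ray_average P k \<phi> |k \<phi>. smooth_on (ball P r) \<phi>}"
  show ?thesis
  proof (rule smooth_on_up_to_algebra_Basis[OF open_ball, where C = C])
    show "ray_average P k \<phi> \<in> smooth_algebra (ball P r) C"
      by (rule smooth_algebra.gen) (use \<phi> in \<open>auto simp: C_def\<close>)
    fix f assume "f \<in> C"
    then obtain k \<phi> where f: "f = ray_average P k \<phi>" and \<phi>: "smooth_on (ball P r) \<phi>" by (auto simp: C_def)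
    let ?g = "\<lambda>b. ray_average P (Suc k) (\<lambda>x. frechet_derivative \<phi> (at x) b)"
    have "?g b \<in> smooth_algebra (ball P r) C" for b
    proof (rule smooth_algebra.gen)
      show "?g b \<in> C" unfolding C_def using smooth_on_frechet_derivative[OF \<phi>, of b] by blast
    qed
    moreover have "\<forall>x\<in>ball P r. (f has_derivative (\<lambda>v. \<Sum>b\<in>Basis. (v \<bullet> b) * ?g b x)) (at x)"
      unfolding f by (intro ballI has_derivative_ray_average[OF \<phi>])
    ultimately show "\<exists>g. (\<forall>x\<in>ball P r. (f has_derivative (\<lambda>v. \<Sum>b\<in>Basis. (v \<bullet> b) * g b x)) (at x)) \<and>
                 (\<forall>b\<in>Basis. g b \<in> smooth_algebra (ball P r) C)"
      by (intro exI[of _ ?g] conjI ballI) auto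
  qed
qed

text \<open>
  The fundamental theorem of calculus along the ray from \<open>P\<close> to \<open>z\<close>; the coefficients are ray averages of the
  partial derivatives.
\<close>

lemma Hadamard_lemma:
  fixes h :: "'a::euclidean_space \<Rightarrow> real"
  assumes h: "smooth_germ_at P h"
  obtains g where "\<And>b. smooth_germ_at P (g b)" "\<And>b. g b P = frechet_derivative h (at P) b"
    "\<forall>\<^sub>F z in nhds P. h z = h P + (\<Sum>b\<in>Basis. ((z - P) \<bullet> b) * g b z)"
proof -
  obtain S where S: "open S" "P \<in> S" "smooth_on S h" using h unfolding smooth_germ_at_def by blast
  then obtain r where r: "r > 0" "ball P r \<subseteq> S" using open_contains_ball by blast
  have hB: "smooth_on (ball P r) h" by (rule smooth_on_subset[OF S(3) r(2)])
  let ?D = "\<lambda>b x. frechet_derivative h (at x) b"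
  have sD: "smooth_on (ball P r) (?D b)" for b by (rule smooth_on_frechet_derivative[OF hB])
  define g where "g b = ray_average P 0 (?D b)" for b
  have germ: "smooth_germ_at P (g b)" for b
    unfolding g_def using r(1) by (intro smooth_germ_at_I[OF open_ball _ smooth_on_ray_average[OF sD]]) simp
  have val: "g b P = ?D b P" for b by (simp add: g_def ray_average_def)
  have expand: "h z = h P + (\<Sum>b\<in>Basis. ((z - P) \<bullet> b) * g b z)" if z: "z \<in> ball P r" for z
  proof -
    have "((\<lambda>t. h (P + t *\<^sub>R (z - P))) has_vector_derivative
        (\<Sum>b\<in>Basis. ((z - P) \<bullet> b) * ?D b (P + t *\<^sub>R (z - P)))) (at t within {0..1})" if t: "t \<in> {0..1}" for t :: real
    proof -
      let ?p = "P + t *\<^sub>R (z - P)"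
      have D: "(h has_derivative frechet_derivative h (at ?p)) (at ?p)"
        by (rule smooth_on_has_derivative[OF hB ray_in_ball[OF z]]) (use t in auto)
      have lin: "linear (frechet_derivative h (at ?p))" using D by (rule has_derivative_linear)
      have "((\<lambda>t. P + t *\<^sub>R (z - P)) has_derivative (\<lambda>s. s *\<^sub>R (z - P))) (at t)"
        by (auto intro!: derivative_eq_intros)
      from has_derivative_compose[OF this D]
      have A: "((\<lambda>t. h (P + t *\<^sub>R (z - P))) has_derivative (\<lambda>s. s *\<^sub>R frechet_derivative h (at ?p) (z - P))) (at t)"
        by (simp only: linear_cmul[OF lin])
      have eq: "frechet_derivative h (at ?p) (z - P) = (\<Sum>b\<in>Basis. ((z - P) \<bullet> b) *\<^sub>R ?D b ?p)"
        by (subst euclidean_representation[of "z - P", symmetric]) (simp only: linear_sum[OF lin] linear_cmul[OF lin])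
      show ?thesis
        unfolding has_vector_derivative_def eq[unfolded real_scaleR_def, symmetric]
        by (rule has_derivative_at_withinI[OF A])
    qed
    from fundamental_theorem_of_calculus[OF _ this]
    have "((\<lambda>t. \<Sum>b\<in>Basis. ((z - P) \<bullet> b) * ?D b (P + t *\<^sub>R (z - P))) has_integral (h z - h P)) {0..1}" by simp
    then have "h z - h P = integral {0..1} (\<lambda>t. \<Sum>b\<in>Basis. ((z - P) \<bullet> b) * ?D b (P + t *\<^sub>R (z - P)))"
      by (simp add: integral_unique)
    also have "\<dots> = (\<Sum>b\<in>Basis. ((z - P) \<bullet> b) * g b z)"
    proof (subst integral_sum)
      fix b :: 'a
      have "continuous_on {0..1} (\<lambda>t. ?D b (P + t *\<^sub>R (z - P)))"
        by (rule continuous_on_compose2[OF smooth_on_continuous_on[OF sD]])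
           (use ray_in_ball[OF z] in \<open>auto intro!: continuous_intros simp del: mem_ball\<close>)
      then show "(\<lambda>t. ((z - P) \<bullet> b) * ?D b (P + t *\<^sub>R (z - P))) integrable_on {0..1}"
        by (intro integrable_continuous_real continuous_intros)
    qed (simp_all add: g_def ray_average_def)
    finally show ?thesis by simp
  qed
  have "\<forall>\<^sub>F z in nhds P. z \<in> ball P r" using r(1) by (intro eventually_nhds_in_open) simp_all
  then have "\<forall>\<^sub>F z in nhds P. h z = h P + (\<Sum>b\<in>Basis. ((z - P) \<bullet> b) * g b z)"
    by (rule eventually_mono) (rule expand)
  then show ?thesis by (rule that[OF germ val])
qed

section \<open>Intersection multiplicities with the cone\<close>

lemma Hadamard_3:
  fixes h :: "real \<times> real \<times> real \<Rightarrow> real"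
  assumes h: "smooth_germ_at P h"
  shows "\<exists>a b c. smooth_germ_at P a \<and> smooth_germ_at P b \<and> smooth_germ_at P c \<and>
    a P = frechet_derivative h (at P) (1, 0, 0) \<and> b P = frechet_derivative h (at P) (0, 1, 0) \<and>
    c P = frechet_derivative h (at P) (0, 0, 1) \<and>
    (\<forall>\<^sub>F z in nhds P. h z = h P + (fst z - fst P) * a z + (fst (snd z) - fst (snd P)) * b z
        + (snd (snd z) - snd (snd P)) * c z)"
proof -
  obtain g where g: "\<And>b. smooth_germ_at P (g b)" "\<And>b. g b P = frechet_derivative h (at P) b"
    "\<forall>\<^sub>F z in nhds P. h z = h P + (\<Sum>b\<in>Basis. ((z - P) \<bullet> b) * g b z)"
    by (rule Hadamard_lemma[OF h]) blast
  have B: "(\<Sum>b\<in>Basis. F b) = F (1, 0, 0) + F (0, 1, 0) + F (0, 0, 1)" for F :: "real \<times> real \<times> real \<Rightarrow> real"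
  proof -
    have BB: "(Basis :: (real \<times> real \<times> real) set) = {(1, 0, 0), (0, 1, 0), (0, 0, 1)}"
      by (auto simp: Basis_prod_def zero_prod_def)
    show ?thesis unfolding BB by simp
  qed
  have "\<forall>\<^sub>F z in nhds P. h z = h P + (fst z - fst P) * g (1, 0, 0) z + (fst (snd z) - fst (snd P)) * g (0, 1, 0) z
        + (snd (snd z) - snd (snd P)) * g (0, 0, 1) z"
    using g(3) by (rule eventually_mono) (simp add: B inner_prod_def)
  then show ?thesis using g(1,2) by blast
qed

lemma Hadamard_3_0:
  fixes h :: "real \<times> real \<times> real \<Rightarrow> real"
  assumes h: "smooth_germ_at 0 h"
  shows "\<exists>a b c. smooth_germ_at 0 a \<and> smooth_germ_at 0 b \<and> smooth_germ_at 0 c \<and>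
    a 0 = frechet_derivative h (at 0) (1, 0, 0) \<and> b 0 = frechet_derivative h (at 0) (0, 1, 0) \<and>
    c 0 = frechet_derivative h (at 0) (0, 0, 1) \<and>
    (\<forall>\<^sub>F z in nhds 0. h z = h 0 + fst z * a z + fst (snd z) * b z + snd (snd z) * c z)"
  using Hadamard_3[OF h] unfolding fst_zero snd_zero diff_zero .

text \<open>The ideal whose quotient defines the multiplicity.\<close>

definition intersection_ideal ::
  "(real \<times> real \<times> real \<Rightarrow> real \<times> real) \<Rightarrow> real \<times> real \<times> real \<Rightarrow> (real \<times> real \<times> real \<Rightarrow> real) \<Rightarrow> bool" where
  "intersection_ideal H P h \<longleftrightarrow> (\<exists>a1 a2 a3. smooth_germ_at P a1 \<and> smooth_germ_at P a2 \<and> smooth_germ_at P a3 \<and>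
     (\<forall>\<^sub>F z in nhds P. h z = a1 z * fst (H z) + a2 z * snd (H z) + a3 z * cone_eq z))"

lemma intersection_idealI:
  assumes "smooth_germ_at P a1" "smooth_germ_at P a2" "smooth_germ_at P a3"
    "\<forall>\<^sub>F z in nhds P. h z = a1 z * fst (H z) + a2 z * snd (H z) + a3 z * cone_eq z"
  shows "intersection_ideal H P h"
  using assms unfolding intersection_ideal_def by blast

lemma eq_inverse_mult: "d \<noteq> 0 \<Longrightarrow> d * u = x \<Longrightarrow> u = inverse d * x" for d u x :: real
  by auto

lemma local_algebra_spannedI:
  assumes "\<And>i. smooth_germ_at P (e i)"
    and "\<And>h. smooth_germ_at P h \<Longrightarrow> \<exists>c r. intersection_ideal H P r \<and> (\<forall>\<^sub>F z in nhds P. h z = (\<Sum>i<k. c i * e i z) + r z)"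
  shows "local_algebra_spanned H P k"
  unfolding local_algebra_spanned_def
proof (rule exI[of _ e], rule conjI)
  show "\<forall>i<k. smooth_germ_at P (e i)" using assms(1) by simp
  show "\<forall>h. smooth_germ_at P h \<longrightarrow> (\<exists>(c :: nat \<Rightarrow> real) a1 a2 a3.
      smooth_germ_at P a1 \<and> smooth_germ_at P a2 \<and> smooth_germ_at P a3 \<and>
      (\<forall>\<^sub>F z in nhds P. h z = (\<Sum>i<k. c i * e i z) + a1 z * fst (H z) + a2 z * snd (H z) + a3 z * cone_eq z))"
  proof (rule allI, rule impI)
    fix h :: "real \<times> real \<times> real \<Rightarrow> real" assume "smooth_germ_at P h"
    from assms(2)[OF this] obtain c r where r: "intersection_ideal H P r"
      and e: "\<forall>\<^sub>F z in nhds P. h z = (\<Sum>i<k. c i * e i z) + r z" by (elim exE conjE)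
    obtain x1 x2 x3 where x: "smooth_germ_at P x1" "smooth_germ_at P x2" "smooth_germ_at P x3"
      "\<forall>\<^sub>F z in nhds P. r z = x1 z * fst (H z) + x2 z * snd (H z) + x3 z * cone_eq z"
      using r unfolding intersection_ideal_def by (elim exE conjE)
    have ev: "\<forall>\<^sub>F z in nhds P. h z = (\<Sum>i<k. c i * e i z) + x1 z * fst (H z) + x2 z * snd (H z) + x3 z * cone_eq z"
      using e x(4) by eventually_elim linarith
    show "\<exists>(c :: nat \<Rightarrow> real) a1 a2 a3.
      smooth_germ_at P a1 \<and> smooth_germ_at P a2 \<and> smooth_germ_at P a3 \<and>
      (\<forall>\<^sub>F z in nhds P. h z = (\<Sum>i<k. c i * e i z) + a1 z * fst (H z) + a2 z * snd (H z) + a3 z * cone_eq z)"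
      by (rule exI[of _ c], rule exI[of _ x1], rule exI[of _ x2], rule exI[of _ x3], intro conjI x(1-3) ev)
  qed
qed

lemma intersection_ideal_generators:
  "intersection_ideal H P (\<lambda>z. fst (H z))" "intersection_ideal H P (\<lambda>z. snd (H z))" "intersection_ideal H P cone_eq"
  unfolding intersection_ideal_def
  by (rule exI[of _ "\<lambda>z. 1"], rule exI[of _ "\<lambda>z. 0"], rule exI[of _ "\<lambda>z. 0"], simp add: smooth_germ_at_const)
     (rule exI[of _ "\<lambda>z. 0"], rule exI[of _ "\<lambda>z. 1"], rule exI[of _ "\<lambda>z. 0"], simp add: smooth_germ_at_const,
      rule exI[of _ "\<lambda>z. 0"], rule exI[of _ "\<lambda>z. 0"], rule exI[of _ "\<lambda>z. 1"], simp add: smooth_germ_at_const)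

lemma intersection_ideal_add:
  assumes "intersection_ideal H P g" "intersection_ideal H P h"
  shows "intersection_ideal H P (\<lambda>z. g z + h z)"
proof -
  obtain a1 a2 a3 where a: "smooth_germ_at P a1" "smooth_germ_at P a2" "smooth_germ_at P a3"
    "\<forall>\<^sub>F z in nhds P. g z = a1 z * fst (H z) + a2 z * snd (H z) + a3 z * cone_eq z"
    using assms(1) unfolding intersection_ideal_def by (elim exE conjE)
  obtain b1 b2 b3 where b: "smooth_germ_at P b1" "smooth_germ_at P b2" "smooth_germ_at P b3"
    "\<forall>\<^sub>F z in nhds P. h z = b1 z * fst (H z) + b2 z * snd (H z) + b3 z * cone_eq z"
    using assms(2) unfolding intersection_ideal_def by (elim exE conjE)
  have ev: "\<forall>\<^sub>F z in nhds P. g z + h z = (a1 z + b1 z) * fst (H z) + (a2 z + b2 z) * snd (H z) + (a3 z + b3 z) * cone_eq z"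
    using a(4) b(4) by eventually_elim (simp add: algebra_simps)
  show ?thesis by (intro intersection_idealI[OF _ _ _ ev] smooth_germ_at_add a b)
qed

lemma intersection_ideal_mult:
  assumes g: "smooth_germ_at P g" and h: "intersection_ideal H P h"
  shows "intersection_ideal H P (\<lambda>z. g z * h z)"
proof -
  obtain b1 b2 b3 where b: "smooth_germ_at P b1" "smooth_germ_at P b2" "smooth_germ_at P b3"
    "\<forall>\<^sub>F z in nhds P. h z = b1 z * fst (H z) + b2 z * snd (H z) + b3 z * cone_eq z"
    using h unfolding intersection_ideal_def by (elim exE conjE)
  have ev: "\<forall>\<^sub>F z in nhds P. g z * h z = (g z * b1 z) * fst (H z) + (g z * b2 z) * snd (H z) + (g z * b3 z) * cone_eq z"
    using b(4) by eventually_elim (simp add: algebra_simps)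
  show ?thesis by (intro intersection_idealI[OF _ _ _ ev] smooth_germ_at_mult g b)
qed

lemma intersection_ideal_cong:
  assumes h: "intersection_ideal H P h" and eq: "\<forall>\<^sub>F z in nhds P. g z = h z"
  shows "intersection_ideal H P g"
proof -
  obtain b1 b2 b3 where b: "smooth_germ_at P b1" "smooth_germ_at P b2" "smooth_germ_at P b3"
    "\<forall>\<^sub>F z in nhds P. h z = b1 z * fst (H z) + b2 z * snd (H z) + b3 z * cone_eq z"
    using h unfolding intersection_ideal_def by (elim exE conjE)
  have ev: "\<forall>\<^sub>F z in nhds P. g z = b1 z * fst (H z) + b2 z * snd (H z) + b3 z * cone_eq z"
    using b(4) eq by eventually_elim simp
  show ?thesis by (intro intersection_idealI[OF _ _ _ ev] b)
qed

lemma smooth_germ_at_coords: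
  "smooth_germ_at P (\<lambda>z :: real \<times> real \<times> real. fst z)"
  "smooth_germ_at P (\<lambda>z :: real \<times> real \<times> real. fst (snd z))"
  "smooth_germ_at P (\<lambda>z :: real \<times> real \<times> real. snd (snd z))"
  by (intro smooth_germ_at_bounded_linear bounded_linear_fst bounded_linear_compose[OF bounded_linear_fst bounded_linear_snd]
     bounded_linear_compose[OF bounded_linear_snd bounded_linear_snd])+

lemma cone_eq_alt: "cone_eq z = (fst (snd z))\<^sup>2 - fst z * snd (snd z)"
  by (simp add: cone_eq_def case_prod_unfold)

lemma smooth_germ_at_cone_eq: "smooth_germ_at P cone_eq"
proof -
  have "smooth_germ_at P (\<lambda>z. fst (snd z) * fst (snd z) - fst z * snd (snd z))"
    by (intro smooth_germ_at_diff smooth_germ_at_mult smooth_germ_at_coords)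
  then show ?thesis by (simp add: cone_eq_alt[abs_def] power2_eq_square)
qed

lemma frechet_derivative_cone_eq:
  "frechet_derivative cone_eq (at z) v = 2 * fst (snd z) * fst (snd v) - fst v * snd (snd z) - fst z * snd (snd v)"
proof -
  have 1: "((\<lambda>z :: real \<times> real \<times> real. fst (snd z)) has_derivative (\<lambda>v. fst (snd v))) (at z)"
    by (intro bounded_linear_imp_has_derivative bounded_linear_compose[OF bounded_linear_fst bounded_linear_snd])
  have 2: "((\<lambda>z :: real \<times> real \<times> real. snd (snd z)) has_derivative (\<lambda>v. snd (snd v))) (at z)"
    by (intro bounded_linear_imp_has_derivative bounded_linear_compose[OF bounded_linear_snd bounded_linear_snd])
  have 3: "((\<lambda>z :: real \<times> real \<times> real. fst z) has_derivative (\<lambda>v. fst v)) (at z)"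
    by (intro bounded_linear_imp_has_derivative bounded_linear_fst)
  have eq: "cone_eq = (\<lambda>z. fst (snd z) * fst (snd z) - fst z * snd (snd z))"
    by (rule ext) (simp add: cone_eq_alt power2_eq_square)
  have "(cone_eq has_derivative (\<lambda>v. (fst (snd z) * fst (snd v) + fst (snd v) * fst (snd z))
      - (fst z * snd (snd v) + fst v * snd (snd z)))) (at z)"
    unfolding eq by (rule has_derivative_diff[OF has_derivative_mult[OF 1 1] has_derivative_mult[OF 3 2]])
  from fun_cong[OF frechet_derivative_at[OF this], of v]
  have "frechet_derivative cone_eq (at z) v = (fst (snd z) * fst (snd v) + fst (snd v) * fst (snd z))
      - (fst z * snd (snd v) + fst v * snd (snd z))" by (rule sym)
  also have "\<dots> = 2 * fst (snd z) * fst (snd v) - fst v * snd (snd z) - fst z * snd (snd v)" by algebra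
  finally show ?thesis .
qed

lemma Cramer_3:
  fixes u v w :: real
  shows "(a1 * (b2 * c3 - c2 * b3) - b1 * (a2 * c3 - c2 * a3) + c1 * (a2 * b3 - b2 * a3)) * u
      = (b2 * c3 - c2 * b3) * (u * a1 + v * b1 + w * c1) + (c1 * b3 - b1 * c3) * (u * a2 + v * b2 + w * c2) + (b1 * c2 - c1 * b2) * (u * a3 + v * b3 + w * c3)"
  and "(a1 * (b2 * c3 - c2 * b3) - b1 * (a2 * c3 - c2 * a3) + c1 * (a2 * b3 - b2 * a3)) * v
      = (c2 * a3 - a2 * c3) * (u * a1 + v * b1 + w * c1) + (a1 * c3 - c1 * a3) * (u * a2 + v * b2 + w * c2) + (c1 * a2 - a1 * c2) * (u * a3 + v * b3 + w * c3)"
  and "(a1 * (b2 * c3 - c2 * b3) - b1 * (a2 * c3 - c2 * a3) + c1 * (a2 * b3 - b2 * a3)) * w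
      = (a2 * b3 - b2 * a3) * (u * a1 + v * b1 + w * c1) + (b1 * a3 - a1 * b3) * (u * a2 + v * b2 + w * c2) + (a1 * b2 - b1 * a2) * (u * a3 + v * b3 + w * c3)"
  by algebra+

text \<open>
  Transversality. If the three generators have independent differentials at \<open>P\<close>, then by Hadamard
  and Cramer the coordinates of \<open>z - P\<close> lie in the ideal, which is therefore the maximal ideal.
\<close>

lemma spanned_1_if_transverse:
  fixes H :: "real \<times> real \<times> real \<Rightarrow> real \<times> real"
  assumes H: "smooth_germ_at P (\<lambda>z. fst (H z))" "smooth_germ_at P (\<lambda>z. snd (H z))"
    and zero: "H P = 0" "cone_eq P = 0"
  defines "d1 \<equiv> frechet_derivative (\<lambda>z. fst (H z)) (at P)" and "d2 \<equiv> frechet_derivative (\<lambda>z. snd (H z)) (at P)"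
    and "d3 \<equiv> frechet_derivative cone_eq (at P)"
  assumes det: "d1 (1,0,0) * (d2 (0,1,0) * d3 (0,0,1) - d2 (0,0,1) * d3 (0,1,0))
      - d1 (0,1,0) * (d2 (1,0,0) * d3 (0,0,1) - d2 (0,0,1) * d3 (1,0,0))
      + d1 (0,0,1) * (d2 (1,0,0) * d3 (0,1,0) - d2 (0,1,0) * d3 (1,0,0)) \<noteq> 0"
  shows "local_algebra_spanned H P 1"
proof -
  let ?u = "\<lambda>z :: real \<times> real \<times> real. fst z - fst P" and ?v = "\<lambda>z :: real \<times> real \<times> real. fst (snd z) - fst (snd P)"
    and ?w = "\<lambda>z :: real \<times> real \<times> real. snd (snd z) - snd (snd P)"
  obtain a1 b1 c1 where g1: "smooth_germ_at P a1" "smooth_germ_at P b1" "smooth_germ_at P c1"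
    and v1: "a1 P = d1 (1,0,0)" "b1 P = d1 (0,1,0)" "c1 P = d1 (0,0,1)"
    and e10: "\<forall>\<^sub>F z in nhds P. fst (H z) = fst (H P) + ?u z * a1 z + ?v z * b1 z + ?w z * c1 z"
    using Hadamard_3[OF H(1)] unfolding d1_def by (elim exE conjE)
  obtain a2 b2 c2 where g2: "smooth_germ_at P a2" "smooth_germ_at P b2" "smooth_germ_at P c2"
    and v2: "a2 P = d2 (1,0,0)" "b2 P = d2 (0,1,0)" "c2 P = d2 (0,0,1)"
    and e20: "\<forall>\<^sub>F z in nhds P. snd (H z) = snd (H P) + ?u z * a2 z + ?v z * b2 z + ?w z * c2 z"
    using Hadamard_3[OF H(2)] unfolding d2_def by (elim exE conjE)
  obtain a3 b3 c3 where g3: "smooth_germ_at P a3" "smooth_germ_at P b3" "smooth_germ_at P c3"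
    and v3: "a3 P = d3 (1,0,0)" "b3 P = d3 (0,1,0)" "c3 P = d3 (0,0,1)"
    and e30: "\<forall>\<^sub>F z in nhds P. cone_eq z = cone_eq P + ?u z * a3 z + ?v z * b3 z + ?w z * c3 z"
    using Hadamard_3[OF smooth_germ_at_cone_eq[of P]] unfolding d3_def by (elim exE conjE)
  have e1: "\<forall>\<^sub>F z in nhds P. fst (H z) = ?u z * a1 z + ?v z * b1 z + ?w z * c1 z"
    using e10 unfolding zero fst_zero add_0 .
  have e2: "\<forall>\<^sub>F z in nhds P. snd (H z) = ?u z * a2 z + ?v z * b2 z + ?w z * c2 z"
    using e20 unfolding zero snd_zero add_0 .
  have e3: "\<forall>\<^sub>F z in nhds P. cone_eq z = ?u z * a3 z + ?v z * b3 z + ?w z * c3 z"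
    using e30 unfolding zero add_0 .
  define D where "D z = a1 z * (b2 z * c3 z - c2 z * b3 z) - b1 z * (a2 z * c3 z - c2 z * a3 z)
      + c1 z * (a2 z * b3 z - b2 z * a3 z)" for z
  have D: "smooth_germ_at P D"
    unfolding D_def by (intro smooth_germ_at_add smooth_germ_at_diff smooth_germ_at_mult g1 g2 g3)
  have DP: "D P \<noteq> 0" unfolding D_def v1 v2 v3 by (rule det)
  note iD = smooth_germ_at_inverse[OF D DP]
  have nz: "\<forall>\<^sub>F z in nhds P. D z \<noteq> 0"
  proof -
    have "\<forall>\<^sub>F z in nhds P. dist (D z) (D P) < \<bar>D P\<bar>"
      by (rule isCont_eventually_near[OF smooth_germ_at_isCont[OF D]]) (use DP in simp)
    then show ?thesis by (rule eventually_mono) (auto simp: dist_real_def)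
  qed
  note gen = intersection_ideal_generators[of H P]
  have comb: "intersection_ideal H P (\<lambda>z. inverse (D z) * (x1 z * fst (H z) + x2 z * snd (H z) + x3 z * cone_eq z))"
    if "smooth_germ_at P x1" "smooth_germ_at P x2" "smooth_germ_at P x3" for x1 x2 x3
    by (intro intersection_ideal_mult intersection_ideal_add iD that gen)
  have minor: "smooth_germ_at P (\<lambda>z. f z * g z - h z * k z)"
    if "smooth_germ_at P f" "smooth_germ_at P g" "smooth_germ_at P h" "smooth_germ_at P k" for f g h k :: "real \<times> real \<times> real \<Rightarrow> real"
    by (rule smooth_germ_at_diff[OF smooth_germ_at_mult[OF that(1,2)] smooth_germ_at_mult[OF that(3,4)]])
  have "intersection_ideal H P ?u"
  proof (rule intersection_ideal_cong[OF comb[OF minor[OF g2(2) g3(3) g2(3) g3(2)] minor[OF g1(3) g3(2) g1(2) g3(3)] minor[OF g1(2) g2(3) g1(3) g2(2)]]])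
    show "\<forall>\<^sub>F z in nhds P. ?u z = inverse (D z) * ((b2 z * c3 z - c2 z * b3 z) * fst (H z) + (c1 z * b3 z - b1 z * c3 z) * snd (H z) + (b1 z * c2 z - c1 z * b2 z) * cone_eq z)"
      using e1 e2 e3 nz
    proof eventually_elim
      case (elim z)
      show ?case unfolding elim(1-3)
        by (rule eq_inverse_mult[OF elim(4)]) (unfold D_def, rule Cramer_3)
    qed
  qed
  moreover have "intersection_ideal H P ?v"
  proof (rule intersection_ideal_cong[OF comb[OF minor[OF g2(3) g3(1) g2(1) g3(3)] minor[OF g1(1) g3(3) g1(3) g3(1)] minor[OF g1(3) g2(1) g1(1) g2(3)]]])
    show "\<forall>\<^sub>F z in nhds P. ?v z = inverse (D z) * ((c2 z * a3 z - a2 z * c3 z) * fst (H z) + (a1 z * c3 z - c1 z * a3 z) * snd (H z) + (c1 z * a2 z - a1 z * c2 z) * cone_eq z)"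
      using e1 e2 e3 nz
    proof eventually_elim
      case (elim z)
      show ?case unfolding elim(1-3)
        by (rule eq_inverse_mult[OF elim(4)]) (unfold D_def, rule Cramer_3)
    qed
  qed
  moreover have "intersection_ideal H P ?w"
  proof (rule intersection_ideal_cong[OF comb[OF minor[OF g2(1) g3(2) g2(2) g3(1)] minor[OF g1(2) g3(1) g1(1) g3(2)] minor[OF g1(1) g2(2) g1(2) g2(1)]]])
    show "\<forall>\<^sub>F z in nhds P. ?w z = inverse (D z) * ((a2 z * b3 z - b2 z * a3 z) * fst (H z) + (b1 z * a3 z - a1 z * b3 z) * snd (H z) + (a1 z * b2 z - b1 z * a2 z) * cone_eq z)"
      using e1 e2 e3 nz
    proof eventually_elim
      case (elim z)
      show ?case unfolding elim(1-3)
        by (rule eq_inverse_mult[OF elim(4)]) (unfold D_def, rule Cramer_3)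
    qed
  qed
  ultimately have I: "intersection_ideal H P ?u" "intersection_ideal H P ?v" "intersection_ideal H P ?w" .
  define e :: "nat \<Rightarrow> real \<times> real \<times> real \<Rightarrow> real" where "e i z = 1" for i z
  show ?thesis
  proof (rule local_algebra_spannedI[of P e])
    show "smooth_germ_at P (e i)" for i unfolding e_def by (rule smooth_germ_at_const)
    fix h :: "real \<times> real \<times> real \<Rightarrow> real" assume h: "smooth_germ_at P h"
    obtain a b c where g: "smooth_germ_at P a" "smooth_germ_at P b" "smooth_germ_at P c"
      and exp: "\<forall>\<^sub>F z in nhds P. h z = h P + ?u z * a z + ?v z * b z + ?w z * c z"
      using Hadamard_3[OF h] by (elim exE conjE)
    have mem: "intersection_ideal H P (\<lambda>z. a z * ?u z + b z * ?v z + c z * ?w z)"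
      by (intro intersection_ideal_add intersection_ideal_mult g I)
    have ev: "\<forall>\<^sub>F z in nhds P. h z = (\<Sum>i<1. h P * e i z) + (a z * ?u z + b z * ?v z + c z * ?w z)"
      using exp by eventually_elim (simp add: e_def)
    show "\<exists>c r. intersection_ideal H P r \<and> (\<forall>\<^sub>F z in nhds P. h z = (\<Sum>i<1. c i * e i z) + r z)"
      by (rule exI[of _ "\<lambda>_. h P"], rule exI[of _ "\<lambda>z. a z * ?u z + b z * ?v z + c z * ?w z"], rule conjI[OF mem ev])
  qed
qed

text \<open>
  The determinant allows one to solve for the first two coordinates: modulo the components of \<open>H\<close>, they are
  multiples of the third coordinate \<open>w\<close>. The equation of the cone becomes \<open>w\<^sup>2\<close> times a germ whose value at the origin is
  nonzero exactly if the line on which both differentials vanish is not on the cone. So \<open>w\<^sup>2\<close> is in the ideal, and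
  \<open>1\<close> and \<open>w\<close> span.
\<close>

lemma spanned_2_if_line_off_cone:
  fixes H :: "real \<times> real \<times> real \<Rightarrow> real \<times> real"
  assumes H: "smooth_germ_at 0 (\<lambda>z. fst (H z))" "smooth_germ_at 0 (\<lambda>z. snd (H z))"
    and zero: "H 0 = 0"
  defines "d1 \<equiv> frechet_derivative (\<lambda>z. fst (H z)) (at 0)" and "d2 \<equiv> frechet_derivative (\<lambda>z. snd (H z)) (at 0)"
  assumes det: "d1 (1,0,0) * d2 (0,1,0) - d1 (0,1,0) * d2 (1,0,0) \<noteq> 0"
    and cone: "(d1 (0,0,1) * d2 (1,0,0) - d1 (1,0,0) * d2 (0,0,1))\<^sup>2 \<noteq>
      (d1 (0,1,0) * d2 (0,0,1) - d1 (0,0,1) * d2 (0,1,0)) * (d1 (1,0,0) * d2 (0,1,0) - d1 (0,1,0) * d2 (1,0,0))"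
  shows "local_algebra_spanned H 0 2"
proof -
  let ?u = "\<lambda>z :: real \<times> real \<times> real. fst z" and ?v = "\<lambda>z :: real \<times> real \<times> real. fst (snd z)"
    and ?w = "\<lambda>z :: real \<times> real \<times> real. snd (snd z)"
  note g0 = smooth_germ_at_coords[of 0]
  obtain a1 b1 c1 where g1: "smooth_germ_at 0 a1" "smooth_germ_at 0 b1" "smooth_germ_at 0 c1"
    and v1: "a1 0 = d1 (1,0,0)" "b1 0 = d1 (0,1,0)" "c1 0 = d1 (0,0,1)"
    and e10: "\<forall>\<^sub>F z in nhds 0. fst (H z) = fst (H 0) + ?u z * a1 z + ?v z * b1 z + ?w z * c1 z"
    using Hadamard_3_0[OF H(1)] unfolding d1_def by (elim exE conjE)
  obtain a2 b2 c2 where g2: "smooth_germ_at 0 a2" "smooth_germ_at 0 b2" "smooth_germ_at 0 c2"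
    and v2: "a2 0 = d2 (1,0,0)" "b2 0 = d2 (0,1,0)" "c2 0 = d2 (0,0,1)"
    and e20: "\<forall>\<^sub>F z in nhds 0. snd (H z) = snd (H 0) + ?u z * a2 z + ?v z * b2 z + ?w z * c2 z"
    using Hadamard_3_0[OF H(2)] unfolding d2_def by (elim exE conjE)
  have e1: "\<forall>\<^sub>F z in nhds 0. fst (H z) = ?u z * a1 z + ?v z * b1 z + ?w z * c1 z"
    using e10 unfolding zero fst_zero snd_zero add_0 .
  have e2: "\<forall>\<^sub>F z in nhds 0. snd (H z) = ?u z * a2 z + ?v z * b2 z + ?w z * c2 z"
    using e20 unfolding zero fst_zero snd_zero add_0 .
  define D where "D z = a1 z * b2 z - b1 z * a2 z" for z
  have D: "smooth_germ_at 0 D"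
    unfolding D_def by (intro smooth_germ_at_diff smooth_germ_at_mult g1 g2)
  have D0: "D 0 \<noteq> 0" unfolding D_def v1 v2 by (rule det)
  have ev_nz: "\<forall>\<^sub>F z in nhds 0. G z \<noteq> 0" if "smooth_germ_at 0 G" "G 0 \<noteq> 0" for G :: "real \<times> real \<times> real \<Rightarrow> real"
  proof -
    have "\<forall>\<^sub>F z in nhds 0. dist (G z) (G 0) < \<bar>G 0\<bar>"
      by (rule isCont_eventually_near[OF smooth_germ_at_isCont[OF that(1)]]) (use that(2) in simp)
    then show ?thesis by (rule eventually_mono) (auto simp: dist_real_def)
  qed
  note iD = smooth_germ_at_inverse[OF D D0] and nz = ev_nz[OF D D0]
  define s where "s z = inverse (D z) * (b1 z * c2 z - c1 z * b2 z)" for z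
  define r where "r z = inverse (D z) * (c1 z * a2 z - a1 z * c2 z)" for z
  have sr: "smooth_germ_at 0 s" "smooth_germ_at 0 r"
    unfolding s_def r_def by (intro smooth_germ_at_diff smooth_germ_at_mult g1 g2 iD)+
  note gen = intersection_ideal_generators[of H 0]
  have comb: "intersection_ideal H 0 (\<lambda>z. inverse (D z) * (x1 z * fst (H z) + x2 z * snd (H z)))"
    if "smooth_germ_at 0 x1" "smooth_germ_at 0 x2" for x1 x2
    by (intro intersection_ideal_mult intersection_ideal_add iD that gen)
  have neg: "smooth_germ_at 0 (\<lambda>z. - 1 * g z)" if "smooth_germ_at 0 g" for g :: "real \<times> real \<times> real \<Rightarrow> real"
    by (intro smooth_germ_at_mult smooth_germ_at_const that)
  have Iu: "intersection_ideal H 0 (\<lambda>z. ?u z - s z * ?w z)"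
  proof (rule intersection_ideal_cong[OF comb[OF g2(2) neg[OF g1(2)]]])
    show "\<forall>\<^sub>F z in nhds 0. ?u z - s z * ?w z = inverse (D z) * (b2 z * fst (H z) + (- 1 * b1 z) * snd (H z))"
      using e1 e2 nz
    proof eventually_elim
      case (elim z)
      have Ds: "D z * s z = b1 z * c2 z - c1 z * b2 z" using elim(3) by (simp add: s_def)
      have "D z * (?u z - s z * ?w z) = D z * ?u z - (D z * s z) * ?w z" by algebra
      also have "\<dots> = b2 z * fst (H z) + (- 1 * b1 z) * snd (H z)"
        unfolding Ds unfolding elim(1,2) D_def by algebra
      finally show ?case by (rule eq_inverse_mult[OF elim(3)])
    qed
  qed
  have Iv: "intersection_ideal H 0 (\<lambda>z. ?v z - r z * ?w z)"
  proof (rule intersection_ideal_cong[OF comb[OF neg[OF g2(1)] g1(1)]])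
    show "\<forall>\<^sub>F z in nhds 0. ?v z - r z * ?w z = inverse (D z) * ((- 1 * a2 z) * fst (H z) + a1 z * snd (H z))"
      using e1 e2 nz
    proof eventually_elim
      case (elim z)
      have Dr: "D z * r z = c1 z * a2 z - a1 z * c2 z" using elim(3) by (simp add: r_def)
      have "D z * (?v z - r z * ?w z) = D z * ?v z - (D z * r z) * ?w z" by algebra
      also have "\<dots> = (- 1 * a2 z) * fst (H z) + a1 z * snd (H z)"
        unfolding Dr unfolding elim(1,2) D_def by algebra
      finally show ?case by (rule eq_inverse_mult[OF elim(3)])
    qed
  qed
  define q where "q z = r z * r z - s z" for z
  have q: "smooth_germ_at 0 q" unfolding q_def by (intro smooth_germ_at_diff smooth_germ_at_mult sr)
  have q0: "q 0 \<noteq> 0"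
  proof
    assume "q 0 = 0"
    moreover have "inverse (D 0) * D 0 = 1" using D0 by simp
    ultimately have "(c1 0 * a2 0 - a1 0 * c2 0)\<^sup>2 = (b1 0 * c2 0 - c1 0 * b2 0) * D 0"
      unfolding q_def s_def r_def by algebra
    then show False using cone unfolding D_def v1 v2 by simp
  qed
  have Iw: "intersection_ideal H 0 (\<lambda>z. ?w z * ?w z)"
  proof (rule intersection_ideal_cong)
    show "intersection_ideal H 0 (\<lambda>z. inverse (q z) * (1 * cone_eq z + (- 1 * (?v z + r z * ?w z) * (?v z - r z * ?w z)
        + ?w z * (?u z - s z * ?w z))))"
      by (intro intersection_ideal_mult intersection_ideal_add smooth_germ_at_inverse[OF q q0] gen Iu Iv
           neg smooth_germ_at_add smooth_germ_at_mult sr g0 smooth_germ_at_const)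
    show "\<forall>\<^sub>F z in nhds 0. ?w z * ?w z = inverse (q z) * (1 * cone_eq z + (- 1 * (?v z + r z * ?w z) * (?v z - r z * ?w z)
        + ?w z * (?u z - s z * ?w z)))"
      using ev_nz[OF q q0]
    proof eventually_elim
      case (elim z)
      show ?case
        by (rule eq_inverse_mult[OF elim]) (unfold q_def cone_eq_alt, algebra)
    qed
  qed
  have expand: "\<exists>k c. smooth_germ_at 0 k \<and> smooth_germ_at 0 c \<and> intersection_ideal H 0 c \<and>
      (\<forall>\<^sub>F z in nhds 0. h z = h 0 + k z * ?w z + c z)"
    if h: "smooth_germ_at 0 h" for h :: "real \<times> real \<times> real \<Rightarrow> real"
  proof -
    obtain a b c where g: "smooth_germ_at 0 a" "smooth_germ_at 0 b" "smooth_germ_at 0 c"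
      and e: "\<forall>\<^sub>F z in nhds 0. h z = h 0 + ?u z * a z + ?v z * b z + ?w z * c z"
      using Hadamard_3_0[OF h] by (elim exE conjE)
    let ?k = "\<lambda>z. a z * s z + b z * r z + c z" and ?c = "\<lambda>z. a z * (?u z - s z * ?w z) + b z * (?v z - r z * ?w z)"
    have "\<forall>\<^sub>F z in nhds 0. h z = h 0 + ?k z * ?w z + ?c z"
      using e by eventually_elim (simp add: algebra_simps)
    moreover have "smooth_germ_at 0 ?k" "smooth_germ_at 0 ?c"
      by (intro smooth_germ_at_add smooth_germ_at_mult smooth_germ_at_diff g sr g0)+
    moreover have "intersection_ideal H 0 ?c"
      by (intro intersection_ideal_add intersection_ideal_mult g Iu Iv)
    ultimately show ?thesis by (intro exI conjI)
  qed
  define e :: "nat \<Rightarrow> real \<times> real \<times> real \<Rightarrow> real" where "e i z = (if i = 0 then 1 else ?w z)" for i z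
  show ?thesis
  proof (rule local_algebra_spannedI[of 0 e])
    show "smooth_germ_at 0 (e i)" for i
      unfolding e_def by (cases "i = 0") (simp_all add: smooth_germ_at_const g0)
    fix h :: "real \<times> real \<times> real \<Rightarrow> real" assume h: "smooth_germ_at 0 h"
    obtain k c where k: "smooth_germ_at 0 k" "smooth_germ_at 0 c" "intersection_ideal H 0 c"
      "\<forall>\<^sub>F z in nhds 0. h z = h 0 + k z * ?w z + c z"
      using expand[OF h] by (elim exE conjE)
    obtain k' c' where k': "smooth_germ_at 0 k'" "smooth_germ_at 0 c'" "intersection_ideal H 0 c'"
      "\<forall>\<^sub>F z in nhds 0. k z = k 0 + k' z * ?w z + c' z"
      using expand[OF k(1)] by (elim exE conjE)
    have mem: "intersection_ideal H 0 (\<lambda>z. k' z * (?w z * ?w z) + (?w z * c' z + c z))"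
      by (intro intersection_ideal_add intersection_ideal_mult k(3) k'(1,3) Iw g0)
    define x where "x i = (if i = 0 then h 0 else k 0)" for i :: nat
    have ev: "\<forall>\<^sub>F z in nhds 0. h z = (\<Sum>i<2. x i * e i z) + (k' z * (?w z * ?w z) + (?w z * c' z + c z))"
      using k(4) k'(4)
    proof eventually_elim
      case (elim z)
      have "(\<Sum>i<2. x i * e i z) = h 0 + k 0 * ?w z" by (simp add: x_def e_def numeral_2_eq_2)
      then show ?case unfolding elim(1) elim(2) by (simp add: algebra_simps)
    qed
    show "\<exists>c r. intersection_ideal H 0 r \<and> (\<forall>\<^sub>F z in nhds 0. h z = (\<Sum>i<2. c i * e i z) + r z)"
      by (rule exI[of _ x], rule exI[of _ "\<lambda>z. k' z * (?w z * ?w z) + (?w z * c' z + c z)"], rule conjI[OF mem ev])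
  qed
qed

lemma homogeneous_system_nontrivial:
  fixes c :: "nat \<Rightarrow> nat \<Rightarrow> real"
  shows "\<exists>x. (\<exists>j\<le>k. x j \<noteq> 0) \<and> (\<forall>i<k. (\<Sum>j\<le>k. x j * c j i) = 0)"
proof (induction k arbitrary: c)
  case 0
  show ?case by (rule exI[of _ "\<lambda>_. 1"]) simp
next
  case (Suc k)
  show ?case
  proof (cases "\<exists>p\<le>Suc k. c p k \<noteq> 0")
    case False
    obtain x j where x: "j \<le> k" "x j \<noteq> 0" "\<And>i. i < k \<Longrightarrow> (\<Sum>j\<le>k. x j * c j i) = 0"
      using Suc.IH[of c] by blast
    define y where "y j = (if j \<le> k then x j else 0)" for j
    have "(\<Sum>j\<le>Suc k. y j * c j i) = (\<Sum>j\<le>k. x j * c j i)" for i by (simp add: y_def)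
    moreover have "(\<Sum>j\<le>k. x j * c j k) = 0" using False by (intro sum.neutral) simp
    ultimately have "\<forall>i<Suc k. (\<Sum>j\<le>Suc k. y j * c j i) = 0" using x(3) by (simp add: less_Suc_eq)
    moreover have "\<exists>j\<le>Suc k. y j \<noteq> 0" using x(1,2) by (intro exI[of _ j]) (simp add: y_def)
    ultimately show ?thesis by blast
  next
    case True
    then obtain p where p: "p \<le> Suc k" "c p k \<noteq> 0" by blast
    define \<pi> where "\<pi> j = (if j = p then Suc k else if j = Suc k then p else j)" for j
    define c' where "c' j = c (\<pi> j)" for j
    have c'k: "c' (Suc k) k \<noteq> 0" using p by (simp add: c'_def \<pi>_def)
    obtain x j where x: "j \<le> k" "x j \<noteq> 0"
      "\<And>i. i < k \<Longrightarrow> (\<Sum>j\<le>k. x j * (c' j i - c' j k / c' (Suc k) k * c' (Suc k) i)) = 0"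
      using Suc.IH[of "\<lambda>j i. c' j i - c' j k / c' (Suc k) k * c' (Suc k) i"] by blast
    define s where "s = (\<Sum>j\<le>k. x j * c' j k) / c' (Suc k) k"
    define y where "y j = (if j \<le> k then x j else - s)" for j
    have y: "(\<Sum>j\<le>Suc k. y j * c' j i) = (\<Sum>j\<le>k. x j * c' j i) - s * c' (Suc k) i" for i
      by (simp add: y_def)
    have "(\<Sum>j\<le>Suc k. y j * c' j i) = 0" if "i < Suc k" for i
    proof (cases "i = k")
      case True
      then show ?thesis using c'k unfolding y by (simp add: s_def)
    next
      case False
      then have "(\<Sum>j\<le>k. x j * c' j i - x j * c' j k / c' (Suc k) k * c' (Suc k) i) = 0"
        using x(3)[of i] that by (simp add: algebra_simps)
      then show ?thesis unfolding y s_def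
        by (simp add: sum_subtractf sum_distrib_right sum_divide_distrib)
    qed
    moreover have "(\<Sum>j\<le>Suc k. y (\<pi> j) * c j i) = (\<Sum>j\<le>Suc k. y j * c' j i)" for i
      by (rule sum.reindex_bij_witness[where i = \<pi> and j = \<pi>]) (use p in \<open>auto simp: \<pi>_def c'_def\<close>)
    ultimately have "\<forall>i<Suc k. (\<Sum>j\<le>Suc k. y (\<pi> j) * c j i) = 0" by simp
    moreover have "\<pi> j \<le> Suc k" "y (\<pi> (\<pi> j)) \<noteq> 0"
      using x(1,2) p by (auto simp: \<pi>_def y_def)
    ultimately show ?thesis by (intro exI[of _ "\<lambda>j. y (\<pi> j)"]) blast
  qed
qed

text \<open>
  A lower bound for the dimension: if the generators of the ideal are \<open>o(\<rho>)\<close> along a curve, then modulo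
  \<open>o(\<rho>)\<close> the restrictions to the curve of germs span a space of dimension at most \<open>k\<close>.
\<close>

lemma spanned_imp_dependent_along_curve:
  fixes H :: "real \<times> real \<times> real \<Rightarrow> real \<times> real" and \<gamma> :: "real \<Rightarrow> real \<times> real \<times> real"
  assumes sp: "local_algebra_spanned H P k" and \<gamma>: "(\<gamma> \<longlongrightarrow> P) (at 0)"
    and H: "((\<lambda>t. fst (H (\<gamma> t)) / \<rho> t) \<longlongrightarrow> 0) (at 0)" "((\<lambda>t. snd (H (\<gamma> t)) / \<rho> t) \<longlongrightarrow> 0) (at 0)"
    and Q: "((\<lambda>t. cone_eq (\<gamma> t) / \<rho> t) \<longlongrightarrow> 0) (at 0)"
    and h: "\<And>j. smooth_germ_at P (h j)"
  shows "\<exists>x. (\<exists>j\<le>k. x j \<noteq> 0) \<and> ((\<lambda>t. (\<Sum>j\<le>k. x j * h j (\<gamma> t)) / \<rho> t) \<longlongrightarrow> 0) (at 0)"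
proof -
  obtain e where e: "\<forall>i<k. smooth_germ_at P (e i)"
    "\<forall>h. smooth_germ_at P h \<longrightarrow> (\<exists>(c :: nat \<Rightarrow> real) a1 a2 a3. smooth_germ_at P a1 \<and> smooth_germ_at P a2 \<and> smooth_germ_at P a3 \<and>
      (\<forall>\<^sub>F z in nhds P. h z = (\<Sum>i<k. c i * e i z) + a1 z * fst (H z) + a2 z * snd (H z) + a3 z * cone_eq z))"
    using sp unfolding local_algebra_spanned_def by (elim exE conjE)
  have "\<exists>c. ((\<lambda>t. (h j (\<gamma> t) - (\<Sum>i<k. c i * e i (\<gamma> t))) / \<rho> t) \<longlongrightarrow> 0) (at 0)" for j
  proof -
    obtain c a1 a2 a3 where a: "smooth_germ_at P a1" "smooth_germ_at P a2" "smooth_germ_at P a3"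
      "\<forall>\<^sub>F z in nhds P. h j z = (\<Sum>i<k. c i * e i z) + a1 z * fst (H z) + a2 z * snd (H z) + a3 z * cone_eq z"
      using e(2)[rule_format, OF h[of j]] by (elim exE conjE)
    have l: "((\<lambda>t. a (\<gamma> t)) \<longlongrightarrow> a P) (at 0)" if "smooth_germ_at P a" for a :: "real \<times> real \<times> real \<Rightarrow> real"
      by (rule isCont_tendsto_compose[OF smooth_germ_at_isCont[OF that] \<gamma>])
    have "((\<lambda>t. a1 (\<gamma> t) * (fst (H (\<gamma> t)) / \<rho> t) + a2 (\<gamma> t) * (snd (H (\<gamma> t)) / \<rho> t)
        + a3 (\<gamma> t) * (cone_eq (\<gamma> t) / \<rho> t)) \<longlongrightarrow> a1 P * 0 + a2 P * 0 + a3 P * 0) (at 0)"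
      by (intro tendsto_add tendsto_mult l a H Q)
    then have lim: "((\<lambda>t. a1 (\<gamma> t) * (fst (H (\<gamma> t)) / \<rho> t) + a2 (\<gamma> t) * (snd (H (\<gamma> t)) / \<rho> t)
        + a3 (\<gamma> t) * (cone_eq (\<gamma> t) / \<rho> t)) \<longlongrightarrow> 0) (at 0)" by simp
    have ev: "\<forall>\<^sub>F t in at 0. a1 (\<gamma> t) * (fst (H (\<gamma> t)) / \<rho> t) + a2 (\<gamma> t) * (snd (H (\<gamma> t)) / \<rho> t)
        + a3 (\<gamma> t) * (cone_eq (\<gamma> t) / \<rho> t) = (h j (\<gamma> t) - (\<Sum>i<k. c i * e i (\<gamma> t))) / \<rho> t"
      using eventually_compose_filterlim[OF a(4) \<gamma>]
      by eventually_elim (simp add: add_divide_distrib)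
    show ?thesis by (rule exI[of _ c], rule Lim_transform_eventually[OF lim ev])
  qed
  then have "\<forall>j. \<exists>c. ((\<lambda>t. (h j (\<gamma> t) - (\<Sum>i<k. c i * e i (\<gamma> t))) / \<rho> t) \<longlongrightarrow> 0) (at 0)" by (rule allI)
  from choice[OF this] obtain c where
    c: "\<forall>j. ((\<lambda>t. (h j (\<gamma> t) - (\<Sum>i<k. c j i * e i (\<gamma> t))) / \<rho> t) \<longlongrightarrow> 0) (at 0)" by (rule exE)
  obtain x where x: "\<exists>j\<le>k. x j \<noteq> 0" "\<forall>i<k. (\<Sum>j\<le>k. x j * c j i) = 0"
    using homogeneous_system_nontrivial[of k c] by blast
  have "((\<lambda>t. \<Sum>j\<le>k. x j * ((h j (\<gamma> t) - (\<Sum>i<k. c j i * e i (\<gamma> t))) / \<rho> t)) \<longlongrightarrow> (\<Sum>j\<le>k. x j * 0)) (at 0)"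
    by (intro tendsto_sum tendsto_mult tendsto_const c[rule_format])
  moreover have "(\<Sum>j\<le>k. x j * ((h j (\<gamma> t) - (\<Sum>i<k. c j i * e i (\<gamma> t))) / \<rho> t)) = (\<Sum>j\<le>k. x j * h j (\<gamma> t)) / \<rho> t" for t
  proof -
    have "(\<Sum>j\<le>k. x j * (\<Sum>i<k. c j i * e i (\<gamma> t))) = (\<Sum>j\<le>k. \<Sum>i<k. x j * c j i * e i (\<gamma> t))"
      by (simp add: sum_distrib_left mult.assoc)
    also have "\<dots> = (\<Sum>i<k. \<Sum>j\<le>k. x j * c j i * e i (\<gamma> t))" by (rule sum.swap)
    also have "\<dots> = (\<Sum>i<k. (\<Sum>j\<le>k. x j * c j i) * e i (\<gamma> t))" by (simp add: sum_distrib_right)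
    also have "\<dots> = 0" using x(2) by simp
    finally have 0: "(\<Sum>j\<le>k. x j * (\<Sum>i<k. c j i * e i (\<gamma> t))) = 0" .
    have "(\<Sum>j\<le>k. x j * ((h j (\<gamma> t) - (\<Sum>i<k. c j i * e i (\<gamma> t))) / \<rho> t))
        = (\<Sum>j\<le>k. x j * h j (\<gamma> t) - x j * (\<Sum>i<k. c j i * e i (\<gamma> t))) / \<rho> t"
      by (simp add: sum_divide_distrib right_diff_distrib)
    also have "\<dots> = (\<Sum>j\<le>k. x j * h j (\<gamma> t)) / \<rho> t" by (simp add: sum_subtractf 0)
    finally show ?thesis .
  qed
  ultimately have "((\<lambda>t. (\<Sum>j\<le>k. x j * h j (\<gamma> t)) / \<rho> t) \<longlongrightarrow> 0) (at 0)" by simp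
  then show ?thesis using x(1) by blast
qed

lemma polynomial_little_o_imp_0:
  fixes b :: "nat \<Rightarrow> real"
  assumes lim: "((\<lambda>t. (\<Sum>i\<le>k. b i * t ^ i) / t ^ r) \<longlongrightarrow> 0) (at 0)" and k: "k \<le> r" and j: "j \<le> k"
  shows "b j = 0"
  using j
proof (induction j rule: less_induct)
  case (less j)
  have "((\<lambda>t. (\<Sum>i\<le>k. b i * t ^ i) / t ^ r * t ^ (r - j)) \<longlongrightarrow> 0 * 0 ^ (r - j)) (at 0)"
    by (intro tendsto_mult lim tendsto_power tendsto_ident_at)
  moreover have "\<forall>\<^sub>F t in at (0::real). (\<Sum>i\<le>k. b i * t ^ i) / t ^ r * t ^ (r - j) = (\<Sum>i\<in>{j..k}. b i * t ^ (i - j))"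
    unfolding eventually_at_filter
  proof (rule always_eventually, intro allI impI)
    fix t :: real assume t: "t \<noteq> 0"
    have "(\<Sum>i\<le>k. b i * t ^ i) = (\<Sum>i\<in>{j..k}. b i * t ^ i)"
      by (rule sum.mono_neutral_right) (use less in auto)
    also have "\<dots> = (\<Sum>i\<in>{j..k}. b i * t ^ (i - j)) * t ^ j"
      unfolding sum_distrib_right by (rule sum.cong) (simp_all add: power_add[symmetric])
    finally have "(\<Sum>i\<le>k. b i * t ^ i) * t ^ (r - j) = (\<Sum>i\<in>{j..k}. b i * t ^ (i - j)) * t ^ r"
      using less.prems k by (simp add: power_add[symmetric])
    then show "(\<Sum>i\<le>k. b i * t ^ i) / t ^ r * t ^ (r - j) = (\<Sum>i\<in>{j..k}. b i * t ^ (i - j))"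
      using t by (simp add: divide_eq_eq)
  qed
  ultimately have "((\<lambda>t. \<Sum>i\<in>{j..k}. b i * t ^ (i - j)) \<longlongrightarrow> 0 * 0 ^ (r - j)) (at 0)"
    by (rule Lim_transform_eventually)
  moreover have "((\<lambda>t. \<Sum>i\<in>{j..k}. b i * t ^ (i - j)) \<longlongrightarrow> (\<Sum>i\<in>{j..k}. b i * 0 ^ (i - j))) (at 0)"
    by (intro tendsto_sum tendsto_mult tendsto_const tendsto_power tendsto_ident_at)
  ultimately have "0 = (\<Sum>i\<in>{j..k}. b i * 0 ^ (i - j))"
    using tendsto_unique[OF at_neq_bot] by fastforce
  also have "\<dots> = (\<Sum>i\<in>{j}. b i * 0 ^ (i - j))"
    by (rule sum.mono_neutral_right) (use less.prems in auto)
  finally show ?case by simp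
qed

lemma smooth_germ_at_power:
  fixes f :: "'a::real_normed_vector \<Rightarrow> real"
  assumes "smooth_germ_at P f" shows "smooth_germ_at P (\<lambda>z. f z ^ n)"
  by (induction n) (simp_all add: smooth_germ_at_const smooth_germ_at_mult assms)

text \<open>
  If \<open>k \<le> r\<close>, then the restrictions of \<open>1, l, \<dots>, l ^ k\<close> to the curve are linearly independent modulo
  \<open>o(t ^ r)\<close>.
\<close>

lemma spanned_imp_order_less:
  fixes H :: "real \<times> real \<times> real \<Rightarrow> real \<times> real" and \<gamma> :: "real \<Rightarrow> real \<times> real \<times> real"
  assumes sp: "local_algebra_spanned H P k" and \<gamma>: "(\<gamma> \<longlongrightarrow> P) (at 0)"
    and H: "((\<lambda>t. fst (H (\<gamma> t)) / t ^ r) \<longlongrightarrow> 0) (at 0)" "((\<lambda>t. snd (H (\<gamma> t)) / t ^ r) \<longlongrightarrow> 0) (at 0)"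
    and Q: "((\<lambda>t. cone_eq (\<gamma> t) / t ^ r) \<longlongrightarrow> 0) (at 0)"
    and l: "smooth_germ_at P l" "\<And>t. l (\<gamma> t) = m * t" "m \<noteq> 0"
  shows "r < k"
proof (rule ccontr)
  assume "\<not> r < k"
  then have k: "k \<le> r" by simp
  obtain x where x: "\<exists>j\<le>k. x j \<noteq> 0" "((\<lambda>t. (\<Sum>j\<le>k. x j * l (\<gamma> t) ^ j) / t ^ r) \<longlongrightarrow> 0) (at 0)"
    using spanned_imp_dependent_along_curve[where h = "\<lambda>j z. l z ^ j", OF sp \<gamma> H Q smooth_germ_at_power[OF l(1)]]
    by blast
  have "((\<lambda>t. (\<Sum>j\<le>k. (x j * m ^ j) * t ^ j) / t ^ r) \<longlongrightarrow> 0) (at 0)"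
    using x(2) unfolding l(2) power_mult_distrib mult.assoc .
  from polynomial_little_o_imp_0[OF this k] have "x j = 0" if "j \<le> k" for j
    using that l(3) by fastforce
  then show False using x(1) by blast
qed

lemma tendsto_triple:
  fixes f g h :: "real \<Rightarrow> real"
  assumes "(f \<longlongrightarrow> 0) F" "(g \<longlongrightarrow> 0) F" "(h \<longlongrightarrow> 0) F"
  shows "((\<lambda>t. (f t, g t, h t)) \<longlongrightarrow> (0 :: real \<times> real \<times> real)) F"
  using tendsto_Pair[OF assms(1) tendsto_Pair[OF assms(2,3)]] by (simp add: zero_prod_def)

text \<open>
  Two linear forms on three-space have a common zero \<open>n\<close>, and the equation of the cone is quadratic.
  So all three generators are \<open>o(t)\<close> along the line \<open>t n\<close>.
\<close>

lemma spanned_imp_ge_2: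
  fixes H :: "real \<times> real \<times> real \<Rightarrow> real \<times> real"
  assumes H: "smooth_germ_at 0 (\<lambda>z. fst (H z))" "smooth_germ_at 0 (\<lambda>z. snd (H z))" and zero: "H 0 = 0"
    and sp: "local_algebra_spanned H 0 k"
  shows "2 \<le> k"
proof -
  obtain a1 b1 c1 where g1: "smooth_germ_at 0 a1" "smooth_germ_at 0 b1" "smooth_germ_at 0 c1"
    and e1: "\<forall>\<^sub>F z in nhds 0. fst (H z) = fst (H 0) + fst z * a1 z + fst (snd z) * b1 z + snd (snd z) * c1 z"
    using Hadamard_3_0[OF H(1)] by (elim exE conjE)
  obtain a2 b2 c2 where g2: "smooth_germ_at 0 a2" "smooth_germ_at 0 b2" "smooth_germ_at 0 c2"
    and e2: "\<forall>\<^sub>F z in nhds 0. snd (H z) = snd (H 0) + fst z * a2 z + fst (snd z) * b2 z + snd (snd z) * c2 z"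
    using Hadamard_3_0[OF H(2)] by (elim exE conjE)
  define A where "A j i = (if i = 0 then (if j = 0 then a1 0 else if j = 1 then b1 0 else c1 0)
     else (if j = 0 then a2 0 else if j = 1 then b2 0 else c2 0))" for i j :: nat
  obtain n where n: "\<exists>j\<le>2. n j \<noteq> 0" "\<forall>i<2. (\<Sum>j\<le>2. n j * A j i) = 0"
    using homogeneous_system_nontrivial[of 2 A] by blast
  have s3: "(\<Sum>j\<le>2. F j) = F 0 + F 1 + F 2" for F :: "nat \<Rightarrow> real" by (simp add: numeral_2_eq_2)
  have n1: "n 0 * a1 0 + n 1 * b1 0 + n 2 * c1 0 = 0" and n2: "n 0 * a2 0 + n 1 * b2 0 + n 2 * c2 0 = 0"
    using n(2)[rule_format, of 0] n(2)[rule_format, of 1] by (simp_all add: s3 A_def)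
  define \<gamma> where "\<gamma> t = (t * n 0, t * n 1, t * n 2)" for t :: real
  have \<gamma>: "(\<gamma> \<longlongrightarrow> 0) (at 0)"
    unfolding \<gamma>_def by (intro tendsto_triple tendsto_mult_left_zero tendsto_ident_at)
  have lim: "((\<lambda>t. h (\<gamma> t) / t ^ 1) \<longlongrightarrow> 0) (at 0)"
    if "smooth_germ_at 0 a" "smooth_germ_at 0 b" "smooth_germ_at 0 c" "h 0 = 0"
      "\<forall>\<^sub>F z in nhds 0. h z = h 0 + fst z * a z + fst (snd z) * b z + snd (snd z) * c z"
      "n 0 * a 0 + n 1 * b 0 + n 2 * c 0 = 0" for h a b c :: "real \<times> real \<times> real \<Rightarrow> real"
  proof -
    have "((\<lambda>t. n 0 * a (\<gamma> t) + n 1 * b (\<gamma> t) + n 2 * c (\<gamma> t)) \<longlongrightarrow> n 0 * a 0 + n 1 * b 0 + n 2 * c 0) (at 0)"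
      by (intro tendsto_add tendsto_mult tendsto_const isCont_tendsto_compose[OF smooth_germ_at_isCont \<gamma>] that)
    moreover have "\<forall>\<^sub>F t in at 0. n 0 * a (\<gamma> t) + n 1 * b (\<gamma> t) + n 2 * c (\<gamma> t) = h (\<gamma> t) / t ^ 1"
      using eventually_compose_filterlim[OF that(5) \<gamma>] eventually_neq_at_within[of 0]
      by eventually_elim (simp add: \<gamma>_def that(4) field_simps)
    ultimately show ?thesis using that(6) Lim_transform_eventually by fastforce
  qed
  \<comment> \<open>The linear form with coefficients \<open>n\<close> is not constant along the line.\<close>
  define m where "m = n 0 * n 0 + n 1 * n 1 + n 2 * n 2"
  have "m \<noteq> 0"
  proof
    assume "m = 0"
    then have "n 0 = 0 \<and> n 1 = 0 \<and> n 2 = 0" unfolding m_def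
      by (metis add_nonneg_eq_0_iff mult_eq_0_iff zero_le_square add_nonneg_nonneg)
    moreover obtain j where "j \<le> 2" "n j \<noteq> 0" using n(1) by blast
    moreover then have "j = 0 \<or> j = 1 \<or> j = 2" by linarith
    ultimately show False by blast
  qed
  have "((\<lambda>t. (n 1 * n 1 - n 0 * n 2) * t) \<longlongrightarrow> (n 1 * n 1 - n 0 * n 2) * 0) (at 0)"
    by (intro tendsto_mult tendsto_const tendsto_ident_at)
  moreover have "\<forall>\<^sub>F t in at (0::real). (n 1 * n 1 - n 0 * n 2) * t = cone_eq (\<gamma> t) / t ^ 1"
    using eventually_neq_at_within[of 0]
    by eventually_elim (simp add: cone_eq_alt \<gamma>_def power2_eq_square field_simps)
  ultimately have Q: "((\<lambda>t. cone_eq (\<gamma> t) / t ^ 1) \<longlongrightarrow> 0) (at 0)"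
    using Lim_transform_eventually by fastforce
  have "1 < k"
  proof (rule spanned_imp_order_less[OF sp \<gamma> _ _ Q])
    show "((\<lambda>t. fst (H (\<gamma> t)) / t ^ 1) \<longlongrightarrow> 0) (at 0)"
      by (rule lim[OF g1 _ e1 n1]) (simp add: zero)
    show "((\<lambda>t. snd (H (\<gamma> t)) / t ^ 1) \<longlongrightarrow> 0) (at 0)"
      by (rule lim[OF g2 _ e2 n2]) (simp add: zero)
    show "smooth_germ_at 0 (\<lambda>z. n 0 * fst z + n 1 * fst (snd z) + n 2 * snd (snd z))"
      by (intro smooth_germ_at_add smooth_germ_at_mult smooth_germ_at_const smooth_germ_at_coords)
    show "n 0 * fst (\<gamma> t) + n 1 * fst (snd (\<gamma> t)) + n 2 * snd (snd (\<gamma> t)) = m * t" for t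
      by (simp add: \<gamma>_def m_def algebra_simps)
  qed (rule \<open>m \<noteq> 0\<close>)
  then show ?thesis by simp
qed

text \<open>
  The coefficient of \<open>t\<^sup>2\<close> responds to a quadratic correction \<open>(x, y)\<close> of the curve only through the
  differential; the remaining contribution \<open>s\<close> does not involve \<open>(x, y)\<close>.
\<close>

lemma second_order_along_curve:
  fixes h :: "real \<times> real \<times> real \<Rightarrow> real"
  assumes h: "smooth_germ_at 0 h" "h 0 = 0"
  defines "d \<equiv> frechet_derivative h (at 0)"
  assumes p: "p * d (1,0,0) + q * d (0,1,0) + r * d (0,0,1) = 0"
  shows "\<exists>s. \<forall>x y. ((\<lambda>t. h (t * (p + t * x), t * (q + t * y), t * r) / t ^ 2) \<longlongrightarrow> x * d (1,0,0) + y * d (0,1,0) + s) (at 0)"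
proof -
  obtain a b c where g: "smooth_germ_at 0 a" "smooth_germ_at 0 b" "smooth_germ_at 0 c"
    and d: "a 0 = d (1,0,0)" "b 0 = d (0,1,0)" "c 0 = d (0,0,1)"
    and e: "\<forall>\<^sub>F z in nhds 0. h z = h 0 + fst z * a z + fst (snd z) * b z + snd (snd z) * c z"
    using Hadamard_3_0[OF h(1)] unfolding d_def by (elim exE conjE)
  have "\<exists>l. \<forall>x y. ((\<lambda>t. (g (t * (p + t * x), t * (q + t * y), t * r) - g 0) / t) \<longlongrightarrow> l) (at 0)"
    if sg: "smooth_germ_at 0 g" for g :: "real \<times> real \<times> real \<Rightarrow> real"
  proof -
    obtain a b c where ga: "smooth_germ_at 0 a" "smooth_germ_at 0 b" "smooth_germ_at 0 c"
      and e: "\<forall>\<^sub>F z in nhds 0. g z = g 0 + fst z * a z + fst (snd z) * b z + snd (snd z) * c z"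
      using Hadamard_3_0[OF sg] by (elim exE conjE)
    have "((\<lambda>t. (g (t * (p + t * x), t * (q + t * y), t * r) - g 0) / t) \<longlongrightarrow> p * a 0 + q * b 0 + r * c 0) (at 0)" for x y
    proof -
      define \<gamma> where "\<gamma> t = (t * (p + t * x), t * (q + t * y), t * r)" for t :: real
      have \<gamma>: "(\<gamma> \<longlongrightarrow> 0) (at 0)"
        unfolding \<gamma>_def by (intro tendsto_triple) (auto intro!: tendsto_eq_intros)
      have "((\<lambda>t. (p + t * x) * a (\<gamma> t) + (q + t * y) * b (\<gamma> t) + r * c (\<gamma> t))
          \<longlongrightarrow> (p + 0 * x) * a 0 + (q + 0 * y) * b 0 + r * c 0) (at 0)"
        by (intro tendsto_add tendsto_mult tendsto_const tendsto_ident_at isCont_tendsto_compose[OF smooth_germ_at_isCont \<gamma>] ga)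
      moreover have "\<forall>\<^sub>F t in at 0. (p + t * x) * a (\<gamma> t) + (q + t * y) * b (\<gamma> t) + r * c (\<gamma> t) = (g (\<gamma> t) - g 0) / t"
        using eventually_compose_filterlim[OF e \<gamma>] eventually_neq_at_within[of 0]
        by eventually_elim (simp add: \<gamma>_def field_simps)
      ultimately have "((\<lambda>t. (g (\<gamma> t) - g 0) / t) \<longlongrightarrow> (p + 0 * x) * a 0 + (q + 0 * y) * b 0 + r * c 0) (at 0)"
        by (rule Lim_transform_eventually)
      then show ?thesis by (simp add: \<gamma>_def)
    qed
    then show ?thesis by blast
  qed
  note D = this
  obtain la where la: "\<And>x y. ((\<lambda>t. (a (t * (p + t * x), t * (q + t * y), t * r) - a 0) / t) \<longlongrightarrow> la) (at 0)" using D[OF g(1)] by blast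
  obtain lb where lb: "\<And>x y. ((\<lambda>t. (b (t * (p + t * x), t * (q + t * y), t * r) - b 0) / t) \<longlongrightarrow> lb) (at 0)" using D[OF g(2)] by blast
  obtain lc where lc: "\<And>x y. ((\<lambda>t. (c (t * (p + t * x), t * (q + t * y), t * r) - c 0) / t) \<longlongrightarrow> lc) (at 0)" using D[OF g(3)] by blast
  have "((\<lambda>t. h (t * (p + t * x), t * (q + t * y), t * r) / t ^ 2) \<longlongrightarrow> x * d (1,0,0) + y * d (0,1,0) + (p * la + q * lb + r * lc)) (at 0)" for x y
  proof -
    define \<gamma> where "\<gamma> t = (t * (p + t * x), t * (q + t * y), t * r)" for t :: real
    have \<gamma>: "(\<gamma> \<longlongrightarrow> 0) (at 0)"
      unfolding \<gamma>_def by (intro tendsto_triple) (auto intro!: tendsto_eq_intros)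
    have "((\<lambda>t. x * a 0 + y * b 0 + ((p + t * x) * ((a (\<gamma> t) - a 0) / t) + (q + t * y) * ((b (\<gamma> t) - b 0) / t) + r * ((c (\<gamma> t) - c 0) / t)))
        \<longlongrightarrow> x * a 0 + y * b 0 + ((p + 0 * x) * la + (q + 0 * y) * lb + r * lc)) (at 0)"
      unfolding \<gamma>_def by (intro tendsto_add tendsto_mult tendsto_const tendsto_ident_at la lb lc)
    moreover have "\<forall>\<^sub>F t in at 0. x * a 0 + y * b 0 + ((p + t * x) * ((a (\<gamma> t) - a 0) / t) + (q + t * y) * ((b (\<gamma> t) - b 0) / t) + r * ((c (\<gamma> t) - c 0) / t))
        = h (\<gamma> t) / t ^ 2"
      using eventually_compose_filterlim[OF e \<gamma>] eventually_neq_at_within[of 0]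
    proof eventually_elim
      case (elim t)
      have pq: "p * a 0 + q * b 0 + r * c 0 = 0" using p unfolding d .
      have "t * (x * a 0 + y * b 0 + ((p + t * x) * ((a (\<gamma> t) - a 0) / t) + (q + t * y) * ((b (\<gamma> t) - b 0) / t) + r * ((c (\<gamma> t) - c 0) / t)))
          = t * (x * a 0 + y * b 0) + ((p + t * x) * (a (\<gamma> t) - a 0) + (q + t * y) * (b (\<gamma> t) - b 0) + r * (c (\<gamma> t) - c 0))"
        using elim(2) by (simp add: field_simps)
      also have "\<dots> = (p + t * x) * a (\<gamma> t) + (q + t * y) * b (\<gamma> t) + r * c (\<gamma> t)"
        using pq by algebra
      finally have "t * t * (x * a 0 + y * b 0 + ((p + t * x) * ((a (\<gamma> t) - a 0) / t) + (q + t * y) * ((b (\<gamma> t) - b 0) / t) + r * ((c (\<gamma> t) - c 0) / t)))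
          = t * ((p + t * x) * a (\<gamma> t) + (q + t * y) * b (\<gamma> t) + r * c (\<gamma> t))" by (simp only: mult.assoc)
      also have "\<dots> = h (\<gamma> t)" using elim(1) h(2) by (simp add: \<gamma>_def algebra_simps)
      finally show ?case using elim(2) by (simp add: eq_divide_eq power2_eq_square mult.commute)
    qed
    ultimately have "((\<lambda>t. h (\<gamma> t) / t ^ 2) \<longlongrightarrow> x * a 0 + y * b 0 + ((p + 0 * x) * la + (q + 0 * y) * lb + r * lc)) (at 0)"
      by (rule Lim_transform_eventually)
    then show ?thesis by (simp add: \<gamma>_def d)
  qed
  then show ?thesis by blast
qed

text \<open>
  The line on which both differentials vanish can be bent in such a way that both components of \<open>H\<close> are
  \<open>o(t\<^sup>2)\<close> along the resulting curve. Since the line is on the cone, so is the equation of the cone.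
\<close>

lemma spanned_imp_ge_3_if_line_on_cone:
  fixes H :: "real \<times> real \<times> real \<Rightarrow> real \<times> real"
  assumes H: "smooth_germ_at 0 (\<lambda>z. fst (H z))" "smooth_germ_at 0 (\<lambda>z. snd (H z))"
    and zero: "H 0 = 0"
  defines "d1 \<equiv> frechet_derivative (\<lambda>z. fst (H z)) (at 0)" and "d2 \<equiv> frechet_derivative (\<lambda>z. snd (H z)) (at 0)"
  assumes det: "d1 (1,0,0) * d2 (0,1,0) - d1 (0,1,0) * d2 (1,0,0) \<noteq> 0"
    and cone: "(d1 (0,0,1) * d2 (1,0,0) - d1 (1,0,0) * d2 (0,0,1))\<^sup>2 =
      (d1 (0,1,0) * d2 (0,0,1) - d1 (0,0,1) * d2 (0,1,0)) * (d1 (1,0,0) * d2 (0,1,0) - d1 (0,1,0) * d2 (1,0,0))"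
    and sp: "local_algebra_spanned H 0 k"
  shows "3 \<le> k"
proof -
  define p where "p = d1 (0,1,0) * d2 (0,0,1) - d1 (0,0,1) * d2 (0,1,0)"
  define q where "q = d1 (0,0,1) * d2 (1,0,0) - d1 (1,0,0) * d2 (0,0,1)"
  define r where "r = d1 (1,0,0) * d2 (0,1,0) - d1 (0,1,0) * d2 (1,0,0)"
  have r: "r \<noteq> 0" and pqr: "q\<^sup>2 = p * r" using det cone by (simp_all add: p_def q_def r_def)
  have z1: "fst (H 0) = 0" and z2: "snd (H 0) = 0" by (simp_all add: zero)
  have "p * d1 (1,0,0) + q * d1 (0,1,0) + r * d1 (0,0,1) = 0" unfolding p_def q_def r_def by algebra
  then obtain s1 where s1: "\<And>x y. ((\<lambda>t. fst (H (t * (p + t * x), t * (q + t * y), t * r)) / t ^ 2) \<longlongrightarrow> x * d1 (1,0,0) + y * d1 (0,1,0) + s1) (at 0)"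
    using second_order_along_curve[OF H(1) z1, of p q r] unfolding d1_def by blast
  have "p * d2 (1,0,0) + q * d2 (0,1,0) + r * d2 (0,0,1) = 0" unfolding p_def q_def r_def by algebra
  then obtain s2 where s2: "\<And>x y. ((\<lambda>t. snd (H (t * (p + t * x), t * (q + t * y), t * r)) / t ^ 2) \<longlongrightarrow> x * d2 (1,0,0) + y * d2 (0,1,0) + s2) (at 0)"
    using second_order_along_curve[OF H(2) z2, of p q r] unfolding d2_def by blast
  \<comment> \<open>Cramer's rule for the quadratic correction that cancels \<open>s1\<close> and \<open>s2\<close>.\<close>
  define x where "x = (s2 * d1 (0,1,0) - s1 * d2 (0,1,0)) / r"
  define y where "y = (s1 * d2 (1,0,0) - s2 * d1 (1,0,0)) / r"
  have xy: "x * r = s2 * d1 (0,1,0) - s1 * d2 (0,1,0)" "y * r = s1 * d2 (1,0,0) - s2 * d1 (1,0,0)"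
    using r by (simp_all add: x_def y_def)
  have "(x * d1 (1,0,0) + y * d1 (0,1,0) + s1) * r = 0" "(x * d2 (1,0,0) + y * d2 (0,1,0) + s2) * r = 0"
    using xy unfolding r_def by algebra+
  then have v: "x * d1 (1,0,0) + y * d1 (0,1,0) + s1 = 0" "x * d2 (1,0,0) + y * d2 (0,1,0) + s2 = 0"
    using r by auto
  define \<gamma> where "\<gamma> t = (t * (p + t * x), t * (q + t * y), t * r)" for t :: real
  have \<gamma>: "(\<gamma> \<longlongrightarrow> 0) (at 0)"
    unfolding \<gamma>_def by (intro tendsto_triple) (auto intro!: tendsto_eq_intros)
  have "((\<lambda>t. (q + t * y)\<^sup>2 - (p + t * x) * r) \<longlongrightarrow> (q + 0 * y)\<^sup>2 - (p + 0 * x) * r) (at 0)"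
    by (intro tendsto_diff tendsto_power tendsto_add tendsto_mult tendsto_const tendsto_ident_at)
  moreover have "\<forall>\<^sub>F t in at (0::real). (q + t * y)\<^sup>2 - (p + t * x) * r = cone_eq (\<gamma> t) / t ^ 2"
    using eventually_neq_at_within[of 0]
    by eventually_elim (simp add: cone_eq_alt \<gamma>_def power2_eq_square field_simps)
  ultimately have "((\<lambda>t. cone_eq (\<gamma> t) / t ^ 2) \<longlongrightarrow> (q + 0 * y)\<^sup>2 - (p + 0 * x) * r) (at 0)"
    by (rule Lim_transform_eventually)
  then have Q: "((\<lambda>t. cone_eq (\<gamma> t) / t ^ 2) \<longlongrightarrow> 0) (at 0)" using pqr by simp
  have "2 < k"
  proof (rule spanned_imp_order_less[OF sp \<gamma> _ _ Q])
    show "((\<lambda>t. fst (H (\<gamma> t)) / t ^ 2) \<longlongrightarrow> 0) (at 0)" using s1[of x y] unfolding v \<gamma>_def .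
    show "((\<lambda>t. snd (H (\<gamma> t)) / t ^ 2) \<longlongrightarrow> 0) (at 0)" using s2[of x y] unfolding v \<gamma>_def .
    show "smooth_germ_at 0 (\<lambda>z :: real \<times> real \<times> real. snd (snd z))" by (rule smooth_germ_at_coords)
    show "snd (snd (\<gamma> t)) = r * t" for t by (simp add: \<gamma>_def)
  qed (rule r)
  then show ?thesis by simp
qed

section \<open>The minimal multiplicity at the origin\<close>

lemma smooth_germ_at_components:
  assumes "smooth_germ_at P (H :: 'a::real_normed_vector \<Rightarrow> real \<times> real)"
  shows "smooth_germ_at P (\<lambda>z. fst (H z))" "smooth_germ_at P (\<lambda>z. snd (H z))"
proof -
  obtain S where S: "open S" "P \<in> S" "smooth_on S H" using assms unfolding smooth_germ_at_def by blast
  show "smooth_germ_at P (\<lambda>z. fst (H z))" "smooth_germ_at P (\<lambda>z. snd (H z))"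
    by (rule smooth_germ_at_I[OF S(1,2) smooth_on_bounded_linear_compose[OF bounded_linear_fst S(1,3)]],
        rule smooth_germ_at_I[OF S(1,2) smooth_on_bounded_linear_compose[OF bounded_linear_snd S(1,3)]])
qed

lemma intersection_mult_le: "local_algebra_spanned H P k \<Longrightarrow> intersection_mult H P \<le> enat k"
  unfolding intersection_mult_def by (rule Inf_lower) blast

lemma intersection_mult_ge:
  "(\<And>k. local_algebra_spanned H P k \<Longrightarrow> n \<le> k) \<Longrightarrow> enat n \<le> intersection_mult H P"
  unfolding intersection_mult_def by (rule Inf_greatest) auto

lemma minimal_origin_mult_eq_2: "minimal_origin_mult = 2"
proof (rule antisym)
  have "enat 2 \<le> minimal_origin_mult"
    unfolding minimal_origin_mult_def
    by (rule INF_greatest, rule intersection_mult_ge, rule spanned_imp_ge_2)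
       (auto intro: smooth_germ_at_components)
  then show "2 \<le> minimal_origin_mult" by (simp add: numeral_eq_enat)
  \<comment> \<open>The line \<open>v = 0, u = w\<close> meets the cone only at its vertex.\<close>
  define G :: "real \<times> real \<times> real \<Rightarrow> real \<times> real" where "G z = (fst (snd z), fst z - snd (snd z))" for z
  have bl: "bounded_linear (\<lambda>z :: real \<times> real \<times> real. fst (snd z))" "bounded_linear (\<lambda>z :: real \<times> real \<times> real. fst z - snd (snd z))"
    by (intro bounded_linear_sub bounded_linear_fst bounded_linear_compose[OF bounded_linear_fst bounded_linear_snd]
        bounded_linear_compose[OF bounded_linear_snd bounded_linear_snd])+
  have G: "smooth_germ_at 0 G" unfolding G_def by (intro smooth_germ_at_bounded_linear bounded_linear_Pair bl)
  have d1: "frechet_derivative (\<lambda>z. fst (G z)) (at 0) = (\<lambda>z. fst (snd z))"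
    unfolding G_def fst_conv using frechet_derivative_at[OF bounded_linear_imp_has_derivative[OF bl(1)], of 0] by (rule sym)
  have d2: "frechet_derivative (\<lambda>z. snd (G z)) (at 0) = (\<lambda>z. fst z - snd (snd z))"
    unfolding G_def snd_conv using frechet_derivative_at[OF bounded_linear_imp_has_derivative[OF bl(2)], of 0] by (rule sym)
  have G0: "G 0 = 0" by (simp add: G_def zero_prod_def)
  have "local_algebra_spanned G 0 2"
    by (rule spanned_2_if_line_off_cone[OF smooth_germ_at_components[OF G] G0]) (simp_all add: d1 d2)
  then have "intersection_mult G 0 \<le> enat 2" by (rule intersection_mult_le)
  moreover have "minimal_origin_mult \<le> intersection_mult G 0"
    unfolding minimal_origin_mult_def by (rule INF_lower) (simp add: G G0)
  ultimately show "minimal_origin_mult \<le> 2" by (simp add: numeral_eq_enat)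
qed

text \<open>
  The three determinants are the coordinates of a direction vector of the line on which both differentials
  vanish, and the equation says that this line is on the cone.
\<close>

lemma origin_mult_greater_iff:
  fixes H :: "real \<times> real \<times> real \<Rightarrow> real \<times> real"
  assumes H: "smooth_germ_at 0 (\<lambda>z. fst (H z))" "smooth_germ_at 0 (\<lambda>z. snd (H z))"
    and zero: "H 0 = 0"
  defines "d1 \<equiv> frechet_derivative (\<lambda>z. fst (H z)) (at 0)" and "d2 \<equiv> frechet_derivative (\<lambda>z. snd (H z)) (at 0)"
  assumes det: "d1 (1,0,0) * d2 (0,1,0) - d1 (0,1,0) * d2 (1,0,0) \<noteq> 0"
  shows "intersection_mult H 0 > minimal_origin_mult \<longleftrightarrow> (d1 (0,0,1) * d2 (1,0,0) - d1 (1,0,0) * d2 (0,0,1))\<^sup>2 =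
      (d1 (0,1,0) * d2 (0,0,1) - d1 (0,0,1) * d2 (0,1,0)) * (d1 (1,0,0) * d2 (0,1,0) - d1 (0,1,0) * d2 (1,0,0))"
    (is "?L \<longleftrightarrow> ?R")
proof
  assume ?R
  then have "enat 3 \<le> intersection_mult H 0"
    using spanned_imp_ge_3_if_line_on_cone[OF H zero] det unfolding d1_def d2_def by (intro intersection_mult_ge)
  moreover have "minimal_origin_mult < enat 3" by (simp add: minimal_origin_mult_eq_2 numeral_eq_enat)
  ultimately show ?L by (rule less_le_trans[rotated])
next
  assume L: ?L
  show ?R
  proof (rule ccontr)
    assume "\<not> ?R"
    then have "local_algebra_spanned H 0 2"
      using spanned_2_if_line_off_cone[OF H zero] det unfolding d1_def d2_def by blast
    then have "intersection_mult H 0 \<le> 2" using intersection_mult_le numeral_eq_enat by metis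
    then show False using L by (simp add: minimal_origin_mult_eq_2)
  qed
qed

section \<open>Directional derivatives\<close>

definition dir :: "real \<times> real \<Rightarrow> (real \<times> real \<Rightarrow> real) \<Rightarrow> real \<times> real \<Rightarrow> real" where
  "dir v f z = fst v * partial_x f z + snd v * partial_y f z"

lemma smooth_on_dir:
  assumes S: "open S" and f: "smooth_on S f" shows "smooth_on S (dir v f)"
  unfolding dir_def[abs_def]
  by (intro smooth_on_add[OF S] smooth_on_mult[OF S] smooth_on_const[OF S] smooth_on_partial[OF f])

lemma smooth_on_dir_iterate:
  assumes S: "open S" and f: "smooth_on S f" shows "smooth_on S ((dir v ^^ n) f)"
  by (induction n) (simp_all add: f smooth_on_dir[OF S])

lemma DERIV_dir:
  assumes f: "smooth_on S f" and z: "(p + t * x, q + t * y) \<in> S"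
  shows "((\<lambda>t. f (p + t * x, q + t * y)) has_real_derivative dir (x, y) f (p + t * x, q + t * y)) (at t)"
proof -
  have "((\<lambda>t. p + t * x) has_real_derivative x) (at t)" "((\<lambda>t. q + t * y) has_real_derivative y) (at t)"
    by (auto intro!: derivative_eq_intros)
  from has_derivative_along[OF f z this] show ?thesis by (simp add: dir_def)
qed

lemma DERIV_dir_iterate:
  assumes S: "open S" and f: "smooth_on S f" and z: "(p + t * x, q + t * y) \<in> S"
  shows "((\<lambda>t. (dir (x, y) ^^ n) f (p + t * x, q + t * y)) has_real_derivative
    (dir (x, y) ^^ Suc n) f (p + t * x, q + t * y)) (at t)"
  using DERIV_dir[OF smooth_on_dir_iterate[OF S f, where v = "(x, y)" and n = n] z] by simp

lemma partials_linear:
  assumes S: "open S" and g: "smooth_on S g" and h: "smooth_on S h" and z: "z \<in> S"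
  shows "partial_x (\<lambda>z. a * g z + b * h z) z = a * partial_x g z + b * partial_x h z"
    and "partial_y (\<lambda>z. a * g z + b * h z) z = a * partial_y g z + b * partial_y h z"
proof -
  have "((\<lambda>z. a * g z + b * h z) has_derivative (\<lambda>v. a * (fst v * partial_x g z + snd v * partial_y g z)
      + b * (fst v * partial_x h z + snd v * partial_y h z))) (at z)"
    by (intro has_derivative_add has_derivative_mult_right has_derivative_partials[OF g z] has_derivative_partials[OF h z])
  then have "((\<lambda>z. a * g z + b * h z) has_derivative (\<lambda>v. fst v * (a * partial_x g z + b * partial_x h z)
      + snd v * (a * partial_y g z + b * partial_y h z))) (at z)"
    by (rule has_derivative_eq_rhs) (rule ext, algebra)
  from partials_eqI[OF this] show "partial_x (\<lambda>z. a * g z + b * h z) z = a * partial_x g z + b * partial_x h z"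
    "partial_y (\<lambda>z. a * g z + b * h z) z = a * partial_y g z + b * partial_y h z" .
qed

lemma dir_iterate_linear:
  assumes S: "open S" and g: "smooth_on S g" and h: "smooth_on S h" and z: "z \<in> S"
  shows "(dir v ^^ n) (\<lambda>z. a * g z + b * h z) z = a * (dir v ^^ n) g z + b * (dir v ^^ n) h z"
  using z
proof (induction n arbitrary: z)
  case (Suc n)
  note sg = smooth_on_dir_iterate[OF S g, where v = v and n = n] and sh = smooth_on_dir_iterate[OF S h, where v = v and n = n]
  have comb: "smooth_on S (\<lambda>z. a * g z + b * h z)"
    by (intro smooth_on_add[OF S] smooth_on_mult[OF S] smooth_on_const[OF S] g h)
  note sc = smooth_on_dir_iterate[OF S comb, where v = v and n = n]
  have "(dir v ^^ Suc n) (\<lambda>z. a * g z + b * h z) z = dir v ((dir v ^^ n) (\<lambda>z. a * g z + b * h z)) z" by simp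
  also have "\<dots> = dir v (\<lambda>z. a * (dir v ^^ n) g z + b * (dir v ^^ n) h z) z"
    unfolding dir_def[of v "(dir v ^^ n) (\<lambda>z. a * g z + b * h z)"] dir_def[of v "\<lambda>z. a * (dir v ^^ n) g z + b * (dir v ^^ n) h z"]
    using partials_cong[OF S Suc.prems sc Suc.IH] by simp
  also have "\<dots> = a * (dir v ^^ Suc n) g z + b * (dir v ^^ Suc n) h z"
    unfolding dir_def[of v "\<lambda>z. a * (dir v ^^ n) g z + b * (dir v ^^ n) h z"] partials_linear[OF S sg sh Suc.prems]
    by (simp add: dir_def algebra_simps)
  finally show ?case .
qed simp

lemma dir_iterate_split:
  assumes S: "open S" and f: "smooth_on S f" and z: "z \<in> S"
  shows "(dir v ^^ Suc n) f z = fst v * (dir v ^^ n) (partial_x f) z + snd v * (dir v ^^ n) (partial_y f) z"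
proof -
  have "(dir v ^^ Suc n) f z = (dir v ^^ n) (\<lambda>z. fst v * partial_x f z + snd v * partial_y f z) z"
    by (simp only: funpow_Suc_right comp_apply dir_def[of v f, abs_def])
  then show ?thesis using dir_iterate_linear[OF S smooth_on_partial[OF f] z] by simp
qed

lemma dir_iterate_scale:
  assumes S: "open S" and f: "smooth_on S f" and z: "z \<in> S"
  shows "(dir (c * x, c * y) ^^ n) f z = c ^ n * (dir (x, y) ^^ n) f z"
  using f
proof (induction n arbitrary: f)
  case (Suc n)
  show ?case
    unfolding dir_iterate_split[OF S Suc.prems z] using Suc.IH[OF smooth_on_partial_x[OF Suc.prems]]
      Suc.IH[OF smooth_on_partial_y[OF Suc.prems]] by (simp add: algebra_simps)
qed simp

text \<open>
  Iterated derivatives in the direction \<open>(\<tau>, 1)\<close> depend continuously on the direction and the point,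
  and for \<open>\<tau> = 0\<close> they are the pure \<open>y\<close>-derivatives.
\<close>

lemma continuous_on_dir_iterate:
  assumes S: "open S" and f: "smooth_on S f"
  shows "continuous_on (UNIV \<times> S) (\<lambda>w. (dir (fst w, 1) ^^ n) f (snd w))"
  using f
proof (induction n arbitrary: f)
  case 0
  show ?case
    by (simp, rule continuous_on_compose2[OF smooth_on_continuous_on[OF 0] continuous_on_snd[OF continuous_on_id]]) auto
next
  case (Suc n)
  have "continuous_on (UNIV \<times> S) (\<lambda>w. fst w * (dir (fst w, 1) ^^ n) (partial_x f) (snd w) + 1 * (dir (fst w, 1) ^^ n) (partial_y f) (snd w))"
    by (intro continuous_on_add continuous_on_mult continuous_on_const continuous_on_fst continuous_on_id Suc.IH smooth_on_partial[OF Suc.prems])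
  then show ?case
    by (rule continuous_on_eq) (auto simp: dir_iterate_split[OF S Suc.prems] simp del: funpow.simps)
qed

lemma dir_0_1_iterate: "(dir (0, 1) ^^ n) f = (partial_y ^^ n) f"
proof -
  have "dir (0, 1) = partial_y" by (intro ext) (simp add: dir_def)
  then show ?thesis by simp
qed

lemma dir_iterate_near_origin:
  assumes S: "open S" "(0, 0) \<in> S" and f: "smooth_on S f" and e: "e > 0"
  shows "\<exists>\<rho>>0. \<forall>\<tau> x y. \<bar>\<tau>\<bar> < \<rho> \<longrightarrow> \<bar>x\<bar> < \<rho> \<longrightarrow> \<bar>y\<bar> < \<rho> \<longrightarrow>
    (x, y) \<in> S \<and> \<bar>(dir (\<tau>, 1) ^^ n) f (x, y) - (partial_y ^^ n) f (0, 0)\<bar> < e"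
proof -
  let ?K = "\<lambda>w. (dir (fst w, 1) ^^ n) f (snd w)" and ?o = "(0, 0, 0) :: real \<times> real \<times> real"
  have o: "open (UNIV \<times> S :: (real \<times> real \<times> real) set)" using S(1) by (simp add: open_Times)
  have mem: "?o \<in> UNIV \<times> S" using S(2) by simp
  have "isCont ?K ?o"
    using continuous_on_dir_iterate[OF S(1) f, of n] o mem by (simp add: continuous_on_eq_continuous_at)
  then have near: "\<forall>\<^sub>F w in nhds ?o. dist (?K w) (?K ?o) < e" using e by (rule isCont_eventually_near)
  have "\<forall>\<^sub>F w in nhds ?o. w \<in> UNIV \<times> S" by (rule eventually_nhds_in_open[OF o mem])
  from this near have "\<forall>\<^sub>F w in nhds ?o. w \<in> UNIV \<times> S \<and> dist (?K w) (?K ?o) < e" by (rule eventually_conj)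
  then obtain d where d: "d > 0" "\<And>w. dist w ?o < d \<Longrightarrow> w \<in> UNIV \<times> S \<and> dist (?K w) (?K ?o) < e"
    unfolding eventually_nhds_metric by blast
  have "(x, y) \<in> S \<and> \<bar>(dir (\<tau>, 1) ^^ n) f (x, y) - (partial_y ^^ n) f (0, 0)\<bar> < e"
    if "\<bar>\<tau>\<bar> < d / 3" "\<bar>x\<bar> < d / 3" "\<bar>y\<bar> < d / 3" for \<tau> x y
  proof -
    have "dist (\<tau>, x, y) ?o \<le> \<bar>\<tau>\<bar> + dist (x, y) (0, 0)"
      unfolding dist_Pair_Pair[of \<tau>] by (rule order_trans[OF sqrt_sum_squares_le_sum_abs]) simp
    also have "dist (x, y) (0, 0) \<le> \<bar>x\<bar> + \<bar>y\<bar>"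
      unfolding dist_Pair_Pair by (rule order_trans[OF sqrt_sum_squares_le_sum_abs]) simp
    finally have "dist (\<tau>, x, y) ?o < d" using that by linarith
    from d(2)[OF this] show ?thesis by (simp add: dist_real_def dir_0_1_iterate)
  qed
  then show ?thesis using d(1) by (intro exI[of _ "d / 3"]) auto
qed

section \<open>Taylor expansion of symmetric second differences\<close>

lemma symmetric_difference_chain:
  fixes \<psi> :: "nat \<Rightarrow> real \<Rightarrow> real"
  assumes d: "\<And>n t. \<bar>t\<bar> \<le> h \<Longrightarrow> (\<psi> n has_real_derivative \<psi> (Suc n) t) (at t)"
  defines "\<phi> \<equiv> \<lambda>n t. \<psi> n t + (- 1) ^ n * \<psi> n (- t) - (if n = 0 then 2 * \<psi> 0 0 else 0)"
  assumes t: "\<bar>t\<bar> \<le> h"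
  shows "(\<phi> n has_real_derivative \<phi> (Suc n) t) (at t)"
proof -
  have "((\<lambda>t. \<psi> n (- t)) has_real_derivative (- 1) * \<psi> (Suc n) (- t)) (at t)"
    by (rule DERIV_cong[OF DERIV_chain'[where f = uminus, OF DERIV_minus[OF DERIV_ident] d]]) (use t in auto)
  from DERIV_add[OF d[OF t] DERIV_cmult[OF this, of "(- 1) ^ n"], of n]
  have "((\<lambda>t. \<psi> n t + (- 1) ^ n * \<psi> n (- t)) has_real_derivative \<psi> (Suc n) t + (- 1) ^ n * ((- 1) * \<psi> (Suc n) (- t))) (at t)" .
  from DERIV_diff[OF this DERIV_const]
  show ?thesis unfolding \<phi>_def by (rule DERIV_cong) simp
qed

lemma symmetric_difference_taylor_2:
  fixes \<psi> :: "nat \<Rightarrow> real \<Rightarrow> real"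
  assumes d: "\<And>n t. \<bar>t\<bar> \<le> \<bar>s\<bar> \<Longrightarrow> (\<psi> n has_real_derivative \<psi> (Suc n) t) (at t)"
  shows "\<exists>t. \<bar>t\<bar> \<le> \<bar>s\<bar> \<and> \<psi> 0 s + \<psi> 0 (- s) - 2 * \<psi> 0 0 = (\<psi> 2 t + \<psi> 2 (- t)) / 2 * s\<^sup>2"
proof -
  define \<phi> where "\<phi> = (\<lambda>n t. \<psi> n t + (- 1) ^ n * \<psi> n (- t) - (if n = 0 then 2 * \<psi> 0 0 else 0))"
  have "\<forall>m t. m < 2 \<and> \<bar>t\<bar> \<le> \<bar>s\<bar> \<longrightarrow> (\<phi> m has_real_derivative \<phi> (Suc m) t) (at t)"
    unfolding \<phi>_def by (intro allI impI symmetric_difference_chain[where \<psi> = \<psi> and h = "\<bar>s\<bar>", OF d]) auto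
  from Maclaurin_bi_le[OF refl this] obtain t where t: "\<bar>t\<bar> \<le> \<bar>s\<bar>"
    "\<phi> 0 s = (\<Sum>m<2. \<phi> m 0 / fact m * s ^ m) + \<phi> 2 t / fact 2 * s ^ 2" by (elim exE conjE)
  have "(\<Sum>m<2. \<phi> m 0 / fact m * s ^ m) = 0" by (simp add: numeral_2_eq_2 \<phi>_def)
  then show ?thesis using t by (intro exI[of _ t]) (simp add: \<phi>_def)
qed

lemma symmetric_difference_limit:
  fixes \<psi> :: "nat \<Rightarrow> real \<Rightarrow> real"
  assumes h: "h > 0" and d: "\<And>n t. \<bar>t\<bar> \<le> h \<Longrightarrow> (\<psi> n has_real_derivative \<psi> (Suc n) t) (at t)"
  shows "((\<lambda>s. (\<psi> 0 s + \<psi> 0 (- s) - 2 * \<psi> 0 0) / s\<^sup>2) \<longlongrightarrow> \<psi> 2 0) (at 0)"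
proof -
  define \<phi> where "\<phi> = (\<lambda>n t. \<psi> n t + (- 1) ^ n * \<psi> n (- t) - (if n = 0 then 2 * \<psi> 0 0 else 0))"
  have d\<phi>: "(\<phi> n has_real_derivative \<phi> (Suc n) t) (at t)" if "\<bar>t\<bar> \<le> h" for n t
    unfolding \<phi>_def by (rule symmetric_difference_chain[where \<psi> = \<psi>, OF d that])
  have "\<exists>B\<ge>0. \<forall>t. \<bar>t\<bar> \<le> h \<longrightarrow> \<bar>\<phi> 3 t\<bar> \<le> B" by (rule bounded_on_segment[OF DERIV_isCont[OF d\<phi>]])
  then obtain B where B: "\<And>t. \<bar>t\<bar> \<le> h \<Longrightarrow> \<bar>\<phi> 3 t\<bar> \<le> B" by blast
  have bound: "norm (\<phi> 0 s / s\<^sup>2 - \<psi> 2 0) \<le> B * \<bar>s\<bar>" if s: "s \<noteq> 0" "\<bar>s\<bar> \<le> h" for s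
  proof -
    have "\<forall>m t. m < 3 \<and> \<bar>t\<bar> \<le> \<bar>s\<bar> \<longrightarrow> (\<phi> m has_real_derivative \<phi> (Suc m) t) (at t)"
      using d\<phi> s(2) by (intro allI impI) auto
    from Maclaurin_bi_le[OF refl this] obtain t where t: "\<bar>t\<bar> \<le> \<bar>s\<bar>"
      "\<phi> 0 s = (\<Sum>m<3. \<phi> m 0 / fact m * s ^ m) + \<phi> 3 t / fact 3 * s ^ 3" by (elim exE conjE)
    have "(\<Sum>m<3. \<phi> m 0 / fact m * s ^ m) = \<psi> 2 0 * s\<^sup>2" by (simp add: eval_nat_numeral \<phi>_def)
    then have "\<phi> 0 s / s\<^sup>2 - \<psi> 2 0 = \<phi> 3 t / 6 * s"
      using t(2) s(1) by (simp add: field_simps eval_nat_numeral)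
    moreover have "\<bar>\<phi> 3 t / 6 * s\<bar> \<le> B * \<bar>s\<bar>"
      unfolding abs_mult using B[of t] t(1) s(2) by (intro mult_right_mono) auto
    ultimately show ?thesis by (simp only: real_norm_def)
  qed
  have "((\<lambda>s. \<phi> 0 s / s\<^sup>2 - \<psi> 2 0) \<longlongrightarrow> 0) (at 0)"
  proof (rule Lim_null_comparison)
    show "\<forall>\<^sub>F s in at 0. norm (\<phi> 0 s / s\<^sup>2 - \<psi> 2 0) \<le> B * \<bar>s\<bar>"
      unfolding eventually_at using h bound by (intro exI[of _ h]) (auto simp: dist_real_def)
    have "((\<lambda>s. B * \<bar>s\<bar>) \<longlongrightarrow> B * \<bar>0\<bar>) (at (0::real))" by (intro tendsto_mult tendsto_const tendsto_rabs tendsto_ident_at)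
    then show "((\<lambda>s. B * \<bar>s\<bar>) \<longlongrightarrow> 0) (at (0::real))" by simp
  qed
  then have "((\<lambda>s. \<phi> 0 s / s\<^sup>2) \<longlongrightarrow> \<psi> 2 0) (at 0)" by (rule LIM_zero_cancel)
  then show ?thesis by (simp add: \<phi>_def)
qed

text \<open>
  The quadratic part is removed from the symmetric difference \<open>\<phi>\<close> by forming \<open>\<phi>'(1) - 2 \<phi>(1)\<close>, so that
  only fourth derivatives remain.
\<close>

lemma symmetric_difference_taylor_4:
  fixes \<psi> :: "nat \<Rightarrow> real \<Rightarrow> real"
  assumes d: "\<And>n t. \<bar>t\<bar> \<le> 1 \<Longrightarrow> (\<psi> n has_real_derivative \<psi> (Suc n) t) (at t)"
  shows "\<exists>t t'. \<bar>t\<bar> \<le> 1 \<and> \<bar>t'\<bar> \<le> 1 \<and> (\<psi> 1 1 - \<psi> 1 (- 1)) - 2 * (\<psi> 0 1 + \<psi> 0 (- 1) - 2 * \<psi> 0 0)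
    = (\<psi> 4 t + \<psi> 4 (- t)) / 6 - (\<psi> 4 t' + \<psi> 4 (- t')) / 12"
proof -
  define \<phi> where "\<phi> = (\<lambda>n t. \<psi> n t + (- 1) ^ n * \<psi> n (- t) - (if n = 0 then 2 * \<psi> 0 0 else 0))"
  have d\<phi>: "(\<phi> n has_real_derivative \<phi> (Suc n) t) (at t)" if "\<bar>t\<bar> \<le> 1" for n t
    unfolding \<phi>_def by (rule symmetric_difference_chain[where \<psi> = \<psi>, OF d that])
  have "\<forall>m t. m < 4 \<and> \<bar>t\<bar> \<le> \<bar>1\<bar> \<longrightarrow> (\<phi> m has_real_derivative \<phi> (Suc m) t) (at t)"
    using d\<phi> by (intro allI impI) auto
  from Maclaurin_bi_le[OF refl this] obtain t' where t': "\<bar>t'\<bar> \<le> 1"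
    "\<phi> 0 1 = (\<Sum>m<4. \<phi> m 0 / fact m * 1 ^ m) + \<phi> 4 t' / fact 4 * 1 ^ 4" by auto
  have "\<forall>m t. m < 3 \<and> \<bar>t\<bar> \<le> \<bar>1\<bar> \<longrightarrow> (\<phi> (Suc m) has_real_derivative \<phi> (Suc (Suc m)) t) (at t)"
    using d\<phi> by (intro allI impI) auto
  from Maclaurin_bi_le[where diff = "\<lambda>m. \<phi> (Suc m)", OF refl this] obtain t where t: "\<bar>t\<bar> \<le> 1"
    "\<phi> 1 1 = (\<Sum>m<3. \<phi> (Suc m) 0 / fact m * 1 ^ m) + \<phi> 4 t / fact 3 * 1 ^ 3" by (auto simp: eval_nat_numeral)
  have "(\<Sum>m<4. \<phi> m 0 / fact m * 1 ^ m) = \<psi> 2 0" "(\<Sum>m<3. \<phi> (Suc m) 0 / fact m * 1 ^ m) = 2 * \<psi> 2 0"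
    by (simp_all add: eval_nat_numeral \<phi>_def)
  then have "\<phi> 1 1 - 2 * \<phi> 0 1 = \<phi> 4 t / 6 - \<phi> 4 t' / 12"
    using t(2) t'(2) by (simp add: fact_numeral)
  then show ?thesis using t(1) t'(1) by (intro exI[of _ t] exI[of _ t']) (simp add: \<phi>_def)
qed

section \<open>Zeros of contact maps away from the origin\<close>

lemma symmetric_point_in_box:
  fixes p x t r :: real
  assumes "\<bar>p\<bar> < r" "\<bar>x\<bar> < r" "\<bar>t\<bar> \<le> 1" shows "\<bar>p + t * x\<bar> < 2 * r"
proof -
  have "\<bar>t * x\<bar> \<le> 1 * \<bar>x\<bar>" unfolding abs_mult using assms(3) by (intro mult_right_mono) auto
  then show ?thesis using assms by linarith
qed

text \<open>
  The second difference equals, up to a factor, a sum of values of the Hessian form of \<open>g\<close> at intermediate points.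
  Near the origin this form is close to a nonzero multiple of \<open>x\<^sup>2\<close>, so it vanishes only for vectors that are close to
  the \<open>y\<close>-axis.
\<close>

lemma contact_map_zero_direction:
  assumes W: "open W" "(0, 0) \<in> W" and g: "smooth_on W g"
    and gxx: "partial_x (partial_x g) (0, 0) \<noteq> 0" and gxy: "partial_x (partial_y g) (0, 0) = 0"
    and gyy: "partial_y (partial_y g) (0, 0) = 0" and e: "e > 0"
  shows "\<exists>r>0. \<forall>p q x y. \<bar>p\<bar> < r \<longrightarrow> \<bar>q\<bar> < r \<longrightarrow> \<bar>x\<bar> < r \<longrightarrow> \<bar>y\<bar> < r \<longrightarrow> (x, y) \<noteq> 0 \<longrightarrow>
    g (p + x, q + y) + g (p - x, q - y) - 2 * g (p, q) = 0 \<longrightarrow> \<bar>x\<bar> < e * \<bar>y\<bar>"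
proof -
  define \<beta> where "\<beta> = partial_x (partial_x g) (0, 0)"
  have \<beta>: "\<bar>\<beta>\<bar> > 0" using gxx by (simp add: \<beta>_def)
  define m where "m = min e 1"
  have m: "m > 0" "m \<le> 1" "m \<le> e" using e by (auto simp: m_def)
  define \<eta> where "\<eta> = \<bar>\<beta>\<bar> * m\<^sup>2 / 8"
  have \<eta>: "\<eta> > 0" using \<beta> m by (simp add: \<eta>_def)
  have gyx: "partial_y (partial_x g) (0, 0) = 0" using partial_x_partial_y_commute[OF W(1) g W(2)] gxy by simp
  note sx = smooth_on_partial_x[OF g] and sy = smooth_on_partial_y[OF g]
  have b2: "\<bar>\<beta>\<bar> / 2 > 0" using \<beta> by simp
  obtain r1 where r1: "r1 > 0" "\<And>x y. \<bar>x\<bar> < r1 \<Longrightarrow> \<bar>y\<bar> < r1 \<Longrightarrow> (x, y) \<in> W \<and> \<bar>partial_x (partial_x g) (x, y) - \<beta>\<bar> < \<bar>\<beta>\<bar> / 2"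
    using dir_iterate_near_origin[OF W smooth_on_partial_x[OF sx] b2, of 0] unfolding \<beta>_def funpow_0 by (metis abs_zero)
  obtain r2 where r2: "r2 > 0" "\<And>x y. \<bar>x\<bar> < r2 \<Longrightarrow> \<bar>y\<bar> < r2 \<Longrightarrow> \<bar>partial_x (partial_y g) (x, y)\<bar> < \<eta>"
    using dir_iterate_near_origin[OF W smooth_on_partial_x[OF sy] \<eta>, of 0] unfolding gxy funpow_0 diff_zero by (metis abs_zero)
  obtain r3 where r3: "r3 > 0" "\<And>x y. \<bar>x\<bar> < r3 \<Longrightarrow> \<bar>y\<bar> < r3 \<Longrightarrow> \<bar>partial_y (partial_x g) (x, y)\<bar> < \<eta>"
    using dir_iterate_near_origin[OF W smooth_on_partial_y[OF sx] \<eta>, of 0] unfolding gyx funpow_0 diff_zero by (metis abs_zero)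
  obtain r4 where r4: "r4 > 0" "\<And>x y. \<bar>x\<bar> < r4 \<Longrightarrow> \<bar>y\<bar> < r4 \<Longrightarrow> \<bar>partial_y (partial_y g) (x, y)\<bar> < \<eta>"
    using dir_iterate_near_origin[OF W smooth_on_partial_y[OF sy] \<eta>, of 0] unfolding gyy funpow_0 diff_zero by (metis abs_zero)
  define r where "r = min (min r1 r2) (min r3 r4) / 2"
  have r: "r > 0" "2 * r \<le> r1" "2 * r \<le> r2" "2 * r \<le> r3" "2 * r \<le> r4"
    using r1(1) r2(1) r3(1) r4(1) by (auto simp: r_def)
  have "\<bar>x\<bar> < e * \<bar>y\<bar>"
    if b: "\<bar>p\<bar> < r" "\<bar>q\<bar> < r" "\<bar>x\<bar> < r" "\<bar>y\<bar> < r" and nz: "(x, y) \<noteq> 0"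
      and zero: "g (p + x, q + y) + g (p - x, q - y) - 2 * g (p, q) = 0" for p q x y
  proof (rule ccontr)
    assume "\<not> \<bar>x\<bar> < e * \<bar>y\<bar>"
    then have xy: "e * \<bar>y\<bar> \<le> \<bar>x\<bar>" by simp
    have box: "\<bar>p + t * x\<bar> < 2 * r" "\<bar>q + t * y\<bar> < 2 * r" if "\<bar>t\<bar> \<le> 1" for t
      using symmetric_point_in_box b that by blast+
    have inW: "(p + t * x, q + t * y) \<in> W" if "\<bar>t\<bar> \<le> 1" for t
      using r1(2) box[OF that] r(2) by (meson less_le_trans)
    define \<psi> where "\<psi> n t = (dir (x, y) ^^ n) g (p + t * x, q + t * y)" for n t
    have d: "(\<psi> n has_real_derivative \<psi> (Suc n) t) (at t)" if "\<bar>t\<bar> \<le> \<bar>1\<bar>" for n t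
      unfolding \<psi>_def by (rule DERIV_dir_iterate[OF W(1) g inW]) (use that in simp)
    obtain t where t: "\<bar>t\<bar> \<le> 1" "\<psi> 0 1 + \<psi> 0 (- 1) - 2 * \<psi> 0 0 = (\<psi> 2 t + \<psi> 2 (- t)) / 2"
      using symmetric_difference_taylor_2[where \<psi> = \<psi> and s = 1, OF d] by auto
    have "\<psi> 2 t + \<psi> 2 (- t) = 0" using t(2) zero by (simp add: \<psi>_def)
    moreover have \<psi>2: "\<psi> 2 t = x * (x * partial_x (partial_x g) (p + t * x, q + t * y) + y * partial_y (partial_x g) (p + t * x, q + t * y))
      + y * (x * partial_x (partial_y g) (p + t * x, q + t * y) + y * partial_y (partial_y g) (p + t * x, q + t * y))"
      if "\<bar>t\<bar> \<le> 1" for t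
      using dir_iterate_split[OF W(1) g inW[OF that], where v = "(x, y)" and n = 1] by (simp add: \<psi>_def numeral_2_eq_2 dir_def)
    have \<psi>2': "\<bar>\<psi> 2 t - x\<^sup>2 * \<beta>\<bar> < x\<^sup>2 * (\<bar>\<beta>\<bar>)" if t: "\<bar>t\<bar> \<le> 1" for t
    proof -
      let ?z = "(p + t * x, q + t * y)"
      have G: "\<bar>partial_x (partial_x g) ?z - \<beta>\<bar> \<le> \<bar>\<beta>\<bar> / 2" "\<bar>partial_x (partial_y g) ?z\<bar> \<le> \<eta>"
        "\<bar>partial_y (partial_x g) ?z\<bar> \<le> \<eta>" "\<bar>partial_y (partial_y g) ?z\<bar> \<le> \<eta>"
        using r1(2)[of "p + t * x" "q + t * y"] r2(2)[of "p + t * x" "q + t * y"] r3(2)[of "p + t * x" "q + t * y"]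
          r4(2)[of "p + t * x" "q + t * y"] box[OF t] r by auto
      have my: "m * \<bar>y\<bar> \<le> \<bar>x\<bar>" using mult_right_mono[OF m(3), of "\<bar>y\<bar>"] xy by simp
      have x0: "\<bar>x\<bar> > 0" using nz my m(1) by (auto simp: zero_prod_def mult_le_0_iff)
      have xx: "\<bar>x\<bar> * \<bar>x\<bar> = x\<^sup>2" by (simp add: power2_eq_square)
      have A: "\<bar>x * x * (partial_x (partial_x g) ?z - \<beta>)\<bar> \<le> x\<^sup>2 * (\<bar>\<beta>\<bar> / 2)"
        unfolding abs_mult xx using G(1) by (intro mult_left_mono) auto
      have mm: "m * (m * \<bar>y\<bar>) \<le> m * \<bar>x\<bar>" using my m(1) by (intro mult_left_mono) auto
      have "m * \<bar>x\<bar> \<le> 1 * \<bar>x\<bar>" using m(2) by (intro mult_right_mono) auto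
      then have mmy: "m * m * \<bar>y\<bar> \<le> \<bar>x\<bar>" using mm by (simp add: mult.assoc)
      have "\<bar>x\<bar> * \<bar>y\<bar> * \<eta> = \<bar>x\<bar> * (m * m * \<bar>y\<bar>) * (\<bar>\<beta>\<bar> / 8)" by (simp add: \<eta>_def power2_eq_square)
      also have "\<dots> \<le> \<bar>x\<bar> * \<bar>x\<bar> * (\<bar>\<beta>\<bar> / 8)" using mmy by (intro mult_right_mono mult_left_mono) auto
      finally have xy\<eta>: "\<bar>x\<bar> * \<bar>y\<bar> * \<eta> \<le> x\<^sup>2 * (\<bar>\<beta>\<bar> / 8)" unfolding xx .
      have "\<bar>y\<bar> * \<bar>y\<bar> * \<eta> = (m * \<bar>y\<bar>) * (m * \<bar>y\<bar>) * (\<bar>\<beta>\<bar> / 8)" by (simp add: \<eta>_def power2_eq_square)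
      also have "\<dots> \<le> \<bar>x\<bar> * \<bar>x\<bar> * (\<bar>\<beta>\<bar> / 8)" using my m(1) by (intro mult_right_mono mult_mono) auto
      finally have yy\<eta>: "\<bar>y\<bar> * \<bar>y\<bar> * \<eta> \<le> x\<^sup>2 * (\<bar>\<beta>\<bar> / 8)" unfolding xx .
      have B: "\<bar>x * y * partial_y (partial_x g) ?z\<bar> \<le> x\<^sup>2 * (\<bar>\<beta>\<bar> / 8)"
        unfolding abs_mult by (rule order_trans[OF mult_left_mono[OF G(3)] xy\<eta>]) simp
      have C: "\<bar>x * y * partial_x (partial_y g) ?z\<bar> \<le> x\<^sup>2 * (\<bar>\<beta>\<bar> / 8)"
        unfolding abs_mult by (rule order_trans[OF mult_left_mono[OF G(2)] xy\<eta>]) simp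
      have D: "\<bar>y * y * partial_y (partial_y g) ?z\<bar> \<le> x\<^sup>2 * (\<bar>\<beta>\<bar> / 8)"
        unfolding abs_mult by (rule order_trans[OF mult_left_mono[OF G(4)] yy\<eta>]) simp
      have "\<psi> 2 t - x\<^sup>2 * \<beta> = x * x * (partial_x (partial_x g) ?z - \<beta>) + x * y * partial_y (partial_x g) ?z
          + x * y * partial_x (partial_y g) ?z + y * y * partial_y (partial_y g) ?z"
        unfolding \<psi>2[OF t] by algebra
      then have "\<bar>\<psi> 2 t - x\<^sup>2 * \<beta>\<bar> \<le> x\<^sup>2 * (\<bar>\<beta>\<bar> / 2) + x\<^sup>2 * (\<bar>\<beta>\<bar> / 8) + x\<^sup>2 * (\<bar>\<beta>\<bar> / 8) + x\<^sup>2 * (\<bar>\<beta>\<bar> / 8)"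
        using A B C D by linarith
      also have "\<dots> = x\<^sup>2 * \<bar>\<beta>\<bar> * (7 / 8)" by (simp add: algebra_simps)
      also have "\<dots> < x\<^sup>2 * \<bar>\<beta>\<bar>" using x0 \<beta> by simp
      finally show ?thesis .
    qed
    ultimately have "\<bar>2 * (x\<^sup>2 * \<beta>)\<bar> < 2 * (x\<^sup>2 * \<bar>\<beta>\<bar>)"
      using \<psi>2'[of t] \<psi>2'[of "- t"] t(1) by linarith
    then show False by (simp add: abs_mult)
  qed
  then show ?thesis using r(1) by blast
qed

text \<open>
  Let \<open>A\<close> and \<open>B\<close> be the components of the contact map, and let \<open>E\<close> be the Euler derivative minus twice the function. At a
  common zero of \<open>A\<close> and \<open>B\<close> the Jacobian determinant times \<open>y\<close> equals \<open>A\<^sub>x E\<^sub>B - B\<^sub>x E\<^sub>A\<close>. The quadratic parts drop out of \<open>E\<close>, and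
  zeros are close to the \<open>y\<close>-axis. So \<open>A\<^sub>x\<close> is comparable to \<open>y\<close> and \<open>E\<^sub>B\<close> to \<open>y ^ 4\<close>, whereas \<open>B\<^sub>x\<close> is small compared with \<open>y\<close>
  and \<open>E\<^sub>A\<close> is bounded by a multiple of \<open>y ^ 4\<close>.
\<close>

lemma contact_map_zeros_transverse:
  assumes W: "open W" "(0, 0) \<in> W" and f: "smooth_on W f" and g: "smooth_on W g"
    and fxy: "partial_x (partial_y f) (0, 0) \<noteq> 0"
    and gxx: "partial_x (partial_x g) (0, 0) \<noteq> 0" and gxy: "partial_x (partial_y g) (0, 0) = 0"
    and gyy: "partial_y (partial_y g) (0, 0) = 0" and g4: "(partial_y ^^ 4) g (0, 0) \<noteq> 0"
  shows "\<exists>r>0. \<forall>p q x y. \<bar>p\<bar> < r \<longrightarrow> \<bar>q\<bar> < r \<longrightarrow> \<bar>x\<bar> < r \<longrightarrow> \<bar>y\<bar> < r \<longrightarrow> (x, y) \<noteq> 0 \<longrightarrow>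
    contact_map f g (p, q) (x, y) = 0 \<longrightarrow>
    (partial_x f (p + x, q + y) - partial_x f (p - x, q - y)) * (partial_y g (p + x, q + y) - partial_y g (p - x, q - y)) \<noteq>
    (partial_y f (p + x, q + y) - partial_y f (p - x, q - y)) * (partial_x g (p + x, q + y) - partial_x g (p - x, q - y))"
proof -
  define \<mu> where "\<mu> = partial_y (partial_x f) (0, 0)"
  define \<kappa> where "\<kappa> = (partial_y ^^ 4) g (0, 0)"
  define M where "M = \<bar>(partial_y ^^ 4) f (0, 0)\<bar> + 1"
  have \<mu>: "\<bar>\<mu>\<bar> > 0" using partial_x_partial_y_commute[OF W(1) f W(2)] fxy by (simp add: \<mu>_def)
  have \<kappa>: "\<bar>\<kappa>\<bar> > 0" using g4 by (simp add: \<kappa>_def)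
  have M: "M > 0" by (simp add: M_def)
  define \<eta> where "\<eta> = \<bar>\<mu>\<bar> * \<bar>\<kappa>\<bar> / (24 * M)"
  have \<eta>: "\<eta> > 0" using \<mu> \<kappa> M by (simp add: \<eta>_def)
  have gyx: "partial_y (partial_x g) (0, 0) = 0" using partial_x_partial_y_commute[OF W(1) g W(2)] gxy by simp
  have pos: "\<bar>\<kappa>\<bar> / 6 > 0" "\<bar>\<mu>\<bar> / 2 > 0" using \<mu> \<kappa> by simp_all
  obtain r1 where r1: "r1 > 0" "\<And>\<tau> x y. \<bar>\<tau>\<bar> < r1 \<Longrightarrow> \<bar>x\<bar> < r1 \<Longrightarrow> \<bar>y\<bar> < r1 \<Longrightarrow>
      (x, y) \<in> W \<and> \<bar>(dir (\<tau>, 1) ^^ 4) f (x, y) - (partial_y ^^ 4) f (0, 0)\<bar> < 1"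
    using dir_iterate_near_origin[OF W f zero_less_one, of 4] by blast
  obtain r2 where r2: "r2 > 0" "\<And>\<tau> x y. \<bar>\<tau>\<bar> < r2 \<Longrightarrow> \<bar>x\<bar> < r2 \<Longrightarrow> \<bar>y\<bar> < r2 \<Longrightarrow>
      (x, y) \<in> W \<and> \<bar>(dir (\<tau>, 1) ^^ 4) g (x, y) - \<kappa>\<bar> < \<bar>\<kappa>\<bar> / 6"
    using dir_iterate_near_origin[OF W g pos(1), of 4] unfolding \<kappa>_def by blast
  obtain r3 where r3: "r3 > 0" "\<And>\<tau> x y. \<bar>\<tau>\<bar> < r3 \<Longrightarrow> \<bar>x\<bar> < r3 \<Longrightarrow> \<bar>y\<bar> < r3 \<Longrightarrow>
      (x, y) \<in> W \<and> \<bar>(dir (\<tau>, 1) ^^ 1) (partial_x f) (x, y) - (partial_y ^^ 1) (partial_x f) (0, 0)\<bar> < \<bar>\<mu>\<bar> / 2"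
    using dir_iterate_near_origin[OF W smooth_on_partial_x[OF f] pos(2), of 1] by blast
  obtain r4 where r4: "r4 > 0" "\<And>\<tau> x y. \<bar>\<tau>\<bar> < r4 \<Longrightarrow> \<bar>x\<bar> < r4 \<Longrightarrow> \<bar>y\<bar> < r4 \<Longrightarrow>
      (x, y) \<in> W \<and> \<bar>(dir (\<tau>, 1) ^^ 1) (partial_x g) (x, y) - (partial_y ^^ 1) (partial_x g) (0, 0)\<bar> < \<eta>"
    using dir_iterate_near_origin[OF W smooth_on_partial_x[OF g] \<eta>, of 1] by blast
  define e where "e = min (min r1 r2) (min r3 r4)"
  have e: "e > 0" "e \<le> r1" "e \<le> r2" "e \<le> r3" "e \<le> r4" using r1(1) r2(1) r3(1) r4(1) by (auto simp: e_def)
  obtain r0 where r0: "r0 > 0" "\<And>p q x y. \<bar>p\<bar> < r0 \<Longrightarrow> \<bar>q\<bar> < r0 \<Longrightarrow> \<bar>x\<bar> < r0 \<Longrightarrow> \<bar>y\<bar> < r0 \<Longrightarrow> (x, y) \<noteq> 0 \<Longrightarrow>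
    g (p + x, q + y) + g (p - x, q - y) - 2 * g (p, q) = 0 \<Longrightarrow> \<bar>x\<bar> < e * \<bar>y\<bar>"
    using contact_map_zero_direction[OF W g gxx gxy gyy e(1)] by blast
  define r where "r = min r0 (e / 2)"
  have r: "r > 0" "r \<le> r0" "2 * r \<le> e" using r0(1) e(1) by (auto simp: r_def)
  have "(partial_x f (p + x, q + y) - partial_x f (p - x, q - y)) * (partial_y g (p + x, q + y) - partial_y g (p - x, q - y)) \<noteq>
    (partial_y f (p + x, q + y) - partial_y f (p - x, q - y)) * (partial_x g (p + x, q + y) - partial_x g (p - x, q - y))"
    if b: "\<bar>p\<bar> < r" "\<bar>q\<bar> < r" "\<bar>x\<bar> < r" "\<bar>y\<bar> < r" and nz: "(x, y) \<noteq> 0"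
      and zero: "contact_map f g (p, q) (x, y) = 0" for p q x y
  proof
    let ?Ax = "partial_x f (p + x, q + y) - partial_x f (p - x, q - y)" and ?Ay = "partial_y f (p + x, q + y) - partial_y f (p - x, q - y)"
      and ?Bx = "partial_x g (p + x, q + y) - partial_x g (p - x, q - y)" and ?By = "partial_y g (p + x, q + y) - partial_y g (p - x, q - y)"
    assume det: "?Ax * ?By = ?Ay * ?Bx"
    have zf: "f (p + x, q + y) + f (p - x, q - y) - 2 * f (p, q) = 0" and zg: "g (p + x, q + y) + g (p - x, q - y) - 2 * g (p, q) = 0"
      using zero by (simp_all add: contact_map_def zero_prod_def)
    have xy: "\<bar>x\<bar> < e * \<bar>y\<bar>" using r0(2)[OF _ _ _ _ nz zg] b r(2) by simp
    then have y: "y \<noteq> 0" by auto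
    define \<tau> where "\<tau> = x / y"
    have \<tau>: "\<bar>\<tau>\<bar> < e" "x = y * \<tau>" using xy y by (simp_all add: \<tau>_def divide_less_eq)
    have box: "\<bar>p + t * x\<bar> < e" "\<bar>q + t * y\<bar> < e" if "\<bar>t\<bar> \<le> 1" for t
      using symmetric_point_in_box[OF b(1,3) that] symmetric_point_in_box[OF b(2,4) that] r(3) by auto
    have inW: "(p + t * x, q + t * y) \<in> W" if "\<bar>t\<bar> \<le> 1" for t
      using r1(2)[of \<tau> "p + t * x" "q + t * y"] box[OF that] \<tau>(1) e(2) by simp
    have scale: "(dir (x, y) ^^ n) h z = y ^ n * (dir (\<tau>, 1) ^^ n) h z" if "smooth_on W h" "z \<in> W" for h n z
      using dir_iterate_scale[OF W(1) that, where c = y and x = \<tau> and y = 1 and n = n] \<tau>(2) by simp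
    have mvt: "\<exists>t. \<bar>t\<bar> \<le> 1 \<and> h (p + x, q + y) - h (p - x, q - y) = 2 * (y * (dir (\<tau>, 1) ^^ 1) h (p + t * x, q + t * y))"
      if h: "smooth_on W h" for h
    proof -
      have "\<exists>t. - 1 < t \<and> t < 1 \<and> h (p + 1 * x, q + 1 * y) - h (p + (- 1) * x, q + (- 1) * y) = (1 - (- 1)) * dir (x, y) h (p + t * x, q + t * y)"
        by (rule MVT2) (auto intro!: DERIV_dir[OF h inW])
      then obtain t where t: "- 1 < t" "t < 1" "h (p + x, q + y) - h (p - x, q - y) = 2 * dir (x, y) h (p + t * x, q + t * y)"
        by auto
      have t1: "\<bar>t\<bar> \<le> 1" using t by simp
      then show ?thesis using t(3) scale[OF h inW[OF t1], of 1] by (intro exI[of _ t]) simp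
    qed
    have euler: "\<exists>t t'. \<bar>t\<bar> \<le> 1 \<and> \<bar>t'\<bar> \<le> 1 \<and>
       x * (partial_x h (p + x, q + y) - partial_x h (p - x, q - y)) + y * (partial_y h (p + x, q + y) - partial_y h (p - x, q - y))
       = y ^ 4 * (((dir (\<tau>, 1) ^^ 4) h (p + t * x, q + t * y) + (dir (\<tau>, 1) ^^ 4) h (p + (- t) * x, q + (- t) * y)) / 6
          - ((dir (\<tau>, 1) ^^ 4) h (p + t' * x, q + t' * y) + (dir (\<tau>, 1) ^^ 4) h (p + (- t') * x, q + (- t') * y)) / 12)"
      if h: "smooth_on W h" and z: "h (p + x, q + y) + h (p - x, q - y) - 2 * h (p, q) = 0" for h
    proof -
      define \<psi> where "\<psi> n t = (dir (x, y) ^^ n) h (p + t * x, q + t * y)" for n t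
      have d: "(\<psi> n has_real_derivative \<psi> (Suc n) t) (at t)" if "\<bar>t\<bar> \<le> 1" for n t
        unfolding \<psi>_def by (rule DERIV_dir_iterate[OF W(1) h inW[OF that]])
      obtain t t' where t: "\<bar>t\<bar> \<le> 1" "\<bar>t'\<bar> \<le> 1"
        "(\<psi> 1 1 - \<psi> 1 (- 1)) - 2 * (\<psi> 0 1 + \<psi> 0 (- 1) - 2 * \<psi> 0 0) = (\<psi> 4 t + \<psi> 4 (- t)) / 6 - (\<psi> 4 t' + \<psi> 4 (- t')) / 12"
        using symmetric_difference_taylor_4[where \<psi> = \<psi>, OF d] by blast
      have \<psi>4: "\<psi> 4 s = y ^ 4 * (dir (\<tau>, 1) ^^ 4) h (p + s * x, q + s * y)" if "\<bar>s\<bar> \<le> 1" for s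
        unfolding \<psi>_def by (rule scale[OF h inW[OF that]])
      have "\<psi> 0 1 + \<psi> 0 (- 1) - 2 * \<psi> 0 0 = 0" using z by (simp add: \<psi>_def)
      moreover have "\<psi> 1 1 - \<psi> 1 (- 1) = x * (partial_x h (p + x, q + y) - partial_x h (p - x, q - y)) + y * (partial_y h (p + x, q + y) - partial_y h (p - x, q - y))"
        by (simp add: \<psi>_def dir_def algebra_simps)
      ultimately have "x * (partial_x h (p + x, q + y) - partial_x h (p - x, q - y)) + y * (partial_y h (p + x, q + y) - partial_y h (p - x, q - y))
         = (\<psi> 4 t + \<psi> 4 (- t)) / 6 - (\<psi> 4 t' + \<psi> 4 (- t')) / 12" using t(3) by simp
      also have "\<dots> = y ^ 4 * (((dir (\<tau>, 1) ^^ 4) h (p + t * x, q + t * y) + (dir (\<tau>, 1) ^^ 4) h (p + (- t) * x, q + (- t) * y)) / 6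
          - ((dir (\<tau>, 1) ^^ 4) h (p + t' * x, q + t' * y) + (dir (\<tau>, 1) ^^ 4) h (p + (- t') * x, q + (- t') * y)) / 12)"
      proof -
        have "\<bar>- t\<bar> \<le> 1" "\<bar>- t'\<bar> \<le> 1" using t by simp_all
        then show ?thesis unfolding \<psi>4[OF t(1)] \<psi>4[OF t(2)] \<psi>4[OF \<open>\<bar>- t\<bar> \<le> 1\<close>] \<psi>4[OF \<open>\<bar>- t'\<bar> \<le> 1\<close>] by algebra
      qed
      finally show ?thesis using t(1,2) by blast
    qed
    obtain t1 where t1: "\<bar>t1\<bar> \<le> 1" "?Ax = 2 * (y * (dir (\<tau>, 1) ^^ 1) (partial_x f) (p + t1 * x, q + t1 * y))"
      using mvt[OF smooth_on_partial_x[OF f]] by blast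
    obtain t2 where t2: "\<bar>t2\<bar> \<le> 1" "?Bx = 2 * (y * (dir (\<tau>, 1) ^^ 1) (partial_x g) (p + t2 * x, q + t2 * y))"
      using mvt[OF smooth_on_partial_x[OF g]] by blast
    define a where "a = (dir (\<tau>, 1) ^^ 1) (partial_x f) (p + t1 * x, q + t1 * y)"
    define c where "c = (dir (\<tau>, 1) ^^ 1) (partial_x g) (p + t2 * x, q + t2 * y)"
    have a: "\<bar>a - \<mu>\<bar> < \<bar>\<mu>\<bar> / 2"
      using r3(2)[of \<tau> "p + t1 * x" "q + t1 * y"] box[OF t1(1)] \<tau>(1) e(4) by (simp add: a_def \<mu>_def)
    have c: "\<bar>c\<bar> < \<eta>"
      using r4(2)[of \<tau> "p + t2 * x" "q + t2 * y"] box[OF t2(1)] \<tau>(1) e(5) by (simp add: c_def gyx)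
    have f4: "\<bar>(dir (\<tau>, 1) ^^ 4) f (p + s * x, q + s * y)\<bar> \<le> M" if "\<bar>s\<bar> \<le> 1" for s
      using r1(2)[of \<tau> "p + s * x" "q + s * y"] box[OF that] \<tau>(1) e(2) unfolding M_def by linarith
    have g4': "\<bar>(dir (\<tau>, 1) ^^ 4) g (p + s * x, q + s * y) - \<kappa>\<bar> \<le> \<bar>\<kappa>\<bar> / 6" if "\<bar>s\<bar> \<le> 1" for s
      using r2(2)[of \<tau> "p + s * x" "q + s * y"] box[OF that] \<tau>(1) e(3) by linarith
    obtain s s' where s: "\<bar>s\<bar> \<le> 1" "\<bar>s'\<bar> \<le> 1" and EA: "x * ?Ax + y * ?Ay = y ^ 4 * (((dir (\<tau>, 1) ^^ 4) f (p + s * x, q + s * y) + (dir (\<tau>, 1) ^^ 4) f (p + (- s) * x, q + (- s) * y)) / 6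
          - ((dir (\<tau>, 1) ^^ 4) f (p + s' * x, q + s' * y) + (dir (\<tau>, 1) ^^ 4) f (p + (- s') * x, q + (- s') * y)) / 12)" (is "_ = y ^ 4 * ?eA")
      using euler[OF f zf] by blast
    obtain u u' where u: "\<bar>u\<bar> \<le> 1" "\<bar>u'\<bar> \<le> 1" and EB: "x * ?Bx + y * ?By = y ^ 4 * (((dir (\<tau>, 1) ^^ 4) g (p + u * x, q + u * y) + (dir (\<tau>, 1) ^^ 4) g (p + (- u) * x, q + (- u) * y)) / 6
          - ((dir (\<tau>, 1) ^^ 4) g (p + u' * x, q + u' * y) + (dir (\<tau>, 1) ^^ 4) g (p + (- u') * x, q + (- u') * y)) / 12)" (is "_ = y ^ 4 * ?eB")
      using euler[OF g zg] by blast
    have su: "\<bar>- s\<bar> \<le> 1" "\<bar>- s'\<bar> \<le> 1" "\<bar>- u\<bar> \<le> 1" "\<bar>- u'\<bar> \<le> 1" using s u by simp_all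
    define eA where "eA = ?eA"
    define eB where "eB = ?eB"
    have comb: "\<bar>(k1 + k2) / 6 - (k3 + k4) / 12\<bar> \<le> m / 2"
      if "\<bar>k1\<bar> \<le> m" "\<bar>k2\<bar> \<le> m" "\<bar>k3\<bar> \<le> m" "\<bar>k4\<bar> \<le> m" for k1 k2 k3 k4 m :: real
      using that unfolding abs_le_iff by (simp add: field_simps)
    have eA: "\<bar>eA\<bar> \<le> M / 2" unfolding eA_def by (rule comb[OF f4[OF s(1)] f4[OF su(1)] f4[OF s(2)] f4[OF su(2)]])
    have "eB - \<kappa> / 6 = (((dir (\<tau>, 1) ^^ 4) g (p + u * x, q + u * y) - \<kappa>) + ((dir (\<tau>, 1) ^^ 4) g (p + (- u) * x, q + (- u) * y) - \<kappa>)) / 6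
          - (((dir (\<tau>, 1) ^^ 4) g (p + u' * x, q + u' * y) - \<kappa>) + ((dir (\<tau>, 1) ^^ 4) g (p + (- u') * x, q + (- u') * y) - \<kappa>)) / 12"
      unfolding eB_def by (simp add: field_simps)
    then have "\<bar>eB - \<kappa> / 6\<bar> \<le> (\<bar>\<kappa>\<bar> / 6) / 2"
      using comb[OF g4'[OF u(1)] g4'[OF su(3)] g4'[OF u(2)] g4'[OF su(4)]] by (simp only:)
    then have eB: "\<bar>eB\<bar> \<ge> \<bar>\<kappa>\<bar> / 12" by linarith
    have "?Ax * (x * ?Bx + y * ?By) = ?Bx * (x * ?Ax + y * ?Ay)" using det by algebra
    then have "?Ax * (y ^ 4 * eB) = ?Bx * (y ^ 4 * eA)"
      unfolding EA EB eA_def[symmetric] eB_def[symmetric] .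
    then have "(2 * y ^ 5) * (a * eB) = (2 * y ^ 5) * (c * eA)"
      unfolding t1(2) t2(2) a_def[symmetric] c_def[symmetric] by algebra
    then have eq: "a * eB = c * eA" using y by simp
    have "\<bar>\<mu>\<bar> / 2 \<le> \<bar>a\<bar>" using a by linarith
    then have "\<bar>\<mu>\<bar> / 2 * (\<bar>\<kappa>\<bar> / 12) \<le> \<bar>a\<bar> * \<bar>eB\<bar>" using eB by (intro mult_mono) auto
    moreover have "\<bar>c\<bar> * \<bar>eA\<bar> \<le> \<eta> * (M / 2)" using c eA \<eta> by (intro mult_mono) auto
    moreover have "\<eta> * (M / 2) = \<bar>\<mu>\<bar> * \<bar>\<kappa>\<bar> / 48" using M by (simp add: \<eta>_def)
    moreover have "\<bar>a\<bar> * \<bar>eB\<bar> = \<bar>c\<bar> * \<bar>eA\<bar>" using eq by (metis abs_mult)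
    moreover have "\<bar>\<mu>\<bar> * \<bar>\<kappa>\<bar> > 0" using \<mu> \<kappa> by (rule mult_pos_pos)
    ultimately show False by simp
  qed
  then show ?thesis using r(1) by blast
qed

section \<open>Lifts of contact maps\<close>

lemma abs_less_if_square_less: "x\<^sup>2 < b\<^sup>2 \<Longrightarrow> 0 < b \<Longrightarrow> \<bar>x\<bar> < b" for x b :: real
  by (metis abs_le_square_iff abs_of_pos linorder_not_le)

lemma lift_partials:
  fixes h :: "real \<times> real \<times> real \<Rightarrow> real"
  assumes h: "smooth_germ_at (x\<^sup>2, x * y, y\<^sup>2) h"
    and F: "\<forall>\<^sub>F z in nhds (x, y). F z = h ((fst z)\<^sup>2, fst z * snd z, (snd z)\<^sup>2)"
    and Fx: "((\<lambda>t. F (t, y)) has_real_derivative a) (at x)" and Fy: "((\<lambda>t. F (x, t)) has_real_derivative b) (at y)"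
  defines "d \<equiv> frechet_derivative h (at (x\<^sup>2, x * y, y\<^sup>2))"
  shows "a = 2 * x * d (1, 0, 0) + y * d (0, 1, 0)" "b = x * d (0, 1, 0) + 2 * y * d (0, 0, 1)"
proof -
  have D: "(h has_derivative d) (at (x\<^sup>2, x * y, y\<^sup>2))"
    unfolding d_def by (rule smooth_germ_at_has_derivative[OF h])
  have lin: "linear d" using D by (rule has_derivative_linear)
  have comp: "d (k * r, k * s, k * t) = k * (r * d (1, 0, 0) + s * d (0, 1, 0) + t * d (0, 0, 1))" for k r s t
  proof -
    have "(k * r, k * s, k * t) = k *\<^sub>R (r *\<^sub>R (1, 0, 0) + (s *\<^sub>R (0, 1, 0) + t *\<^sub>R (0, 0, 1)))"
      by simp
    then show ?thesis
      by (simp only: linear_cmul[OF lin] linear_add[OF lin] real_scaleR_def add.assoc)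
  qed
  have "((\<lambda>t. (t\<^sup>2, t * y, y\<^sup>2)) has_derivative (\<lambda>k. (k * (2 * x), k * y, k * 0))) (at x)"
    by (intro has_derivative_Pair) (auto intro!: derivative_eq_intros)
  from has_derivative_compose[OF this D]
  have "((\<lambda>t. h (t\<^sup>2, t * y, y\<^sup>2)) has_derivative (\<lambda>k. k * (2 * x * d (1, 0, 0) + y * d (0, 1, 0) + 0 * d (0, 0, 1)))) (at x)"
    unfolding comp .
  then have 1: "((\<lambda>t. h (t\<^sup>2, t * y, y\<^sup>2)) has_real_derivative (2 * x * d (1, 0, 0) + y * d (0, 1, 0) + 0 * d (0, 0, 1))) (at x)"
    unfolding has_field_derivative_def by (rule has_derivative_eq_rhs) (rule ext, rule mult.commute)
  have "((\<lambda>t. (x\<^sup>2, x * t, t\<^sup>2)) has_derivative (\<lambda>k. (k * 0, k * x, k * (2 * y)))) (at y)"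
    by (intro has_derivative_Pair) (auto intro!: derivative_eq_intros)
  from has_derivative_compose[OF this D]
  have "((\<lambda>t. h (x\<^sup>2, x * t, t\<^sup>2)) has_derivative (\<lambda>k. k * (0 * d (1, 0, 0) + x * d (0, 1, 0) + 2 * y * d (0, 0, 1)))) (at y)"
    unfolding comp .
  then have 2: "((\<lambda>t. h (x\<^sup>2, x * t, t\<^sup>2)) has_real_derivative (0 * d (1, 0, 0) + x * d (0, 1, 0) + 2 * y * d (0, 0, 1))) (at y)"
    unfolding has_field_derivative_def by (rule has_derivative_eq_rhs) (rule ext, rule mult.commute)
  have ev1: "\<forall>\<^sub>F t in nhds x. F (t, y) = h (t\<^sup>2, t * y, y\<^sup>2)"
  proof -
    have "((\<lambda>t. (t, y)) \<longlongrightarrow> (x, y)) (nhds x)" by (intro tendsto_Pair tendsto_const filterlim_ident)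
    from eventually_compose_filterlim[OF F this] show ?thesis by simp
  qed
  have ev2: "\<forall>\<^sub>F t in nhds y. F (x, t) = h (x\<^sup>2, x * t, t\<^sup>2)"
  proof -
    have "((\<lambda>t. (x, t)) \<longlongrightarrow> (x, y)) (nhds y)" by (intro tendsto_Pair tendsto_const filterlim_ident)
    from eventually_compose_filterlim[OF F this] show ?thesis by simp
  qed
  have "((\<lambda>t. F (t, y)) has_real_derivative (2 * x * d (1, 0, 0) + y * d (0, 1, 0) + 0 * d (0, 0, 1))) (at x)"
    using DERIV_cong_ev[OF refl ev1 refl] 1 by blast
  from DERIV_unique[OF Fx this] show "a = 2 * x * d (1, 0, 0) + y * d (0, 1, 0)" by simp
  have "((\<lambda>t. F (x, t)) has_real_derivative (0 * d (1, 0, 0) + x * d (0, 1, 0) + 2 * y * d (0, 0, 1))) (at y)"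
    using DERIV_cong_ev[OF refl ev2 refl] 2 by blast
  from DERIV_unique[OF Fy this] show "b = x * d (0, 1, 0) + 2 * y * d (0, 0, 1)" by simp
qed

lemma lift_differential_at_0:
  fixes h :: "real \<times> real \<times> real \<Rightarrow> real"
  assumes W: "open W" and f: "smooth_on W f" and c: "(p, q) \<in> W" and h: "smooth_germ_at 0 h"
    and F: "\<forall>\<^sub>F z in nhds (0, 0). f (p + fst z, q + snd z) + f (p - fst z, q - snd z) - 2 * f (p, q)
      = h ((fst z)\<^sup>2, fst z * snd z, (snd z)\<^sup>2)"
  defines "d \<equiv> frechet_derivative h (at 0)"
  shows "d (1, 0, 0) = partial_x (partial_x f) (p, q)" "d (0, 1, 0) = 2 * partial_x (partial_y f) (p, q)"
    "d (0, 0, 1) = partial_y (partial_y f) (p, q)"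
proof -
  obtain a b c where g: "smooth_germ_at 0 a" "smooth_germ_at 0 b" "smooth_germ_at 0 c"
    and v: "a 0 = d (1,0,0)" "b 0 = d (0,1,0)" "c 0 = d (0,0,1)"
    and e: "\<forall>\<^sub>F z in nhds 0. h z = h 0 + fst z * a z + fst (snd z) * b z + snd (snd z) * c z"
    using Hadamard_3_0[OF h] unfolding d_def by (elim exE conjE)
  have h0: "h 0 = 0" using eventually_nhds_x_imp_x[OF F] by (simp add: zero_prod_def)
  have key: "x\<^sup>2 * d (1,0,0) + x * y * d (0,1,0) + y\<^sup>2 * d (0,0,1)
      = x * (x * partial_x (partial_x f) (p, q) + y * partial_y (partial_x f) (p, q))
        + y * (x * partial_x (partial_y f) (p, q) + y * partial_y (partial_y f) (p, q))" for x y
  proof -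
    define \<psi> where "\<psi> n t = (dir (x, y) ^^ n) f (p + t * x, q + t * y)" for n t
    have "((\<lambda>t. (p + t * x, q + t * y)) \<longlongrightarrow> (p + 0 * x, q + 0 * y)) (nhds 0)"
      by (intro tendsto_intros filterlim_ident)
    then have "((\<lambda>t. (p + t * x, q + t * y)) \<longlongrightarrow> (p, q)) (nhds 0)" by simp
    then have "\<forall>\<^sub>F t in nhds 0. (p + t * x, q + t * y) \<in> W"
      using W \<open>(p, q) \<in> W\<close> by (rule topological_tendstoD)
    then obtain h' where h': "h' > 0" "\<And>t. dist t 0 < h' \<Longrightarrow> (p + t * x, q + t * y) \<in> W"
      unfolding eventually_nhds_metric by blast
    have L1: "((\<lambda>s. (\<psi> 0 s + \<psi> 0 (- s) - 2 * \<psi> 0 0) / s\<^sup>2) \<longlongrightarrow> \<psi> 2 0) (at 0)"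
    proof (rule symmetric_difference_limit[where \<psi> = \<psi> and h = "h' / 2"])
      show "(\<psi> n has_real_derivative \<psi> (Suc n) t) (at t)" if "\<bar>t\<bar> \<le> h' / 2" for n t
        unfolding \<psi>_def by (rule DERIV_dir_iterate[OF W f h'(2)]) (use that h'(1) in \<open>simp add: dist_real_def\<close>)
    qed (use h'(1) in simp)
    have \<psi>2: "\<psi> 2 0 = x * (x * partial_x (partial_x f) (p, q) + y * partial_y (partial_x f) (p, q))
        + y * (x * partial_x (partial_y f) (p, q) + y * partial_y (partial_y f) (p, q))"
      using dir_iterate_split[OF W f \<open>(p, q) \<in> W\<close>, where v = "(x, y)" and n = 1] by (simp add: \<psi>_def numeral_2_eq_2 dir_def)
    have L2: "((\<lambda>s. (\<psi> 0 s + \<psi> 0 (- s) - 2 * \<psi> 0 0) / s\<^sup>2) \<longlongrightarrow> x\<^sup>2 * d (1,0,0) + x * y * d (0,1,0) + y\<^sup>2 * d (0,0,1)) (at 0)"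
    proof -
      define \<gamma> where "\<gamma> s = ((s * x)\<^sup>2, (s * x) * (s * y), (s * y)\<^sup>2)" for s :: real
      have \<gamma>3: "fst (\<gamma> s) = (s * x)\<^sup>2" "fst (snd (\<gamma> s)) = (s * x) * (s * y)" "snd (snd (\<gamma> s)) = (s * y)\<^sup>2" for s
        by (simp_all add: \<gamma>_def)
      have \<gamma>: "(\<gamma> \<longlongrightarrow> 0) (at 0)"
        unfolding \<gamma>_def by (intro tendsto_triple) (auto intro!: tendsto_eq_intros)
      have "((\<lambda>s. x\<^sup>2 * a (\<gamma> s) + x * y * b (\<gamma> s) + y\<^sup>2 * c (\<gamma> s)) \<longlongrightarrow> x\<^sup>2 * a 0 + x * y * b 0 + y\<^sup>2 * c 0) (at 0)"
        by (intro tendsto_add tendsto_mult tendsto_const isCont_tendsto_compose[OF smooth_germ_at_isCont \<gamma>] g)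
      moreover have "((\<lambda>s. (s * x, s * y)) \<longlongrightarrow> (0 * x, 0 * y)) (at 0)" by (intro tendsto_intros)
      then have "((\<lambda>s. (s * x, s * y)) \<longlongrightarrow> (0, 0)) (at 0)" by simp
      from eventually_compose_filterlim[OF F this] eventually_compose_filterlim[OF e \<gamma>] eventually_neq_at_within[of 0]
      have "\<forall>\<^sub>F s in at 0. x\<^sup>2 * a (\<gamma> s) + x * y * b (\<gamma> s) + y\<^sup>2 * c (\<gamma> s) = (\<psi> 0 s + \<psi> 0 (- s) - 2 * \<psi> 0 0) / s\<^sup>2"
      proof eventually_elim
        case (elim s)
        have "\<psi> 0 s + \<psi> 0 (- s) - 2 * \<psi> 0 0 = h (\<gamma> s)"
          using elim(1) by (simp add: \<psi>_def \<gamma>_def)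
        also have "\<dots> = s\<^sup>2 * (x\<^sup>2 * a (\<gamma> s) + x * y * b (\<gamma> s) + y\<^sup>2 * c (\<gamma> s))"
          unfolding elim(2) h0 \<gamma>3 by algebra
        finally show ?case using elim(3) by (simp add: eq_divide_eq mult.commute)
      qed
      ultimately show ?thesis unfolding v by (rule Lim_transform_eventually)
    qed
    show ?thesis using tendsto_unique[OF at_neq_bot L2 L1] unfolding \<psi>2 .
  qed
  have comm: "partial_y (partial_x f) (p, q) = partial_x (partial_y f) (p, q)"
    using partial_x_partial_y_commute[OF W f \<open>(p, q) \<in> W\<close>] by (rule sym)
  show 1: "d (1, 0, 0) = partial_x (partial_x f) (p, q)" using key[of 1 0] by simp
  show 2: "d (0, 0, 1) = partial_y (partial_y f) (p, q)" using key[of 0 1] by simp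
  show "d (0, 1, 0) = 2 * partial_x (partial_y f) (p, q)" using key[of 1 1] 1 2 comm by simp
qed

lemma contact_map_components:
  "fst (contact_map f g (p, q) z) = f (p + fst z, q + snd z) + f (p - fst z, q - snd z) - 2 * f (p, q)"
  "snd (contact_map f g (p, q) z) = g (p + fst z, q + snd z) + g (p - fst z, q - snd z) - 2 * g (p, q)"
  by (simp_all add: contact_map_def case_prod_unfold)

lemma DERIV_contact_component:
  assumes f: "smooth_on W f" and z: "(p + x, q + y) \<in> W" "(p - x, q - y) \<in> W"
  shows "((\<lambda>t. f (p + t, q + y) + f (p - t, q - y) - 2 * f (p, q)) has_real_derivative
      partial_x f (p + x, q + y) - partial_x f (p - x, q - y)) (at x)"
    and "((\<lambda>t. f (p + x, q + t) + f (p - x, q - t) - 2 * f (p, q)) has_real_derivative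
      partial_y f (p + x, q + y) - partial_y f (p - x, q - y)) (at y)"
proof -
  have l: "((\<lambda>t. k + t) has_real_derivative 1) (at s)" "((\<lambda>t. k - t) has_real_derivative - 1) (at s)" for k s :: real
    by (auto intro!: derivative_eq_intros)
  have c: "((\<lambda>t. k) has_real_derivative 0) (at s)" for k s :: real by (rule DERIV_const)
  show "((\<lambda>t. f (p + t, q + y) + f (p - t, q - y) - 2 * f (p, q)) has_real_derivative
      partial_x f (p + x, q + y) - partial_x f (p - x, q - y)) (at x)"
    by (rule DERIV_cong[OF DERIV_diff[OF DERIV_add[OF has_derivative_along[OF f z(1) l(1) c] has_derivative_along[OF f z(2) l(2) c]] DERIV_const]]) simp
  show "((\<lambda>t. f (p + x, q + t) + f (p - x, q - t) - 2 * f (p, q)) has_real_derivative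
      partial_y f (p + x, q + y) - partial_y f (p - x, q - y)) (at y)"
    by (rule DERIV_cong[OF DERIV_diff[OF DERIV_add[OF has_derivative_along[OF f z(1) c l(1)] has_derivative_along[OF f z(2) c l(2)]] DERIV_const]]) simp
qed

lemma invariant_lift_eventually:
  assumes N: "open N" "(x\<^sup>2, x * y, y\<^sup>2) \<in> N" and H: "invariant_lift N F H"
  shows "\<forall>\<^sub>F z in nhds (x, y). F z = H ((fst z)\<^sup>2, fst z * snd z, (snd z)\<^sup>2)"
proof -
  have "((\<lambda>z. ((fst z)\<^sup>2, fst z * snd z, (snd z)\<^sup>2)) \<longlongrightarrow> ((fst (x, y))\<^sup>2, fst (x, y) * snd (x, y), (snd (x, y))\<^sup>2)) (nhds (x, y))"
    by (intro tendsto_intros filterlim_ident)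
  then have "\<forall>\<^sub>F z in nhds (x, y). ((fst z)\<^sup>2, fst z * snd z, (snd z)\<^sup>2) \<in> N"
    using N by (intro topological_tendstoD) auto
  then show ?thesis
    by (rule eventually_mono) (use H in \<open>auto simp: invariant_lift_def\<close>)
qed

text \<open>
  At a point of the cone other than its vertex, the determinant of the differentials of \<open>H\<close> and of the equation of the
  cone is \<open>- 1 / 2\<close> times the Jacobian determinant of the contact map at a preimage.
\<close>

lemma lift_spanned_1:
  assumes W: "open W" and f: "smooth_on W f" and g: "smooth_on W g"
    and z: "(p + x, q + y) \<in> W" "(p - x, q - y) \<in> W"
    and N: "open N" "(x\<^sup>2, x * y, y\<^sup>2) \<in> N" and H: "invariant_lift N (contact_map f g (p, q)) H"
    and zero: "contact_map f g (p, q) (x, y) = 0"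
    and det: "(partial_x f (p + x, q + y) - partial_x f (p - x, q - y)) * (partial_y g (p + x, q + y) - partial_y g (p - x, q - y)) \<noteq>
      (partial_y f (p + x, q + y) - partial_y f (p - x, q - y)) * (partial_x g (p + x, q + y) - partial_x g (p - x, q - y))"
  shows "local_algebra_spanned H (x\<^sup>2, x * y, y\<^sup>2) 1"
proof -
  let ?P = "(x\<^sup>2, x * y, y\<^sup>2)"
  have germ: "smooth_germ_at ?P H" using N H by (auto simp: invariant_lift_def intro: smooth_germ_at_I)
  note gH = smooth_germ_at_components[OF germ]
  note ev = invariant_lift_eventually[OF N H]
  have ev1: "\<forall>\<^sub>F z in nhds (x, y). fst (contact_map f g (p, q) z) = fst (H ((fst z)\<^sup>2, fst z * snd z, (snd z)\<^sup>2))"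
    using ev by (rule eventually_mono) simp
  have ev2: "\<forall>\<^sub>F z in nhds (x, y). snd (contact_map f g (p, q) z) = snd (H ((fst z)\<^sup>2, fst z * snd z, (snd z)\<^sup>2))"
    using ev by (rule eventually_mono) simp
  note Df = DERIV_contact_component[OF f z] and Dg = DERIV_contact_component[OF g z]
  define d1 where "d1 = frechet_derivative (\<lambda>z. fst (H z)) (at ?P)"
  define d2 where "d2 = frechet_derivative (\<lambda>z. snd (H z)) (at ?P)"
  have cf: "((\<lambda>t. fst (contact_map f g (p, q) (t, y))) has_real_derivative partial_x f (p + x, q + y) - partial_x f (p - x, q - y)) (at x)"
    "((\<lambda>t. fst (contact_map f g (p, q) (x, t))) has_real_derivative partial_y f (p + x, q + y) - partial_y f (p - x, q - y)) (at y)"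
    unfolding contact_map_components fst_conv snd_conv by (rule Df)+
  have cg: "((\<lambda>t. snd (contact_map f g (p, q) (t, y))) has_real_derivative partial_x g (p + x, q + y) - partial_x g (p - x, q - y)) (at x)"
    "((\<lambda>t. snd (contact_map f g (p, q) (x, t))) has_real_derivative partial_y g (p + x, q + y) - partial_y g (p - x, q - y)) (at y)"
    unfolding contact_map_components fst_conv snd_conv by (rule Dg)+
  have F: "partial_x f (p + x, q + y) - partial_x f (p - x, q - y) = 2 * x * d1 (1,0,0) + y * d1 (0,1,0)"
    "partial_y f (p + x, q + y) - partial_y f (p - x, q - y) = x * d1 (0,1,0) + 2 * y * d1 (0,0,1)"
    unfolding d1_def by (rule lift_partials[OF gH(1) ev1 cf])+
  have G: "partial_x g (p + x, q + y) - partial_x g (p - x, q - y) = 2 * x * d2 (1,0,0) + y * d2 (0,1,0)"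
    "partial_y g (p + x, q + y) - partial_y g (p - x, q - y) = x * d2 (0,1,0) + 2 * y * d2 (0,0,1)"
    unfolding d2_def by (rule lift_partials[OF gH(2) ev2 cg])+
  have HP: "H ?P = 0" using eventually_nhds_x_imp_x[OF ev] zero by simp
  have QP: "cone_eq ?P = 0" by (simp add: cone_eq_def power_mult_distrib)
  show ?thesis
  proof (rule spanned_1_if_transverse[OF gH HP QP])
    have Q: "frechet_derivative cone_eq (at ?P) (1,0,0) = - y\<^sup>2" "frechet_derivative cone_eq (at ?P) (0,1,0) = 2 * (x * y)"
      "frechet_derivative cone_eq (at ?P) (0,0,1) = - x\<^sup>2"
      by (simp_all add: frechet_derivative_cone_eq)
    let ?D = "d1 (1,0,0) * (d2 (0,1,0) * - x\<^sup>2 - d2 (0,0,1) * (2 * (x * y)))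
      - d1 (0,1,0) * (d2 (1,0,0) * - x\<^sup>2 - d2 (0,0,1) * - y\<^sup>2)
      + d1 (0,0,1) * (d2 (1,0,0) * (2 * (x * y)) - d2 (0,1,0) * - y\<^sup>2)"
    have "(2 * x * d1 (1,0,0) + y * d1 (0,1,0)) * (x * d2 (0,1,0) + 2 * y * d2 (0,0,1))
        - (x * d1 (0,1,0) + 2 * y * d1 (0,0,1)) * (2 * x * d2 (1,0,0) + y * d2 (0,1,0)) = - 2 * ?D" by algebra
    then have "?D \<noteq> 0" using det unfolding F G by auto
    then show "frechet_derivative (\<lambda>z. fst (H z)) (at ?P) (1,0,0) * (frechet_derivative (\<lambda>z. snd (H z)) (at ?P) (0,1,0) * frechet_derivative cone_eq (at ?P) (0,0,1)
        - frechet_derivative (\<lambda>z. snd (H z)) (at ?P) (0,0,1) * frechet_derivative cone_eq (at ?P) (0,1,0))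
      - frechet_derivative (\<lambda>z. fst (H z)) (at ?P) (0,1,0) * (frechet_derivative (\<lambda>z. snd (H z)) (at ?P) (1,0,0) * frechet_derivative cone_eq (at ?P) (0,0,1)
        - frechet_derivative (\<lambda>z. snd (H z)) (at ?P) (0,0,1) * frechet_derivative cone_eq (at ?P) (1,0,0))
      + frechet_derivative (\<lambda>z. fst (H z)) (at ?P) (0,0,1) * (frechet_derivative (\<lambda>z. snd (H z)) (at ?P) (1,0,0) * frechet_derivative cone_eq (at ?P) (0,1,0)
        - frechet_derivative (\<lambda>z. snd (H z)) (at ?P) (0,1,0) * frechet_derivative cone_eq (at ?P) (1,0,0)) \<noteq> 0"
      unfolding Q d1_def[symmetric] d2_def[symmetric] .
  qed
qed

text \<open>
  The differential of a lift at the origin is given by the Hessians of \<open>f\<close> and \<open>g\<close> at \<open>(p, q)\<close>. For these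
  coefficients, the criterion for the line to be on the cone is the equation of the parabolic set.
\<close>

lemma lift_origin_mult_greater_iff:
  assumes W: "open W" and f: "smooth_on W f" and g: "smooth_on W g" and c: "(p, q) \<in> W"
    and N: "open N" "0 \<in> N" and H: "invariant_lift N (contact_map f g (p, q)) H"
    and det: "partial_x (partial_x f) (p, q) * partial_x (partial_y g) (p, q) \<noteq> partial_x (partial_y f) (p, q) * partial_x (partial_x g) (p, q)"
  shows "intersection_mult H 0 > minimal_origin_mult \<longleftrightarrow> (p, q) \<in> parabolic_set W f g"
proof -
  have N': "((0::real)\<^sup>2, 0 * 0, (0::real)\<^sup>2) \<in> N" using N(2) by (simp add: zero_prod_def)
  have germ: "smooth_germ_at 0 H" using N H by (auto simp: invariant_lift_def intro: smooth_germ_at_I)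
  note gH = smooth_germ_at_components[OF germ]
  note ev = invariant_lift_eventually[OF N(1) N' H]
  have "\<forall>\<^sub>F z in nhds (0, 0). f (p + fst z, q + snd z) + f (p - fst z, q - snd z) - 2 * f (p, q) = fst (H ((fst z)\<^sup>2, fst z * snd z, (snd z)\<^sup>2))"
    using ev by (rule eventually_mono) (metis contact_map_components(1))
  note d1 = lift_differential_at_0[OF W f c gH(1) this]
  have "\<forall>\<^sub>F z in nhds (0, 0). g (p + fst z, q + snd z) + g (p - fst z, q - snd z) - 2 * g (p, q) = snd (H ((fst z)\<^sup>2, fst z * snd z, (snd z)\<^sup>2))"
    using ev by (rule eventually_mono) (metis contact_map_components(2))
  note d2 = lift_differential_at_0[OF W g c gH(2) this]
  have H0: "H 0 = 0" using eventually_nhds_x_imp_x[OF ev] by (simp add: contact_map_def zero_prod_def)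
  define A where "A = partial_x (partial_x f) (p, q)"
  define B where "B = partial_x (partial_y f) (p, q)"
  define C where "C = partial_y (partial_y f) (p, q)"
  define A' where "A' = partial_x (partial_x g) (p, q)"
  define B' where "B' = partial_x (partial_y g) (p, q)"
  define C' where "C' = partial_y (partial_y g) (p, q)"
  note defs = A_def[symmetric] B_def[symmetric] C_def[symmetric] A'_def[symmetric] B'_def[symmetric] C'_def[symmetric]
  have "A * (2 * B') - 2 * B * A' \<noteq> 0" using det unfolding defs by simp
  then have "intersection_mult H 0 > minimal_origin_mult \<longleftrightarrow>
     (C * A' - A * C')\<^sup>2 = (2 * B * C' - C * (2 * B')) * (A * (2 * B') - 2 * B * A')"
    using origin_mult_greater_iff[OF gH H0] unfolding d1 d2 defs by blast
  also have "\<dots> \<longleftrightarrow> (A * C' - C * A')\<^sup>2 = 4 * (B * C' - C * B') * (A * B' - B * A')"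
  proof -
    have "(C * A' - A * C')\<^sup>2 = (A * C' - C * A')\<^sup>2"
      "(2 * B * C' - C * (2 * B')) * (A * (2 * B') - 2 * B * A') = 4 * (B * C' - C * B') * (A * B' - B * A')" by algebra+
    then show ?thesis by simp
  qed
  also have "\<dots> \<longleftrightarrow> (p, q) \<in> parabolic_set W f g"
    using c by (simp add: parabolic_set_def Let_def defs)
  finally show ?thesis .
qed

lemma contact_map_has_lift:
  assumes f: "smooth_on W f" and g: "smooth_on W g" and a: "a > 0" and W: "{-2*a<..<2*a} \<times> {-2*a<..<2*a} \<subseteq> W"
    and c: "\<bar>p\<bar> < a" "\<bar>q\<bar> < a"
  shows "\<exists>H. invariant_lift {(u, v, w). \<bar>u\<bar> < (a/2)\<^sup>2 \<and> \<bar>w\<bar> < (a/2)\<^sup>2} (contact_map f g (p, q)) H"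
proof -
  let ?B = "{-a<..<a} \<times> {-a<..<a}" and ?N = "{(u, v, w). \<bar>u\<bar> < (a/2)\<^sup>2 \<and> \<bar>w\<bar> < (a/2)\<^sup>2} :: (real \<times> real \<times> real) set"
  have B: "open ?B" by (intro open_Times) auto
  have N: "open ?N"
    unfolding case_prod_unfold by (intro open_Collect_conj open_Collect_less continuous_intros)
  have sm: "smooth_on ?B (\<lambda>z. k (p + fst z, q + snd z) + k (p - fst z, q - snd z) - 2 * k (p, q))"
    if k: "smooth_on W k" for k :: "real \<times> real \<Rightarrow> real"
  proof -
    have "smooth_on ?B (\<lambda>z. k (p + fst z, q + snd z))"
      by (rule smooth_on_compose_plane[OF B k])
         (use c in \<open>auto intro!: subsetD[OF W] smooth_on_add[OF B] smooth_on_const[OF B] smooth_on_fst[OF B] smooth_on_snd[OF B]\<close>)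
    moreover have "smooth_on ?B (\<lambda>z. k (p - fst z, q - snd z))"
      by (rule smooth_on_compose_plane[OF B k])
         (use c in \<open>auto intro!: subsetD[OF W] smooth_on_diff[OF B] smooth_on_const[OF B] smooth_on_fst[OF B] smooth_on_snd[OF B]\<close>)
    ultimately show ?thesis
      by (intro smooth_on_diff[OF B] smooth_on_add[OF B] smooth_on_const[OF B])
  qed
  obtain H1 where H1: "smooth_on ?N H1"
    "\<And>x y. \<bar>x\<bar> < a/2 \<Longrightarrow> \<bar>y\<bar> < a/2 \<Longrightarrow> f (p + fst (x, y), q + snd (x, y)) + f (p - fst (x, y), q - snd (x, y)) - 2 * f (p, q) = H1 (x\<^sup>2, x * y, y\<^sup>2)"
    by (rule even_function_lift[OF a sm[OF f]]) (simp add: add.commute, blast)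
  obtain H2 where H2: "smooth_on ?N H2"
    "\<And>x y. \<bar>x\<bar> < a/2 \<Longrightarrow> \<bar>y\<bar> < a/2 \<Longrightarrow> g (p + fst (x, y), q + snd (x, y)) + g (p - fst (x, y), q - snd (x, y)) - 2 * g (p, q) = H2 (x\<^sup>2, x * y, y\<^sup>2)"
    by (rule even_function_lift[OF a sm[OF g]]) (simp add: add.commute, blast)
  have "invariant_lift ?N (contact_map f g (p, q)) (\<lambda>z. (H1 z, H2 z))"
    unfolding invariant_lift_def
  proof (intro conjI allI impI smooth_on_Pair N H1 H2)
    fix x y :: real assume "(x\<^sup>2, x * y, y\<^sup>2) \<in> ?N"
    then have "x\<^sup>2 < (a/2)\<^sup>2" "y\<^sup>2 < (a/2)\<^sup>2" by auto
    then have "\<bar>x\<bar> < a/2" "\<bar>y\<bar> < a/2" using abs_less_if_square_less a by (metis half_gt_zero)+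
    then show "contact_map f g (p, q) (x, y) = (H1 (x\<^sup>2, x * y, y\<^sup>2), H2 (x\<^sup>2, x * y, y\<^sup>2))"
      using H1(2)[of x y] H2(2)[of x y] by (simp add: contact_map_def)
  qed
  then show ?thesis by blast
qed

lemma invariant_lift_subset: "invariant_lift N F H \<Longrightarrow> M \<subseteq> N \<Longrightarrow> invariant_lift M F H"
  unfolding invariant_lift_def using smooth_on_subset by blast

lemma half_cone_cases:
  assumes "P \<in> half_cone" obtains x y where "P = (x\<^sup>2, x * y, y\<^sup>2)"
proof -
  obtain u v w where P: "P = (u, v, w)" "v\<^sup>2 = u * w" "u \<ge> 0" "w \<ge> 0" using assms by (auto simp: half_cone_def)
  have "(sqrt u * sqrt w)\<^sup>2 = v\<^sup>2" using P by (simp add: power_mult_distrib)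
  then have "v = sqrt u * sqrt w \<or> v = sqrt u * (- sqrt w)" by (simp add: power2_eq_iff) linarith
  then show ?thesis
  proof
    assume "v = sqrt u * sqrt w" then show ?thesis using that[of "sqrt u" "sqrt w"] P by simp
  next
    assume "v = sqrt u * (- sqrt w)" then show ?thesis using that[of "sqrt u" "- sqrt w"] P by simp
  qed
qed

text \<open>
  Zeros of a lift away from the origin have multiplicity at most one, since the contact map is transverse there. So a
  parameter is in the bifurcation set exactly if the multiplicity at the origin is not minimal. Membership in the
  bifurcation set also needs some lift on \<open>N\<close>, which Whitney's theorem provides.
\<close>

lemma bifurcation_set_eq_parabolic_set:
  assumes W: "open W" "(0, 0) \<in> W" and f: "smooth_on W f" and g: "smooth_on W g"
    and fxx: "partial_x (partial_x f) (0, 0) = 0" and fxy: "partial_x (partial_y f) (0, 0) \<noteq> 0"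
    and gxx: "partial_x (partial_x g) (0, 0) \<noteq> 0" and gxy: "partial_x (partial_y g) (0, 0) = 0"
    and gyy: "partial_y (partial_y g) (0, 0) = 0" and g4: "(partial_y ^^ 4) g (0, 0) \<noteq> 0"
  shows "\<exists>U N\<^sub>0. open U \<and> (0, 0) \<in> U \<and> U \<subseteq> W \<and> open N\<^sub>0 \<and> 0 \<in> N\<^sub>0 \<and>
    (\<forall>N. open N \<and> 0 \<in> N \<and> N \<subseteq> N\<^sub>0 \<longrightarrow> bifurcation_set N f g \<inter> U = parabolic_set W f g \<inter> U)"
proof -
  obtain r where r: "r > 0" and trans: "\<And>p q x y. \<bar>p\<bar> < r \<Longrightarrow> \<bar>q\<bar> < r \<Longrightarrow> \<bar>x\<bar> < r \<Longrightarrow> \<bar>y\<bar> < r \<Longrightarrow> (x, y) \<noteq> 0 \<Longrightarrow>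
    contact_map f g (p, q) (x, y) = 0 \<Longrightarrow>
    (partial_x f (p + x, q + y) - partial_x f (p - x, q - y)) * (partial_y g (p + x, q + y) - partial_y g (p - x, q - y)) \<noteq>
    (partial_y f (p + x, q + y) - partial_y f (p - x, q - y)) * (partial_x g (p + x, q + y) - partial_x g (p - x, q - y))"
    using contact_map_zeros_transverse[OF W f g fxy gxx gxy gyy g4] by blast
  obtain s where s: "s > 0" "\<And>x y. \<bar>x\<bar> < s \<Longrightarrow> \<bar>y\<bar> < s \<Longrightarrow> (x, y) \<in> W"
    using dir_iterate_near_origin[OF W f zero_less_one, of 0] by (metis abs_zero)
  define a where "a = min r (s / 2)"
  have a: "a > 0" "a \<le> r" "2 * a \<le> s" using r s(1) by (auto simp: a_def)
  have box: "{-2*a<..<2*a} \<times> {-2*a<..<2*a} \<subseteq> W" using s(2) a(3) by (auto simp: subset_iff)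
  \<comment> \<open>A nonzero \<open>D\<close> makes the first two columns of the differential of a lift at the origin independent.\<close>
  define D where "D z = partial_x (partial_x f) z * partial_x (partial_y g) z - partial_x (partial_y f) z * partial_x (partial_x g) z" for z
  have sD: "smooth_on W D" unfolding D_def
    by (intro smooth_on_diff[OF W(1)] smooth_on_mult[OF W(1)] smooth_on_partial_x smooth_on_partial_y f g)
  have D0: "D (0, 0) \<noteq> 0" using fxx fxy gxx by (simp add: D_def)
  have "\<forall>\<^sub>F z in nhds (0, 0). dist (D z) (D (0, 0)) < \<bar>D (0, 0)\<bar>"
    by (rule isCont_eventually_near[OF smooth_on_isCont[OF sD W(2)]]) (use D0 in simp)
  then obtain V where V: "open V" "(0, 0) \<in> V" "\<And>z. z \<in> V \<Longrightarrow> dist (D z) (D (0, 0)) < \<bar>D (0, 0)\<bar>"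
    unfolding eventually_nhds by blast
  have DV: "D z \<noteq> 0" if "z \<in> V" for z using V(3)[OF that] by (auto simp: dist_real_def)
  define U where "U = V \<inter> ({-a<..<a} \<times> {-a<..<a})"
  define N\<^sub>0 where "N\<^sub>0 = ({(u, v, w). \<bar>u\<bar> < (a/2)\<^sup>2 \<and> \<bar>w\<bar> < (a/2)\<^sup>2} :: (real \<times> real \<times> real) set)"
  have U: "open U" "(0, 0) \<in> U" "U \<subseteq> W" using V a box by (auto simp: U_def open_Int open_Times)
  have N0: "open N\<^sub>0" "0 \<in> N\<^sub>0"
    unfolding N\<^sub>0_def case_prod_unfold using a(1) by (auto intro!: open_Collect_conj open_Collect_less continuous_intros)
  have "bifurcation_set N f g \<inter> U = parabolic_set W f g \<inter> U" if N: "open N" "0 \<in> N" "N \<subseteq> N\<^sub>0" for N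
  proof -
    have "c \<in> bifurcation_set N f g \<longleftrightarrow> c \<in> parabolic_set W f g" if c: "c \<in> U" for c
    proof -
      obtain p q where pq: "c = (p, q)" by force
      have cb: "\<bar>p\<bar> < a" "\<bar>q\<bar> < a" "(p, q) \<in> W" using c U(3) by (auto simp: pq U_def)
      have "D (p, q) \<noteq> 0" using DV c by (auto simp: pq U_def)
      then have det: "partial_x (partial_x f) (p, q) * partial_x (partial_y g) (p, q) \<noteq> partial_x (partial_y f) (p, q) * partial_x (partial_x g) (p, q)"
        by (simp add: D_def)
      note iff = lift_origin_mult_greater_iff[OF W(1) f g cb(3) N(1,2) _ det]
      show ?thesis
      proof
        assume "c \<in> parabolic_set W f g"
        obtain H where "invariant_lift N\<^sub>0 (contact_map f g (p, q)) H"
          using contact_map_has_lift[OF f g a(1) box cb(1,2)] unfolding N\<^sub>0_def by blast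
        then have H: "invariant_lift N (contact_map f g (p, q)) H" using N(3) invariant_lift_subset by blast
        then have "intersection_mult H 0 > minimal_origin_mult" using iff \<open>c \<in> parabolic_set W f g\<close> pq by blast
        then show "c \<in> bifurcation_set N f g" unfolding bifurcation_set_def pq using H by blast
      next
        assume "c \<in> bifurcation_set N f g"
        then obtain H where H: "invariant_lift N (contact_map f g (p, q)) H"
          and or: "intersection_mult H 0 > minimal_origin_mult \<or> (\<exists>P \<in> half_cone \<inter> N. P \<noteq> 0 \<and> H P = 0 \<and> intersection_mult H P > 1)"
          unfolding bifurcation_set_def pq by blast
        have "\<not> (\<exists>P \<in> half_cone \<inter> N. P \<noteq> 0 \<and> H P = 0 \<and> intersection_mult H P > 1)"
        proof
          assume "\<exists>P \<in> half_cone \<inter> N. P \<noteq> 0 \<and> H P = 0 \<and> intersection_mult H P > 1"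
          then obtain P where P: "P \<in> half_cone" "P \<in> N" "P \<noteq> 0" "H P = 0" "intersection_mult H P > 1" by blast
          obtain x y where xy: "P = (x\<^sup>2, x * y, y\<^sup>2)" using half_cone_cases[OF P(1)] by blast
          have nz: "(x, y) \<noteq> 0" using P(3) xy by (auto simp: zero_prod_def)
          have PN: "(x\<^sup>2, x * y, y\<^sup>2) \<in> N" using P(2) xy by simp
          then have "(x\<^sup>2, x * y, y\<^sup>2) \<in> N\<^sub>0" using N(3) by blast
          then have "x\<^sup>2 < (a/2)\<^sup>2" "y\<^sup>2 < (a/2)\<^sup>2" by (auto simp: N\<^sub>0_def)
          then have "\<bar>x\<bar> < a/2" "\<bar>y\<bar> < a/2" using abs_less_if_square_less a(1) by (metis half_gt_zero)+
          then have b: "\<bar>x\<bar> < a" "\<bar>y\<bar> < a" using a(1) by auto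
          have zero: "contact_map f g (p, q) (x, y) = 0"
            using H PN P(4) xy unfolding invariant_lift_def by metis
          have "(p + x, q + y) \<in> W" "(p - x, q - y) \<in> W" by (rule subsetD[OF box], use cb(1,2) b in auto)+
          then have "local_algebra_spanned H (x\<^sup>2, x * y, y\<^sup>2) 1"
            using cb(1,2) b a(2) by (intro lift_spanned_1[OF W(1) f g _ _ N(1) PN H zero] trans[OF _ _ _ _ nz zero]) auto
          then have "intersection_mult H P \<le> enat 1" using intersection_mult_le xy by blast
          then show False using P(5) by (simp add: one_enat_def)
        qed
        then show "c \<in> parabolic_set W f g" using or iff[OF H] pq by blast
      qed
    qed
    then show ?thesis by blast
  qed
  then show ?thesis using U N0 by blast
qed

section \<open>Expansions along curves\<close>

lemma taylor_little_o:
  fixes \<psi> :: "nat \<Rightarrow> real \<Rightarrow> real"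
  assumes h: "h > 0" and d: "\<And>n t. \<bar>t\<bar> \<le> h \<Longrightarrow> (\<psi> n has_real_derivative \<psi> (Suc n) t) (at t)"
  shows "((\<lambda>s. (\<psi> 0 s - (\<Sum>m\<le>n. \<psi> m 0 / fact m * s ^ m)) / s ^ n) \<longlongrightarrow> 0) (at 0)"
proof -
  have "\<exists>B\<ge>0. \<forall>t. \<bar>t\<bar> \<le> h \<longrightarrow> \<bar>\<psi> (Suc n) t\<bar> \<le> B" by (rule bounded_on_segment[OF DERIV_isCont[OF d]])
  then obtain B where B: "\<And>t. \<bar>t\<bar> \<le> h \<Longrightarrow> \<bar>\<psi> (Suc n) t\<bar> \<le> B" by blast
  have bound: "norm ((\<psi> 0 s - (\<Sum>m\<le>n. \<psi> m 0 / fact m * s ^ m)) / s ^ n) \<le> B * \<bar>s\<bar>" if s: "s \<noteq> 0" "\<bar>s\<bar> \<le> h" for s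
  proof -
    have "\<forall>m t. m < Suc n \<and> \<bar>t\<bar> \<le> \<bar>s\<bar> \<longrightarrow> (\<psi> m has_real_derivative \<psi> (Suc m) t) (at t)"
      using d s(2) by (intro allI impI) auto
    from Maclaurin_bi_le[OF refl this] obtain t where t: "\<bar>t\<bar> \<le> \<bar>s\<bar>"
      "\<psi> 0 s = (\<Sum>m<Suc n. \<psi> m 0 / fact m * s ^ m) + \<psi> (Suc n) t / fact (Suc n) * s ^ Suc n" by (elim exE conjE)
    have "(\<psi> 0 s - (\<Sum>m\<le>n. \<psi> m 0 / fact m * s ^ m)) / s ^ n = \<psi> (Suc n) t / fact (Suc n) * s"
      unfolding t(2) lessThan_Suc_atMost using s(1) by simp
    moreover have "\<bar>\<psi> (Suc n) t / fact (Suc n) * s\<bar> \<le> B / 1 * \<bar>s\<bar>"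
      unfolding abs_mult abs_divide using B[of t] t(1) s(2) by (intro mult_right_mono frac_le) (auto simp: fact_ge_1 simp del: fact_Suc)
    ultimately show ?thesis by simp
  qed
  have "\<forall>\<^sub>F s in at 0. norm ((\<psi> 0 s - (\<Sum>m\<le>n. \<psi> m 0 / fact m * s ^ m)) / s ^ n) \<le> B * \<bar>s\<bar>"
    unfolding eventually_at using h bound by (intro exI[of _ h]) (auto simp: dist_real_def)
  moreover have "((\<lambda>s. B * \<bar>s\<bar>) \<longlongrightarrow> B * \<bar>0\<bar>) (at (0::real))" by (intro tendsto_mult tendsto_const tendsto_rabs tendsto_ident_at)
  then have "((\<lambda>s. B * \<bar>s\<bar>) \<longlongrightarrow> 0) (at (0::real))" by simp
  ultimately show ?thesis by (rule Lim_null_comparison)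
qed

lemma line_in_open:
  fixes p q x y :: real
  assumes W: "open W" and c: "(p, q) \<in> W"
  obtains h where "h > 0" "\<And>t. \<bar>t\<bar> \<le> h \<Longrightarrow> (p + t * x, q + t * y) \<in> W"
proof -
  have "((\<lambda>t. (p + t * x, q + t * y)) \<longlongrightarrow> (p + 0 * x, q + 0 * y)) (nhds 0)"
    by (intro tendsto_intros filterlim_ident)
  then have "((\<lambda>t. (p + t * x, q + t * y)) \<longlongrightarrow> (p, q)) (nhds 0)" by simp
  then have "\<forall>\<^sub>F t in nhds 0. (p + t * x, q + t * y) \<in> W" using W c by (rule topological_tendstoD)
  then obtain h where h: "h > 0" "\<And>t. dist t 0 < h \<Longrightarrow> (p + t * x, q + t * y) \<in> W"
    unfolding eventually_nhds_metric by blast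
  have "(p + t * x, q + t * y) \<in> W" if "\<bar>t\<bar> \<le> h / 2" for t
    by (rule h(2)) (use that h(1) in \<open>simp add: dist_real_def\<close>)
  then show ?thesis using that[of "h / 2"] h(1) by simp
qed

lemma taylor_along_line:
  assumes W: "open W" and c: "(p, q) \<in> W" and f: "smooth_on W f"
  shows "((\<lambda>s. (f (p + s * x, q + s * y) - (\<Sum>m\<le>n. (dir (x, y) ^^ m) f (p, q) / fact m * s ^ m)) / s ^ n) \<longlongrightarrow> 0) (at 0)"
proof -
  obtain h where h: "h > 0" "\<And>t. \<bar>t\<bar> \<le> h \<Longrightarrow> (p + t * x, q + t * y) \<in> W" by (rule line_in_open[OF W c]) blast
  define \<psi> where "\<psi> n t = (dir (x, y) ^^ n) f (p + t * x, q + t * y)" for n t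
  have "((\<lambda>s. (\<psi> 0 s - (\<Sum>m\<le>n. \<psi> m 0 / fact m * s ^ m)) / s ^ n) \<longlongrightarrow> 0) (at 0)"
    by (rule taylor_little_o[OF h(1)]) (unfold \<psi>_def, rule DERIV_dir_iterate[OF W f h(2)])
  then show ?thesis by (simp add: \<psi>_def)
qed

lemma Hadamard_2:
  fixes h :: "real \<times> real \<Rightarrow> real"
  assumes h: "smooth_germ_at P h"
  obtains a b where "smooth_germ_at P a" "smooth_germ_at P b" "a P = partial_x h P" "b P = partial_y h P"
    "\<forall>\<^sub>F z in nhds P. h z = h P + (fst z - fst P) * a z + (snd z - snd P) * b z"
proof -
  obtain g where g: "\<And>b. smooth_germ_at P (g b)" "\<And>b. g b P = frechet_derivative h (at P) b"
    "\<forall>\<^sub>F z in nhds P. h z = h P + (\<Sum>b\<in>Basis. ((z - P) \<bullet> b) * g b z)"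
    by (rule Hadamard_lemma[OF h]) blast
  have BB: "(Basis :: (real \<times> real) set) = {(1, 0), (0, 1)}" by (auto simp: Basis_prod_def)
  have B: "(\<Sum>b\<in>Basis. F b) = F (1, 0) + F (0, 1)" for F :: "real \<times> real \<Rightarrow> real" unfolding BB by simp
  have "\<forall>\<^sub>F z in nhds P. h z = h P + (fst z - fst P) * g (1, 0) z + (snd z - snd P) * g (0, 1) z"
    using g(3) by (rule eventually_mono) (simp add: B inner_prod_def)
  then show ?thesis
    using that[OF g(1) g(1), of "(1, 0)" "(0, 1)"] g(2) unfolding partial_x_def partial_y_def by blast
qed

lemma tendsto_0_if_quotient:
  assumes "((\<lambda>s. k s / s) \<longlongrightarrow> l) (at (0::real))" shows "(k \<longlongrightarrow> (0::real)) (at 0)"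
proof -
  have "((\<lambda>s. k s / s * s) \<longlongrightarrow> l * 0) (at 0)" by (intro tendsto_mult assms tendsto_ident_at)
  moreover have "\<forall>\<^sub>F s in at (0::real). k s / s * s = k s"
    using eventually_neq_at_within[of 0] by eventually_elim simp
  ultimately have "(k \<longlongrightarrow> l * 0) (at 0)" by (rule Lim_transform_eventually)
  then show ?thesis by simp
qed

lemma dir_2:
  assumes W: "open W" and f: "smooth_on W f" and c: "c \<in> W"
  shows "(dir (v, w) ^^ 2) f c = partial_x (partial_x f) c * v\<^sup>2 + 2 * partial_x (partial_y f) c * v * w + partial_y (partial_y f) c * w\<^sup>2"
proof -
  have e: "v * (v * A + w * B) + w * (v * B + w * C) = A * v\<^sup>2 + 2 * B * v * w + C * w\<^sup>2" for A B C :: real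
    by (simp add: power2_eq_square algebra_simps)
  have "(dir (v, w) ^^ Suc (Suc 0)) f c = v * (v * partial_x (partial_x f) c + w * partial_y (partial_x f) c)
        + w * (v * partial_x (partial_y f) c + w * partial_y (partial_y f) c)"
    unfolding dir_iterate_split[OF W f c] by (simp add: dir_def)
  then show ?thesis
    unfolding partial_x_partial_y_commute[OF W f c, symmetric] e numeral_2_eq_2 .
qed

lemma first_order_line:
  assumes "smooth_germ_at (p, q) h"
  shows "((\<lambda>s. (h (p + s * v, q + s * w) - h (p, q)) / s) \<longlongrightarrow> v * partial_x h (p, q) + w * partial_y h (p, q)) (at 0)"
proof -
  obtain S where S: "open S" "(p, q) \<in> S" "smooth_on S h" using assms unfolding smooth_germ_at_def by blast
  have "(p + 0 * v, q + 0 * w) \<in> S" using S(2) by simp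
  from DERIV_dir[OF S(3) this] show ?thesis by (simp add: DERIV_def dir_def)
qed

lemma second_order_line:
  assumes W: "open W" and c: "(p, q) \<in> W" and f: "smooth_on W f"
  shows "((\<lambda>s. (f (p + s * v, q + s * w) - f (p, q) - s * v * partial_x f (p, q) - s * w * partial_y f (p, q)) / s\<^sup>2)
    \<longlongrightarrow> (dir (v, w) ^^ 2) f (p, q) / 2) (at 0)"
proof -
  have aux: "(X - S) / s\<^sup>2 + D / 2 = (X - F - s * v * P - s * w * Q) / s\<^sup>2"
    if "S = F + (v * P + w * Q) * s + D / 2 * s\<^sup>2" "s \<noteq> 0" for X S s D F v P w Q :: real
    unfolding that(1) using that(2) by (simp add: field_simps)
  have T: "(\<Sum>m\<le>2. a m / fact m * s ^ m) = a 0 + a 1 * s + a 2 / 2 * s\<^sup>2" for a :: "nat \<Rightarrow> real" and s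
    by (simp add: numeral_2_eq_2)
  have "((\<lambda>s. (f (p + s * v, q + s * w) - (\<Sum>m\<le>2. (dir (v, w) ^^ m) f (p, q) / fact m * s ^ m)) / s ^ 2 + (dir (v, w) ^^ 2) f (p, q) / 2)
      \<longlongrightarrow> 0 + (dir (v, w) ^^ 2) f (p, q) / 2) (at 0)"
    by (intro tendsto_add tendsto_const taylor_along_line[OF W c f])
  moreover have "\<forall>\<^sub>F s in at 0. (f (p + s * v, q + s * w) - (\<Sum>m\<le>2. (dir (v, w) ^^ m) f (p, q) / fact m * s ^ m)) / s ^ 2 + (dir (v, w) ^^ 2) f (p, q) / 2
      = (f (p + s * v, q + s * w) - f (p, q) - s * v * partial_x f (p, q) - s * w * partial_y f (p, q)) / s\<^sup>2"
    using eventually_neq_at_within[of 0]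
  proof eventually_elim
    case (elim s)
    have d1: "(dir (v, w) ^^ 1) f (p, q) = v * partial_x f (p, q) + w * partial_y f (p, q)"
      and d0: "(dir (v, w) ^^ 0) f = f" by (simp_all add: dir_def)
    show ?case by (rule aux[OF _ elim]) (simp only: T d1 d0)
  qed
  ultimately show ?thesis unfolding add_0 by (rule Lim_transform_eventually)
qed

context
  fixes W :: "(real \<times> real) set" and f :: "real \<times> real \<Rightarrow> real" and p q :: real and \<sigma> \<tau> :: "real \<Rightarrow> real" and v w :: real
  assumes W: "open W" and f: "smooth_on W f" and c: "(p, q) \<in> W"
    and \<sigma>: "((\<lambda>s. \<sigma> s / s) \<longlongrightarrow> v) (at 0)" and \<tau>: "((\<lambda>s. \<tau> s / s) \<longlongrightarrow> w) (at 0)"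
begin

lemma curve_tendsto: "((\<lambda>s. (p + \<sigma> s, q + \<tau> s)) \<longlongrightarrow> (p, q)) (at 0)"
proof -
  have "((\<lambda>s. (p + \<sigma> s, q + \<tau> s)) \<longlongrightarrow> (p + 0, q + 0)) (at 0)"
    by (intro tendsto_Pair tendsto_add tendsto_const tendsto_0_if_quotient[OF \<sigma>] tendsto_0_if_quotient[OF \<tau>])
  then show ?thesis by simp
qed

lemma first_order_limit:
  assumes h: "smooth_germ_at (p, q) h"
  shows "((\<lambda>s. (h (p + \<sigma> s, q + \<tau> s) - h (p, q)) / s) \<longlongrightarrow> v * partial_x h (p, q) + w * partial_y h (p, q)) (at 0)"
proof -
  obtain a b where g: "smooth_germ_at (p, q) a" "smooth_germ_at (p, q) b"
    and ab: "a (p, q) = partial_x h (p, q)" "b (p, q) = partial_y h (p, q)"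
    and e: "\<forall>\<^sub>F z in nhds (p, q). h z = h (p, q) + (fst z - fst (p, q)) * a z + (snd z - snd (p, q)) * b z"
    by (rule Hadamard_2[OF h], rule that)
  have "((\<lambda>s. \<sigma> s / s * a (p + \<sigma> s, q + \<tau> s) + \<tau> s / s * b (p + \<sigma> s, q + \<tau> s)) \<longlongrightarrow> v * a (p, q) + w * b (p, q)) (at 0)"
    by (intro tendsto_add tendsto_mult \<sigma> \<tau> isCont_tendsto_compose[OF smooth_germ_at_isCont curve_tendsto] g)
  moreover have "\<forall>\<^sub>F s in at 0. \<sigma> s / s * a (p + \<sigma> s, q + \<tau> s) + \<tau> s / s * b (p + \<sigma> s, q + \<tau> s) = (h (p + \<sigma> s, q + \<tau> s) - h (p, q)) / s"
    using eventually_compose_filterlim[OF e curve_tendsto] by eventually_elim (simp add: add_divide_distrib)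
  ultimately show ?thesis unfolding ab by (rule Lim_transform_eventually)
qed

lemma second_order_limit:
  "((\<lambda>s. (f (p + \<sigma> s, q + \<tau> s) - f (p, q) - \<sigma> s * partial_x f (p, q) - \<tau> s * partial_y f (p, q)) / s\<^sup>2) \<longlongrightarrow>
    (partial_x (partial_x f) (p, q) * v\<^sup>2 + 2 * partial_x (partial_y f) (p, q) * v * w + partial_y (partial_y f) (p, q) * w\<^sup>2) / 2) (at 0)"
proof -
  have gf: "smooth_germ_at (p, q) f" by (rule smooth_germ_at_I[OF W c f])
  obtain a b where g: "smooth_germ_at (p, q) a" "smooth_germ_at (p, q) b"
    and ab: "a (p, q) = partial_x f (p, q)" "b (p, q) = partial_y f (p, q)"
    and e: "\<forall>\<^sub>F z in nhds (p, q). f z = f (p, q) + (fst z - fst (p, q)) * a z + (snd z - snd (p, q)) * b z"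
    by (rule Hadamard_2[OF gf], rule that)
  define Q where "Q v w = v * (v * partial_x a (p, q) + w * partial_y a (p, q)) + w * (v * partial_x b (p, q) + w * partial_y b (p, q))" for v w
  have lim: "((\<lambda>s. (f (p + \<sigma> s, q + \<tau> s) - f (p, q) - \<sigma> s * partial_x f (p, q) - \<tau> s * partial_y f (p, q)) / s\<^sup>2) \<longlongrightarrow> Q v w) (at 0)"
    if \<gamma>: "((\<lambda>s. (p + \<sigma> s, q + \<tau> s)) \<longlongrightarrow> (p, q)) (at 0)" and \<sigma>: "((\<lambda>s. \<sigma> s / s) \<longlongrightarrow> v) (at 0)" and \<tau>: "((\<lambda>s. \<tau> s / s) \<longlongrightarrow> w) (at 0)"
      and a: "((\<lambda>s. (a (p + \<sigma> s, q + \<tau> s) - a (p, q)) / s) \<longlongrightarrow> v * partial_x a (p, q) + w * partial_y a (p, q)) (at 0)"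
      and b: "((\<lambda>s. (b (p + \<sigma> s, q + \<tau> s) - b (p, q)) / s) \<longlongrightarrow> v * partial_x b (p, q) + w * partial_y b (p, q)) (at 0)"
    for \<sigma> \<tau> :: "real \<Rightarrow> real" and v w
  proof -
    have "((\<lambda>s. \<sigma> s / s * ((a (p + \<sigma> s, q + \<tau> s) - a (p, q)) / s) + \<tau> s / s * ((b (p + \<sigma> s, q + \<tau> s) - b (p, q)) / s)) \<longlongrightarrow> Q v w) (at 0)"
      unfolding Q_def by (intro tendsto_add tendsto_mult \<sigma> \<tau> a b)
    moreover have "\<forall>\<^sub>F s in at 0. \<sigma> s / s * ((a (p + \<sigma> s, q + \<tau> s) - a (p, q)) / s) + \<tau> s / s * ((b (p + \<sigma> s, q + \<tau> s) - b (p, q)) / s)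
        = (f (p + \<sigma> s, q + \<tau> s) - f (p, q) - \<sigma> s * partial_x f (p, q) - \<tau> s * partial_y f (p, q)) / s\<^sup>2"
      using eventually_compose_filterlim[OF e \<gamma>]
    proof eventually_elim
      case (elim s)
      have "f (p + \<sigma> s, q + \<tau> s) - f (p, q) - \<sigma> s * partial_x f (p, q) - \<tau> s * partial_y f (p, q)
          = \<sigma> s * (a (p + \<sigma> s, q + \<tau> s) - a (p, q)) + \<tau> s * (b (p + \<sigma> s, q + \<tau> s) - b (p, q))"
      proof -
        have e': "f (p + \<sigma> s, q + \<tau> s) = f (p, q) + \<sigma> s * a (p + \<sigma> s, q + \<tau> s) + \<tau> s * b (p + \<sigma> s, q + \<tau> s)"
          using elim unfolding fst_conv snd_conv add_diff_cancel_left' .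
        show ?thesis unfolding e' ab by algebra
      qed
      then show ?case by (simp only: add_divide_distrib power2_eq_square times_divide_times_eq)
    qed
    ultimately show ?thesis by (rule Lim_transform_eventually)
  qed
  \<comment> \<open>The quadratic form \<open>Q\<close> is identified by means of straight lines.\<close>
  have lines: "((\<lambda>s. s * x / s) \<longlongrightarrow> x) (at 0)" for x :: real
  proof -
    have "\<forall>\<^sub>F s in at (0::real). x = s * x / s" using eventually_neq_at_within[of 0] by eventually_elim simp
    with tendsto_const show ?thesis by (rule Lim_transform_eventually)
  qed
  have "((\<lambda>s. (p + s * v, q + s * w)) \<longlongrightarrow> (p + 0 * v, q + 0 * w)) (at 0)" by (intro tendsto_intros)
  then have \<gamma>: "((\<lambda>s. (p + s * v, q + s * w)) \<longlongrightarrow> (p, q)) (at 0)" by simp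
  have Qeq: "Q v w = (dir (v, w) ^^ 2) f (p, q) / 2"
    by (rule tendsto_unique[OF at_neq_bot lim[of "\<lambda>s. s * v" "\<lambda>s. s * w" v w, OF \<gamma> lines lines
        first_order_line[OF g(1)] first_order_line[OF g(2)]] second_order_line[OF W c f]])
  show ?thesis

    unfolding dir_2[OF W f c, symmetric] Qeq[symmetric] by (rule lim[of \<sigma> \<tau> v w, OF curve_tendsto \<sigma> \<tau> first_order_limit[OF g(1)] first_order_limit[OF g(2)]])
qed

end

lemma two_jet_reduced_iff:
  "two_jet_reduced f g \<longleftrightarrow>
    (f (0, 0) = 0 \<and> partial_x f (0, 0) = 0 \<and> partial_y f (0, 0) = 0 \<and>
      partial_x (partial_x f) (0, 0) = 0 \<and> partial_y (partial_y f) (0, 0) = 0) \<and>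
    (g (0, 0) = 0 \<and> partial_x g (0, 0) = 0 \<and> partial_y g (0, 0) = 0 \<and>
      partial_x (partial_y g) (0, 0) = 0 \<and> partial_y (partial_y g) (0, 0) = 0)"
proof -
  have e: "(\<forall>i j. i + j \<le> 2 \<and> (i, j) \<noteq> k \<longrightarrow> P i j) \<longleftrightarrow>
      (\<forall>(i, j) \<in> {(0, 0), (1, 0), (0, 1), (2, 0), (1, 1), (0, 2)} - {k}. P i j)" for k and P :: "nat \<Rightarrow> nat \<Rightarrow> bool"
  proof -
    have "i + j \<le> 2 \<longleftrightarrow> (i, j) \<in> {(0, 0), (1, 0), (0, 1), (2, 0), (1, 1), (0, 2)}" for i j :: nat
      by (simp, presburger)
    then show ?thesis by blast
  qed
  have s: "{(0, 0), (1, 0), (0, 1), (2, 0), (1, 1), (0, 2)} - {(1, 1)} = {(0, 0), (1, 0), (0, 1), (2, 0), (0, 2) :: nat \<times> nat}"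
    "{(0, 0), (1, 0), (0, 1), (2, 0), (1, 1), (0, 2)} - {(2, 0)} = {(0, 0), (1, 0), (0, 1), (1, 1), (0, 2) :: nat \<times> nat}"
    by auto
  show ?thesis unfolding two_jet_reduced_def e s by (simp add: taylor_coeff_def numeral_2_eq_2)
qed

section \<open>Fourth order along a null direction\<close>

lemma tendsto_compose_at_0:
  fixes R \<tau> :: "real \<Rightarrow> real"
  assumes R: "((\<lambda>h. R h / h ^ n) \<longlongrightarrow> 0) (at 0)" and \<tau>: "((\<lambda>s. \<tau> s / s) \<longlongrightarrow> t) (at 0)" and t: "t \<noteq> 0"
  shows "((\<lambda>s. R (\<tau> s) / s ^ n) \<longlongrightarrow> 0) (at 0)"
proof -
  have ne: "\<forall>\<^sub>F s in at 0. \<tau> s \<noteq> 0"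
    using tendsto_imp_eventually_ne[OF \<tau> t] by eventually_elim auto
  have "filterlim \<tau> (at 0) (at 0)"
    by (rule filterlim_atI[OF tendsto_0_if_quotient[OF \<tau>] ne])
  from tendsto_mult[OF filterlim_compose[OF R this] tendsto_power[OF \<tau>, of n]]
  have "((\<lambda>s. R (\<tau> s) / \<tau> s ^ n * (\<tau> s / s) ^ n) \<longlongrightarrow> 0) (at 0)" by simp
  moreover have "\<forall>\<^sub>F s in at 0. R (\<tau> s) / \<tau> s ^ n * (\<tau> s / s) ^ n = R (\<tau> s) / s ^ n"
    using ne by eventually_elim (simp add: power_divide)
  ultimately show ?thesis by (rule Lim_transform_eventually)
qed

text \<open>
  The mean value theorem in the first variable, with the intermediate points given as a function of \<open>s\<close>, so that
  limits along them can be formed.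
\<close>

lemma mean_value_x:
  assumes W: "open W" and c: "(p, q) \<in> W" and G: "smooth_on W G"
    and \<alpha>: "(\<alpha> \<longlongrightarrow> 0) (at (0::real))" and u: "(u \<longlongrightarrow> 0) (at 0)" and \<tau>: "(\<tau> \<longlongrightarrow> 0) (at 0)"
  obtains \<theta> where "\<And>s. \<bar>\<theta> s\<bar> \<le> 1"
    "\<forall>\<^sub>F s in at 0. G (p + (\<alpha> s + u s), q + \<tau> s) - G (p + \<alpha> s, q + \<tau> s) = u s * partial_x G (p + (\<alpha> s + \<theta> s * u s), q + \<tau> s)"
proof -
  obtain r where r: "r > 0" "ball (p, q) r \<subseteq> W" using W c open_contains_ball by blast
  let ?P = "\<lambda>s \<theta>. \<bar>\<theta>\<bar> \<le> 1 \<and> G (p + (\<alpha> s + u s), q + \<tau> s) - G (p + \<alpha> s, q + \<tau> s) = u s * partial_x G (p + (\<alpha> s + \<theta> * u s), q + \<tau> s)"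
  have "((\<lambda>s. (p + \<alpha> s, q + \<tau> s)) \<longlongrightarrow> (p + 0, q + 0)) (at 0)" "((\<lambda>s. (p + (\<alpha> s + u s), q + \<tau> s)) \<longlongrightarrow> (p + (0 + 0), q + 0)) (at 0)"
    by (intro tendsto_Pair tendsto_add tendsto_const \<alpha> u \<tau>)+
  then have "((\<lambda>s. (p + \<alpha> s, q + \<tau> s)) \<longlongrightarrow> (p, q)) (at 0)" "((\<lambda>s. (p + (\<alpha> s + u s), q + \<tau> s)) \<longlongrightarrow> (p, q)) (at 0)"
    by simp_all
  note lims = this
  have "\<forall>\<^sub>F s in at 0. (p + \<alpha> s, q + \<tau> s) \<in> ball (p, q) r" "\<forall>\<^sub>F s in at 0. (p + (\<alpha> s + u s), q + \<tau> s) \<in> ball (p, q) r"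
    using topological_tendstoD[OF lims(1) open_ball] topological_tendstoD[OF lims(2) open_ball] r(1) by simp_all
  then have ex: "\<forall>\<^sub>F s in at 0. \<exists>\<theta>. ?P s \<theta>"
  proof eventually_elim
    case (elim s)
    have seg: "(p + \<alpha> s + t * u s, q + \<tau> s + t * 0) \<in> W" if "0 \<le> t" "t \<le> 1" for t
    proof -
      have "(1 - t) *\<^sub>R (p + \<alpha> s, q + \<tau> s) + t *\<^sub>R (p + (\<alpha> s + u s), q + \<tau> s) \<in> ball (p, q) r"
        by (rule convexD[OF convex_ball elim]) (use that in auto)
      also have "(1 - t) *\<^sub>R (p + \<alpha> s, q + \<tau> s) + t *\<^sub>R (p + (\<alpha> s + u s), q + \<tau> s) = (p + \<alpha> s + t * u s, q + \<tau> s + t * 0)"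
        by (simp add: algebra_simps)
      finally show ?thesis using r(2) by blast
    qed
    obtain \<theta> where \<theta>: "0 < \<theta>" "\<theta> < 1"
      "G (p + \<alpha> s + 1 * u s, q + \<tau> s + 1 * 0) - G (p + \<alpha> s + 0 * u s, q + \<tau> s + 0 * 0) = (1 - 0) * dir (u s, 0) G (p + \<alpha> s + \<theta> * u s, q + \<tau> s + \<theta> * 0)"
      using MVT2[of 0 1 "\<lambda>t. G (p + \<alpha> s + t * u s, q + \<tau> s + t * 0)" "\<lambda>t. dir (u s, 0) G (p + \<alpha> s + t * u s, q + \<tau> s + t * 0)"]
        DERIV_dir[OF G seg] by auto
    then have "?P s \<theta>" by (simp add: dir_def add.assoc)
    then show ?case by blast
  qed
  define \<theta> where "\<theta> s = (if \<exists>\<theta>. ?P s \<theta> then SOME \<theta>. ?P s \<theta> else 0)" for s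
  have P: "?P s (\<theta> s)" if "\<exists>\<theta>. ?P s \<theta>" for s
    unfolding \<theta>_def if_P[OF that] by (rule someI_ex[OF that])
  have "\<bar>\<theta> s\<bar> \<le> 1" for s
  proof (cases "\<exists>\<theta>. ?P s \<theta>")
    case True
    from P[OF this] show ?thesis by (rule conjunct1)
  next
    case False
    then show ?thesis unfolding \<theta>_def if_not_P[OF False] by simp
  qed
  moreover have "\<forall>\<^sub>F s in at 0. G (p + (\<alpha> s + u s), q + \<tau> s) - G (p + \<alpha> s, q + \<tau> s) = u s * partial_x G (p + (\<alpha> s + \<theta> s * u s), q + \<tau> s)"
    using ex by (rule eventually_mono) (use P in blast)
  ultimately show ?thesis by (rule that)
qed

text \<open>
  The hypotheses \<open>k1\<close> and \<open>k2\<close> say that \<open>(m, 1)\<close> is in the kernel of the Hessian of \<open>G\<close>. The curve stays within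
  distance \<open>O(s\<^sup>3)\<close> of the line through \<open>(p, q)\<close> in this direction. The mean value theorem compares \<open>G\<close> with its value at
  a point of the line: the difference, after subtraction of the linear term, is the displacement \<open>u = O(s\<^sup>3)\<close> times an
  increment of \<open>partial_x G\<close>, which is \<open>o(s)\<close> because of the kernel. So up to \<open>o(s ^ 4)\<close> the Taylor polynomial
  along the line decides.
\<close>

lemma quartic_limit:
  assumes W: "open W" and c: "(p, q) \<in> W" and G: "smooth_on W G"
    and k1: "m * partial_x (partial_x G) (p, q) + partial_x (partial_y G) (p, q) = 0"
    and k2: "m * partial_x (partial_y G) (p, q) + partial_y (partial_y G) (p, q) = 0"
    and \<tau>: "((\<lambda>s. (\<tau> s - t * s) / s ^ 3) \<longlongrightarrow> l) (at 0)" and u: "((\<lambda>s. u s / s ^ 3) \<longlongrightarrow> l') (at 0)" and t: "t \<noteq> 0"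
  shows "((\<lambda>s. (G (p + (\<tau> s * m + u s), q + \<tau> s) - G (p, q) - (\<tau> s * m + u s) * partial_x G (p, q) - \<tau> s * partial_y G (p, q)
    - (dir (m, 1) ^^ 3) G (p, q) / 6 * t ^ 3 * s ^ 3) / s ^ 4) \<longlongrightarrow> (dir (m, 1) ^^ 4) G (p, q) / 24 * t ^ 4) (at 0)"
proof -
  define D where "D n = (dir (m, 1) ^^ n) G (p, q)" for n
  have id: "((\<lambda>s. s) \<longlongrightarrow> 0) (at (0::real))" by (rule tendsto_ident_at)
  have ne: "\<forall>\<^sub>F s in at (0::real). s \<noteq> 0" by (rule eventually_neq_at_within)
  have \<tau>1: "((\<lambda>s. \<tau> s / s) \<longlongrightarrow> t) (at 0)"
  proof -
    have "((\<lambda>s. (\<tau> s - t * s) / s ^ 3 * (s * s) + t) \<longlongrightarrow> l * (0 * 0) + t) (at 0)"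
      by (intro tendsto_add tendsto_mult \<tau> id tendsto_const)
    moreover have "\<forall>\<^sub>F s in at 0. (\<tau> s - t * s) / s ^ 3 * (s * s) + t = \<tau> s / s"
      using ne by eventually_elim (simp add: power3_eq_cube field_simps)
    ultimately show ?thesis using Lim_transform_eventually by fastforce
  qed
  have u1: "((\<lambda>s. u s / s) \<longlongrightarrow> 0) (at 0)"
  proof -
    have "((\<lambda>s. u s / s ^ 3 * (s * s)) \<longlongrightarrow> l' * (0 * 0)) (at 0)"
      by (intro tendsto_mult u id)
    moreover have "\<forall>\<^sub>F s in at 0. u s / s ^ 3 * (s * s) = u s / s"
      using ne by eventually_elim (simp add: power3_eq_cube field_simps)
    ultimately show ?thesis using Lim_transform_eventually by fastforce
  qed
  note \<tau>0 = tendsto_0_if_quotient[OF \<tau>1] and u0 = tendsto_0_if_quotient[OF u1]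
  have D0: "D 0 = G (p, q)" "D 1 = m * partial_x G (p, q) + partial_y G (p, q)" by (simp_all add: D_def dir_def)
  have D2: "D 2 = 0"
  proof -
    have "D 2 = m * (m * partial_x (partial_x G) (p, q) + partial_x (partial_y G) (p, q)) + (m * partial_x (partial_y G) (p, q) + partial_y (partial_y G) (p, q))"
      unfolding D_def dir_2[OF W G c] by (simp add: power2_eq_square algebra_simps)
    then show ?thesis unfolding k1 k2 by simp
  qed
  define R where "R h = G (p + h * m, q + h * 1) - (\<Sum>i\<le>4. D i / fact i * h ^ i)" for h
  have "((\<lambda>h. R h / h ^ 4) \<longlongrightarrow> 0) (at 0)"
    unfolding R_def D_def by (rule taylor_along_line[OF W c G])
  from tendsto_compose_at_0[OF this \<tau>1 t] have L1: "((\<lambda>s. R (\<tau> s) / s ^ 4) \<longlongrightarrow> 0) (at 0)" .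
  have Req: "G (p + h * m, q + h) = G (p, q) + (m * partial_x G (p, q) + partial_y G (p, q)) * h + D 3 / 6 * h ^ 3 + D 4 / 24 * h ^ 4 + R h" for h
  proof -
    have "(\<Sum>i\<le>4. D i / fact i * h ^ i) = D 0 + D 1 * h + D 2 / 2 * h ^ 2 + D 3 / 6 * h ^ 3 + D 4 / 24 * h ^ 4"
      by (simp add: eval_nat_numeral)
    then show ?thesis unfolding R_def D0 D2 by simp
  qed
  have "((\<lambda>s. \<tau> s * m) \<longlongrightarrow> 0 * m) (at 0)" by (intro tendsto_mult \<tau>0 tendsto_const)
  then have \<alpha>0: "((\<lambda>s. \<tau> s * m) \<longlongrightarrow> 0) (at 0)" by simp
  obtain \<theta> where \<theta>: "\<And>s. \<bar>\<theta> s\<bar> \<le> 1"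
    "\<forall>\<^sub>F s in at 0. G (p + (\<tau> s * m + u s), q + \<tau> s) - G (p + \<tau> s * m, q + \<tau> s) = u s * partial_x G (p + (\<tau> s * m + \<theta> s * u s), q + \<tau> s)"
    by (rule mean_value_x[OF W c G \<alpha>0 u0 \<tau>0], rule that)
  have "((\<lambda>s. \<theta> s * (u s / s)) \<longlongrightarrow> 0) (at 0)"
  proof (rule Lim_null_comparison)
    show "\<forall>\<^sub>F s in at 0. norm (\<theta> s * (u s / s)) \<le> \<bar>u s / s\<bar>"
    proof (intro always_eventually allI)
      fix s
      show "norm (\<theta> s * (u s / s)) \<le> \<bar>u s / s\<bar>"
        using mult_right_mono[OF \<theta>(1)[of s] abs_ge_zero[of "u s / s"]] unfolding real_norm_def abs_mult by simp
    qed
    show "((\<lambda>s. \<bar>u s / s\<bar>) \<longlongrightarrow> 0) (at 0)" using u1 by (rule tendsto_rabs_zero)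
  qed
  from tendsto_add[OF tendsto_mult[OF \<tau>1 tendsto_const[of m]] this]
  have \<sigma>1: "((\<lambda>s. (\<tau> s * m + \<theta> s * u s) / s) \<longlongrightarrow> t * m) (at 0)" by (simp add: add_divide_distrib)
  have gx: "smooth_germ_at (p, q) (partial_x G)" by (rule smooth_germ_at_I[OF W c smooth_on_partial_x[OF G]])
  have "t * m * partial_x (partial_x G) (p, q) + t * partial_y (partial_x G) (p, q)
      = t * (m * partial_x (partial_x G) (p, q) + partial_x (partial_y G) (p, q))"
    unfolding partial_x_partial_y_commute[OF W G c] by (simp add: algebra_simps)
  then have null: "t * m * partial_x (partial_x G) (p, q) + t * partial_y (partial_x G) (p, q) = 0" unfolding k1 by simp
  have L2: "((\<lambda>s. u s / s ^ 3 * ((partial_x G (p + (\<tau> s * m + \<theta> s * u s), q + \<tau> s) - partial_x G (p, q)) / s)) \<longlongrightarrow> l' * 0) (at 0)"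
    by (intro tendsto_mult u first_order_limit[OF W G c \<sigma>1 \<tau>1 gx, unfolded null])
  have L3: "((\<lambda>s. D 3 / 6 * (((\<tau> s - t * s) / s ^ 3) * s * ((\<tau> s / s)\<^sup>2 + \<tau> s / s * t + t\<^sup>2)) + D 4 / 24 * (\<tau> s / s) ^ 4)
      \<longlongrightarrow> D 3 / 6 * (l * 0 * (t\<^sup>2 + t * t + t\<^sup>2)) + D 4 / 24 * t ^ 4) (at 0)"
    by (intro tendsto_add tendsto_mult tendsto_const tendsto_power \<tau> \<tau>1 id)
  have alg: "a / s ^ 3 * (b / s) + (d * (((k - t * s) / s ^ 3) * s * ((k / s)\<^sup>2 + k / s * t + t\<^sup>2)) + e * (k / s) ^ 4) + r / s ^ 4
      = (a * b + d * (k ^ 3 - t ^ 3 * s ^ 3) + e * k ^ 4 + r) / s ^ 4" if "s \<noteq> 0" for a b d e k r s :: real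
  proof -
    have f: "((k - t * s) / s ^ 3) * s * ((k / s)\<^sup>2 + k / s * t + t\<^sup>2) = (k ^ 3 - t ^ 3 * s ^ 3) / s ^ 4"
      using that by (simp add: field_simps power2_eq_square power3_eq_cube power4_eq_xxxx)
    have "a / s ^ 3 * (b / s) = a * b / s ^ 4" using that by (simp add: power3_eq_cube power4_eq_xxxx)
    then show ?thesis unfolding f by (simp add: power_divide add_divide_distrib)
  qed
  from tendsto_add[OF tendsto_add[OF L2 L3] L1]
  have "((\<lambda>s. u s / s ^ 3 * ((partial_x G (p + (\<tau> s * m + \<theta> s * u s), q + \<tau> s) - partial_x G (p, q)) / s)
      + (D 3 / 6 * (((\<tau> s - t * s) / s ^ 3) * s * ((\<tau> s / s)\<^sup>2 + \<tau> s / s * t + t\<^sup>2)) + D 4 / 24 * (\<tau> s / s) ^ 4) + R (\<tau> s) / s ^ 4)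
      \<longlongrightarrow> D 4 / 24 * t ^ 4) (at 0)" by simp
  moreover have "\<forall>\<^sub>F s in at 0. u s / s ^ 3 * ((partial_x G (p + (\<tau> s * m + \<theta> s * u s), q + \<tau> s) - partial_x G (p, q)) / s)
      + (D 3 / 6 * (((\<tau> s - t * s) / s ^ 3) * s * ((\<tau> s / s)\<^sup>2 + \<tau> s / s * t + t\<^sup>2)) + D 4 / 24 * (\<tau> s / s) ^ 4) + R (\<tau> s) / s ^ 4
      = (G (p + (\<tau> s * m + u s), q + \<tau> s) - G (p, q) - (\<tau> s * m + u s) * partial_x G (p, q) - \<tau> s * partial_y G (p, q)
        - D 3 / 6 * t ^ 3 * s ^ 3) / s ^ 4"
    using \<theta>(2) ne
  proof eventually_elim
    case (elim s)
    have "G (p + (\<tau> s * m + u s), q + \<tau> s) = G (p + \<tau> s * m, q + \<tau> s) + u s * partial_x G (p + (\<tau> s * m + \<theta> s * u s), q + \<tau> s)"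
      using elim(1) by simp
    then show ?case unfolding alg[OF elim(2)] Req by (simp add: algebra_simps)
  qed
  ultimately show ?thesis unfolding D_def by (rule Lim_transform_eventually)
qed

section \<open>Invariance of the sign under affine transformations\<close>

text \<open>
  If \<open>a 1, \<dots>, a 4\<close> is a row of the matrix of a linear map, this is the corresponding coordinate of the image of the
  point \<open>(fr z, gr z, z)\<close> of the reduced surface.
\<close>

definition frame_comb :: "(nat \<Rightarrow> real) \<Rightarrow> (real \<times> real \<Rightarrow> real) \<Rightarrow> (real \<times> real \<Rightarrow> real) \<Rightarrow> real \<times> real \<Rightarrow> real" where
  "frame_comb a fr gr z = fr z * a 1 + gr z * a 2 + fst z * a 3 + snd z * a 4"

text \<open>
  The inverse of the affine transformation takes the points of the reduced surface near the origin to points of \<open>M\<close>.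
  The rows \<open>a, b, c, d\<close> of its linear part belong to the four coordinates of the ambient space of \<open>M\<close>; the last two give the
  parameters. The last conclusion is its injectivity on the tangent plane of the reduced surface.
\<close>

lemma reduction_equations:
  assumes "reduction_at W f g (p, q) fr gr"
  obtains W' a b c d where "open W'" "(0, 0) \<in> W'" "smooth_on W' fr" "smooth_on W' gr"
    "\<forall>\<^sub>F z in nhds (0, 0). f (p + frame_comb c fr gr z, q + frame_comb d fr gr z) - f (p, q) = frame_comb a fr gr z"
    "\<forall>\<^sub>F z in nhds (0, 0). g (p + frame_comb c fr gr z, q + frame_comb d fr gr z) - g (p, q) = frame_comb b fr gr z"
    "\<And>x y. x * a 3 + y * a 4 = 0 \<Longrightarrow> x * b 3 + y * b 4 = 0 \<Longrightarrow> x * c 3 + y * c 4 = 0 \<Longrightarrow> x * d 3 + y * d 4 = 0 \<Longrightarrow> x = 0 \<and> y = 0"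
proof -
  obtain A W' N where jet: "two_jet_reduced fr gr" and A: "affine_transformation A" "A (surface_param f g (p, q)) = 0"
    and W': "open W'" "(0, 0) \<in> W'" "smooth_on W' fr" "smooth_on W' gr" and N: "open N" "0 \<in> N"
    and im: "A ` (surface_param f g ` W) \<inter> N = surface_param fr gr ` W' \<inter> N"
    using assms unfolding reduction_at_def by blast
  obtain L e0 where L: "linear L" "bij L" and Aeq: "A = (\<lambda>z. L z + e0)"
    using A(1) unfolding affine_transformation_def by blast
  obtain M where M: "linear M" "\<And>z. M (L z) = z" "\<And>z. L (M z) = z"
  proof -
    have "linear (inv L)" using L by (simp add: inj_linear_imp_inv_linear bij_is_inj)
    then show ?thesis using that L(2) by (simp add: bij_is_inj bij_is_surj surj_f_inv_f)
  qed
  define e where "e i = M (if i = 1 then (1, 0, 0, 0) else if i = 2 then (0, 1, 0, 0) else if i = 3 then (0, 0, 1, 0) else (0, 0, 0, 1))" for i :: nat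
  define a where "a = (\<lambda>i. fst (e i))"
  define b where "b = (\<lambda>i. fst (snd (e i)))"
  define c where "c = (\<lambda>i. fst (snd (snd (e i))))"
  define d where "d = (\<lambda>i. snd (snd (snd (e i))))"
  have Mexp: "M (n1, n2, x, y) = (n1 * a 1 + n2 * a 2 + x * a 3 + y * a 4, n1 * b 1 + n2 * b 2 + x * b 3 + y * b 4,
      n1 * c 1 + n2 * c 2 + x * c 3 + y * c 4, n1 * d 1 + n2 * d 2 + x * d 3 + y * d 4)" for n1 n2 x y
  proof -
    have "(n1, n2, x, y) = n1 *\<^sub>R (1, 0, 0, 0) + n2 *\<^sub>R (0, 1, 0, 0) + x *\<^sub>R (0, 0, 1, 0) + y *\<^sub>R (0, 0, 0, 1)" by simp
    then have "M (n1, n2, x, y) = n1 *\<^sub>R e 1 + n2 *\<^sub>R e 2 + x *\<^sub>R e 3 + y *\<^sub>R e 4"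
      by (simp only: linear_add[OF M(1)] linear_scale[OF M(1)]) (simp add: e_def)
    moreover have "e i = (a i, b i, c i, d i)" for i by (simp add: a_def b_def c_def d_def)
    ultimately show ?thesis by simp
  qed
  have ev: "\<forall>\<^sub>F z in nhds (0, 0). f (p + frame_comb c fr gr z, q + frame_comb d fr gr z) - f (p, q) = frame_comb a fr gr z \<and>
     g (p + frame_comb c fr gr z, q + frame_comb d fr gr z) - g (p, q) = frame_comb b fr gr z"
  proof -
    have 0: "surface_param fr gr (0, 0) = 0"
      using jet unfolding two_jet_reduced_iff surface_param_def by (simp add: zero_prod_def)
    have "isCont (\<lambda>z. (fr z, gr z, fst z, snd z)) (0, 0)"
      by (intro continuous_Pair smooth_on_isCont[OF W'(3,2)] smooth_on_isCont[OF W'(4,2)] continuous_fst continuous_snd continuous_ident)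
    moreover have "(\<lambda>z. (fr z, gr z, fst z, snd z)) = surface_param fr gr" unfolding surface_param_def by auto
    ultimately have "isCont (surface_param fr gr) (0, 0)" by simp
    then have "(surface_param fr gr \<longlongrightarrow> 0) (at (0, 0))" unfolding isCont_def 0 .
    then have "(surface_param fr gr \<longlongrightarrow> 0) (nhds (0, 0))" using 0 by (simp add: tendsto_nhds_iff)
    then have "\<forall>\<^sub>F z in nhds (0, 0). surface_param fr gr z \<in> N" using N by (rule topological_tendstoD)
    moreover have "\<forall>\<^sub>F z in nhds (0, 0). z \<in> W'" using W'(1,2) by (rule eventually_nhds_in_open)
    ultimately show ?thesis
    proof eventually_elim
      case (elim z)
      then have "surface_param fr gr z \<in> A ` (surface_param f g ` W)" using im by blast
      then obtain w where w: "w \<in> W" "surface_param fr gr z = A (surface_param f g w)" by blast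
      have "L (surface_param f g w - surface_param f g (p, q)) = surface_param fr gr z"
      proof -
        have "e0 = - L (surface_param f g (p, q))"
          using A(2) unfolding Aeq eq_neg_iff_add_eq_0 by (simp only: add.commute)
        then show ?thesis unfolding linear_diff[OF L(1)] w(2) Aeq by simp
      qed
      then have "surface_param f g w - surface_param f g (p, q) = M (surface_param fr gr z)" by (metis M(2))
      then have eqs: "f w - f (p, q) = frame_comb a fr gr z" "g w - g (p, q) = frame_comb b fr gr z"
          "fst w - p = frame_comb c fr gr z" "snd w - q = frame_comb d fr gr z"
        by (cases w; cases z; simp add: surface_param_def Mexp frame_comb_def)+
      have "w = (p + frame_comb c fr gr z, q + frame_comb d fr gr z)" unfolding eqs(3,4)[symmetric] by simp
      then show ?case using eqs(1,2) by simp
    qed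
  qed
  show ?thesis
  proof (rule that[OF W', of c d a b])
    fix x y
    assume "x * a 3 + y * a 4 = 0" "x * b 3 + y * b 4 = 0" "x * c 3 + y * c 4 = 0" "x * d 3 + y * d 4 = 0"
    then have "M (0, 0, x, y) = 0" unfolding Mexp by (simp add: zero_prod_def)
    then have "(0, 0, x, y) = (0 :: real \<times> real \<times> real \<times> real)" using M(3) linear_0[OF L(1)] by metis
    then show "x = 0 \<and> y = 0" by (simp add: zero_prod_def)
  qed (use ev in \<open>simp_all add: eventually_conj_iff\<close>)
qed

lemma reduced_along_line:
  assumes W': "open W'" "(0, 0) \<in> W'" "smooth_on W' fr" "smooth_on W' gr" and jet: "two_jet_reduced fr gr"
  shows "((\<lambda>s. fr (s * x, s * y) / s\<^sup>2) \<longlongrightarrow> taylor_coeff fr 1 1 * x * y) (at 0)"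
    and "((\<lambda>s. gr (s * x, s * y) / s\<^sup>2) \<longlongrightarrow> taylor_coeff gr 2 0 * x\<^sup>2) (at 0)"
proof -
  have n: "fr (0, 0) = 0" "partial_x fr (0, 0) = 0" "partial_y fr (0, 0) = 0" "partial_x (partial_x fr) (0, 0) = 0" "partial_y (partial_y fr) (0, 0) = 0"
    "gr (0, 0) = 0" "partial_x gr (0, 0) = 0" "partial_y gr (0, 0) = 0" "partial_x (partial_y gr) (0, 0) = 0" "partial_y (partial_y gr) (0, 0) = 0"
    using jet unfolding two_jet_reduced_iff by blast+
  have "(dir (x, y) ^^ 2) fr (0, 0) / 2 = taylor_coeff fr 1 1 * x * y" "(dir (x, y) ^^ 2) gr (0, 0) / 2 = taylor_coeff gr 2 0 * x\<^sup>2"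
    unfolding dir_2[OF W'(1,3,2)] dir_2[OF W'(1,4,2)] n by (simp_all add: taylor_coeff_def numeral_2_eq_2)
  then show "((\<lambda>s. fr (s * x, s * y) / s\<^sup>2) \<longlongrightarrow> taylor_coeff fr 1 1 * x * y) (at 0)"
    "((\<lambda>s. gr (s * x, s * y) / s\<^sup>2) \<longlongrightarrow> taylor_coeff gr 2 0 * x\<^sup>2) (at 0)"
    using second_order_line[OF W'(1,2,3), of x y] second_order_line[OF W'(1,2,4), of x y] by (simp_all add: n)
qed

lemma frame_comb_along_line:
  assumes "open W'" "(0, 0) \<in> W'" "smooth_on W' fr" "smooth_on W' gr" "two_jet_reduced fr gr"
  shows "((\<lambda>s. frame_comb a fr gr (s * x, s * y) / s) \<longlongrightarrow> x * a 3 + y * a 4) (at 0)"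
proof -
  have "((\<lambda>s. fr (s * x, s * y) / s\<^sup>2 * s * a 1 + gr (s * x, s * y) / s\<^sup>2 * s * a 2 + (x * a 3 + y * a 4))
      \<longlongrightarrow> taylor_coeff fr 1 1 * x * y * 0 * a 1 + taylor_coeff gr 2 0 * x\<^sup>2 * 0 * a 2 + (x * a 3 + y * a 4)) (at 0)"
    by (intro tendsto_add tendsto_mult tendsto_const tendsto_ident_at reduced_along_line[OF assms])
  then have "((\<lambda>s. fr (s * x, s * y) / s\<^sup>2 * s * a 1 + gr (s * x, s * y) / s\<^sup>2 * s * a 2 + (x * a 3 + y * a 4)) \<longlongrightarrow> x * a 3 + y * a 4) (at 0)"
    by simp
  moreover have "\<forall>\<^sub>F s in at 0. fr (s * x, s * y) / s\<^sup>2 * s * a 1 + gr (s * x, s * y) / s\<^sup>2 * s * a 2 + (x * a 3 + y * a 4) = frame_comb a fr gr (s * x, s * y) / s"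
    using eventually_neq_at_within[of 0] by eventually_elim (simp add: frame_comb_def power2_eq_square add_divide_distrib)
  ultimately show ?thesis by (rule Lim_transform_eventually)
qed

text \<open>
  Comparison of the coefficients of \<open>s\<close> and \<open>s\<^sup>2\<close> after the substitution \<open>z = (s x, s y)\<close>. The numbers \<open>r i\<close> measure
  how far the \<open>i\<close>-th basis vector is mapped out of the tangent plane of the graph of \<open>f\<close>.
\<close>

lemma reduction_second_order:
  assumes W: "open W" and c0: "(p, q) \<in> W" and f: "smooth_on W f"
    and W': "open W'" "(0, 0) \<in> W'" "smooth_on W' fr" "smooth_on W' gr" and jet: "two_jet_reduced fr gr"
    and E: "\<forall>\<^sub>F z in nhds (0, 0). f (p + frame_comb c fr gr z, q + frame_comb d fr gr z) - f (p, q) = frame_comb a fr gr z"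
  defines "r \<equiv> \<lambda>i. a i - c i * partial_x f (p, q) - d i * partial_y f (p, q)"
  shows "r 3 = 0" "r 4 = 0"
    "partial_x (partial_x f) (p, q) * (x * c 3 + y * c 4)\<^sup>2 + 2 * partial_x (partial_y f) (p, q) * (x * c 3 + y * c 4) * (x * d 3 + y * d 4)
      + partial_y (partial_y f) (p, q) * (x * d 3 + y * d 4)\<^sup>2 = 2 * (r 1 * (taylor_coeff fr 1 1 * x * y) + r 2 * (taylor_coeff gr 2 0 * x\<^sup>2))"
proof -
  note lim = frame_comb_along_line[OF W' jet]
  have E': "\<forall>\<^sub>F s in at 0. f (p + frame_comb c fr gr (s * x, s * y), q + frame_comb d fr gr (s * x, s * y)) - f (p, q) = frame_comb a fr gr (s * x, s * y)" for x y
  proof (rule eventually_compose_filterlim[OF E])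
    have "((\<lambda>s. (s * x, s * y)) \<longlongrightarrow> (0 * x, 0 * y)) (at 0)" by (intro tendsto_intros)
    then show "((\<lambda>s. (s * x, s * y)) \<longlongrightarrow> (0, 0)) (at 0)" by simp
  qed
  have gf: "smooth_germ_at (p, q) f" by (rule smooth_germ_at_I[OF W c0 f])
  have first: "x * a 3 + y * a 4 = (x * c 3 + y * c 4) * partial_x f (p, q) + (x * d 3 + y * d 4) * partial_y f (p, q)" for x y
  proof (rule tendsto_unique[OF at_neq_bot lim])
    have "\<forall>\<^sub>F s in at 0. (f (p + frame_comb c fr gr (s * x, s * y), q + frame_comb d fr gr (s * x, s * y)) - f (p, q)) / s = frame_comb a fr gr (s * x, s * y) / s"
      using E'[of x y] by eventually_elim simp
    with first_order_limit[OF W f c0 lim[of c x y] lim[of d x y] gf]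
    show "((\<lambda>s. frame_comb a fr gr (s * x, s * y) / s) \<longlongrightarrow> (x * c 3 + y * c 4) * partial_x f (p, q) + (x * d 3 + y * d 4) * partial_y f (p, q)) (at 0)"
      by (rule Lim_transform_eventually)
  qed
  show r3: "r 3 = 0" and r4: "r 4 = 0" using first[of 1 0] first[of 0 1] by (simp_all add: r_def)
  have "(partial_x (partial_x f) (p, q) * (x * c 3 + y * c 4)\<^sup>2 + 2 * partial_x (partial_y f) (p, q) * (x * c 3 + y * c 4) * (x * d 3 + y * d 4)
      + partial_y (partial_y f) (p, q) * (x * d 3 + y * d 4)\<^sup>2) / 2 = taylor_coeff fr 1 1 * x * y * r 1 + taylor_coeff gr 2 0 * x\<^sup>2 * r 2"
  proof (rule tendsto_unique[OF at_neq_bot second_order_limit[OF W f c0 lim[of c x y] lim[of d x y]]])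
    have "((\<lambda>s. fr (s * x, s * y) / s\<^sup>2 * r 1 + gr (s * x, s * y) / s\<^sup>2 * r 2) \<longlongrightarrow> taylor_coeff fr 1 1 * x * y * r 1 + taylor_coeff gr 2 0 * x\<^sup>2 * r 2) (at 0)"
      by (intro tendsto_add tendsto_mult tendsto_const reduced_along_line[OF W' jet])
    moreover have "\<forall>\<^sub>F s in at 0. fr (s * x, s * y) / s\<^sup>2 * r 1 + gr (s * x, s * y) / s\<^sup>2 * r 2
      = (f (p + frame_comb c fr gr (s * x, s * y), q + frame_comb d fr gr (s * x, s * y)) - f (p, q) - frame_comb c fr gr (s * x, s * y) * partial_x f (p, q)
          - frame_comb d fr gr (s * x, s * y) * partial_y f (p, q)) / s\<^sup>2"
      using E'[of x y]
    proof eventually_elim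
      case (elim s)
      have "frame_comb a fr gr (s * x, s * y) - frame_comb c fr gr (s * x, s * y) * partial_x f (p, q) - frame_comb d fr gr (s * x, s * y) * partial_y f (p, q)
         = fr (s * x, s * y) * r 1 + gr (s * x, s * y) * r 2 + s * x * r 3 + s * y * r 4"
        by (simp add: frame_comb_def r_def algebra_simps)
      then show ?case unfolding elim r3 r4 by (simp add: add_divide_distrib)
    qed
    ultimately show "((\<lambda>s. (f (p + frame_comb c fr gr (s * x, s * y), q + frame_comb d fr gr (s * x, s * y)) - f (p, q) - frame_comb c fr gr (s * x, s * y) * partial_x f (p, q)
          - frame_comb d fr gr (s * x, s * y) * partial_y f (p, q)) / s\<^sup>2) \<longlongrightarrow> taylor_coeff fr 1 1 * x * y * r 1 + taylor_coeff gr 2 0 * x\<^sup>2 * r 2) (at 0)"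
      by (rule Lim_transform_eventually)
  qed
  then show "partial_x (partial_x f) (p, q) * (x * c 3 + y * c 4)\<^sup>2 + 2 * partial_x (partial_y f) (p, q) * (x * c 3 + y * c 4) * (x * d 3 + y * d 4)
      + partial_y (partial_y f) (p, q) * (x * d 3 + y * d 4)\<^sup>2 = 2 * (r 1 * (taylor_coeff fr 1 1 * x * y) + r 2 * (taylor_coeff gr 2 0 * x\<^sup>2))"
    by (simp add: mult.commute)
qed

lemma cubic_along_y_axis:
  assumes S: "open S" "(0, 0) \<in> S" "smooth_on S h"
    and 0: "h (0, 0) = 0" "partial_y h (0, 0) = 0" "partial_y (partial_y h) (0, 0) = 0"
  shows "((\<lambda>s. h (s * 0, s * 1) / s ^ 3) \<longlongrightarrow> (dir (0, 1) ^^ 3) h (0, 0) / 6) (at 0)"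
    and "((\<lambda>s. (h (s * 0, s * 1) - (dir (0, 1) ^^ 3) h (0, 0) / 6 * s ^ 3 - (dir (0, 1) ^^ 4) h (0, 0) / 24 * s ^ 4) / s ^ 4) \<longlongrightarrow> 0) (at 0)"
proof -
  define D where "D n = (dir (0, 1) ^^ n) h (0, 0)" for n
  have D: "D 0 = 0" "D 1 = 0" "D 2 = 0"
    using 0 unfolding D_def dir_0_1_iterate by (simp_all add: numeral_2_eq_2)
  have s3: "(\<Sum>i\<le>3. D i / fact i * s ^ i) = D 3 / 6 * s ^ 3" and s4: "(\<Sum>i\<le>4. D i / fact i * s ^ i) = D 3 / 6 * s ^ 3 + D 4 / 24 * s ^ 4" for s
    using D by (simp_all add: eval_nat_numeral)
  have "((\<lambda>s. (h (0 + s * 0, 0 + s * 1) - (\<Sum>i\<le>3. D i / fact i * s ^ i)) / s ^ 3 + D 3 / 6) \<longlongrightarrow> 0 + D 3 / 6) (at 0)"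
    unfolding D_def by (intro tendsto_add tendsto_const taylor_along_line[OF S])
  moreover have "\<forall>\<^sub>F s in at 0. (h (0 + s * 0, 0 + s * 1) - (\<Sum>i\<le>3. D i / fact i * s ^ i)) / s ^ 3 + D 3 / 6 = h (s * 0, s * 1) / s ^ 3"
    unfolding s3 using eventually_neq_at_within[of 0] by eventually_elim (simp add: diff_divide_distrib)
  ultimately show "((\<lambda>s. h (s * 0, s * 1) / s ^ 3) \<longlongrightarrow> (dir (0, 1) ^^ 3) h (0, 0) / 6) (at 0)"
    unfolding D_def add_0 by (rule Lim_transform_eventually)
  have "((\<lambda>s. (h (0 + s * 0, 0 + s * 1) - (\<Sum>i\<le>4. D i / fact i * s ^ i)) / s ^ 4) \<longlongrightarrow> 0) (at 0)"
    unfolding D_def by (rule taylor_along_line[OF S])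
  then show "((\<lambda>s. (h (s * 0, s * 1) - (dir (0, 1) ^^ 3) h (0, 0) / 6 * s ^ 3 - (dir (0, 1) ^^ 4) h (0, 0) / 24 * s ^ 4) / s ^ 4) \<longlongrightarrow> 0) (at 0)"
    unfolding s4 add_0 diff_diff_eq unfolding D_def .
qed

text \<open>
  The sign is the same for all reductions. By \<open>f0\<close>, \<open>k1\<close> and \<open>k2\<close>, the direction \<open>(m, 1)\<close> is isotropic for the Hessian of \<open>f\<close>
  and in the kernel of that of \<open>G\<close>. The transformation takes the \<open>y\<close>-axis of the reduced surface to this direction and turns the
  equation for \<open>G\<close> into \<open>rG 2 * gr\<close> plus a multiple of \<open>fr\<close>, and this multiple is zero because \<open>fr\<close> has a term
  \<open>x * y\<close>, by \<open>f1\<close>, and the quadratic part of \<open>G\<close> in these coordinates has none. Comparing the coefficients of \<open>x\<^sup>2\<close>, and those of \<open>y ^ 4\<close> along the \<open>y\<close>-axis,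
  shows that the two coefficients of \<open>gr\<close>, multiplied by \<open>rG 2\<close>, are positive multiples of \<open>partial_x (partial_x G) (p, q)\<close> and of the fourth derivative of \<open>G\<close>
  in the null direction.
\<close>

lemma reduced_sign:
  assumes W: "open W" and c0: "(p, q) \<in> W" and f: "smooth_on W f" and G: "smooth_on W G"
    and W': "open W'" "(0, 0) \<in> W'" "smooth_on W' fr" "smooth_on W' gr" and jet: "two_jet_reduced fr gr"
    and Ef: "\<forall>\<^sub>F z in nhds (0, 0). f (p + frame_comb c fr gr z, q + frame_comb d fr gr z) - f (p, q) = frame_comb a fr gr z"
    and EG: "\<forall>\<^sub>F z in nhds (0, 0). G (p + frame_comb c fr gr z, q + frame_comb d fr gr z) - G (p, q) = frame_comb b fr gr z"
    and inj: "\<And>x y. x * a 3 + y * a 4 = 0 \<Longrightarrow> x * b 3 + y * b 4 = 0 \<Longrightarrow> x * c 3 + y * c 4 = 0 \<Longrightarrow> x * d 3 + y * d 4 = 0 \<Longrightarrow> x = 0 \<and> y = 0"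
    and f0: "partial_x (partial_x f) (p, q) * m\<^sup>2 + 2 * partial_x (partial_y f) (p, q) * m + partial_y (partial_y f) (p, q) = 0"
    and f1: "partial_x (partial_x f) (p, q) * m + partial_x (partial_y f) (p, q) \<noteq> 0"
    and k1: "m * partial_x (partial_x G) (p, q) + partial_x (partial_y G) (p, q) = 0"
    and k2: "m * partial_x (partial_y G) (p, q) + partial_y (partial_y G) (p, q) = 0"
    and G0: "partial_x (partial_x G) (p, q) \<noteq> 0" and \<gamma>0: "(dir (m, 1) ^^ 4) G (p, q) \<noteq> 0"
  shows "sgn (taylor_coeff gr 2 0 * taylor_coeff gr 0 4) = sgn (partial_x (partial_x G) (p, q) * (dir (m, 1) ^^ 4) G (p, q))"
proof -
  define A B C where "A = partial_x (partial_x f) (p, q)" and "B = partial_x (partial_y f) (p, q)" and "C = partial_y (partial_y f) (p, q)"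
  define GA GB GC where "GA = partial_x (partial_x G) (p, q)" and "GB = partial_x (partial_y G) (p, q)" and "GC = partial_y (partial_y G) (p, q)"
  note defs = A_def[symmetric] B_def[symmetric] C_def[symmetric] GA_def[symmetric] GB_def[symmetric] GC_def[symmetric]
  define F11 G20 where "F11 = taylor_coeff fr 1 1" and "G20 = taylor_coeff gr 2 0"
  define rf where "rf = (\<lambda>i. a i - c i * partial_x f (p, q) - d i * partial_y f (p, q))"
  define rG where "rG = (\<lambda>i. b i - c i * partial_x G (p, q) - d i * partial_y G (p, q))"
  have ri: "a i - c i * partial_x f (p, q) - d i * partial_y f (p, q) = rf i" "b i - c i * partial_x G (p, q) - d i * partial_y G (p, q) = rG i" for i
    by (simp_all add: rf_def rG_def)
  note hf = reduction_second_order[OF W c0 f W' jet Ef, unfolded ri defs F11_def[symmetric] G20_def[symmetric]]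
  note hG = reduction_second_order[OF W c0 G W' jet EG, unfolded ri defs F11_def[symmetric] G20_def[symmetric]]
  have C: "C = - A * m\<^sup>2 - 2 * B * m" using f0 unfolding defs by algebra
  have GB: "GB = - m * GA" using k1 unfolding defs by algebra
  have GC: "GC = m\<^sup>2 * GA" using k2 unfolding defs GB by algebra
  have a3: "a 3 = c 3 * partial_x f (p, q) + d 3 * partial_y f (p, q)" and a4: "a 4 = c 4 * partial_x f (p, q) + d 4 * partial_y f (p, q)"
    using hf(1,2) by (simp_all add: rf_def)
  have b3: "b 3 = c 3 * partial_x G (p, q) + d 3 * partial_y G (p, q)" and b4: "b 4 = c 4 * partial_x G (p, q) + d 4 * partial_y G (p, q)"
    using hG(1,2) by (simp_all add: rG_def)
  \<comment> \<open>Neither \<open>fr\<close> nor \<open>gr\<close> has a term \<open>y\<^sup>2\<close>, and the quadratic part of \<open>G\<close> is a multiple of a square.\<close>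
  have c4: "c 4 = m * d 4"
  proof -
    have "GA * (c 4 - m * d 4)\<^sup>2 = 0" using hG(3)[of 0 1] unfolding GB GC by (simp add: power2_eq_square algebra_simps)
    then show ?thesis using G0 unfolding defs by simp
  qed
  have d4: "d 4 \<noteq> 0"
  proof
    assume "d 4 = 0"
    then show False using inj[of 0 1] c4 a4 b4 by simp
  qed
  have \<tau>0: "c 3 - m * d 3 \<noteq> 0"
  proof
    assume "c 3 - m * d 3 = 0"
    then have c3: "c 3 = m * d 3" by simp
    have "d 4 = 0 \<and> - d 3 = 0" by (rule inj) (simp_all add: a3 a4 b3 b4 c3 c4 algebra_simps)
    then show False using d4 by simp
  qed
  have "rf 1 * F11 = d 4 * (A * m + B) * (c 3 - m * d 3)"
    using hf(3)[of 1 1] hf(3)[of 1 0] hf(3)[of 0 1] unfolding C c4 mult_1 mult_1_right mult_zero_left mult_zero_right power_one zero_power2 add_0 add_0_right by algebra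
  moreover have "d 4 * (A * m + B) * (c 3 - m * d 3) \<noteq> 0" using d4 f1 \<tau>0 unfolding defs by simp
  ultimately have F11: "F11 \<noteq> 0" by auto
  have "rG 1 * F11 = 0" using hG(3)[of 1 1] hG(3)[of 1 0] hG(3)[of 0 1] unfolding GB GC c4 mult_1 mult_1_right mult_zero_left mult_zero_right power_one zero_power2 add_0 add_0_right by algebra
  then have rG1: "rG 1 = 0" using F11 by simp
  have rG2: "GA * (c 3 - m * d 3)\<^sup>2 = 2 * (rG 2 * G20)"
    using hG(3)[of 1 0] unfolding GB GC rG1 by (simp add: power2_eq_square algebra_simps)
  \<comment> \<open>The \<open>y\<close>-axis of the reduced surface: \<open>\<tau>\<close> is the second parameter of its image, and \<open>u\<close> the distance of the image
      from the null line, measured in the first coordinate. Both expansions have no quadratic term.\<close>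
  have n: "fr (0, 0) = 0" "partial_y fr (0, 0) = 0" "partial_y (partial_y fr) (0, 0) = 0"
    "gr (0, 0) = 0" "partial_y gr (0, 0) = 0" "partial_y (partial_y gr) (0, 0) = 0"
    using jet unfolding two_jet_reduced_iff by blast+
  define F3 G3 G4 where "F3 = (dir (0, 1) ^^ 3) fr (0, 0) / 6" and "G3 = (dir (0, 1) ^^ 3) gr (0, 0) / 6" and "G4 = (dir (0, 1) ^^ 4) gr (0, 0) / 24"
  note lf = cubic_along_y_axis(1)[OF W'(1,2,3) n(1,2,3), folded F3_def] and lg = cubic_along_y_axis[OF W'(1,2,4) n(4,5,6), folded G3_def G4_def]
  define \<tau> where "\<tau> s = frame_comb d fr gr (s * 0, s * 1)" for s
  define u where "u s = fr (s * 0, s * 1) * (c 1 - m * d 1) + gr (s * 0, s * 1) * (c 2 - m * d 2)" for s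
  have \<sigma>: "\<tau> s * m + u s = frame_comb c fr gr (s * 0, s * 1)" for s
    unfolding \<tau>_def u_def frame_comb_def c4 fst_conv snd_conv by algebra
  have "((\<lambda>s. fr (s * 0, s * 1) / s ^ 3 * d 1 + gr (s * 0, s * 1) / s ^ 3 * d 2) \<longlongrightarrow> F3 * d 1 + G3 * d 2) (at 0)"
    by (intro tendsto_add tendsto_mult tendsto_const lf lg(1))
  moreover have eq: "fr (s * 0, s * 1) / s ^ 3 * d 1 + gr (s * 0, s * 1) / s ^ 3 * d 2 = (\<tau> s - d 4 * s) / s ^ 3" for s
    by (simp add: \<tau>_def frame_comb_def add_divide_distrib mult.commute)
  ultimately have \<tau>3: "((\<lambda>s. (\<tau> s - d 4 * s) / s ^ 3) \<longlongrightarrow> F3 * d 1 + G3 * d 2) (at 0)" by (simp only: eq)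
  have "((\<lambda>s. fr (s * 0, s * 1) / s ^ 3 * (c 1 - m * d 1) + gr (s * 0, s * 1) / s ^ 3 * (c 2 - m * d 2))
      \<longlongrightarrow> F3 * (c 1 - m * d 1) + G3 * (c 2 - m * d 2)) (at 0)"
    by (intro tendsto_add tendsto_mult tendsto_const lf lg(1))
  moreover have eq: "fr (s * 0, s * 1) / s ^ 3 * (c 1 - m * d 1) + gr (s * 0, s * 1) / s ^ 3 * (c 2 - m * d 2) = u s / s ^ 3" for s
    unfolding u_def by (simp add: add_divide_distrib)
  ultimately have u3: "((\<lambda>s. u s / s ^ 3) \<longlongrightarrow> F3 * (c 1 - m * d 1) + G3 * (c 2 - m * d 2)) (at 0)" by (simp only: eq)
  define K \<Gamma> where "K = (dir (m, 1) ^^ 3) G (p, q) / 6 * d 4 ^ 3" and "\<Gamma> = (dir (m, 1) ^^ 4) G (p, q) / 24 * d 4 ^ 4"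
  note q4 = quartic_limit[OF W c0 G k1 k2 \<tau>3 u3 d4, unfolded \<sigma>, folded K_def \<Gamma>_def]
  have "((\<lambda>s. (frame_comb b fr gr (s * 0, s * 1) - frame_comb c fr gr (s * 0, s * 1) * partial_x G (p, q) - \<tau> s * partial_y G (p, q) - K * s ^ 3) / s ^ 4) \<longlongrightarrow> \<Gamma>) (at 0)"
  proof (rule Lim_transform_eventually[OF q4])
    have "((\<lambda>s. (s * 0, s * 1)) \<longlongrightarrow> (0 * 0, 0 * 1)) (at (0 :: real))" by (intro tendsto_intros)
    then have "((\<lambda>s. (s * 0, s * 1)) \<longlongrightarrow> (0, 0)) (at (0 :: real))" by simp
    from eventually_compose_filterlim[OF EG this]
    show "\<forall>\<^sub>F s in at 0. (G (p + frame_comb c fr gr (s * 0, s * 1), q + \<tau> s) - G (p, q) - frame_comb c fr gr (s * 0, s * 1) * partial_x G (p, q) - \<tau> s * partial_y G (p, q) - K * s ^ 3) / s ^ 4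
      = (frame_comb b fr gr (s * 0, s * 1) - frame_comb c fr gr (s * 0, s * 1) * partial_x G (p, q) - \<tau> s * partial_y G (p, q) - K * s ^ 3) / s ^ 4"
      unfolding \<tau>_def by eventually_elim simp
  qed
  moreover have eq: "frame_comb b fr gr (s * 0, s * 1) - frame_comb c fr gr (s * 0, s * 1) * partial_x G (p, q) - \<tau> s * partial_y G (p, q) = rG 2 * gr (s * 0, s * 1)" for s
  proof -
    have b1: "b 1 = c 1 * partial_x G (p, q) + d 1 * partial_y G (p, q)" and b2: "b 2 = rG 2 + c 2 * partial_x G (p, q) + d 2 * partial_y G (p, q)"
      using rG1 by (simp_all add: rG_def)
    show ?thesis unfolding \<tau>_def frame_comb_def b1 b2 b3 b4 fst_conv snd_conv by algebra
  qed
  ultimately have q4: "((\<lambda>s. (rG 2 * gr (s * 0, s * 1) - K * s ^ 3) / s ^ 4) \<longlongrightarrow> \<Gamma>) (at 0)" by (simp only: eq)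
  define e where "e i = (if i = 3 then rG 2 * G3 - K else if i = 4 then rG 2 * G4 - \<Gamma> else 0)" for i :: nat
  have "((\<lambda>s. (\<Sum>i\<le>4. e i * s ^ i) / s ^ 4) \<longlongrightarrow> 0) (at 0)"
  proof (rule Lim_transform_eventually)
    have "((\<lambda>s. (rG 2 * gr (s * 0, s * 1) - K * s ^ 3) / s ^ 4 - \<Gamma> - rG 2 * ((gr (s * 0, s * 1) - G3 * s ^ 3 - G4 * s ^ 4) / s ^ 4)) \<longlongrightarrow> \<Gamma> - \<Gamma> - rG 2 * 0) (at 0)"
      by (intro tendsto_diff tendsto_mult tendsto_const q4 lg(2))
    then show "((\<lambda>s. (rG 2 * gr (s * 0, s * 1) - K * s ^ 3) / s ^ 4 - \<Gamma> - rG 2 * ((gr (s * 0, s * 1) - G3 * s ^ 3 - G4 * s ^ 4) / s ^ 4)) \<longlongrightarrow> 0) (at 0)"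
      by simp
    have e: "(\<Sum>i\<le>4. e i * s ^ i) = (rG 2 * G3 - K) * s ^ 3 + (rG 2 * G4 - \<Gamma>) * s ^ 4" for s
      by (simp add: e_def eval_nat_numeral)
    have alg: "(\<rho> * x - K * s ^ 3) / s ^ 4 - \<Gamma> - \<rho> * ((x - G3 * s ^ 3 - G4 * s ^ 4) / s ^ 4) = ((\<rho> * G3 - K) * s ^ 3 + (\<rho> * G4 - \<Gamma>) * s ^ 4) / s ^ 4"
      if "s \<noteq> 0" for \<rho> x s K \<Gamma> G3 G4 :: real
    proof -
      have "s ^ 4 \<noteq> 0" using that by simp
      then have "\<Gamma> = \<Gamma> * s ^ 4 / s ^ 4" by simp
      then have "(\<rho> * x - K * s ^ 3) / s ^ 4 - \<Gamma> - \<rho> * ((x - G3 * s ^ 3 - G4 * s ^ 4) / s ^ 4)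
          = ((\<rho> * x - K * s ^ 3) - \<Gamma> * s ^ 4 - \<rho> * (x - G3 * s ^ 3 - G4 * s ^ 4)) / s ^ 4"
        unfolding diff_divide_distrib[of "(\<rho> * x - K * s ^ 3) - \<Gamma> * s ^ 4"] diff_divide_distrib[of "\<rho> * x - K * s ^ 3" "\<Gamma> * s ^ 4"] times_divide_eq_right by metis
      also have "(\<rho> * x - K * s ^ 3) - \<Gamma> * s ^ 4 - \<rho> * (x - G3 * s ^ 3 - G4 * s ^ 4) = (\<rho> * G3 - K) * s ^ 3 + (\<rho> * G4 - \<Gamma>) * s ^ 4"
        by algebra
      finally show ?thesis .
    qed
    show "\<forall>\<^sub>F s in at 0. (rG 2 * gr (s * 0, s * 1) - K * s ^ 3) / s ^ 4 - \<Gamma> - rG 2 * ((gr (s * 0, s * 1) - G3 * s ^ 3 - G4 * s ^ 4) / s ^ 4) = (\<Sum>i\<le>4. e i * s ^ i) / s ^ 4"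
      unfolding e using eventually_neq_at_within[of 0] by eventually_elim (rule alg)
  qed
  then have "e 4 = 0" by (rule polynomial_little_o_imp_0) simp_all
  then have G4: "rG 2 * G4 = \<Gamma>" by (simp add: e_def)
  have tc: "taylor_coeff gr 0 4 = G4" by (simp add: taylor_coeff_def G4_def dir_0_1_iterate fact_numeral)
  have "(G20 * G4) * (2 * (rG 2)\<^sup>2) = (GA * (dir (m, 1) ^^ 4) G (p, q)) * ((c 3 - m * d 3)\<^sup>2 * d 4 ^ 4 / 24)"
  proof -
    have "(G20 * G4) * (2 * (rG 2)\<^sup>2) = (2 * (rG 2 * G20)) * (rG 2 * G4)" by algebra
    also have "\<dots> = (GA * (c 3 - m * d 3)\<^sup>2) * ((dir (m, 1) ^^ 4) G (p, q) / 24 * d 4 ^ 4)" unfolding rG2[symmetric] G4 \<Gamma>_def ..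
    finally show ?thesis by simp
  qed
  then have "sgn (G20 * G4) * sgn (2 * (rG 2)\<^sup>2) = sgn (GA * (dir (m, 1) ^^ 4) G (p, q)) * sgn ((c 3 - m * d 3)\<^sup>2 * d 4 ^ 4 / 24)"
    by (simp only: sgn_mult[symmetric])
  moreover have "rG 2 \<noteq> 0" using rG2 G0 \<tau>0 unfolding defs by auto
  then have "sgn (2 * (rG 2)\<^sup>2) = 1" by (intro sgn_pos) simp
  moreover have "sgn ((c 3 - m * d 3)\<^sup>2 * d 4 ^ 4 / 24) = 1" using \<tau>0 d4 by (intro sgn_pos) simp
  ultimately show ?thesis unfolding tc G20_def[symmetric] GA_def[symmetric] by simp
qed

section \<open>Existence of a reduction\<close>

lemma shear_partials:
  assumes h: "smooth_on W h" and z: "(p + fst z + m * snd z, q + snd z) \<in> W"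
  shows "partial_x (\<lambda>z. h (p + fst z + m * snd z, q + snd z) + (\<alpha> * fst z + \<beta> * snd z + \<delta>)) z = partial_x h (p + fst z + m * snd z, q + snd z) + \<alpha>"
    and "partial_y (\<lambda>z. h (p + fst z + m * snd z, q + snd z) + (\<alpha> * fst z + \<beta> * snd z + \<delta>)) z = dir (m, 1) h (p + fst z + m * snd z, q + snd z) + \<beta>"
proof -
  let ?T = "\<lambda>z. (p + fst z + m * snd z, q + snd z)"
  have "(?T has_derivative (\<lambda>v. (0 + fst v + m * snd v, 0 + snd v))) (at z)"
    by (intro has_derivative_Pair has_derivative_add has_derivative_const has_derivative_mult_right has_derivative_fst has_derivative_snd has_derivative_ident)
  from has_derivative_compose[OF this has_derivative_partials[OF h z]]
  have "((\<lambda>z. h (?T z)) has_derivative (\<lambda>v. fst (0 + fst v + m * snd v, 0 + snd v) * partial_x h (?T z) + snd (0 + fst v + m * snd v, 0 + snd v) * partial_y h (?T z))) (at z)" .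
  then have "((\<lambda>z. h (?T z) + (\<alpha> * fst z + \<beta> * snd z + \<delta>)) has_derivative (\<lambda>v. (fst (0 + fst v + m * snd v, 0 + snd v) * partial_x h (?T z)
      + snd (0 + fst v + m * snd v, 0 + snd v) * partial_y h (?T z)) + (\<alpha> * fst v + \<beta> * snd v + 0))) (at z)"
    by (intro has_derivative_add has_derivative_const has_derivative_mult_right has_derivative_fst has_derivative_snd has_derivative_ident)
  then have "((\<lambda>z. h (?T z) + (\<alpha> * fst z + \<beta> * snd z + \<delta>)) has_derivative (\<lambda>v. fst v * (partial_x h (?T z) + \<alpha>) + snd v * (dir (m, 1) h (?T z) + \<beta>))) (at z)"
    by (rule has_derivative_eq_rhs) (rule ext, unfold dir_def fst_conv snd_conv, algebra)
  from partials_eqI[OF this]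
  show "partial_x (\<lambda>z. h (?T z) + (\<alpha> * fst z + \<beta> * snd z + \<delta>)) z = partial_x h (?T z) + \<alpha>"
    "partial_y (\<lambda>z. h (?T z) + (\<alpha> * fst z + \<beta> * snd z + \<delta>)) z = dir (m, 1) h (?T z) + \<beta>" .
qed

text \<open>
  In the coordinates of \<open>W'\<close> the direction \<open>(m, 1)\<close> is the \<open>y\<close>-axis; the affine part of \<open>h\<close> at the base point is removed.
\<close>

lemma shear_jet:
  fixes h :: "real \<times> real \<Rightarrow> real" and p q m :: real
  assumes W: "open W" and c: "(p, q) \<in> W" and h: "smooth_on W h"
  defines "W' \<equiv> {z. (p + fst z + m * snd z, q + snd z) \<in> W}"
    and "k \<equiv> \<lambda>z. h (p + fst z + m * snd z, q + snd z) + (- partial_x h (p, q) * fst z + - dir (m, 1) h (p, q) * snd z + - h (p, q))"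
  shows "open W'" "(0, 0) \<in> W'" "smooth_on W' k"
    and "k (0, 0) = 0" "partial_x k (0, 0) = 0" "partial_y k (0, 0) = 0"
    and "partial_x (partial_x k) (0, 0) = partial_x (partial_x h) (p, q)"
    and "partial_x (partial_y k) (0, 0) = m * partial_x (partial_x h) (p, q) + partial_x (partial_y h) (p, q)"
    and "partial_y (partial_y k) (0, 0) = (dir (m, 1) ^^ 2) h (p, q)"
proof -
  let ?T = "\<lambda>z. (p + fst z + m * snd z, q + snd z)"
  have "open (?T -` W)" by (rule open_vimage[OF W]) (intro continuous_intros)
  then show W': "open W'" by (simp add: W'_def vimage_def)
  show o: "(0, 0) \<in> W'" using c by (simp add: W'_def)
  have sT: "smooth_on W' (\<lambda>z. p + fst z + m * snd z)" "smooth_on W' (\<lambda>z. q + snd z)"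
    by (intro smooth_on_add[OF W'] smooth_on_mult[OF W'] smooth_on_const[OF W'] smooth_on_fst[OF W'] smooth_on_snd[OF W'])+
  have s: "smooth_on W' (\<lambda>z. h (?T z) + (\<alpha> * fst z + \<beta> * snd z + \<delta>))" if h: "smooth_on W h" for \<alpha> \<beta> \<delta> and h :: "real \<times> real \<Rightarrow> real"
    by (intro smooth_on_add[OF W'] smooth_on_mult[OF W'] smooth_on_const[OF W'] smooth_on_fst[OF W'] smooth_on_snd[OF W']
        smooth_on_compose_plane[OF W' h _ sT]) (simp add: W'_def)
  show k: "smooth_on W' k" unfolding k_def by (rule s[OF h])
  have kx: "partial_x k z = partial_x h (?T z) + (0 * fst z + 0 * snd z + - partial_x h (p, q))" if "z \<in> W'" for z
  proof -
    have "?T z \<in> W" using that by (simp add: W'_def)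
    from shear_partials(1)[OF h this, where \<alpha> = "- partial_x h (p, q)" and \<beta> = "- dir (m, 1) h (p, q)" and \<delta> = "- h (p, q)"]
    show ?thesis unfolding k_def by (simp only: mult_zero_left add_0)
  qed
  have ky: "partial_y k z = dir (m, 1) h (?T z) + (0 * fst z + 0 * snd z + - dir (m, 1) h (p, q))" if "z \<in> W'" for z
  proof -
    have "?T z \<in> W" using that by (simp add: W'_def)
    from shear_partials(2)[OF h this, where \<alpha> = "- partial_x h (p, q)" and \<beta> = "- dir (m, 1) h (p, q)" and \<delta> = "- h (p, q)"]
    show ?thesis unfolding k_def by (simp only: mult_zero_left add_0)
  qed
  show "k (0, 0) = 0" by (simp add: k_def)
  show "partial_x k (0, 0) = 0" "partial_y k (0, 0) = 0" using kx[OF o] ky[OF o] by simp_all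
  have T0: "?T (0, 0) \<in> W" using c by simp
  note hx = smooth_on_partial_x[OF h] and hy = smooth_on_dir[OF W h, of "(m, 1)"]
  have "partial_x (partial_x k) (0, 0) = partial_x (partial_x h) (?T (0, 0)) + 0"
    using partials_cong(1)[OF W' o smooth_on_partial_x[OF k] kx] shear_partials(1)[OF hx T0] by presburger
  then show "partial_x (partial_x k) (0, 0) = partial_x (partial_x h) (p, q)" by simp
  have "partial_y (partial_y k) (0, 0) = dir (m, 1) (dir (m, 1) h) (?T (0, 0)) + 0"
    using partials_cong(2)[OF W' o smooth_on_partial_y[OF k] ky] shear_partials(2)[OF hy T0] by presburger
  then show "partial_y (partial_y k) (0, 0) = (dir (m, 1) ^^ 2) h (p, q)" by (simp add: numeral_2_eq_2)
  have "partial_x (partial_y k) (0, 0) = partial_x (dir (m, 1) h) (?T (0, 0)) + 0"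
    using partials_cong(1)[OF W' o smooth_on_partial_y[OF k] ky] shear_partials(1)[OF hy T0] by presburger
  also have "dir (m, 1) h = (\<lambda>z. m * partial_x h z + 1 * partial_y h z)" by (simp add: dir_def fun_eq_iff)
  finally show "partial_x (partial_y k) (0, 0) = m * partial_x (partial_x h) (p, q) + partial_x (partial_y h) (p, q)"
    using partials_linear(1)[OF W smooth_on_partial_x[OF h] smooth_on_partial_y[OF h] c, of m 1] by simp
qed

text \<open>
  After the shear that makes \<open>(m, 1)\<close> the \<open>y\<close>-axis, the quadratic part of \<open>G\<close> is a multiple of \<open>x\<^sup>2\<close> and that of \<open>F\<close> a multiple
  of \<open>x * y\<close>. Passing from \<open>(f, g)\<close> to \<open>(F, G)\<close>, shearing, and removing the affine parts are restrictions of
  affine transformations of four-space.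
\<close>

lemma reduction_exists:
  fixes f g F G :: "real \<times> real \<Rightarrow> real" and \<kappa> \<mu> m :: real
  assumes W: "open W" and c: "(p, q) \<in> W" and f: "smooth_on W f" and g: "smooth_on W g"
    and G_def: "G = (\<lambda>z. 1 * g z + (- \<kappa>) * f z)" and F_def: "F = (\<lambda>z. 1 * f z + (- \<mu>) * G z)"
    and F0: "partial_x (partial_x F) (p, q) = 0" and F2: "(dir (m, 1) ^^ 2) F (p, q) = 0"
    and G1: "m * partial_x (partial_x G) (p, q) + partial_x (partial_y G) (p, q) = 0" and G2: "(dir (m, 1) ^^ 2) G (p, q) = 0"
  shows "\<exists>fr gr. reduction_at W f g (p, q) fr gr"
proof -
  define T where "T = (\<lambda>z :: real \<times> real. (p + fst z + m * snd z, q + snd z))"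
  define W' where "W' = {z. T z \<in> W}"
  have sG: "smooth_on W G" unfolding G_def by (intro smooth_on_add[OF W] smooth_on_mult[OF W] smooth_on_const[OF W] f g)
  have sF: "smooth_on W F" unfolding F_def by (intro smooth_on_add[OF W] smooth_on_mult[OF W] smooth_on_const[OF W] f sG)
  define red where "red h = (\<lambda>z. h (T z) + (- partial_x h (p, q) * fst z + - dir (m, 1) h (p, q) * snd z + - h (p, q)))" for h
  note jF = shear_jet[OF W c sF, where m = m] and jG = shear_jet[OF W c sG, where m = m]
  have red: "red h = (\<lambda>z. h (p + fst z + m * snd z, q + snd z) + (- partial_x h (p, q) * fst z + - dir (m, 1) h (p, q) * snd z + - h (p, q)))" for h
    by (simp add: red_def T_def)
  have W'_eq: "W' = {z. (p + fst z + m * snd z, q + snd z) \<in> W}" by (simp add: W'_def T_def)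
  have jet: "two_jet_reduced (red F) (red G)"
    unfolding two_jet_reduced_iff red using jF(4-9) jG(4-9) F0 F2 G1 G2 by (intro conjI) (simp_all only:)
  define Fx Fy Gx Gy where "Fx = partial_x F (p, q)" and "Fy = partial_y F (p, q)" and "Gx = partial_x G (p, q)" and "Gy = partial_y G (p, q)"
  define L :: "real \<times> real \<times> real \<times> real \<Rightarrow> real \<times> real \<times> real \<times> real"
    where "L = (\<lambda>(n1, n2, x, y). (n1 - \<mu> * (n2 - \<kappa> * n1) - Fx * x - Fy * y, n2 - \<kappa> * n1 - Gx * x - Gy * y, x - m * y, y))"
  have lin: "linear L" unfolding L_def by (rule linearI) (auto simp: algebra_simps)
  have "inj L"
  proof (rule injI)
    fix a b assume "L a = L b"
    then have "L (a - b) = 0" using lin by (simp add: linear_diff)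
    then have "a - b = 0" by (cases "a - b") (auto simp: L_def zero_prod_def)
    then show "a = b" by simp
  qed
  then have bij: "bij L" using linear_injective_imp_surjective[OF lin] by (simp add: bij_def)
  define A where "A z = L z + (- L (surface_param f g (p, q)))" for z
  have "affine_transformation A" unfolding affine_transformation_def A_def using lin bij by (intro exI conjI) (auto simp: fun_eq_iff)
  moreover have "A (surface_param f g (p, q)) = 0" by (simp add: A_def)
  moreover have "A ` (surface_param f g ` W) = surface_param (red F) (red G) ` W'"
  proof -
    have v: "F w = f w - \<mu> * (g w - \<kappa> * f w)" "G w = g w - \<kappa> * f w" for w by (simp_all add: F_def G_def)
    have rF: "red F z = F (T z) - Fx * fst z - (m * Fx + Fy) * snd z - F (p, q)" and rG: "red G z = G (T z) - Gx * fst z - (m * Gx + Gy) * snd z - G (p, q)" for z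
      by (simp_all add: red_def Fx_def Fy_def Gx_def Gy_def dir_def algebra_simps)
    have eq: "A (surface_param f g (T z)) = surface_param (red F) (red G) z" for z
      by (cases z) (simp add: A_def L_def surface_param_def T_def rF rG v algebra_simps)
    have "W = T ` W'"
    proof (intro equalityI subsetI)
      fix w assume "w \<in> W"
      moreover have "w = T (fst w - p - m * (snd w - q), snd w - q)" by (simp add: T_def)
      ultimately show "w \<in> T ` W'" unfolding W'_def by (metis (mono_tags, lifting) image_eqI mem_Collect_eq)
    qed (auto simp: W'_def)
    then have "A ` (surface_param f g ` W) = (\<lambda>z. A (surface_param f g (T z))) ` W'" by (metis image_image)
    then show ?thesis unfolding eq .
  qed
  ultimately have "reduction_at W f g (p, q) (red F) (red G)"
    unfolding reduction_at_def using jet jF(1-3)[folded W'_eq red] jG(3)[folded W'_eq red]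
    by (intro conjI exI[of _ A] exI[of _ W'] exI[of _ UNIV]) simp_all
  then show ?thesis by blast
qed

section \<open>Parabolic points near the origin\<close>

lemma second_partials_linear:
  assumes W: "open W" and c: "c \<in> W" and g: "smooth_on W g" and h: "smooth_on W h"
  shows "partial_x (partial_x (\<lambda>z. a * g z + b * h z)) c = a * partial_x (partial_x g) c + b * partial_x (partial_x h) c"
    and "partial_x (partial_y (\<lambda>z. a * g z + b * h z)) c = a * partial_x (partial_y g) c + b * partial_x (partial_y h) c"
    and "partial_y (partial_y (\<lambda>z. a * g z + b * h z)) c = a * partial_y (partial_y g) c + b * partial_y (partial_y h) c"
proof -
  have s: "smooth_on W (\<lambda>z. a * g z + b * h z)"
    by (intro smooth_on_add[OF W] smooth_on_mult[OF W] smooth_on_const[OF W] g h)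
  note gx = smooth_on_partial_x[OF g] and gy = smooth_on_partial_y[OF g] and hx = smooth_on_partial_x[OF h] and hy = smooth_on_partial_y[OF h]
  note lx = partials_linear(1)[OF W g h] and ly = partials_linear(2)[OF W g h]
  show "partial_x (partial_x (\<lambda>z. a * g z + b * h z)) c = a * partial_x (partial_x g) c + b * partial_x (partial_x h) c"
    by (rule trans[OF partials_cong(1)[OF W c smooth_on_partial_x[OF s] lx[where a = a and b = b]] partials_linear(1)[OF W gx hx c]])
  show "partial_x (partial_y (\<lambda>z. a * g z + b * h z)) c = a * partial_x (partial_y g) c + b * partial_x (partial_y h) c"
    by (rule trans[OF partials_cong(1)[OF W c smooth_on_partial_y[OF s] ly[where a = a and b = b]] partials_linear(1)[OF W gy hy c]])
  show "partial_y (partial_y (\<lambda>z. a * g z + b * h z)) c = a * partial_y (partial_y g) c + b * partial_y (partial_y h) c"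
    by (rule trans[OF partials_cong(2)[OF W c smooth_on_partial_y[OF s] ly[where a = a and b = b]] partials_linear(2)[OF W gy hy c]])
qed

text \<open>
  The hypothesis \<open>disc\<close> says that the resultant of the two quadratic polynomials in \<open>m\<close> vanishes.
\<close>

lemma common_root:
  fixes A B C A' B' C' :: real
  assumes disc: "(A * C' - C * A')\<^sup>2 = 4 * (B * C' - C * B') * (A * B' - B * A')" and r: "A * B' - B * A' \<noteq> 0"
  defines "m \<equiv> - (A * C' - C * A') / (2 * (A * B' - B * A'))"
  shows "A * m\<^sup>2 + 2 * B * m + C = 0" "A' * m\<^sup>2 + 2 * B' * m + C' = 0"
proof -
  define r where "r = A * B' - B * A'"
  define n where "n = A * C' - C * A'"
  have r0: "r \<noteq> 0" using assms(2) by (simp add: r_def)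
  have n: "n = - 2 * r * m" using r0 unfolding m_def n_def[symmetric] r_def[symmetric] by simp
  have "4 * r * (r * m\<^sup>2 - (B * C' - C * B')) = 0" using disc unfolding r_def[symmetric] n_def[symmetric] n by algebra
  then have q: "r * m\<^sup>2 = B * C' - C * B'" using r0 by simp
  have "r * (A * m\<^sup>2 + 2 * B * m + C) = A * (r * m\<^sup>2) - B * (- 2 * r * m) + C * r" by algebra
  also have "\<dots> = 0" unfolding q n[symmetric] unfolding n_def r_def by algebra
  finally show "A * m\<^sup>2 + 2 * B * m + C = 0" using r0 by simp
  have "r * (A' * m\<^sup>2 + 2 * B' * m + C') = A' * (r * m\<^sup>2) - B' * (- 2 * r * m) + C' * r" by algebra
  also have "\<dots> = 0" unfolding q n[symmetric] unfolding n_def r_def by algebra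
  finally show "A' * m\<^sup>2 + 2 * B' * m + C' = 0" using r0 by simp
qed

text \<open>
  At a parabolic point the Hessians of \<open>f\<close> and \<open>g\<close> have a common isotropic direction \<open>(m, 1)\<close>. The number \<open>\<kappa>\<close> is chosen such
  that this direction is in the kernel of the Hessian of \<open>g - \<kappa> f\<close>.
\<close>

lemma sign_at_parabolic_point:
  fixes f g :: "real \<times> real \<Rightarrow> real"
  assumes W: "open W" and c: "(p, q) \<in> W" and f: "smooth_on W f" and g: "smooth_on W g"
  defines "A \<equiv> partial_x (partial_x f) (p, q)" and "B \<equiv> partial_x (partial_y f) (p, q)" and "C \<equiv> partial_y (partial_y f) (p, q)"
    and "A' \<equiv> partial_x (partial_x g) (p, q)" and "B' \<equiv> partial_x (partial_y g) (p, q)" and "C' \<equiv> partial_y (partial_y g) (p, q)"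
  assumes par: "(p, q) \<in> parabolic_set W f g" and r: "A * B' - B * A' \<noteq> 0"
  defines "m \<equiv> - (A * C' - C * A') / (2 * (A * B' - B * A'))"
  assumes b: "A * m + B \<noteq> 0"
  defines "\<kappa> \<equiv> (A' * m + B') / (A * m + B)"
  assumes pos: "s * ((A' - \<kappa> * A) * ((dir (m, 1) ^^ 4) g (p, q) - \<kappa> * (dir (m, 1) ^^ 4) f (p, q))) > 0" and s: "s \<in> {1, - 1}"
  shows "\<exists>fr gr. reduction_at W f g (p, q) fr gr"
    and "\<forall>fr gr. reduction_at W f g (p, q) fr gr \<longrightarrow> sgn (taylor_coeff gr 2 0 * taylor_coeff gr 0 4) = s"
proof -
  define G where "G = (\<lambda>z. 1 * g z + (- \<kappa>) * f z)"
  have sG: "smooth_on W G" unfolding G_def by (intro smooth_on_add[OF W] smooth_on_mult[OF W] smooth_on_const[OF W] f g)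
  have Gxx: "partial_x (partial_x G) (p, q) = A' - \<kappa> * A" and Gxy: "partial_x (partial_y G) (p, q) = B' - \<kappa> * B" and Gyy: "partial_y (partial_y G) (p, q) = C' - \<kappa> * C"
    unfolding G_def second_partials_linear[OF W c g f] A_def B_def C_def A'_def B'_def C'_def by simp_all
  have G4: "(dir (m, 1) ^^ 4) G (p, q) = (dir (m, 1) ^^ 4) g (p, q) - \<kappa> * (dir (m, 1) ^^ 4) f (p, q)"
    unfolding G_def dir_iterate_linear[OF W g f c] by simp
  have disc: "(A * C' - C * A')\<^sup>2 = 4 * (B * C' - C * B') * (A * B' - B * A')"
    using par unfolding parabolic_set_def Let_def A_def B_def C_def A'_def B'_def C'_def by simp
  note roots = common_root[OF disc r, folded m_def]
  have \<kappa>: "\<kappa> * (A * m + B) = A' * m + B'" using b by (simp add: \<kappa>_def)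
  have k1: "m * partial_x (partial_x G) (p, q) + partial_x (partial_y G) (p, q) = 0"
    unfolding Gxx Gxy using \<kappa> by algebra
  have k2: "m * partial_x (partial_y G) (p, q) + partial_y (partial_y G) (p, q) = 0"
    unfolding Gxy Gyy using \<kappa> roots by algebra
  have GA: "A' - \<kappa> * A \<noteq> 0" and \<gamma>: "(dir (m, 1) ^^ 4) G (p, q) \<noteq> 0" using pos unfolding G4 by auto
  \<comment> \<open>Removes the term \<open>x\<^sup>2\<close> from \<open>f - \<mu> G\<close>.\<close>
  define \<mu> where "\<mu> = A / (A' - \<kappa> * A)"
  have G2: "(dir (m, 1) ^^ 2) G (p, q) = 0"
  proof -
    have "(dir (m, 1) ^^ 2) G (p, q) = m * (m * partial_x (partial_x G) (p, q) + partial_x (partial_y G) (p, q))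
        + (m * partial_x (partial_y G) (p, q) + partial_y (partial_y G) (p, q))"
      unfolding dir_2[OF W sG c] by (simp add: power2_eq_square algebra_simps)
    then show ?thesis unfolding k1 k2 by simp
  qed
  show "\<exists>fr gr. reduction_at W f g (p, q) fr gr"
  proof (rule reduction_exists[OF W c f g G_def refl _ _ k1 G2, where \<mu> = \<mu>])
    have "partial_x (partial_x (\<lambda>z. 1 * f z + - \<mu> * G z)) (p, q) = A - \<mu> * (A' - \<kappa> * A)"
      unfolding second_partials_linear(1)[OF W c f sG] Gxx A_def by simp
    then show "partial_x (partial_x (\<lambda>z. 1 * f z + - \<mu> * G z)) (p, q) = 0" using GA by (simp add: \<mu>_def)
    show "(dir (m, 1) ^^ 2) (\<lambda>z. 1 * f z + - \<mu> * G z) (p, q) = 0"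
      unfolding dir_iterate_linear[OF W f sG c] G2 unfolding dir_2[OF W f c] using roots(1) by (simp add: A_def B_def C_def)
  qed
  show "\<forall>fr gr. reduction_at W f g (p, q) fr gr \<longrightarrow> sgn (taylor_coeff gr 2 0 * taylor_coeff gr 0 4) = s"
  proof (intro allI impI)
    fix fr gr assume red: "reduction_at W f g (p, q) fr gr"
    then have jet: "two_jet_reduced fr gr" by (simp add: reduction_at_def)
    obtain W' a b c' d where W': "open W'" "(0, 0) \<in> W'" "smooth_on W' fr" "smooth_on W' gr"
      and Ef: "\<forall>\<^sub>F z in nhds (0, 0). f (p + frame_comb c' fr gr z, q + frame_comb d fr gr z) - f (p, q) = frame_comb a fr gr z"
      and Eg: "\<forall>\<^sub>F z in nhds (0, 0). g (p + frame_comb c' fr gr z, q + frame_comb d fr gr z) - g (p, q) = frame_comb b fr gr z"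
      and inj: "\<And>x y. x * a 3 + y * a 4 = 0 \<Longrightarrow> x * b 3 + y * b 4 = 0 \<Longrightarrow> x * c' 3 + y * c' 4 = 0 \<Longrightarrow> x * d 3 + y * d 4 = 0 \<Longrightarrow> x = 0 \<and> y = 0"
      by (rule reduction_equations[OF red]) (rule that)
    have EG: "\<forall>\<^sub>F z in nhds (0, 0). G (p + frame_comb c' fr gr z, q + frame_comb d fr gr z) - G (p, q) = frame_comb (\<lambda>i. b i - \<kappa> * a i) fr gr z"
      using Ef Eg
    proof eventually_elim
      case (elim z)
      have Gd: "G w - G (p, q) = (g w - g (p, q)) - \<kappa> * (f w - f (p, q))" for w by (simp add: G_def algebra_simps)
      show ?case unfolding Gd elim by (simp add: frame_comb_def algebra_simps)
    qed
    have "sgn (taylor_coeff gr 2 0 * taylor_coeff gr 0 4) = sgn (partial_x (partial_x G) (p, q) * (dir (m, 1) ^^ 4) G (p, q))"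
    proof (rule reduced_sign[OF W c f sG W' jet Ef EG _ _ _ k1 k2 _ \<gamma>])
      fix x y
      assume 1: "x * a 3 + y * a 4 = 0" and 2: "x * (b 3 - \<kappa> * a 3) + y * (b 4 - \<kappa> * a 4) = 0" and 3: "x * c' 3 + y * c' 4 = 0" "x * d 3 + y * d 4 = 0"
      have "x * b 3 + y * b 4 = 0" using 1 2 by algebra
      then show "x = 0 \<and> y = 0" by (rule inj[OF 1 _ 3])
    qed (use roots(1) b GA in \<open>simp_all only: Gxx A_def B_def C_def not_False_eq_True\<close>)
    moreover have "sgn (partial_x (partial_x G) (p, q) * (dir (m, 1) ^^ 4) G (p, q)) = s"
      using pos s unfolding Gxx G4 by (auto simp: sgn_if zero_less_mult_iff mult_less_0_iff)
    ultimately show "sgn (taylor_coeff gr 2 0 * taylor_coeff gr 0 4) = s" by simp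
  qed
qed

text \<open>
  At the origin \<open>m\<close> and \<open>\<kappa>\<close> are zero, so that the product whose sign matters is that of the second \<open>x\<close>-derivative and
  the fourth \<open>y\<close>-derivative of \<open>g\<close>. It depends continuously on the point.
\<close>

lemma sign_near_origin:
  fixes f g :: "real \<times> real \<Rightarrow> real"
  assumes W: "open W" "(0, 0) \<in> W" and f: "smooth_on W f" and g: "smooth_on W g"
    and f0: "partial_x (partial_x f) (0, 0) = 0" "partial_x (partial_y f) (0, 0) \<noteq> 0" "partial_y (partial_y f) (0, 0) = 0"
    and g0: "partial_x (partial_x g) (0, 0) \<noteq> 0" "partial_x (partial_y g) (0, 0) = 0" "partial_y (partial_y g) (0, 0) = 0"
    and g4: "(partial_y ^^ 4) g (0, 0) \<noteq> 0"
  shows "\<forall>\<^sub>F c in nhds (0, 0). c \<in> parabolic_set W f g \<longrightarrow> (\<exists>s \<in> {1, - 1}.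
    (\<exists>fr gr. reduction_at W f g c fr gr) \<and>
    (\<forall>fr gr. reduction_at W f g c fr gr \<longrightarrow> sgn (taylor_coeff gr 2 0 * taylor_coeff gr 0 4) = s))"
proof -
  let ?F = "nhds (0, 0) :: (real \<times> real) filter"
  have tend: "(h \<longlongrightarrow> h (0, 0)) ?F" if "smooth_on W h" for h :: "real \<times> real \<Rightarrow> real"
    using smooth_on_isCont[OF that W(2)] by (simp add: isCont_def tendsto_nhds_iff)
  define A B C where "A = partial_x (partial_x f)" and "B = partial_x (partial_y f)" and "C = partial_y (partial_y f)"
  define A' B' C' where "A' = partial_x (partial_x g)" and "B' = partial_x (partial_y g)" and "C' = partial_y (partial_y g)"
  have lims: "(A \<longlongrightarrow> 0) ?F" "(B \<longlongrightarrow> B (0, 0)) ?F" "(C \<longlongrightarrow> 0) ?F" "(A' \<longlongrightarrow> A' (0, 0)) ?F" "(B' \<longlongrightarrow> 0) ?F" "(C' \<longlongrightarrow> 0) ?F"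
    using tend[OF smooth_on_partial_x[OF smooth_on_partial_x[OF f]]] tend[OF smooth_on_partial_x[OF smooth_on_partial_y[OF f]]]
      tend[OF smooth_on_partial_y[OF smooth_on_partial_y[OF f]]] tend[OF smooth_on_partial_x[OF smooth_on_partial_x[OF g]]]
      tend[OF smooth_on_partial_x[OF smooth_on_partial_y[OF g]]] tend[OF smooth_on_partial_y[OF smooth_on_partial_y[OF g]]]
    unfolding f0(1,3) g0(2,3) A_def B_def C_def A'_def B'_def C'_def by simp_all
  have B0: "B (0, 0) \<noteq> 0" and A0: "A' (0, 0) \<noteq> 0" using f0(2) g0(1) by (simp_all add: B_def A'_def)
  define R where "R z = A z * B' z - B z * A' z" for z
  define m where "m z = - (A z * C' z - C z * A' z) / (2 * R z)" for z
  define \<kappa> where "\<kappa> z = (A' z * m z + B' z) / (A z * m z + B z)" for z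
  define K where "K z = (dir (m z, 1) ^^ 4) g z - \<kappa> z * (dir (m z, 1) ^^ 4) f z" for z
  have R: "(R \<longlongrightarrow> 0 * 0 - B (0, 0) * A' (0, 0)) ?F" unfolding R_def by (intro tendsto_intros lims)
  have "(m \<longlongrightarrow> - (0 * 0 - 0 * A' (0, 0)) / (2 * (0 * 0 - B (0, 0) * A' (0, 0)))) ?F"
    unfolding m_def using A0 B0 by (intro tendsto_intros lims R) simp
  then have m: "(m \<longlongrightarrow> 0) ?F" by simp
  have b: "((\<lambda>z. A z * m z + B z) \<longlongrightarrow> 0 * 0 + B (0, 0)) ?F" by (intro tendsto_intros lims m)
  have "(\<kappa> \<longlongrightarrow> (A' (0, 0) * 0 + 0) / (0 * 0 + B (0, 0))) ?F"
    unfolding \<kappa>_def using B0 by (intro tendsto_intros lims m b) simp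
  then have \<kappa>: "(\<kappa> \<longlongrightarrow> 0) ?F" by simp
  have dirs: "((\<lambda>z. (dir (m z, 1) ^^ 4) h z) \<longlongrightarrow> (partial_y ^^ 4) h (0, 0)) ?F" if h: "smooth_on W h" for h
  proof -
    have "isCont (\<lambda>w. (dir (fst w, 1) ^^ 4) h (snd w)) (0, (0, 0))"
      using continuous_on_dir_iterate[OF W(1) h, of 4] W by (simp add: continuous_on_eq_continuous_at open_Times)
    from isCont_tendsto_compose[OF this tendsto_Pair[OF m filterlim_ident]]
    show ?thesis by (simp add: dir_0_1_iterate)
  qed
  have K: "(K \<longlongrightarrow> (partial_y ^^ 4) g (0, 0) - 0 * (partial_y ^^ 4) f (0, 0)) ?F"
    unfolding K_def by (intro tendsto_intros dirs f g \<kappa>)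
  define s where "s = sgn (A' (0, 0) * (partial_y ^^ 4) g (0, 0))"
  have s: "s \<in> {1, - 1}" using A0 g4 by (auto simp: s_def sgn_if)
  have "((\<lambda>z. s * ((A' z - \<kappa> z * A z) * K z)) \<longlongrightarrow> s * ((A' (0, 0) - 0 * 0) * ((partial_y ^^ 4) g (0, 0) - 0 * (partial_y ^^ 4) f (0, 0)))) ?F"
    by (intro tendsto_intros lims \<kappa> K)
  moreover have "0 < s * ((A' (0, 0) - 0 * 0) * ((partial_y ^^ 4) g (0, 0) - 0 * (partial_y ^^ 4) f (0, 0)))"
  proof -
    have "0 < sgn x * x" if "x \<noteq> 0" for x :: real using that by (simp add: sgn_if)
    from this[of "A' (0, 0) * (partial_y ^^ 4) g (0, 0)"] show ?thesis using A0 g4 unfolding s_def by simp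
  qed
  ultimately have pos: "\<forall>\<^sub>F z in ?F. 0 < s * ((A' z - \<kappa> z * A z) * K z)" by (rule order_tendstoD(1))
  have Rne: "\<forall>\<^sub>F z in ?F. R z \<noteq> 0" by (rule tendsto_imp_eventually_ne[OF R]) (use A0 B0 in simp)
  have bne: "\<forall>\<^sub>F z in ?F. A z * m z + B z \<noteq> 0" by (rule tendsto_imp_eventually_ne[OF b]) (use B0 in simp)
  show ?thesis
    using pos Rne bne eventually_nhds_in_open[OF W]
  proof eventually_elim
    case (elim c)
    obtain p q where c: "c = (p, q)" by (cases c)
    show ?case
    proof
      assume par: "c \<in> parabolic_set W f g"
      note defs = A_def B_def C_def A'_def B'_def C'_def R_def m_def \<kappa>_def K_def c
      note sp = sign_at_parabolic_point[OF W(1) elim(4)[unfolded c] f g par[unfolded c] elim(2)[unfolded defs] elim(3)[unfolded defs] elim(1)[unfolded defs] s]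
      show "\<exists>s \<in> {1, - 1}. (\<exists>fr gr. reduction_at W f g c fr gr) \<and>
          (\<forall>fr gr. reduction_at W f g c fr gr \<longrightarrow> sgn (taylor_coeff gr 2 0 * taylor_coeff gr 0 4) = s)"
        unfolding c by (intro bexI[of _ s] conjI sp s)
    qed
  qed
qed

theorem proposition3p3:
  fixes f g :: "real \<times> real \<Rightarrow> real" and W :: "(real \<times> real) set"
  assumes "open W" and "(0, 0) \<in> W" and "smooth_on W f" and "smooth_on W g"
    and "two_jet_reduced f g"
    and "taylor_coeff f 1 1 \<noteq> 0" and "taylor_coeff g 2 0 \<noteq> 0" and "taylor_coeff g 0 4 \<noteq> 0"
    and "taylor_coeff g 1 2 \<noteq> 0 \<or> taylor_coeff g 0 3 \<noteq> 0"
  shows "\<exists>U. open U \<and> (0, 0) \<in> U \<and> U \<subseteq> W \<and>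
    (\<exists>N\<^sub>0. open N\<^sub>0 \<and> 0 \<in> N\<^sub>0 \<and>
       (\<forall>N. open N \<and> 0 \<in> N \<and> N \<subseteq> N\<^sub>0 \<longrightarrow>
          bifurcation_set N f g \<inter> U = parabolic_set W f g \<inter> U)) \<and>
    (\<forall>c \<in> parabolic_set W f g \<inter> U. \<exists>s \<in> {1, - 1}.
       (\<exists>fr gr. reduction_at W f g c fr gr) \<and>
       (\<forall>fr gr. reduction_at W f g c fr gr \<longrightarrow>
          sgn (taylor_coeff gr 2 0 * taylor_coeff gr 0 4) = s))"
proof -
  have j: "partial_x (partial_x f) (0, 0) = 0" "partial_y (partial_y f) (0, 0) = 0"
    "partial_x (partial_y g) (0, 0) = 0" "partial_y (partial_y g) (0, 0) = 0"
    using assms(5) unfolding two_jet_reduced_iff by blast+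
  have ne: "partial_x (partial_y f) (0, 0) \<noteq> 0" "partial_x (partial_x g) (0, 0) \<noteq> 0" "(partial_y ^^ 4) g (0, 0) \<noteq> 0"
    using assms(6,7,8) by (simp_all add: taylor_coeff_def numeral_2_eq_2)
  obtain U N\<^sub>0 where U: "open U" "(0, 0) \<in> U" "U \<subseteq> W" and N\<^sub>0: "open N\<^sub>0" "0 \<in> N\<^sub>0"
    and eq: "\<forall>N. open N \<and> 0 \<in> N \<and> N \<subseteq> N\<^sub>0 \<longrightarrow> bifurcation_set N f g \<inter> U = parabolic_set W f g \<inter> U"
    using bifurcation_set_eq_parabolic_set[OF assms(1-4) j(1) ne(1,2) j(3,4) ne(3)] by (elim exE conjE)
  obtain S where S: "open S" "(0, 0) \<in> S"
    and sign: "\<forall>c\<in>S. c \<in> parabolic_set W f g \<longrightarrow> (\<exists>s \<in> {1, - 1}. (\<exists>fr gr. reduction_at W f g c fr gr) \<and>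
      (\<forall>fr gr. reduction_at W f g c fr gr \<longrightarrow> sgn (taylor_coeff gr 2 0 * taylor_coeff gr 0 4) = s))"
    using sign_near_origin[OF assms(1-4) j(1) ne(1) j(2) ne(2) j(3,4) ne(3)] unfolding eventually_nhds by (elim exE conjE)
  show ?thesis
  proof (intro exI[of _ "U \<inter> S"] conjI exI[of _ N\<^sub>0] allI impI ballI)
    show "open (U \<inter> S)" "(0, 0) \<in> U \<inter> S" "U \<inter> S \<subseteq> W" using U S by auto
    show "open N\<^sub>0" "0 \<in> N\<^sub>0" by fact+
  next
    fix N assume "open N \<and> 0 \<in> N \<and> N \<subseteq> N\<^sub>0"
    then have "bifurcation_set N f g \<inter> U = parabolic_set W f g \<inter> U" using eq by blast
    then show "bifurcation_set N f g \<inter> (U \<inter> S) = parabolic_set W f g \<inter> (U \<inter> S)" by blast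
  next
    fix c assume "c \<in> parabolic_set W f g \<inter> (U \<inter> S)"
    then have "c \<in> S" "c \<in> parabolic_set W f g" by simp_all
    from sign[rule_format, OF this] show "\<exists>s \<in> {1, - 1}. (\<exists>fr gr. reduction_at W f g c fr gr) \<and>
      (\<forall>fr gr. reduction_at W f g c fr gr \<longrightarrow> sgn (taylor_coeff gr 2 0 * taylor_coeff gr 0 4) = s)" .
  qed
qed

end
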